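(* Let $\mathfrak D=(Z,X,Y;U,V,W;\Gamma)$ be a $\Pi_+$-admissible BTOA interpolation data set. There exists $S\in\mathcal S^{p\times m}(\Pi_+)$ satisfying $$(XS)^{\wedge L}(Z)=Y,\qquad (SU)^{\wedge R}(W)=V,\qquad (XSU)^{\wedge L,R}(Z,W)=\Gamma\qquad( * )$$ if and only if the subspace $\mathcal M_{\mathfrak D}^{[\perp\mathcal K]}$ is a positive subspace of $\mathcal K$, i.e. $[f,f]_J\ge0$ for all $f\in\mathcal M_{\mathfrak D}^{[\perp\mathcal K]}$. If $\mathcal M_{\mathfrak D}^{[\perp\mathcal K]}$ is a Hilbert space in the inner product of $\mathcal K$, then there is a rational $J$-inner function $\Theta=\begin{bmatrix}\Theta_{11}&\Theta_{12}\\ \Theta_{21}&\Theta_{22}\end{bmatrix}$ such that (1) $\mathcal M_{\mathfrak D}=\Theta\cdot H^2_{p+m}(\Pi_+)$, and (2) the set of all $S\in\mathcal S^{p\times m}(\Pi_+)$ satisfying $( * )$ is given by the formula $S=(\Theta_{11}G+\Theta_{12})(\Theta_{21}G+\Theta_{22})^{-1}$ with $G\in\mathcal S^{p\times m}(\Pi_+)$.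
   Context: $\Pi_\pm=\{z\in\mathbb C:\pm\operatorname{Re}z>0\}$. $\mathcal S^{p\times m}(\Pi_+)$ is the Schur class: analytic functions $S:\Pi_+\to\mathbb C^{p\times m}$ with $\|S(\lambda)\|\le1$ on $\Pi_+$. A $\Pi_+$-admissible BTOA interpolation data set is a septet of matrices $\mathfrak D=(Z,X,Y;U,V,W;\Gamma)$ with $Z\in\mathbb C^{n_Z\times n_Z}$, $X\in\mathbb C^{n_Z\times p}$, $Y\in\mathbb C^{n_Z\times m}$, $W\in\mathbb C^{n_W\times n_W}$, $U\in\mathbb C^{m\times n_W}$, $V\in\mathbb C^{p\times n_W}$, $\Gamma\in\mathbb C^{n_Z\times n_W}$ such that: (1) $\sigma(Z)\cup\sigma(W)\subset\Pi_+$; (2) $(Z,X)$ is controllable and $(U,W)$ is observable; (3) $\Gamma W-Z\Gamma=XV-YU$. For $S$ analytic on $\Pi_+$: $(XS)^{\wedge L}(Z)=\sum_{z_0\in\sigma(Z)}\operatorname{Res}_{\lambda=z_0}(\lambda I-Z)^{-1}XS(\lambda)$, $(SU)^{\wedge R}(W)=\sum_{z_0\in\sigma(W)}\operatorname{Res}_{\lambda=z_0}S(\lambda)U(\lambda I-W)^{-1}$, $(XSU)^{\wedge L,R}(Z,W)=\sum_{z_0\in\sigma(Z)\cup\sigma(W)}\operatorname{Res}_{\lambda=z_0}(\lambda I-Z)^{-1}XS(\lambda)U(\lambda I-W)^{-1}$. $L^2_N(i\mathbb R)$ is the space of $\mathbb C^N$-valued square-integrable functions on the imaginary line; $H^2_N(\Pi_+)$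 is the Hardy space, identified via nontangential boundary values with a subspace of $L^2_N(i\mathbb R)$. Define $$\mathcal M_{\mathfrak D}=\Big\{\begin{bmatrix}V\\ U\end{bmatrix}(\lambda I-W)^{-1}x+\begin{bmatrix}f\\ g\end{bmatrix}: x\in\mathbb C^{n_W},\ \begin{bmatrix}f\\ g\end{bmatrix}\in H^2_{p+m}(\Pi_+),\ \sum_{z_0\in\Pi_+}\operatorname{Res}_{\lambda=z_0}(\lambda I-Z)^{-1}\begin{bmatrix}X&-Y\end{bmatrix}\begin{bmatrix}f(\lambda)\\ g(\lambda)\end{bmatrix}=\Gamma x\Big\},$$ $$\mathcal M_{\mathfrak D,-}=\{U(\lambda I-W)^{-1}x:x\in\mathbb C^{n_W}\}\oplus H^2_m(\Pi_+),\qquad \mathcal K=\begin{bmatrix}L^2_p(i\mathbb R)\\ \mathcal M_{\mathfrak D,-}\end{bmatrix}.$$ $\mathcal K$ carries the Kreĭn-space inner product $[f,g]_J=\langle Jf,g\rangle_{L^2}$ with $J=\begin{bmatrix}I_p&0\\ 0&-I_m\end{bmatrix}$, and $\mathcal M_{\mathfrak D}^{[\perp\mathcal K]}=\{f\in\mathcal K:[f,g]_J=0\ \forall g\in\mathcal M_{\mathfrak D}\}$. A rational $(p+m)\times(p+m)$ matrix function $\Theta$ is $J$-inner if $\Theta(\lambda)^*J\Theta(\lambda)=J$ for $\lambda\in i\mathbb R$ and $J-\Theta(\lambda)^*J\Theta(\lambda)\succeq0$ at all points of analyticity $\lambda\in\Pi_+$. The linear-fractional formula is understood as an identity of meromorphic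 functions on $\Pi_+$, removable singularities being removed. *)

theory Defs
  imports
    "HOL-Complex_Analysis.Complex_Analysis"
    "HOL-Computational_Algebra.Polynomial_Factorial"
begin

(* The matrix sizes p, m, n_Z, n_W are the cardinalities of the finite index types
   'p, 'm, 'z, 'w; a k x l matrix has type complex^'l^'k, and block vectors of size p + m
   are indexed by 'p + 'm. *)

definition right_half_plane :: "complex set" where
  "right_half_plane = {z. Re z > 0}"

definition stack :: "'a^'p::finite \<Rightarrow> 'a^'m::finite \<Rightarrow> 'a^('p + 'm)" where
  "stack a b = (\<chi> i. case i of Inl k \<Rightarrow> a $ k | Inr k \<Rightarrow> b $ k)"

(* As matrices are vectors of rows, stack also forms the block column of two matrices. *)

definition beside :: "'a^'p::finite^'k::finite \<Rightarrow> 'a^'m::finite^'k \<Rightarrow> 'a^('p + 'm)^'k" where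
  "beside A B = (\<chi> i. stack (A $ i) (B $ i))"

definition conj_transpose :: "complex^'l::finite^'k::finite \<Rightarrow> complex^'k^'l" where
  "conj_transpose A = (\<chi> i j. cnj (A $ j $ i))"

definition cinner :: "complex^'k::finite \<Rightarrow> complex^'k \<Rightarrow> complex" where
  "cinner u v = (\<Sum>i\<in>UNIV. u $ i * cnj (v $ i))"

definition pos_semidef :: "complex^'k::finite^'k \<Rightarrow> bool" where
  "pos_semidef A \<longleftrightarrow> (\<forall>v. Im (cinner (A *v v) v) = 0 \<and> 0 \<le> Re (cinner (A *v v) v))"

definition spectrum :: "complex^'k::finite^'k \<Rightarrow> complex set" where
  "spectrum A = {z. \<not> invertible (mat z - A)}"

(* The resolvent is only meaningful off the spectrum, where matrix_inv is a true inverse. *)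
definition resolvent :: "complex^'k::finite^'k \<Rightarrow> complex \<Rightarrow> complex^'k^'k" where
  "resolvent A z = matrix_inv (mat z - A)"

definition vec_holomorphic_on :: "(complex \<Rightarrow> complex^'k::finite) \<Rightarrow> complex set \<Rightarrow> bool" where
  "vec_holomorphic_on F D \<longleftrightarrow> (\<forall>i. (\<lambda>z. F z $ i) holomorphic_on D)"

definition mat_holomorphic_on ::
    "(complex \<Rightarrow> complex^'l::finite^'k::finite) \<Rightarrow> complex set \<Rightarrow> bool" where
  "mat_holomorphic_on F D \<longleftrightarrow> (\<forall>i j. (\<lambda>z. F z $ i $ j) holomorphic_on D)"

definition vec_residue :: "(complex \<Rightarrow> complex^'k::finite) \<Rightarrow> complex \<Rightarrow> complex^'k" where
  "vec_residue F z0 = (\<chi> i. residue (\<lambda>z. F z $ i) z0)"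

definition mat_residue ::
    "(complex \<Rightarrow> complex^'l::finite^'k::finite) \<Rightarrow> complex \<Rightarrow> complex^'l^'k" where
  "mat_residue F z0 = (\<chi> i j. residue (\<lambda>z. F z $ i $ j) z0)"

definition schur_class :: "(complex \<Rightarrow> complex^'m::finite^'p::finite) set" where
  "schur_class = {S. mat_holomorphic_on S right_half_plane \<and>
     (\<forall>z\<in>right_half_plane. onorm (\<lambda>v. S z *v v) \<le> 1)}"

(* Matrix powers are written as iterated products, since the operator ^ on the type of
   vectors is not the matrix power. *)

definition controllable :: "complex^'z::finite^'z \<Rightarrow> complex^'p::finite^'z \<Rightarrow> bool" where
  "controllable Z X \<longleftrightarrow>
     vec.span (\<Union>k<CARD('z). range (\<lambda>u. (((\<lambda>M. Z ** M) ^^ k) X) *v u)) = UNIV"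

definition observable :: "complex^'w::finite^'m::finite \<Rightarrow> complex^'w^'w \<Rightarrow> bool" where
  "observable U W \<longleftrightarrow> (\<Inter>k<CARD('w). {x. (((\<lambda>M. M ** W) ^^ k) U) *v x = 0}) = {0}"

definition admissible_data ::
    "complex^'z::finite^'z \<Rightarrow> complex^'p::finite^'z \<Rightarrow> complex^'m::finite^'z \<Rightarrow>
     complex^'w::finite^'m \<Rightarrow> complex^'w^'p \<Rightarrow> complex^'w^'w \<Rightarrow> complex^'w^'z \<Rightarrow> bool" where
  "admissible_data Z X Y U V W \<Gamma> \<longleftrightarrow>
     spectrum Z \<union> spectrum W \<subseteq> right_half_plane \<and>
     controllable Z X \<and> observable U W \<and>
     \<Gamma> ** W - Z ** \<Gamma> = X ** V - Y ** U"

definition left_eval ::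
    "complex^'z::finite^'z \<Rightarrow> complex^'p::finite^'z \<Rightarrow> (complex \<Rightarrow> complex^'m::finite^'p) \<Rightarrow>
     complex^'m^'z" where
  "left_eval Z X S =
     (\<Sum>z0\<in>spectrum Z. mat_residue (\<lambda>z. resolvent Z z ** X ** S z) z0)"

definition right_eval ::
    "complex^'w::finite^'m::finite \<Rightarrow> complex^'w^'w \<Rightarrow> (complex \<Rightarrow> complex^'m^'p::finite) \<Rightarrow>
     complex^'w^'p" where
  "right_eval U W S =
     (\<Sum>z0\<in>spectrum W. mat_residue (\<lambda>z. S z ** U ** resolvent W z) z0)"

definition left_right_eval ::
    "complex^'z::finite^'z \<Rightarrow> complex^'p::finite^'z \<Rightarrow> complex^'w::finite^'m::finite \<Rightarrow>
     complex^'w^'w \<Rightarrow> (complex \<Rightarrow> complex^'m^'p) \<Rightarrow> complex^'w^'z" where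
  "left_right_eval Z X U W S =
     (\<Sum>z0\<in>spectrum Z \<union> spectrum W.
        mat_residue (\<lambda>z. resolvent Z z ** X ** S z ** U ** resolvent W z) z0)"

definition btoa_solutions ::
    "complex^'z::finite^'z \<Rightarrow> complex^'p::finite^'z \<Rightarrow> complex^'m::finite^'z \<Rightarrow>
     complex^'w::finite^'m \<Rightarrow> complex^'w^'p \<Rightarrow> complex^'w^'w \<Rightarrow> complex^'w^'z \<Rightarrow>
     (complex \<Rightarrow> complex^'m^'p) set" where
  "btoa_solutions Z X Y U V W \<Gamma> =
     {S \<in> schur_class. left_eval Z X S = Y \<and> right_eval U W S = V \<and>
        left_right_eval Z X U W S = \<Gamma>}"

(* A function f on the imaginary line is represented by y |-> f (i y).  Elements of L^2 are
   represented by functions rather than classes, so every subspace below is closed under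
   modification on null sets. *)

definition L2_line :: "(real \<Rightarrow> complex^'k::finite) set" where
  "L2_line = {f. f \<in> borel_measurable lborel \<and> integrable lborel (\<lambda>y. (norm (f y))\<^sup>2)}"

definition L2_inner ::
    "(real \<Rightarrow> complex^'k::finite) \<Rightarrow> (real \<Rightarrow> complex^'k) \<Rightarrow> complex" where
  "L2_inner f g = (LINT y|lborel. cinner (f y) (g y))"

definition hardy2 :: "(complex \<Rightarrow> complex^'k::finite) set" where
  "hardy2 = {F. vec_holomorphic_on F right_half_plane \<and>
     (\<exists>C::real. \<forall>x>0. (\<integral>\<^sup>+y. ennreal ((norm (F (Complex x y)))\<^sup>2) \<partial>lborel) \<le> ennreal C)}"

definition nontangential_boundary_values ::
    "(complex \<Rightarrow> complex^'k::finite) \<Rightarrow> (real \<Rightarrow> complex^'k) \<Rightarrow> bool" where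
  "nontangential_boundary_values F \<phi> \<longleftrightarrow>
     (AE y in lborel. \<forall>\<alpha>>0.
        (F \<longlongrightarrow> \<phi> y) (at (Complex 0 y) within {z. Re z > 0 \<and> \<bar>Im z - y\<bar> < \<alpha> * Re z}))"

(* The residues below vanish off the spectrum of Z, so the infinite sum has only finitely
   many nonzero terms. *)
definition M_D ::
    "complex^'z::finite^'z \<Rightarrow> complex^'p::finite^'z \<Rightarrow> complex^'m::finite^'z \<Rightarrow>
     complex^'w::finite^'m \<Rightarrow> complex^'w^'p \<Rightarrow> complex^'w^'w \<Rightarrow> complex^'w^'z \<Rightarrow>
     (real \<Rightarrow> complex^('p + 'm)) set" where
  "M_D Z X Y U V W \<Gamma> =
     {h \<in> L2_line. \<exists>x. \<exists>F\<in>hardy2. \<exists>\<phi>. nontangential_boundary_values F \<phi> \<and>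
        (AE y in lborel. h y = stack V U *v (resolvent W (Complex 0 y) *v x) + \<phi> y) \<and>
        (\<Sum>\<^sub>\<infinity>z0\<in>right_half_plane.
           vec_residue (\<lambda>z. resolvent Z z *v (beside X (- Y) *v F z)) z0) = \<Gamma> *v x}"

definition M_D_minus ::
    "complex^'w::finite^'m::finite \<Rightarrow> complex^'w^'w \<Rightarrow> (real \<Rightarrow> complex^'m) set" where
  "M_D_minus U W =
     {h \<in> L2_line. \<exists>x. \<exists>F\<in>hardy2. \<exists>\<phi>. nontangential_boundary_values F \<phi> \<and>
        (AE y in lborel. h y = U *v (resolvent W (Complex 0 y) *v x) + \<phi> y)}"

definition krein_K ::
    "complex^'w::finite^'m::finite \<Rightarrow> complex^'w^'w \<Rightarrow>
     (real \<Rightarrow> complex^('p::finite + 'm)) set" where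
  "krein_K U W = {h. \<exists>f\<in>L2_line. \<exists>g\<in>M_D_minus U W. h = (\<lambda>y. stack (f y) (g y))}"

definition J_sig :: "complex^('p::finite + 'm::finite)^('p + 'm)" where
  "J_sig = (\<chi> i j. if i = j then (case i of Inl _ \<Rightarrow> 1 | Inr _ \<Rightarrow> -1) else 0)"

definition J_form ::
    "(real \<Rightarrow> complex^('p::finite + 'm::finite)) \<Rightarrow> (real \<Rightarrow> complex^('p + 'm)) \<Rightarrow> complex" where
  "J_form f g = L2_inner (\<lambda>y. J_sig *v f y) g"

definition M_D_perp ::
    "complex^'z::finite^'z \<Rightarrow> complex^'p::finite^'z \<Rightarrow> complex^'m::finite^'z \<Rightarrow>
     complex^'w::finite^'m \<Rightarrow> complex^'w^'p \<Rightarrow> complex^'w^'w \<Rightarrow> complex^'w^'z \<Rightarrow>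
     (real \<Rightarrow> complex^('p + 'm)) set" where
  "M_D_perp Z X Y U V W \<Gamma> =
     {f \<in> krein_K U W. \<forall>g\<in>M_D Z X Y U V W \<Gamma>. J_form f g = 0}"

(* J_form f f is real for every f in L^2, so taking the real part loses nothing. *)

definition J_positive :: "(real \<Rightarrow> complex^('p::finite + 'm::finite)) set \<Rightarrow> bool" where
  "J_positive N \<longleftrightarrow> (\<forall>f\<in>N. 0 \<le> Re (J_form f f))"

definition J_hilbert :: "(real \<Rightarrow> complex^('p::finite + 'm::finite)) set \<Rightarrow> bool" where
  "J_hilbert N \<longleftrightarrow>
     J_positive N \<and>
     (\<forall>f\<in>N. J_form f f = 0 \<longrightarrow> (AE y in lborel. f y = 0)) \<and>
     (\<forall>s. (\<forall>n::nat. s n \<in> N) \<and>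
        (\<forall>\<epsilon>>0. \<exists>n0. \<forall>k\<ge>n0. \<forall>n\<ge>n0.
           Re (J_form (\<lambda>y. s k y - s n y) (\<lambda>y. s k y - s n y)) < \<epsilon>) \<longrightarrow>
        (\<exists>f\<in>N. (\<lambda>n. Re (J_form (\<lambda>y. s n y - f y) (\<lambda>y. s n y - f y))) \<longlonglongrightarrow> 0))"

(* Coprimality makes the function value at a point where the rational function is analytic
   the correct one; at a pole of an entry that entry has the value 0. *)
definition rational_matrix :: "(complex \<Rightarrow> complex^'l::finite^'k::finite) \<Rightarrow> bool" where
  "rational_matrix \<Theta> \<longleftrightarrow>
     (\<forall>i j. \<exists>P Q :: complex poly. Q \<noteq> 0 \<and> coprime P Q \<and>
        (\<forall>z. \<Theta> z $ i $ j = poly P z / poly Q z))"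

definition mat_analytic_at ::
    "(complex \<Rightarrow> complex^'l::finite^'k::finite) \<Rightarrow> complex \<Rightarrow> bool" where
  "mat_analytic_at F z \<longleftrightarrow> (\<forall>i j. (\<lambda>w. F w $ i $ j) analytic_on {z})"

(* The identity on the imaginary line is required at every point, which presupposes that
   Theta has no poles there. *)
definition rational_J_inner ::
    "(complex \<Rightarrow> complex^('p::finite + 'm::finite)^('p + 'm)) \<Rightarrow> bool" where
  "rational_J_inner \<Theta> \<longleftrightarrow>
     rational_matrix \<Theta> \<and>
     (\<forall>z. Re z = 0 \<longrightarrow> mat_analytic_at \<Theta> z \<and>
        conj_transpose (\<Theta> z) ** J_sig ** \<Theta> z = J_sig) \<and>
     (\<forall>z\<in>right_half_plane. mat_analytic_at \<Theta> z \<longrightarrow>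
        pos_semidef (J_sig - conj_transpose (\<Theta> z) ** J_sig ** \<Theta> z))"

(* Square integrability is not imposed here: an equation M_D = times_hardy2 Theta thus
   also says that Theta maps H^2 into L^2. *)
definition times_hardy2 ::
    "(complex \<Rightarrow> complex^'k::finite^'k) \<Rightarrow> (real \<Rightarrow> complex^'k) set" where
  "times_hardy2 \<Theta> =
     {h \<in> borel_measurable lborel. \<exists>F\<in>hardy2. \<exists>\<phi>. nontangential_boundary_values F \<phi> \<and>
        (AE y in lborel. h y = \<Theta> (Complex 0 y) *v \<phi> y)}"

definition block11 :: "'a^('p::finite + 'm::finite)^('p + 'm) \<Rightarrow> 'a^'p^'p" where
  "block11 A = (\<chi> i j. A $ Inl i $ Inl j)"

definition block12 :: "'a^('p::finite + 'm::finite)^('p + 'm) \<Rightarrow> 'a^'m^'p" where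
  "block12 A = (\<chi> i j. A $ Inl i $ Inr j)"

definition block21 :: "'a^('p::finite + 'm::finite)^('p + 'm) \<Rightarrow> 'a^'p^'m" where
  "block21 A = (\<chi> i j. A $ Inr i $ Inl j)"

definition block22 :: "'a^('p::finite + 'm::finite)^('p + 'm) \<Rightarrow> 'a^'m^'m" where
  "block22 A = (\<chi> i j. A $ Inr i $ Inr j)"

(* S is the linear-fractional transform of G as a meromorphic function, with removable
   singularities removed: S is analytic, and the formula makes sense and holds off a subset
   of the half-plane that has no limit point in it. *)
definition is_lft ::
    "(complex \<Rightarrow> complex^('p::finite + 'm::finite)^('p + 'm)) \<Rightarrow> (complex \<Rightarrow> complex^'m^'p) \<Rightarrow>
     (complex \<Rightarrow> complex^'m^'p) \<Rightarrow> bool" where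
  "is_lft \<Theta> G S \<longleftrightarrow>
     mat_holomorphic_on S right_half_plane \<and>
     (\<forall>\<^sub>\<approx>z\<in>right_half_plane.
        invertible (block21 (\<Theta> z) ** G z + block22 (\<Theta> z)) \<and>
        S z = (block11 (\<Theta> z) ** G z + block12 (\<Theta> z)) **
              matrix_inv (block21 (\<Theta> z) ** G z + block22 (\<Theta> z)))"

end

theory Submission
  imports Defs "HOL-Probability.Sinc_Integral"
begin

text \<open>
  Dividing by \<open>\<lambda> - Z\<close> and \<open>\<lambda> - W\<close>, the interpolation conditions say that \<open>X S - Y\<close>, \<open>S U - V\<close> and
  \<open>X K - \<Gamma>\<close> are holomorphic multiples of \<open>\<lambda> - Z\<close> or \<open>\<lambda> - W\<close>, where \<open>S U = V + K (\<lambda> - W)\<close>. Everything is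
  governed by the Pick matrix \<open>P = [[g\<^sub>X - g\<^sub>Y, \<Gamma>], [\<Gamma>\<^sup>*, g\<^sub>U - g\<^sub>V]]\<close>, with \<open>g\<close> the Gramians, which solves
  \<open>P A + A\<^sup>* P = - C\<^sup>* J C\<close> for \<open>A = diag(-Z\<^sup>*, W)\<close> and \<open>C = [[-X\<^sup>*, V], [-Y\<^sup>*, U]]\<close>.

  For a solution \<open>S\<close> that is regular on the boundary, the quadratic form of \<open>P\<close> is the integral of a
  nonnegative function over the line, and a shift by \<open>\<epsilon>\<close> removes the regularity assumption; so \<open>P \<ge> 0\<close>. If \<open>P > 0\<close>,
  then \<open>\<Theta> = I - C (\<lambda> - A)\<^sup>-\<^sup>1 P\<^sup>-\<^sup>1 C\<^sup>* J\<close> is \<open>J\<close>-inner; its linear-fractional transforms are solutions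
  because the energy balance of \<open>\<Theta>\<close> makes the closed loop invertible on the half-plane, and all solutions
  arise in this way because adjoining one more left interpolation condition keeps the Pick form
  nonnegative. If only \<open>P \<ge> 0\<close>, then the data with \<open>(Y, V, \<Gamma>)\<close> scaled by \<open>r < 1\<close> have \<open>P > 0\<close>, and Montel's
  theorem yields a solution as \<open>r \<rightarrow> 1\<close>. The same solutions \<open>S\<^sub>r\<close> bound \<open>b\<close> by \<open>a\<close> for every \<open>(a, b)\<close> orthogonal
  to \<open>M\<^sub>D\<close>, since \<open>(S\<^sub>r b / r, b)\<close> lies in \<open>M\<^sub>D\<close>. Conversely, explicit orthogonal vectors built from resolvents
  have \<open>J\<close>-form at most \<open>2 \<pi>\<close> times the Pick form, so positivity forces \<open>P \<ge> 0\<close>, and \<open>P > 0\<close> in the Hilbert space case.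
\<close>

text \<open>Two obstacles shape the route. A Schur function is given only on the open half-plane, so
  boundary integrals are formed only for functions with a limit at every boundary point, such as a
  translate \<open>S (z + e)\<close> or the transform of \<open>G = 0\<close>; statements about
  other Schur functions follow by locally uniform limits. And \<open>\<Theta>\<close> has poles
  inside the half-plane, among the eigenvalues of \<open>W\<close>, so its transform cannot be
  evaluated pointwise; the closed-loop pencil carries the same function without exceptional points.
  In the division form, multiplicities of eigenvalues need no separate treatment, Gramians become
  evaluations of kernel functions, and uniqueness of remainders proves the Lyapunov equations. The
  off-diagonal block of the equation for \<open>P\<close> is the Sylvester equation of
  admissibility. The factor \<open>P\<^sup>-\<^sup>1 C\<^sup>* J\<close> in \<open>\<Theta>\<close>
  is the input matrix \<open>B\<close> with \<open>P B = C\<^sup>* J\<close>, which yields exactly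
  the cross term of the energy balance. The constant 2 pi is the integral of 1/(1 + iy) + 1/(1 - iy)
  = 2/(1 + y^2) over the line. Below, X^H is the adjoint of X.\<close>

no_notation fps_nth (infixl "$" 75)

section \<open>Complex matrices and resolvents\<close>

lemma conj_transpose_nth [simp]: "conj_transpose A $ i $ j = cnj (A $ j $ i)"
  by (simp add: conj_transpose_def)

lemma conj_transpose_conj_transpose [simp]: "conj_transpose (conj_transpose A) = A"
  by (simp add: vec_eq_iff)

lemma conj_transpose_mult: "conj_transpose (A ** B) = conj_transpose B ** conj_transpose A"
  by (simp add: vec_eq_iff matrix_matrix_mult_def mult.commute)

lemma conj_transpose_add: "conj_transpose (A + B) = conj_transpose A + conj_transpose B"
  by (simp add: vec_eq_iff)

lemma conj_transpose_diff: "conj_transpose (A - B) = conj_transpose A - conj_transpose B"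
  by (simp add: vec_eq_iff)

lemma conj_transpose_minus: "conj_transpose (- A) = - conj_transpose A"
  by (simp add: vec_eq_iff)

lemma conj_transpose_mat: "conj_transpose (mat z) = mat (cnj z)"
  by (simp add: vec_eq_iff mat_def)

lemma cinner_add_left: "cinner (u + v) w = cinner u w + cinner v w"
  by (simp add: cinner_def algebra_simps sum.distrib)

lemma cinner_add_right: "cinner w (u + v) = cinner w u + cinner w v"
  by (simp add: cinner_def algebra_simps sum.distrib)

lemma cinner_diff_left: "cinner (u - v) w = cinner u w - cinner v w"
  by (simp add: cinner_def algebra_simps sum_subtractf)

lemma cinner_diff_right: "cinner w (u - v) = cinner w u - cinner w v"
  by (simp add: cinner_def algebra_simps sum_subtractf)

lemma cinner_minus_left: "cinner (- u) w = - cinner u w"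
  by (simp add: cinner_def sum_negf)

lemma cinner_minus_right: "cinner w (- u) = - cinner w u"
  by (simp add: cinner_def sum_negf)

lemma cinner_scale_left: "cinner (c *s u) w = c * cinner u w"
  by (simp add: cinner_def sum_distrib_left mult.assoc)

lemma cinner_scale_right: "cinner w (c *s u) = cnj c * cinner w u"
  by (simp add: cinner_def sum_distrib_left mult_ac)

lemma cinner_zero_left [simp]: "cinner 0 w = 0" and cinner_zero_right [simp]: "cinner w 0 = 0"
  by (simp_all add: cinner_def)

lemma cnj_cinner: "cnj (cinner u v) = cinner v u"
  by (simp add: cinner_def mult.commute)

lemma Re_cinner_commute: "Re (cinner u v) = Re (cinner v u)"
  by (metis cnj_cinner complex_cnj(1) complex.sel(1) complex.collapse)

lemma cinner_adjoint: "cinner (A *v u) v = cinner u (conj_transpose A *v v)"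
proof -
  have "cinner (A *v u) v = (\<Sum>i\<in>UNIV. \<Sum>j\<in>UNIV. A $ i $ j * u $ j * cnj (v $ i))"
    by (simp add: cinner_def matrix_vector_mult_def sum_distrib_right)
  also have "\<dots> = (\<Sum>j\<in>UNIV. \<Sum>i\<in>UNIV. A $ i $ j * u $ j * cnj (v $ i))"
    by (rule sum.swap)
  also have "\<dots> = cinner u (conj_transpose A *v v)"
    by (simp add: cinner_def matrix_vector_mult_def sum_distrib_left mult_ac)
  finally show ?thesis .
qed

lemma cinner_adjoint': "cinner u (A *v v) = cinner (conj_transpose A *v u) v"
  by (simp add: cinner_adjoint)

lemma cinner_self: "cinner u u = of_real ((norm u)\<^sup>2)"
  by (simp add: cinner_def norm_vec_def L2_set_def sum_nonneg complex_norm_square flip: of_real_power)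

lemma Re_cinner_self: "Re (cinner u u) = (norm u)\<^sup>2"
  by (simp add: cinner_self)

lemma norm_cinner_le: "norm (cinner u v) \<le> norm u * norm v"
proof -
  have "norm (cinner u v) \<le> (\<Sum>i\<in>UNIV. norm (u $ i) * norm (v $ i))"
    unfolding cinner_def by (rule order_trans[OF norm_sum]) (simp add: norm_mult)
  also have "\<dots> \<le> norm u * norm v"
    unfolding norm_vec_def using L2_set_mult_ineq[of "\<lambda>i. norm (u $ i)" "\<lambda>i. norm (v $ i)" UNIV]
    by simp
  finally show ?thesis .
qed

lemma norm_scale: "norm (c *s (u :: complex^'k::finite)) = norm c * norm u"
  by (simp add: norm_vec_def norm_mult L2_set_right_distrib)

lemma cinner_ext:
  fixes u v :: "complex^'k::finite"
  assumes "\<And>w. cinner u w = cinner v w"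
  shows "u = v"
proof -
  have "cinner (u - v) (u - v) = 0"
    by (simp add: cinner_diff_left assms)
  then show ?thesis by (simp add: cinner_self)
qed

section \<open>Matrix algebra and the action on vectors\<close>

lemma matrix_eqI:
  fixes A B :: "complex^'k::finite^'l::finite"
  assumes "\<And>x. A *v x = B *v x"
  shows "A = B"
  using assms by (simp add: matrix_eq)

lemma matrix_mul_sub_ldistrib: "(A :: complex^'k::finite^'l::finite) ** (B - C) = A ** B - A ** C"
  by (rule matrix_eqI) (simp add: matrix_vector_mult_diff_rdistrib matrix_vector_mult_diff_distrib flip: matrix_vector_mul_assoc)

lemma matrix_mul_sub_rdistrib: "((B :: complex^'k::finite^'l::finite) - C) ** A = B ** A - C ** A"
  by (rule matrix_eqI) (simp add: matrix_vector_mult_diff_rdistrib matrix_vector_mult_diff_distrib flip: matrix_vector_mul_assoc)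

lemma matrix_mul_add_rdistrib: "((B :: complex^'k::finite^'l::finite) + C) ** A = B ** A + C ** A"
  by (rule matrix_eqI) (simp add: matrix_vector_mult_add_rdistrib flip: matrix_vector_mul_assoc)

lemma matrix_vector_minus_left: "(- A :: complex^'k::finite^'l::finite) *v x = - (A *v x)"
  using matrix_vector_mult_diff_rdistrib[of 0 A x] by simp

lemma matrix_vector_minus_right: "(A :: complex^'k::finite^'l::finite) *v (- x) = - (A *v x)"
  using matrix_vector_mult_diff_distrib[of A 0 x] by simp

lemma matrix_mul_minus_left: "(- B :: complex^'k::finite^'l::finite) ** A = - (B ** A)"
  by (rule matrix_eqI) (simp add: matrix_vector_minus_left flip: matrix_vector_mul_assoc)

lemma matrix_mul_minus_right: "(A :: complex^'k::finite^'l::finite) ** (- B) = - (A ** B)"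
  by (rule matrix_eqI) (simp add: matrix_vector_minus_left matrix_vector_minus_right flip: matrix_vector_mul_assoc)

lemma matrix_mul_zero [simp]:
  "(A :: complex^'k::finite^'l::finite) ** 0 = 0" "0 ** (A :: complex^'k::finite^'l::finite) = 0"
  by (rule matrix_eqI, simp flip: matrix_vector_mul_assoc)+

lemma mat_mult_vector: "(mat c :: complex^'k::finite^'k) *v x = c *s x"
  by (simp add: vec_eq_iff matrix_vector_mult_def mat_def if_distrib[of "\<lambda>x. x * _"] cong: if_cong)

lemma matrix_vector_scale: "(A :: complex^'k::finite^'l::finite) *v (c *s x) = c *s (A *v x)"
  by (simp add: vec_eq_iff matrix_vector_mult_def sum_distrib_left mult_ac)

lemma mat_mult_commute: "(mat c :: complex^'l::finite^'l) ** (A :: complex^'k::finite^'l) = A ** mat c"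
  by (rule matrix_eqI) (simp add: mat_mult_vector matrix_vector_scale flip: matrix_vector_mul_assoc)

lemmas mat_vec_simps = matrix_vector_right_distrib matrix_vector_mult_diff_distrib
  matrix_vector_mult_add_rdistrib matrix_vector_mult_diff_rdistrib matrix_vector_minus_left
  matrix_vector_minus_right mat_mult_vector matrix_vector_scale

lemmas mat_mul_simps = matrix_add_ldistrib matrix_mul_add_rdistrib matrix_mul_sub_ldistrib
  matrix_mul_sub_rdistrib matrix_mul_minus_left matrix_mul_minus_right

lemma matrix_vector_bound:
  obtains B where "B > 0" "\<And>x. norm ((A :: complex^'k::finite^'l::finite) *v x) \<le> B * norm x"
  using linear_bounded_pos[OF matrix_vector_mul_linear[of A]] by auto

section \<open>Invertibility, spectrum and resolvent\<close>

lemma invertible_iff_inj: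
  fixes A :: "complex^'k::finite^'k"
  shows "invertible A \<longleftrightarrow> (\<forall>x. A *v x = 0 \<longrightarrow> x = 0)"
  by (simp add: invertible_left_inverse matrix_left_invertible_ker)

lemma invertible_conj_transpose: "invertible (conj_transpose A) \<longleftrightarrow> invertible A"
proof -
  have *: "invertible (conj_transpose A)" if "invertible A" for A :: "complex^'k::finite^'l::finite"
    using that unfolding invertible_def
    by (metis conj_transpose_mult conj_transpose_mat complex_cnj_one)
  show ?thesis
    using *[of A] *[of "conj_transpose A"] by auto
qed

lemma matrix_inv_mult_left:
  fixes A :: "complex^'k::finite^'k"
  assumes "invertible A" shows "matrix_inv A ** A = mat 1"
  using someI_ex[OF assms[unfolded invertible_def]] by (simp add: matrix_inv_def)

lemma matrix_inv_mult_right: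
  fixes A :: "complex^'k::finite^'k"
  assumes "invertible A" shows "A ** matrix_inv A = mat 1"
  using someI_ex[OF assms[unfolded invertible_def]] by (simp add: matrix_inv_def)

lemma resolvent_left: "z \<notin> spectrum A \<Longrightarrow> resolvent A z ** (mat z - A) = mat 1"
  by (simp add: resolvent_def spectrum_def matrix_inv_mult_left)

lemma resolvent_right: "z \<notin> spectrum A \<Longrightarrow> (mat z - A) ** resolvent A z = mat 1"
  by (simp add: resolvent_def spectrum_def matrix_inv_mult_right)

lemma resolvent_left_vec: "z \<notin> spectrum A \<Longrightarrow> resolvent A z *v ((mat z - A) *v x) = x"
  by (simp add: matrix_vector_mul_assoc resolvent_left)

lemma resolvent_right_vec: "z \<notin> spectrum A \<Longrightarrow> (mat z - A) *v (resolvent A z *v x) = x"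
  by (simp add: matrix_vector_mul_assoc resolvent_right)

lemma resolvent_unique: "z \<notin> spectrum A \<Longrightarrow> (mat z - A) *v y = x \<Longrightarrow> resolvent A z *v x = y"
  using resolvent_left_vec by blast

lemma spectrum_conj_transpose: "spectrum (conj_transpose A) = cnj ` spectrum A"
proof -
  have "z \<in> spectrum (conj_transpose A) \<longleftrightarrow> cnj z \<in> spectrum A" for z
    using invertible_conj_transpose[of "mat (cnj z) - A"]
    by (simp add: spectrum_def conj_transpose_diff conj_transpose_mat)
  then show ?thesis
    by (force simp: image_iff intro: exI[of _ "cnj _"])
qed

lemma spectrum_minus: "spectrum (- A) = uminus ` spectrum A"
proof -
  have "invertible (mat z + A) \<longleftrightarrow> invertible (mat (- z) - A)" for z
    by (simp add: invertible_iff_inj mat_vec_simps algebra_simps)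
       (metis add.inverse_inverse add.inverse_neutral minus_add_distrib neg_eq_iff_add_eq_0 vector_smult_lneg)
  then have "z \<in> spectrum (- A) \<longleftrightarrow> - z \<in> spectrum A" for z
    by (simp add: spectrum_def)
  then show ?thesis
    by (force simp: image_iff intro: exI[of _ "- _"])
qed

lemma resolvent_minus:
  assumes "- z \<notin> spectrum A"
  shows "resolvent (- A) z = - resolvent A (- z)"
proof (rule matrix_eqI)
  fix x
  have z: "z \<notin> spectrum (- A)"
    using assms by (auto simp: spectrum_minus)
  have "(mat z - - A) *v (- (resolvent A (- z) *v x)) = (mat (- z) - A) *v (resolvent A (- z) *v x)"
    by (simp add: mat_vec_simps)
  also have "\<dots> = x" by (rule resolvent_right_vec[OF assms])
  finally show "resolvent (- A) z *v x = (- resolvent A (- z)) *v x"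
    unfolding matrix_vector_minus_left by (rule resolvent_unique[OF z])
qed

lemma conj_transpose_resolvent:
  assumes "z \<notin> spectrum A"
  shows "conj_transpose (resolvent A z) = resolvent (conj_transpose A) (cnj z)"
proof -
  have "cnj z \<notin> spectrum (conj_transpose A)"
    using assms by (auto simp: spectrum_conj_transpose)
  moreover have "(mat (cnj z) - conj_transpose A) ** conj_transpose (resolvent A z) = mat 1"
    using arg_cong[OF resolvent_left[OF assms], of conj_transpose]
    by (simp add: conj_transpose_mult conj_transpose_diff conj_transpose_mat)
  ultimately show ?thesis
    by (metis matrix_mul_assoc matrix_mul_lid matrix_mul_rid resolvent_left)
qed

section \<open>Holomorphic matrix and vector functions\<close>

lemma det_holomorphic:
  assumes "mat_holomorphic_on F D"
  shows "(\<lambda>z. det (F z)) holomorphic_on D"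
  using assms unfolding det_def mat_holomorphic_on_def
  by (intro holomorphic_intros) auto

lemma mat_holomorphic_on_const [simp]: "mat_holomorphic_on (\<lambda>_. A) D"
  by (simp add: mat_holomorphic_on_def)

lemma mat_holomorphic_on_mat: "mat_holomorphic_on mat D"
  unfolding mat_holomorphic_on_def
proof (intro allI)
  fix i j :: 'a
  show "(\<lambda>z. mat z $ i $ j) holomorphic_on D"
    by (cases "i = j") (auto simp: mat_def)
qed

lemma mat_holomorphic_on_add:
  "mat_holomorphic_on F D \<Longrightarrow> mat_holomorphic_on G D \<Longrightarrow> mat_holomorphic_on (\<lambda>z. F z + G z) D"
  unfolding mat_holomorphic_on_def by (auto intro!: holomorphic_intros)

lemma mat_holomorphic_on_diff:
  "mat_holomorphic_on F D \<Longrightarrow> mat_holomorphic_on G D \<Longrightarrow> mat_holomorphic_on (\<lambda>z. F z - G z) D"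
  unfolding mat_holomorphic_on_def by (auto intro!: holomorphic_intros)

lemma mat_holomorphic_on_minus:
  "mat_holomorphic_on F D \<Longrightarrow> mat_holomorphic_on (\<lambda>z. - F z) D"
  unfolding mat_holomorphic_on_def by (auto intro!: holomorphic_intros)

lemma mat_holomorphic_on_mult:
  "mat_holomorphic_on F D \<Longrightarrow> mat_holomorphic_on G D \<Longrightarrow> mat_holomorphic_on (\<lambda>z. F z ** G z) D"
  unfolding mat_holomorphic_on_def matrix_matrix_mult_def by (auto intro!: holomorphic_intros)

lemma mat_vec_holomorphic:
  "mat_holomorphic_on F D \<Longrightarrow> vec_holomorphic_on G D \<Longrightarrow> vec_holomorphic_on (\<lambda>z. F z *v G z) D"
  unfolding mat_holomorphic_on_def vec_holomorphic_on_def matrix_vector_mult_def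
  by (auto intro!: holomorphic_intros)

lemma vec_holomorphic_on_const [simp]: "vec_holomorphic_on (\<lambda>_. c) D"
  by (simp add: vec_holomorphic_on_def)

lemma vec_holomorphic_on_add:
  "vec_holomorphic_on F D \<Longrightarrow> vec_holomorphic_on G D \<Longrightarrow> vec_holomorphic_on (\<lambda>z. F z + G z) D"
  unfolding vec_holomorphic_on_def by (auto intro!: holomorphic_intros)

lemma vec_holomorphic_on_diff:
  "vec_holomorphic_on F D \<Longrightarrow> vec_holomorphic_on G D \<Longrightarrow> vec_holomorphic_on (\<lambda>z. F z - G z) D"
  unfolding vec_holomorphic_on_def by (auto intro!: holomorphic_intros)

lemma vec_holomorphic_on_minus:
  "vec_holomorphic_on F D \<Longrightarrow> vec_holomorphic_on (\<lambda>z. - F z) D"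
  unfolding vec_holomorphic_on_def by (auto intro!: holomorphic_intros)

lemma vec_holomorphic_on_scale:
  "f holomorphic_on D \<Longrightarrow> vec_holomorphic_on G D \<Longrightarrow> vec_holomorphic_on (\<lambda>z. f z *s G z) D"
  unfolding vec_holomorphic_on_def by (auto intro!: holomorphic_intros)

lemmas mat_holo_intros = mat_holomorphic_on_const mat_holomorphic_on_mat mat_holomorphic_on_add
  mat_holomorphic_on_diff mat_holomorphic_on_minus mat_holomorphic_on_mult mat_vec_holomorphic
  vec_holomorphic_on_const vec_holomorphic_on_add vec_holomorphic_on_diff
  vec_holomorphic_on_minus vec_holomorphic_on_scale

lemma mat_holomorphic_on_subset:
  "mat_holomorphic_on F D \<Longrightarrow> E \<subseteq> D \<Longrightarrow> mat_holomorphic_on F E"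
  unfolding mat_holomorphic_on_def using holomorphic_on_subset by blast

lemma vec_holomorphic_on_subset:
  "vec_holomorphic_on F D \<Longrightarrow> E \<subseteq> D \<Longrightarrow> vec_holomorphic_on F E"
  unfolding vec_holomorphic_on_def using holomorphic_on_subset by blast

lemma vec_holomorphic_on_cong:
  "vec_holomorphic_on F D \<Longrightarrow> (\<And>z. z \<in> D \<Longrightarrow> F z = G z) \<Longrightarrow> vec_holomorphic_on G D"
  unfolding vec_holomorphic_on_def by (metis (no_types, lifting) holomorphic_transform)

lemma mat_holomorphic_on_cong:
  "mat_holomorphic_on F D \<Longrightarrow> (\<And>z. z \<in> D \<Longrightarrow> F z = G z) \<Longrightarrow> mat_holomorphic_on G D"
  unfolding mat_holomorphic_on_def by (metis (no_types, lifting) holomorphic_transform)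

text \<open>Cramer's rule applied to the \<open>l\<close>-th unit vector. Writing the inverse
  through determinants serves twice: it makes inverses of holomorphic matrix functions holomorphic
  and, later, resolvents rational.\<close>

lemma matrix_inv_cramer:
  fixes A :: "complex^'k::finite^'k"
  assumes "invertible A"
  shows "matrix_inv A $ k $ l = det (\<chi> i j. if j = k then (if i = l then 1 else 0) else A $ i $ j) / det A"
proof -
  have d: "det A \<noteq> 0" using assms by (simp add: invertible_det_nz)
  have "A *v (matrix_inv A *v axis l 1) = axis l 1"
    by (simp add: matrix_vector_mul_assoc matrix_inv_mult_right[OF assms])
  then have "matrix_inv A *v axis l 1 = (\<chi> k. det (\<chi> i j. if j = k then axis l 1 $ i else A $ i $ j) / det A)"
    using cramer[OF d] by blast
  moreover have "(matrix_inv A *v axis l 1) $ k = matrix_inv A $ k $ l"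
    by (simp add: matrix_vector_mult_def axis_def if_distrib[of "\<lambda>x. _ * x"] cong: if_cong)
  moreover have "(axis l 1 :: complex^'k) $ i = (if i = l then 1 else 0)" for i
    by (simp add: axis_def)
  ultimately show ?thesis by (simp cong: if_cong)
qed

lemma matrix_inv_holomorphic:
  fixes F :: "complex \<Rightarrow> complex^'k::finite^'k"
  assumes F: "mat_holomorphic_on F D" and inv: "\<And>z. z \<in> D \<Longrightarrow> invertible (F z)"
  shows "mat_holomorphic_on (\<lambda>z. matrix_inv (F z)) D"
  unfolding mat_holomorphic_on_def
proof (intro allI)
  fix k l
  have "(\<lambda>z. det (\<chi> i j. if j = k then (if i = l then 1 else 0) else F z $ i $ j) / det (F z)) holomorphic_on D"
  proof (intro holomorphic_on_divide det_holomorphic)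
    show "mat_holomorphic_on (\<lambda>z. \<chi> i j. if j = k then (if i = l then 1 else 0) else F z $ i $ j) D"
      unfolding mat_holomorphic_on_def
    proof (intro allI)
      fix i j
      show "(\<lambda>z. (\<chi> i j. if j = k then (if i = l then 1 else 0) else F z $ i $ j) $ i $ j) holomorphic_on D"
        using F by (cases "j = k") (auto simp: mat_holomorphic_on_def)
    qed
  qed (use F inv in \<open>auto simp: invertible_det_nz\<close>)
  then show "(\<lambda>z. matrix_inv (F z) $ k $ l) holomorphic_on D"
    by (rule holomorphic_transform) (simp add: matrix_inv_cramer inv)
qed

lemma resolvent_holomorphic: "D \<inter> spectrum A = {} \<Longrightarrow> mat_holomorphic_on (resolvent A) D"
  unfolding resolvent_def
  by (rule matrix_inv_holomorphic) (auto intro!: mat_holo_intros simp: spectrum_def)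

section \<open>Polynomial functions, the characteristic polynomial and the size of the
  resolvent\<close>

definition polynomial_fun :: "(complex \<Rightarrow> complex) \<Rightarrow> bool" where
  "polynomial_fun f \<longleftrightarrow> (\<exists>p. \<forall>z. f z = poly p z)"

lemma polynomial_fun_const [simp]: "polynomial_fun (\<lambda>_. c)"
  unfolding polynomial_fun_def by (rule exI[of _ "[:c:]"]) simp

lemma polynomial_fun_id [simp]: "polynomial_fun (\<lambda>z. z)"
  unfolding polynomial_fun_def by (rule exI[of _ "[:0, 1:]"]) simp

lemma polynomial_fun_add: "polynomial_fun f \<Longrightarrow> polynomial_fun g \<Longrightarrow> polynomial_fun (\<lambda>z. f z + g z)"
  unfolding polynomial_fun_def by (metis poly_add)

lemma polynomial_fun_diff: "polynomial_fun f \<Longrightarrow> polynomial_fun g \<Longrightarrow> polynomial_fun (\<lambda>z. f z - g z)"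
  unfolding polynomial_fun_def by (metis poly_diff)

lemma polynomial_fun_mult: "polynomial_fun f \<Longrightarrow> polynomial_fun g \<Longrightarrow> polynomial_fun (\<lambda>z. f z * g z)"
  unfolding polynomial_fun_def by (metis poly_mult)

lemma polynomial_fun_sum: "(\<And>i. i \<in> I \<Longrightarrow> polynomial_fun (f i)) \<Longrightarrow> polynomial_fun (\<lambda>z. \<Sum>i\<in>I. f i z)"
  by (induction I rule: infinite_finite_induct) (auto intro: polynomial_fun_add)

lemma polynomial_fun_prod: "(\<And>i. i \<in> I \<Longrightarrow> polynomial_fun (f i)) \<Longrightarrow> polynomial_fun (\<lambda>z. \<Prod>i\<in>I. f i z)"
  by (induction I rule: infinite_finite_induct) (auto intro: polynomial_fun_mult)

lemma polynomial_fun_det: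
  "(\<And>i j. polynomial_fun (\<lambda>z. F z $ i $ j)) \<Longrightarrow> polynomial_fun (\<lambda>z. det (F z))"
  unfolding det_def by (intro polynomial_fun_sum polynomial_fun_mult polynomial_fun_const polynomial_fun_prod)

text \<open>Once |z| is at least twice a bound for \<open>A\<close>, the term \<open>A *v x\<close>
  uses up at most half of \<open>z *s x\<close>, so the pencil is bounded below by |z|/2. This gives
  both injectivity and decay.\<close>

lemma resolvent_large:
  fixes A :: "complex^'k::finite^'k"
  obtains R where "R > 0" "\<And>z. norm z \<ge> R \<Longrightarrow> z \<notin> spectrum A"
    "\<And>z x. norm z \<ge> R \<Longrightarrow> norm (resolvent A z *v x) \<le> 2 * norm x / norm z"
proof -
  obtain B where B: "B > 0" "\<And>x. norm (A *v x) \<le> B * norm x"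
    using matrix_vector_bound by blast
  have low: "norm z / 2 * norm x \<le> norm ((mat z - A) *v x)" if "norm z \<ge> 2 * B" for z x
  proof -
    have "norm (z *s x) \<le> norm ((mat z - A) *v x) + norm (A *v x)"
      using norm_triangle_ineq[of "(mat z - A) *v x" "A *v x"] by (simp add: mat_vec_simps)
    moreover have "norm (A *v x) \<le> norm z / 2 * norm x"
      using B(2)[of x] that mult_right_mono[of B "norm z / 2" "norm x"] by simp
    ultimately show ?thesis by (simp add: norm_scale)
  qed
  have ns: "z \<notin> spectrum A" if "norm z \<ge> 2 * B" for z
  proof -
    have "x = 0" if "(mat z - A) *v x = 0" for x
    proof -
      have "norm z / 2 * norm x \<le> 0" using low[OF \<open>norm z \<ge> 2 * B\<close>, of x] that by simp
      moreover have "norm z > 0" using \<open>norm z \<ge> 2 * B\<close> B(1) by linarith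
      ultimately show ?thesis by (simp add: mult_le_0_iff)
    qed
    then show ?thesis by (simp add: spectrum_def invertible_iff_inj)
  qed
  show ?thesis
  proof
    show "2 * B > 0" using B by simp
    show "z \<notin> spectrum A" if "norm z \<ge> 2 * B" for z using ns that by blast
    show "norm (resolvent A z *v x) \<le> 2 * norm x / norm z" if "norm z \<ge> 2 * B" for z x
    proof -
      have "norm z > 0" using that B(1) by linarith
      then show ?thesis
        using low[OF that, of "resolvent A z *v x"] resolvent_right_vec[OF ns[OF that], of x]
        by (simp add: field_simps)
    qed
  qed
qed

text \<open>The determinant is polynomial in \<open>z\<close> by its expansion; it is not the zero
  polynomial because points of large modulus lie off the spectrum.\<close>

lemma char_poly_exists:
  fixes A :: "complex^'k::finite^'k"
  obtains q where "q \<noteq> 0" "\<And>z. poly q z = det (mat z - A)"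
proof -
  have "polynomial_fun (\<lambda>z. det (mat z - A))"
  proof (rule polynomial_fun_det)
    fix i j
    show "polynomial_fun (\<lambda>z. (mat z - A) $ i $ j)"
      by (cases "i = j") (auto simp: mat_def intro!: polynomial_fun_diff)
  qed
  then obtain q where q: "\<And>z. poly q z = det (mat z - A)"
    unfolding polynomial_fun_def by metis
  obtain R where "\<And>z. norm z \<ge> R \<Longrightarrow> z \<notin> spectrum A"
    using resolvent_large[of A] by metis
  then have "of_real \<bar>R\<bar> \<notin> spectrum A"
    by simp
  then have "q \<noteq> 0"
    using q[of "of_real \<bar>R\<bar>"] by (auto simp: spectrum_def invertible_det_nz)
  with q that show ?thesis by blast
qed

lemma finite_spectrum [simp]: "finite (spectrum A)"
proof -
  obtain q where q: "q \<noteq> 0" "\<And>z. poly q z = det (mat z - A)"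
    using char_poly_exists by blast
  have "spectrum A = {z. poly q z = 0}"
    by (auto simp: spectrum_def invertible_det_nz q)
  then show ?thesis using poly_roots_finite[OF q(1)] by simp
qed

text \<open>\<open>norm A\<close> is the Frobenius norm here, and the bound is Cauchy-Schwarz row by
  row. The conjugate of \<open>x\<close> enters because \<open>cinner\<close> conjugates its second
  argument.\<close>

lemma norm_matrix_vector_le:
  fixes A :: "complex^'k::finite^'l::finite"
  shows "norm (A *v x) \<le> norm A * norm x"
proof -
  have row: "norm ((A *v x) $ i) \<le> norm (A $ i) * norm x" for i
  proof -
    have "(A *v x) $ i = cinner (A $ i) (\<chi> j. cnj (x $ j))"
      by (simp add: matrix_vector_mult_def cinner_def)
    also have "norm \<dots> \<le> norm (A $ i) * norm (\<chi> j. cnj (x $ j))"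
      by (rule norm_cinner_le)
    also have "norm (\<chi> j. cnj (x $ j)) = norm x"
      by (simp add: norm_vec_def)
    finally show ?thesis .
  qed
  have "norm (A *v x) \<le> L2_set (\<lambda>i. norm (A $ i) * norm x) UNIV"
    unfolding norm_vec_def[of "A *v x"] by (rule L2_set_mono) (use row in auto)
  also have "\<dots> = norm A * norm x"
    by (simp add: norm_vec_def[of A] L2_set_left_distrib)
  finally show ?thesis .
qed

lemma vec_holomorphic_continuous:
  assumes "vec_holomorphic_on F D" shows "continuous_on D F"
proof -
  have "continuous_on D (\<lambda>z. \<chi> i. F z $ i)"
    using assms holomorphic_on_imp_continuous_on
    by (intro continuous_on_vec_lambda) (auto simp: vec_holomorphic_on_def)
  then show ?thesis by simp
qed

lemma mat_holomorphic_continuous: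
  assumes "mat_holomorphic_on F D" shows "continuous_on D F"
proof -
  have "continuous_on D (\<lambda>z. \<chi> i. F z $ i)"
    by (intro continuous_on_vec_lambda vec_holomorphic_continuous)
       (use assms in \<open>auto simp: vec_holomorphic_on_def mat_holomorphic_on_def\<close>)
  then show ?thesis by simp
qed

lemma mat_holomorphic_bound_compact:
  assumes "compact K" "mat_holomorphic_on F K"
  obtains B where "B > 0" "\<And>z x. z \<in> K \<Longrightarrow> norm (F z *v x) \<le> B * norm x"
proof -
  have "bounded (F ` K)"
    using assms mat_holomorphic_continuous compact_continuous_image compact_imp_bounded by blast
  then obtain B where B: "B > 0" "\<And>z. z \<in> K \<Longrightarrow> norm (F z) \<le> B"
    by (auto simp: bounded_pos)
  show ?thesis
    using B by (intro that[of B]) (auto intro!: order_trans[OF norm_matrix_vector_le] mult_right_mono)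
qed

section \<open>Residue evaluations as remainders of division\<close>

lemma open_rhp [simp]: "open right_half_plane"
  using open_halfspace_Re_gt[of 0] by (simp add: right_half_plane_def)

lemma convex_rhp: "convex right_half_plane"
  using convex_halfspace_Re_gt[of 0] by (simp add: right_half_plane_def)

text \<open>Large disks centred far out on the positive real axis exhaust the half-plane. So a
  finite spectrum is enclosed by one circle, and a sum of residues becomes a single contour
  integral.\<close>

lemma rhp_ball_cover:
  assumes "compact K" "K \<subseteq> right_half_plane"
  obtains a r where "r > 0" "K \<subseteq> ball a r" "cball a r \<subseteq> right_half_plane"
proof (cases "K = {}")
  case True
  show ?thesis
  proof (rule that[of "1/2" 1])
    show "cball 1 (1 / 2) \<subseteq> right_half_plane"
    proof
      fix z :: complex assume "z \<in> cball 1 (1/2)"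
      then have "\<bar>Re (1 - z)\<bar> \<le> 1/2"
        using abs_Re_le_cmod[of "1 - z"] by (simp add: dist_norm)
      then show "z \<in> right_half_plane" by (simp add: right_half_plane_def abs_if split: if_splits)
    qed
  qed (use True in auto)
next
  case False
  obtain M where M: "M > 0" "\<And>z. z \<in> K \<Longrightarrow> norm z \<le> M"
    using compact_imp_bounded[OF assms(1)] by (auto simp: bounded_pos)
  have "\<exists>x\<in>K. \<forall>y\<in>K. Re x \<le> Re y"
    by (rule continuous_attains_inf[OF assms(1) False]) (intro continuous_intros)
  then obtain w where w: "w \<in> K" "\<And>z. z \<in> K \<Longrightarrow> Re w \<le> Re z" by blast
  define d where "d = Re w"
  have d: "d > 0" using w assms(2) by (auto simp: d_def right_half_plane_def)
  \<comment> \<open>The inclusion in the ball needs M^2 < a d + d^2/4; this choice gives a d = M^2 +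
    2 d^2.\<close>
  define a where "a = (M\<^sup>2 + d\<^sup>2) / d + d"
  have a: "a > d" using d by (simp add: a_def add_nonneg_pos)
  show ?thesis
  proof (rule that[of "a - d/2" "of_real a"])
    show "a - d / 2 > 0" using a d by simp
    show "K \<subseteq> ball (of_real a) (a - d / 2)"
    proof
      fix z assume z: "z \<in> K"
      have "(norm (of_real a - z))\<^sup>2 = a\<^sup>2 - 2 * a * Re z + (norm z)\<^sup>2"
        unfolding cmod_power2 by (simp add: power2_eq_square algebra_simps)
      also have "\<dots> \<le> a\<^sup>2 - 2 * a * d + M\<^sup>2"
        using w(2)[OF z] M(2)[OF z] a d
        by (intro add_mono diff_left_mono mult_left_mono power_mono) (auto simp: d_def)
      also have "\<dots> < (a - d/2)\<^sup>2"
      proof -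
        have "a * d = M\<^sup>2 + d\<^sup>2 + d\<^sup>2"
          using d by (simp add: a_def field_simps power2_eq_square)
        moreover have "(a - d/2)\<^sup>2 = a\<^sup>2 - a * d + d\<^sup>2 / 4"
          by (simp add: power2_eq_square field_simps)
        moreover have "d\<^sup>2 > 0" using d by simp
        ultimately show ?thesis by linarith
      qed
      finally have "norm (of_real a - z) < a - d/2"
        using a d by (intro power2_less_imp_less[of "norm (of_real a - z)"]) auto
      then show "z \<in> ball (of_real a) (a - d/2)" by (simp add: dist_norm)
    qed
    show "cball (of_real a) (a - d / 2) \<subseteq> right_half_plane"
    proof
      fix z :: complex assume "z \<in> cball (of_real a) (a - d/2)"
      then have "\<bar>Re (of_real a - z)\<bar> \<le> a - d/2"
        using abs_Re_le_cmod[of "of_real a - z"] by (simp add: dist_norm)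
      then show "z \<in> right_half_plane" using d by (auto simp: right_half_plane_def)
    qed
  qed
qed

lemma sum_residue_circlepath:
  assumes "finite pts" "pts \<subseteq> ball a r" "cball a r \<subseteq> D" "open D" "connected D" "f holomorphic_on D - pts" "r > 0"
  shows "contour_integral (circlepath a r) f = 2 * pi * \<i> * (\<Sum>p\<in>pts. residue f p)"
proof -
  have "contour_integral (circlepath a r) f
      = 2 * pi * \<i> * (\<Sum>p\<in>pts. winding_number (circlepath a r) p * residue f p)"
  proof (rule Residue_theorem)
    show "path_image (circlepath a r) \<subseteq> D - pts"
      using assms by (auto simp: sphere_def)
    show "\<forall>z. z \<notin> D \<longrightarrow> winding_number (circlepath a r) z = 0"
      using assms(3,7) by (intro allI impI winding_number_zero_outside[of _ "cball a r"]) auto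
  qed (use assms in auto)
  also have "(\<Sum>p\<in>pts. winding_number (circlepath a r) p * residue f p) = (\<Sum>p\<in>pts. residue f p)"
    using assms(2) by (intro sum.cong refl) (auto simp: winding_number_circlepath dist_norm norm_minus_commute)
  finally show ?thesis .
qed

lemma circlepath_integrable:
  assumes "f holomorphic_on D - pts" "pts \<subseteq> ball a r" "cball a r \<subseteq> D" "r > 0"
  shows "f contour_integrable_on circlepath a r"
  by (rule contour_integrable_continuous_circlepath)
     (use assms in \<open>auto intro!: holomorphic_on_imp_continuous_on elim!: holomorphic_on_subset\<close>)

text \<open>The residues add up to the coefficient of 1/z at infinity: on a large circle
  \<open>f\<close> differs from L/z by less than e/|z|, whereas the integral of this difference has
  modulus exactly 2 pi e if \<open>e\<close> is the error.\<close>

lemma sum_residue_infinity: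
  assumes fin: "finite pts" and hol: "f holomorphic_on UNIV - pts"
    and lim: "((\<lambda>z. z * f z) \<longlongrightarrow> L) at_infinity"
  shows "(\<Sum>p\<in>pts. residue f p) = L"
proof (rule ccontr)
  let ?s = "\<Sum>p\<in>pts. residue f p"
  assume ne: "?s \<noteq> L"
  define e where "e = norm (?s - L)"
  have e: "e > 0" using ne by (simp add: e_def)
  obtain b where b: "\<And>z. b \<le> norm z \<Longrightarrow> norm (z * f z - L) < e"
    using lim e unfolding tendsto_iff eventually_at_infinity dist_norm by blast
  obtain M where M: "\<And>z. z \<in> pts \<Longrightarrow> norm z \<le> M"
    using fin finite_imp_bounded bounded_iff by metis
  define r where "r = max \<bar>b\<bar> \<bar>M\<bar> + 1"
  have r: "r > 0" "b \<le> r" "\<And>z. z \<in> pts \<Longrightarrow> norm z < r"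
    using M by (fastforce simp: r_def)+
  have c: "contour_integral (circlepath 0 r) f = 2 * pi * \<i> * ?s"
    by (rule sum_residue_circlepath[where D = UNIV]) (use assms r in auto)
  have "f contour_integrable_on circlepath 0 r"
    by (rule circlepath_integrable[where D = UNIV]) (use assms r in auto)
  then have "(f has_contour_integral 2 * pi * \<i> * ?s) (circlepath 0 r)"
    using c has_contour_integral_integral by metis
  moreover have "((\<lambda>z. L / (z - 0)) has_contour_integral 2 * of_real pi * \<i> * L) (circlepath 0 r)"
    by (rule Cauchy_integral_circlepath) (use r in auto)
  ultimately have h: "((\<lambda>z. f z - L / z) has_contour_integral (2 * pi * \<i> * ?s - 2 * pi * \<i> * L)) (circlepath 0 r)"
    using has_contour_integral_diff by fastforce
  \<comment> \<open>\<open>e'\<close> is the maximum over the compact circle, hence strictly below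
    \<open>e\<close>; the contour estimate by itself would only give a weak inequality.\<close>
  obtain e' where e': "e' < e" "0 \<le> e'" "\<And>z. norm z = r \<Longrightarrow> norm (z * f z - L) \<le> e'"
  proof -
    have "continuous_on (sphere 0 r) (\<lambda>z. norm (z * f z - L))"
      using hol r by (intro continuous_intros holomorphic_on_imp_continuous_on) (fastforce elim!: holomorphic_on_subset)
    then obtain z where z: "norm z = r" "\<And>w. norm w = r \<Longrightarrow> norm (w * f w - L) \<le> norm (z * f z - L)"
      using continuous_attains_sup[of "sphere 0 r" "\<lambda>z. norm (z * f z - L)"] r(1) by auto
    then show ?thesis using b[of z] r(2) by (intro that[of "norm (z * f z - L)"]) auto
  qed
  have "norm (2 * pi * \<i> * ?s - 2 * pi * \<i> * L) \<le> (e' / r) * (2 * pi * r)"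
  proof (rule has_contour_integral_bound_circlepath[OF h])
    fix z :: complex assume "norm (z - 0) = r"
    then have z: "norm z = r" "z \<noteq> 0" using r by auto
    have "f z - L / z = (z * f z - L) / z" using z by (simp add: field_simps)
    then show "norm (f z - L / z) \<le> e' / r"
      using e'(3)[OF z(1)] z r by (simp add: norm_divide divide_right_mono)
  qed (use r e' in auto)
  then have "2 * pi * e \<le> 2 * pi * e'"
    using r by (simp add: e_def norm_mult flip: right_diff_distrib)
  then show False using e'(1) by simp
qed

section \<open>Division with remainder by \<open>mat z - A\<close> from the left\<close>

definition vec_left_eval :: "complex^'z::finite^'z \<Rightarrow> (complex \<Rightarrow> complex^'z) \<Rightarrow> complex^'z" where
  "vec_left_eval A F = (\<Sum>z0\<in>spectrum A. vec_residue (\<lambda>z. resolvent A z *v F z) z0)"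

lemma vec_left_eval_nth:
  "vec_left_eval A F $ i = (\<Sum>z0\<in>spectrum A. residue (\<lambda>z. (resolvent A z *v F z) $ i) z0)"
  by (simp add: vec_left_eval_def vec_residue_def)

lemma resolvent_vec_holomorphic:
  assumes "vec_holomorphic_on F D"
  shows "vec_holomorphic_on (\<lambda>z. resolvent A z *v F z) (D - spectrum A)"
  by (intro mat_vec_holomorphic resolvent_holomorphic vec_holomorphic_on_subset[OF assms]) auto

lemma vec_left_eval_contour:
  assumes F: "vec_holomorphic_on F right_half_plane"
    and r: "r > 0" "spectrum A \<subseteq> ball a r" "cball a r \<subseteq> right_half_plane"
  shows "((\<lambda>z. (resolvent A z *v F z) $ i) has_contour_integral 2 * pi * \<i> * vec_left_eval A F $ i) (circlepath a r)"
proof -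
  have hol: "(\<lambda>z. (resolvent A z *v F z) $ i) holomorphic_on right_half_plane - spectrum A"
    using resolvent_vec_holomorphic[OF F] by (auto simp: vec_holomorphic_on_def)
  have "contour_integral (circlepath a r) (\<lambda>z. (resolvent A z *v F z) $ i) = 2 * pi * \<i> * vec_left_eval A F $ i"
    unfolding vec_left_eval_nth
    by (rule sum_residue_circlepath[OF _ r(2,3) _ _ hol r(1)]) (auto intro: convex_connected convex_rhp)
  moreover have "(\<lambda>z. (resolvent A z *v F z) $ i) contour_integrable_on circlepath a r"
    by (rule circlepath_integrable[OF hol r(2,3,1)])
  ultimately show ?thesis using has_contour_integral_integral by metis
qed

text \<open>The quotient is the Cauchy integral of the resolvent times \<open>F\<close> over a
  circle around the spectrum, which has no poles inside. Outside the circle the quotient can only be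
  \<open>resolvent A z *v (F z - c)\<close>, and the two expressions agree where both make
  sense.\<close>

lemma left_eval_decomp:
  assumes F: "vec_holomorphic_on F right_half_plane" and A: "spectrum A \<subseteq> right_half_plane"
  obtains G where "vec_holomorphic_on G right_half_plane"
    "\<And>z. z \<in> right_half_plane \<Longrightarrow> F z = vec_left_eval A F + (mat z - A) *v G z"
proof -
  obtain a r where r: "r > 0" "spectrum A \<subseteq> ball a r" "cball a r \<subseteq> right_half_plane"
    by (rule rhp_ball_cover[OF finite_imp_compact[OF finite_spectrum] A])
  define c where "c = vec_left_eval A F"
  define K where "K = (\<lambda>z. resolvent A z *v F z)"
  have contK: "continuous_on (sphere a r) (\<lambda>z. K z $ i)" for i
  proof -
    have "(\<lambda>z. K z $ i) holomorphic_on right_half_plane - spectrum A"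
      using resolvent_vec_holomorphic[OF F] by (auto simp: vec_holomorphic_on_def K_def)
    moreover have "sphere a r \<subseteq> right_half_plane - spectrum A"
      using r by fastforce
    ultimately show ?thesis
      using holomorphic_on_imp_continuous_on holomorphic_on_subset by blast
  qed
  define I where "I = (\<lambda>z i. contour_integral (circlepath a r) (\<lambda>\<zeta>. K \<zeta> $ i / (\<zeta> - z)))"
  have I: "((\<lambda>\<zeta>. K \<zeta> $ i / (\<zeta> - z)) has_contour_integral I z i) (circlepath a r)" if "z \<in> ball a r" for z i
  proof -
    have "continuous_on (sphere a r) (\<lambda>\<zeta>. K \<zeta> $ i / (\<zeta> - z))"
      by (rule continuous_on_divide[OF contK]) (use that in \<open>auto intro!: continuous_intros\<close>)
    then have "(\<lambda>\<zeta>. K \<zeta> $ i / (\<zeta> - z)) contour_integrable_on circlepath a r"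
      using r(1) by (intro contour_integrable_continuous_circlepath) simp
    then show ?thesis unfolding I_def by (rule has_contour_integral_integral)
  qed
  define G0 :: "complex \<Rightarrow> complex^'a" where "G0 = (\<lambda>z. \<chi> i. I z i / (2 * pi * \<i>))"
  have holI: "(\<lambda>z. I z i) holomorphic_on ball a r" for i
  proof -
    have "(\<lambda>z. I z i) field_differentiable at w" if w: "w \<in> ball a r" for w
      using Cauchy_next_derivative_circlepath(2)[where k = 1 and f = "\<lambda>\<zeta>. K \<zeta> $ i" and g = "\<lambda>z. I z i", OF _ _ _ w]
        I contK r(1) unfolding field_differentiable_def by fastforce
    then show ?thesis
      by (simp add: holomorphic_on_def field_differentiable_at_within)
  qed
  have holG0: "vec_holomorphic_on G0 (ball a r)"
    unfolding vec_holomorphic_on_def G0_def using holI by (auto intro!: holomorphic_intros)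
  have eq0: "F z = c + (mat z - A) *v G0 z" if z: "z \<in> ball a r" for z
  proof -
    have "(F z - c) $ i = ((mat z - A) *v G0 z) $ i" for i
    proof -
      have h1: "((\<lambda>\<zeta>. z * (K \<zeta> $ i / (\<zeta> - z)) - (\<Sum>j\<in>UNIV. A $ i $ j * (K \<zeta> $ j / (\<zeta> - z))))
          has_contour_integral z * I z i - (\<Sum>j\<in>UNIV. A $ i $ j * I z j)) (circlepath a r)"
        by (intro has_contour_integral_diff has_contour_integral_lmul has_contour_integral_sum I z) auto
      have h2: "((\<lambda>\<zeta>. F \<zeta> $ i / (\<zeta> - z) - K \<zeta> $ i)
          has_contour_integral 2 * of_real pi * \<i> * F z $ i - 2 * pi * \<i> * c $ i) (circlepath a r)"
      proof (intro has_contour_integral_diff)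
        have "(\<lambda>\<zeta>. F \<zeta> $ i) holomorphic_on cball a r"
          using F r(3) holomorphic_on_subset by (auto simp: vec_holomorphic_on_def)
        then show "((\<lambda>\<zeta>. F \<zeta> $ i / (\<zeta> - z)) has_contour_integral 2 * of_real pi * \<i> * F z $ i) (circlepath a r)"
          using z by (intro Cauchy_integral_circlepath_simple) (auto simp: dist_norm norm_minus_commute)
        show "((\<lambda>\<zeta>. K \<zeta> $ i) has_contour_integral 2 * pi * \<i> * c $ i) (circlepath a r)"
          unfolding K_def c_def by (rule vec_left_eval_contour[OF F r])
      qed
      \<comment> \<open>Componentwise, this is (z - A) K/(\<zeta> - z) = F/(\<zeta> - z) - K on the
        circle, a consequence of (\<zeta> - A) K = F. Integrated, the first term on the right gives
        F(z) by Cauchy's formula and the second the remainder \<open>c\<close>.\<close>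
      have h3: "z * (K \<zeta> $ i / (\<zeta> - z)) - (\<Sum>j\<in>UNIV. A $ i $ j * (K \<zeta> $ j / (\<zeta> - z)))
          = F \<zeta> $ i / (\<zeta> - z) - K \<zeta> $ i" if \<zeta>: "\<zeta> \<in> sphere a r" for \<zeta>
      proof -
        have "\<zeta> \<noteq> z" "\<zeta> \<notin> spectrum A" using z \<zeta> r by auto
        have "(mat \<zeta> - A) *v K \<zeta> = F \<zeta>"
          unfolding K_def by (rule resolvent_right_vec[OF \<open>\<zeta> \<notin> spectrum A\<close>])
        then have "F \<zeta> $ i = ((mat \<zeta> - A) *v K \<zeta>) $ i" by simp
        also have "\<dots> = \<zeta> * K \<zeta> $ i - (\<Sum>j\<in>UNIV. A $ i $ j * K \<zeta> $ j)"
          by (simp add: mat_vec_simps matrix_vector_mult_def[of A])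
        finally have "F \<zeta> $ i = \<zeta> * K \<zeta> $ i - (\<Sum>j\<in>UNIV. A $ i $ j * K \<zeta> $ j)" .
        moreover have "(\<Sum>j\<in>UNIV. A $ i $ j * (K \<zeta> $ j / (\<zeta> - z))) = (\<Sum>j\<in>UNIV. A $ i $ j * K \<zeta> $ j) / (\<zeta> - z)"
          by (simp add: sum_divide_distrib)
        moreover have "z * (k / (\<zeta> - z)) - T / (\<zeta> - z) = (\<zeta> * k - T) / (\<zeta> - z) - k" for k T
        proof -
          have "z * (k / (\<zeta> - z)) - T / (\<zeta> - z) = ((\<zeta> * k - T) - k * (\<zeta> - z)) / (\<zeta> - z)"
            by (simp add: algebra_simps flip: diff_divide_distrib)
          then show ?thesis
            using \<open>\<zeta> \<noteq> z\<close> by (simp only: diff_divide_distrib) simp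
        qed
        ultimately show ?thesis by simp
      qed
      have "((\<lambda>\<zeta>. F \<zeta> $ i / (\<zeta> - z) - K \<zeta> $ i)
          has_contour_integral z * I z i - (\<Sum>j\<in>UNIV. A $ i $ j * I z j)) (circlepath a r)"
        by (rule has_contour_integral_eq[OF h1]) (use h3 r(1) in simp)
      then have "z * I z i - (\<Sum>j\<in>UNIV. A $ i $ j * I z j) = 2 * of_real pi * \<i> * F z $ i - 2 * pi * \<i> * c $ i"
        using h2 by (rule has_contour_integral_unique)
      moreover have "((mat z - A) *v G0 z) $ i = (z * I z i - (\<Sum>j\<in>UNIV. A $ i $ j * I z j)) / (2 * pi * \<i>)"
        by (simp add: mat_vec_simps G0_def matrix_vector_mult_def[of A] sum_divide_distrib diff_divide_distrib)
      ultimately have "((mat z - A) *v G0 z) $ i = (2 * of_real pi * \<i> * F z $ i - 2 * pi * \<i> * c $ i) / (2 * pi * \<i>)"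
        by (simp only:)
      also have "\<dots> = F z $ i - c $ i"
        by (simp add: diff_divide_distrib)
      finally show ?thesis by simp
    qed
    then have "F z - c = (mat z - A) *v G0 z" by (simp add: vec_eq_iff)
    then show ?thesis by (simp add: algebra_simps)
  qed
  define G where "G = (\<lambda>z. if z \<in> ball a r then G0 z else resolvent A z *v (F z - c))"
  have G1: "G z = resolvent A z *v (F z - c)" if "z \<notin> spectrum A" for z
    using resolvent_left_vec[OF that] eq0[of z] by (auto simp: G_def)
  have "vec_holomorphic_on G (ball a r)"
    using holG0 by (rule vec_holomorphic_on_cong) (simp add: G_def)
  moreover have "vec_holomorphic_on G (right_half_plane - spectrum A)"
    by (rule vec_holomorphic_on_cong[OF resolvent_vec_holomorphic[of "\<lambda>z. F z - c"]])
       (auto intro: F mat_holo_intros simp: G1)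
  moreover have "ball a r \<union> (right_half_plane - spectrum A) = right_half_plane"
    using r ball_subset_cball by blast
  ultimately have "vec_holomorphic_on G right_half_plane"
    unfolding vec_holomorphic_on_def
    by (metis holomorphic_on_Un open_ball open_rhp open_Diff finite_imp_closed finite_spectrum)
  moreover have "F z = c + (mat z - A) *v G z" if "z \<in> right_half_plane" for z
  proof (cases "z \<in> ball a r")
    case False
    then have "z \<notin> spectrum A" using r by auto
    then show ?thesis by (simp add: G1 resolvent_right_vec)
  qed (use eq0 in \<open>simp add: G_def\<close>)
  ultimately show ?thesis using that unfolding c_def by blast
qed

text \<open>All residues of the resolvent together form its coefficient of 1/z at infinity, which is
  the identity: with R the resolvent, z R - 1 = A R tends to 0.\<close>

lemma vec_left_eval_const:
  assumes "spectrum A \<subseteq> right_half_plane"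
  shows "vec_left_eval A (\<lambda>_. c) = c"
proof -
  have "vec_left_eval A (\<lambda>_. c) $ i = c $ i" for i
    unfolding vec_left_eval_nth
  proof (rule sum_residue_infinity)
    show "(\<lambda>z. (resolvent A z *v c) $ i) holomorphic_on UNIV - spectrum A"
      using resolvent_vec_holomorphic[of "\<lambda>_. c" UNIV A] by (auto simp: vec_holomorphic_on_def)
    obtain R where R: "R > 0" "\<And>z. norm z \<ge> R \<Longrightarrow> z \<notin> spectrum A"
      "\<And>z x. norm z \<ge> R \<Longrightarrow> norm (resolvent A z *v x) \<le> 2 * norm x / norm z"
      using resolvent_large[of A] by blast
    have "((\<lambda>z. z * (resolvent A z *v c) $ i - c $ i) \<longlongrightarrow> 0) at_infinity"
    proof (rule Lim_null_comparison)
      show "\<forall>\<^sub>F z in at_infinity. norm (z * (resolvent A z *v c) $ i - c $ i) \<le> norm A * (2 * norm c) / norm z"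
        unfolding eventually_at_infinity
      proof (intro exI allI impI)
        fix z :: complex assume z: "R \<le> norm z"
        have "z *s (resolvent A z *v c) - c = A *v (resolvent A z *v c)"
          using resolvent_right_vec[OF R(2)[OF z], of c] by (simp add: mat_vec_simps algebra_simps)
        moreover have "norm (A *v (resolvent A z *v c)) \<le> norm A * (2 * norm c / norm z)"
          using norm_matrix_vector_le R(3)[OF z] by (meson mult_left_mono norm_ge_zero order_trans)
        ultimately have "norm (z *s (resolvent A z *v c) - c) \<le> norm A * (2 * norm c / norm z)" by simp
        moreover have "norm (z * (resolvent A z *v c) $ i - c $ i) \<le> norm (z *s (resolvent A z *v c) - c)"
          using Finite_Cartesian_Product.norm_nth_le[of "z *s (resolvent A z *v c) - c" i] by simp
        ultimately show "norm (z * (resolvent A z *v c) $ i - c $ i) \<le> norm A * (2 * norm c) / norm z" by simp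
      qed
      show "((\<lambda>z. norm A * (2 * norm c) / norm z) \<longlongrightarrow> 0) at_infinity"
        by (intro tendsto_divide_0[OF tendsto_const] filterlim_at_top_imp_at_infinity filterlim_norm_at_top)
    qed
    then show "((\<lambda>z. z * (resolvent A z *v c) $ i) \<longlongrightarrow> c $ i) at_infinity"
      by (simp add: Lim_null[symmetric])
  qed simp
  then show ?thesis by (simp add: vec_eq_iff)
qed

text \<open>Applying the resolvent turns the multiple of the pencil into the holomorphic
  \<open>G\<close>, which has no residues, and leaves the evaluation of the constant
  \<open>c\<close>. So evaluations may be read off from any division.\<close>

lemma left_eval_unique:
  assumes A: "spectrum A \<subseteq> right_half_plane" and G: "vec_holomorphic_on G right_half_plane"
    and eq: "\<And>z. z \<in> right_half_plane \<Longrightarrow> F z = c + (mat z - A) *v G z"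
  shows "vec_left_eval A F = c"
proof -
  have "residue (\<lambda>z. (resolvent A z *v F z) $ i) z0 = residue (\<lambda>z. (resolvent A z *v c) $ i) z0"
    if z0: "z0 \<in> spectrum A" for z0 i
  proof -
    define s where "s = right_half_plane - (spectrum A - {z0})"
    have s: "open s" "z0 \<in> s" "s - {z0} \<subseteq> right_half_plane - spectrum A" "s \<subseteq> right_half_plane"
      using z0 A by (auto simp: s_def open_Diff finite_imp_closed)
    have ev: "eventually (\<lambda>z. (resolvent A z *v F z) $ i = (resolvent A z *v c) $ i + G z $ i) (at z0)"
    proof (rule eventually_mono[OF eventually_at_in_open[OF s(1,2)]])
      fix z assume "z \<in> s - {z0}"
      then have "z \<in> right_half_plane" "z \<notin> spectrum A" using s(3) by auto
      then show "(resolvent A z *v F z) $ i = (resolvent A z *v c) $ i + G z $ i"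
        by (simp add: eq matrix_vector_right_distrib resolvent_left_vec)
    qed
    have hol: "(\<lambda>z. (resolvent A z *v c) $ i) holomorphic_on s - {z0}"
      using vec_holomorphic_on_subset[OF resolvent_vec_holomorphic[of "\<lambda>_. c" right_half_plane A] s(3)]
      by (auto simp: vec_holomorphic_on_def)
    have Gs: "(\<lambda>z. G z $ i) holomorphic_on s"
      using vec_holomorphic_on_subset[OF G s(4)] by (auto simp: vec_holomorphic_on_def)
    have "residue (\<lambda>z. (resolvent A z *v F z) $ i) z0 = residue (\<lambda>z. (resolvent A z *v c) $ i + G z $ i) z0"
      by (rule residue_cong[OF ev refl])
    also have "\<dots> = residue (\<lambda>z. (resolvent A z *v c) $ i) z0 + residue (\<lambda>z. G z $ i) z0"
      by (rule residue_add[OF s(1,2) hol]) (use Gs in \<open>auto elim: holomorphic_on_subset\<close>)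
    also have "residue (\<lambda>z. G z $ i) z0 = 0"
      by (rule residue_holo[OF s(1,2) Gs])
    finally show ?thesis by simp
  qed
  then have "vec_left_eval A F = vec_left_eval A (\<lambda>_. c)"
    by (simp add: vec_eq_iff vec_left_eval_nth)
  then show ?thesis using vec_left_eval_const[OF A] by simp
qed

definition mat_left_eval ::
    "complex^'z::finite^'z \<Rightarrow> (complex \<Rightarrow> complex^'l::finite^'z) \<Rightarrow> complex^'l^'z" where
  "mat_left_eval A F = (\<chi> i j. vec_left_eval A (\<lambda>z. column j (F z)) $ i)"

lemma matrix_vector_axis: "((A :: complex^'k::finite^'l::finite) *v axis j 1) $ i = A $ i $ j"
  by (simp add: matrix_vector_mult_def axis_def if_distrib[of "\<lambda>x. _ * x"] cong: if_cong)

lemma column_mult: "column j (A ** B) = A *v column j B"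
  by (simp add: vec_eq_iff column_def matrix_matrix_mult_def matrix_vector_mult_def)

lemma column_add: "column j (A + B) = column j A + column j B"
  by (simp add: vec_eq_iff column_def)

lemma matrix_eq_columns: "A = B \<longleftrightarrow> (\<forall>j. column j A = column j B)"
  by (auto simp: vec_eq_iff column_def)

lemma column_mat_left_eval: "column j (mat_left_eval A F) = vec_left_eval A (\<lambda>z. column j (F z))"
  by (simp add: vec_eq_iff column_def mat_left_eval_def)

lemma vec_holomorphic_column: "mat_holomorphic_on F D \<Longrightarrow> vec_holomorphic_on (\<lambda>z. column j (F z)) D"
  by (simp add: mat_holomorphic_on_def vec_holomorphic_on_def column_def)

lemma mat_left_eval_decomp:
  assumes F: "mat_holomorphic_on F right_half_plane" and A: "spectrum A \<subseteq> right_half_plane"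
  obtains H where "mat_holomorphic_on H right_half_plane"
    "\<And>z. z \<in> right_half_plane \<Longrightarrow> F z = mat_left_eval A F + (mat z - A) ** H z"
proof -
  have "\<exists>G. vec_holomorphic_on G right_half_plane \<and> (\<forall>z\<in>right_half_plane.
      column j (F z) = vec_left_eval A (\<lambda>z. column j (F z)) + (mat z - A) *v G z)" for j
    by (rule left_eval_decomp[OF vec_holomorphic_column[OF F] A]) blast
  then obtain G where G: "\<And>j. vec_holomorphic_on (G j) right_half_plane"
    "\<And>j z. z \<in> right_half_plane \<Longrightarrow>
      column j (F z) = vec_left_eval A (\<lambda>z. column j (F z)) + (mat z - A) *v G j z"
    by metis
  define H where "H = (\<lambda>z. \<chi> i j. G j z $ i)"
  have c: "column j (H z) = G j z" for j z
    by (simp add: vec_eq_iff column_def H_def)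
  show ?thesis
  proof
    show "mat_holomorphic_on H right_half_plane"
      using G(1) by (simp add: mat_holomorphic_on_def vec_holomorphic_on_def H_def)
    show "F z = mat_left_eval A F + (mat z - A) ** H z" if "z \<in> right_half_plane" for z
      unfolding matrix_eq_columns using G(2)[OF that]
      by (simp add: column_add column_mult c column_mat_left_eval)
  qed
qed

lemma mat_left_eval_unique:
  assumes "spectrum A \<subseteq> right_half_plane" "mat_holomorphic_on H right_half_plane"
    and "\<And>z. z \<in> right_half_plane \<Longrightarrow> F z = C + (mat z - A) ** H z"
  shows "mat_left_eval A F = C"
  unfolding matrix_eq_columns column_mat_left_eval
  using left_eval_unique[OF assms(1) vec_holomorphic_column[OF assms(2)]] assms(3)
  by (simp add: column_add column_mult)

lemma left_eval_mat_left_eval: "left_eval Z X S = mat_left_eval Z (\<lambda>z. X ** S z)"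
proof -
  have "(resolvent Z z ** X ** S z) $ i $ j = (resolvent Z z *v column j (X ** S z)) $ i" for z i j
    unfolding matrix_mul_assoc[symmetric]
    by (simp add: column_def matrix_matrix_mult_def[of "resolvent Z z"] matrix_vector_mult_def)
  then show ?thesis
    by (simp add: vec_eq_iff left_eval_def mat_left_eval_def vec_left_eval_nth mat_residue_def)
qed

section \<open>Right and two-sided evaluation\<close>

lemma invertible_transpose: "invertible (transpose A) \<longleftrightarrow> invertible (A :: complex^'k::finite^'k)"
  by (simp add: invertible_det_nz)

lemma transpose_diff_mat: "transpose (mat z - A) = mat z - transpose (A :: complex^'k::finite^'k)"
  by (auto simp: vec_eq_iff transpose_def mat_def)

lemma spectrum_transpose: "spectrum (transpose A) = spectrum (A :: complex^'k::finite^'k)"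
  using invertible_transpose by (fastforce simp: spectrum_def transpose_diff_mat[symmetric])

lemma resolvent_transpose:
  fixes A :: "complex^'k::finite^'k"
  assumes "z \<notin> spectrum A"
  shows "resolvent (transpose A) z = transpose (resolvent A z)"
proof -
  have "(mat z - transpose A) ** transpose (resolvent A z) = mat 1"
    using arg_cong[OF resolvent_left[OF assms], of transpose]
    by (simp add: matrix_transpose_mul transpose_diff_mat)
  then show ?thesis
    using assms by (metis matrix_mul_assoc matrix_mul_lid matrix_mul_rid resolvent_left spectrum_transpose)
qed

lemma eventually_at_spectrum: "eventually (\<lambda>z. z \<notin> spectrum A) (at z0)"
  by (rule eventually_mono[OF eventually_at_in_open[of "UNIV - (spectrum A - {z0})" z0]])
     (auto simp: open_Diff finite_imp_closed)

text \<open>Transposition exchanges the two sides, so right division needs no contour argument of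
  its own. The plain transpose is taken, not the adjoint, because it preserves holomorphy and the
  spectrum.\<close>

lemma right_eval_mat_left_eval:
  "right_eval U W S = transpose (mat_left_eval (transpose W) (\<lambda>z. transpose (S z ** U)))"
proof -
  have "residue (\<lambda>z. (S z ** U ** resolvent W z) $ i $ j) z0
      = residue (\<lambda>z. (resolvent (transpose W) z *v column i (transpose (S z ** U))) $ j) z0" for z0 i j
  proof (rule residue_cong[OF eventually_mono[OF eventually_at_spectrum[of W]]])
    fix z assume "z \<notin> spectrum W"
    then have "resolvent (transpose W) z *v column i (transpose (S z ** U))
        = column i (transpose (S z ** U ** resolvent W z))"
      by (simp add: resolvent_transpose matrix_transpose_mul column_mult)
    then show "(S z ** U ** resolvent W z) $ i $ j
        = (resolvent (transpose W) z *v column i (transpose (S z ** U))) $ j"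
      by (simp add: column_def transpose_def)
  qed simp
  then show ?thesis
    by (simp add: vec_eq_iff right_eval_def mat_left_eval_def vec_left_eval_nth mat_residue_def
        transpose_def spectrum_transpose)
       (simp add: spectrum_transpose flip: transpose_def)
qed

lemma mat_holomorphic_transpose: "mat_holomorphic_on F D \<Longrightarrow> mat_holomorphic_on (\<lambda>z. transpose (F z)) D"
  by (simp add: mat_holomorphic_on_def transpose_def)

lemma transpose_add: "transpose (A + B) = transpose A + transpose B"
  by (simp add: vec_eq_iff transpose_def)

lemma right_eval_decomp:
  assumes S: "mat_holomorphic_on S right_half_plane" and W: "spectrum W \<subseteq> right_half_plane"
  obtains K where "mat_holomorphic_on K right_half_plane"
    "\<And>z. z \<in> right_half_plane \<Longrightarrow> S z ** U = right_eval U W S + K z ** (mat z - W)"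
proof -
  obtain H where H: "mat_holomorphic_on H right_half_plane"
    "\<And>z. z \<in> right_half_plane \<Longrightarrow> transpose (S z ** U)
      = mat_left_eval (transpose W) (\<lambda>z. transpose (S z ** U)) + (mat z - transpose W) ** H z"
    by (rule mat_left_eval_decomp[of "\<lambda>z. transpose (S z ** U)" "transpose W"])
       (use W in \<open>auto intro!: mat_holomorphic_transpose mat_holo_intros S simp: spectrum_transpose\<close>)
  show ?thesis
  proof
    show "mat_holomorphic_on (\<lambda>z. transpose (H z)) right_half_plane"
      by (rule mat_holomorphic_transpose[OF H(1)])
    fix z assume "z \<in> right_half_plane"
    from arg_cong[OF H(2)[OF this], of transpose]
    show "S z ** U = right_eval U W S + transpose (H z) ** (mat z - W)"
      by (simp add: right_eval_mat_left_eval transpose_add matrix_transpose_mul flip: transpose_diff_mat)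
  qed
qed

lemma right_eval_unique:
  assumes W: "spectrum W \<subseteq> right_half_plane" and K: "mat_holomorphic_on K right_half_plane"
    and eq: "\<And>z. z \<in> right_half_plane \<Longrightarrow> S z ** U = V + K z ** (mat z - W)"
  shows "right_eval U W S = V"
proof -
  have "mat_left_eval (transpose W) (\<lambda>z. transpose (S z ** U)) = transpose V"
  proof (rule mat_left_eval_unique)
    show "mat_holomorphic_on (\<lambda>z. transpose (K z)) right_half_plane"
      by (rule mat_holomorphic_transpose[OF K])
    show "transpose (S z ** U) = transpose V + (mat z - transpose W) ** transpose (K z)"
      if "z \<in> right_half_plane" for z
      by (simp add: eq[OF that] transpose_add matrix_transpose_mul transpose_diff_mat)
  qed (simp add: W spectrum_transpose)
  then show ?thesis by (simp add: right_eval_mat_left_eval)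
qed

text \<open>Two resolvents decay like 1/z^2, so the coefficient of 1/z at infinity, which is the sum
  of all residues, vanishes.\<close>

lemma sum_residue_two_resolvents:
  fixes Z :: "complex^'z::finite^'z" and W :: "complex^'w::finite^'w" and M :: "complex^'w^'z"
  shows "(\<Sum>z0\<in>spectrum Z \<union> spectrum W. residue (\<lambda>z. (resolvent Z z ** M ** resolvent W z) $ i $ j) z0) = 0"
proof (rule sum_residue_infinity)
  have "mat_holomorphic_on (\<lambda>z. resolvent Z z ** M ** resolvent W z) (UNIV - (spectrum Z \<union> spectrum W))"
    by (intro mat_holo_intros resolvent_holomorphic) auto
  then show "(\<lambda>z. (resolvent Z z ** M ** resolvent W z) $ i $ j) holomorphic_on UNIV - (spectrum Z \<union> spectrum W)"
    by (simp add: mat_holomorphic_on_def)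
  obtain R where R: "R > 0" "\<And>z x. norm z \<ge> R \<Longrightarrow> norm (resolvent Z z *v x) \<le> 2 * norm x / norm z"
    using resolvent_large[of Z] by metis
  obtain R' where R': "R' > 0" "\<And>z x. norm z \<ge> R' \<Longrightarrow> norm (resolvent W z *v x) \<le> 2 * norm x / norm z"
    using resolvent_large[of W] by metis
  show "((\<lambda>z. z * (resolvent Z z ** M ** resolvent W z) $ i $ j) \<longlongrightarrow> 0) at_infinity"
  proof (rule Lim_null_comparison)
    show "\<forall>\<^sub>F z in at_infinity. norm (z * (resolvent Z z ** M ** resolvent W z) $ i $ j) \<le> 4 * norm M / norm z"
      unfolding eventually_at_infinity
    proof (intro exI allI impI)
      fix z :: complex assume z: "max R R' \<le> norm z"
      let ?e = "axis j 1 :: complex^'w"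
      have z0: "norm z > 0" using z R(1) by linarith
      have "(resolvent Z z ** M ** resolvent W z) $ i $ j = (resolvent Z z *v (M *v (resolvent W z *v ?e))) $ i"
        by (simp only: matrix_vector_mul_assoc matrix_mul_assoc matrix_vector_axis)
      also have "norm \<dots> \<le> norm (resolvent Z z *v (M *v (resolvent W z *v ?e)))"
        by (rule Finite_Cartesian_Product.norm_nth_le)
      also have "\<dots> \<le> 2 * norm (M *v (resolvent W z *v ?e)) / norm z"
        using R(2)[of z] z by simp
      also have "\<dots> \<le> 2 * (norm M * norm (resolvent W z *v ?e)) / norm z"
        using norm_matrix_vector_le[of M] by (intro divide_right_mono mult_left_mono) auto
      also have "\<dots> \<le> 2 * (norm M * (2 * norm ?e / norm z)) / norm z"
        using R'(2)[of z ?e] z by (intro divide_right_mono mult_left_mono) auto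
      also have "norm ?e = 1" by simp
      finally have "norm z * norm ((resolvent Z z ** M ** resolvent W z) $ i $ j)
          \<le> norm z * (2 * (norm M * (2 * 1 / norm z)) / norm z)"
        by (intro mult_left_mono) auto
      then show "norm (z * (resolvent Z z ** M ** resolvent W z) $ i $ j) \<le> 4 * norm M / norm z"
        using z0 by (simp add: norm_mult)
    qed
    show "((\<lambda>z. 4 * norm M / norm (z :: complex)) \<longlongrightarrow> 0) at_infinity"
      by (intro tendsto_divide_0[OF tendsto_const] filterlim_at_top_imp_at_infinity filterlim_norm_at_top)
  qed
qed simp

text \<open>Substituting S U = V + K (z - W) cancels the right resolvent in the \<open>K\<close>
  term. The \<open>V\<close> term is a constant between two resolvents and contributes nothing in
  total. What remains has poles at the eigenvalues of \<open>Z\<close> only.\<close>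

lemma left_right_eval_eq:
  assumes Z: "spectrum Z \<subseteq> right_half_plane" and W: "spectrum W \<subseteq> right_half_plane"
    and K: "mat_holomorphic_on K right_half_plane"
    and eq: "\<And>z. z \<in> right_half_plane \<Longrightarrow> S z ** U = V + K z ** (mat z - W)"
  shows "left_right_eval Z X U W S = mat_left_eval Z (\<lambda>z. X ** K z)"
proof -
  let ?P = "spectrum Z \<union> spectrum W"
  have r: "residue (\<lambda>z. (resolvent Z z ** X ** S z ** U ** resolvent W z) $ i $ j) z0
      = residue (\<lambda>z. (resolvent Z z ** (X ** V) ** resolvent W z) $ i $ j) z0
      + residue (\<lambda>z. (resolvent Z z *v column j (X ** K z)) $ i) z0" (is "?a = ?b + ?c") if z0: "z0 \<in> ?P" for z0 i j
  proof -
    define s where "s = right_half_plane - (?P - {z0})"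
    have s: "open s" "z0 \<in> s" "s - {z0} \<subseteq> right_half_plane - ?P"
      using z0 Z W by (auto simp: s_def open_Diff finite_imp_closed)
    have "?a = residue (\<lambda>z. (resolvent Z z ** (X ** V) ** resolvent W z) $ i $ j
        + (resolvent Z z *v column j (X ** K z)) $ i) z0"
    proof (rule residue_cong[OF eventually_mono[OF eventually_at_in_open[OF s(1,2)]]])
      fix z assume "z \<in> s - {z0}"
      then have z: "z \<in> right_half_plane" "z \<notin> spectrum W" using s(3) by auto
      have "resolvent Z z ** X ** S z ** U ** resolvent W z = resolvent Z z ** X ** (S z ** U) ** resolvent W z"
        by (simp add: matrix_mul_assoc)
      also have "\<dots> = resolvent Z z ** (X ** V) ** resolvent W z
          + resolvent Z z ** (X ** K z) ** ((mat z - W) ** resolvent W z)"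
        by (simp add: eq[OF z(1)] mat_mul_simps matrix_mul_assoc)
      also have "(mat z - W) ** resolvent W z = mat 1"
        by (rule resolvent_right[OF z(2)])
      finally have "column j (resolvent Z z ** X ** S z ** U ** resolvent W z)
          = column j (resolvent Z z ** (X ** V) ** resolvent W z) + resolvent Z z *v column j (X ** K z)"
        by (simp add: column_add column_mult)
      then show "(resolvent Z z ** X ** S z ** U ** resolvent W z) $ i $ j
        = (resolvent Z z ** (X ** V) ** resolvent W z) $ i $ j + (resolvent Z z *v column j (X ** K z)) $ i"
        by (simp add: vec_eq_iff column_def)
    qed simp
    also have "\<dots> = ?b + ?c"
    proof (rule residue_add[OF s(1,2)])
      have "mat_holomorphic_on (\<lambda>z. resolvent Z z ** (X ** V) ** resolvent W z) (s - {z0})"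
        using s(3) by (intro mat_holo_intros resolvent_holomorphic) auto
      then show "(\<lambda>z. (resolvent Z z ** (X ** V) ** resolvent W z) $ i $ j) holomorphic_on s - {z0}"
        by (simp add: mat_holomorphic_on_def)
      have "mat_holomorphic_on K (s - {z0})"
        by (rule mat_holomorphic_on_subset[OF K]) (use s(3) in auto)
      then have "vec_holomorphic_on (\<lambda>z. resolvent Z z *v column j (X ** K z)) (s - {z0})"
        using s(3) by (intro mat_vec_holomorphic vec_holomorphic_column mat_holo_intros resolvent_holomorphic) auto
      then show "(\<lambda>z. (resolvent Z z *v column j (X ** K z)) $ i) holomorphic_on s - {z0}"
        by (simp add: vec_holomorphic_on_def)
    qed
    finally show ?thesis .
  qed
  have z: "residue (\<lambda>z. (resolvent Z z *v column j (X ** K z)) $ i) z0 = 0" if z0: "z0 \<in> ?P - spectrum Z" for z0 i j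
  proof (rule residue_holo)
    show "open (right_half_plane - spectrum Z)" by (simp add: open_Diff finite_imp_closed)
    show "z0 \<in> right_half_plane - spectrum Z" using z0 W by auto
    have "vec_holomorphic_on (\<lambda>z. resolvent Z z *v column j (X ** K z)) (right_half_plane - spectrum Z)"
      by (intro resolvent_vec_holomorphic vec_holomorphic_column mat_holo_intros K)
    then show "(\<lambda>z. (resolvent Z z *v column j (X ** K z)) $ i) holomorphic_on right_half_plane - spectrum Z"
      by (simp add: vec_holomorphic_on_def)
  qed
  have "left_right_eval Z X U W S $ i $ j = mat_left_eval Z (\<lambda>z. X ** K z) $ i $ j" for i j
  proof -
    have "left_right_eval Z X U W S $ i $ j
        = (\<Sum>z0\<in>?P. residue (\<lambda>z. (resolvent Z z *v column j (X ** K z)) $ i) z0)"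
      by (simp add: left_right_eval_def mat_residue_def r sum.distrib sum_residue_two_resolvents)
    also have "\<dots> = (\<Sum>z0\<in>spectrum Z. residue (\<lambda>z. (resolvent Z z *v column j (X ** K z)) $ i) z0)"
      by (rule sum.mono_neutral_right) (auto intro!: z)
    finally show ?thesis by (simp add: mat_left_eval_def vec_left_eval_nth)
  qed
  then show ?thesis by (simp add: vec_eq_iff)
qed

text \<open>The residue conditions as divisibility statements. The quotient \<open>K\<close> of the
  right condition is the function that the two-sided condition evaluates, so both must share
  it.\<close>

definition interpolates ::
    "complex^'z::finite^'z \<Rightarrow> complex^'p::finite^'z \<Rightarrow> complex^'m::finite^'z \<Rightarrow>
     complex^'w::finite^'m \<Rightarrow> complex^'w^'p \<Rightarrow> complex^'w^'w \<Rightarrow> complex^'w^'z \<Rightarrow>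
     (complex \<Rightarrow> complex^'m^'p) \<Rightarrow> bool" where
  "interpolates Z X Y U V W \<Gamma> S \<longleftrightarrow>
     (\<exists>H K L. mat_holomorphic_on H right_half_plane \<and> mat_holomorphic_on K right_half_plane \<and>
       mat_holomorphic_on L right_half_plane \<and>
       (\<forall>z\<in>right_half_plane. X ** S z = Y + (mat z - Z) ** H z \<and>
          S z ** U = V + K z ** (mat z - W) \<and> X ** K z = \<Gamma> + (mat z - Z) ** L z))"

lemma interpolates_evals:
  assumes S: "mat_holomorphic_on S right_half_plane"
    and Z: "spectrum Z \<subseteq> right_half_plane" and W: "spectrum W \<subseteq> right_half_plane"
  shows "interpolates Z X (left_eval Z X S) U (right_eval U W S) W (left_right_eval Z X U W S) S"
proof -
  obtain H where H: "mat_holomorphic_on H right_half_plane"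
    "\<And>z. z \<in> right_half_plane \<Longrightarrow> X ** S z = left_eval Z X S + (mat z - Z) ** H z"
    unfolding left_eval_mat_left_eval
    by (rule mat_left_eval_decomp[of "\<lambda>z. X ** S z" Z]) (auto intro!: mat_holo_intros S Z[THEN subsetD])
  obtain K where K: "mat_holomorphic_on K right_half_plane"
    "\<And>z. z \<in> right_half_plane \<Longrightarrow> S z ** U = right_eval U W S + K z ** (mat z - W)"
    using right_eval_decomp[OF S W, of U] by blast
  have lr: "left_right_eval Z X U W S = mat_left_eval Z (\<lambda>z. X ** K z)"
    by (rule left_right_eval_eq[OF Z W K])
  obtain L where L: "mat_holomorphic_on L right_half_plane"
    "\<And>z. z \<in> right_half_plane \<Longrightarrow> X ** K z = left_right_eval Z X U W S + (mat z - Z) ** L z"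
    unfolding lr
    by (rule mat_left_eval_decomp[of "\<lambda>z. X ** K z" Z]) (auto intro!: mat_holo_intros K Z[THEN subsetD])
  show ?thesis
    unfolding interpolates_def using H K L by blast
qed

lemma interpolates_imp_evals:
  assumes Z: "spectrum Z \<subseteq> right_half_plane" and W: "spectrum W \<subseteq> right_half_plane"
    and "interpolates Z X Y U V W \<Gamma> S"
  shows "left_eval Z X S = Y" "right_eval U W S = V" "left_right_eval Z X U W S = \<Gamma>"
proof -
  obtain H K L where *: "mat_holomorphic_on H right_half_plane" "mat_holomorphic_on K right_half_plane"
    "mat_holomorphic_on L right_half_plane"
    "\<And>z. z \<in> right_half_plane \<Longrightarrow> X ** S z = Y + (mat z - Z) ** H z"
    "\<And>z. z \<in> right_half_plane \<Longrightarrow> S z ** U = V + K z ** (mat z - W)"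
    "\<And>z. z \<in> right_half_plane \<Longrightarrow> X ** K z = \<Gamma> + (mat z - Z) ** L z"
    using assms(3) unfolding interpolates_def by auto
  show "left_eval Z X S = Y"
    unfolding left_eval_mat_left_eval by (rule mat_left_eval_unique[OF Z *(1) *(4)])
  show "right_eval U W S = V"
    by (rule right_eval_unique[OF W *(2) *(5)])
  have "left_right_eval Z X U W S = mat_left_eval Z (\<lambda>z. X ** K z)"
    by (rule left_right_eval_eq[OF Z W *(2) *(5)])
  then show "left_right_eval Z X U W S = \<Gamma>"
    apply simp
    by (rule mat_left_eval_unique[OF Z *(3) *(6)])
qed

lemma btoa_solutions_iff:
  assumes "spectrum Z \<subseteq> right_half_plane" "spectrum W \<subseteq> right_half_plane"
  shows "S \<in> btoa_solutions Z X Y U V W \<Gamma> \<longleftrightarrow> S \<in> schur_class \<and> interpolates Z X Y U V W \<Gamma> S"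
  using interpolates_evals[of S Z W X U] interpolates_imp_evals[OF assms] assms
  unfolding btoa_solutions_def schur_class_def by fastforce

section \<open>Boundary integrals of Hardy functions\<close>

lemma integrable_inverse_1_plus_square_lborel: "integrable lborel (\<lambda>x::real. 1 / (1 + x\<^sup>2))"
  and integral_inverse_1_plus_square_lborel: "(LINT x|lborel. 1 / (1 + x\<^sup>2 :: real)) = pi"
  using integrable_inverse_1_plus_square LBINT_inverse_1_plus_square
  by (simp_all add: inverse_eq_divide set_integrable_def interval_lebesgue_integral_def set_lebesgue_integral_def einterval_def)

text \<open>Bounded L2 norms and pointwise convergence give weak convergence. Fatou's lemma puts
  \<open>\<phi>\<close> into L2; the functions \<open>f n\<close> have no common majorant, so their
  difference from \<open>\<phi>\<close> is split according to its size relative to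
  \<open>g\<close>.\<close>

lemma weak_limit_L2:
  fixes f :: "nat \<Rightarrow> real \<Rightarrow> complex" and g \<phi> :: "real \<Rightarrow> complex"
  assumes f [measurable]: "\<And>n. f n \<in> borel_measurable lborel"
    and \<phi> [measurable]: "\<phi> \<in> borel_measurable lborel" and g [measurable]: "g \<in> borel_measurable lborel"
    and C: "\<And>n. (\<integral>\<^sup>+y. ennreal ((norm (f n y))\<^sup>2) \<partial>lborel) \<le> ennreal C"
    and lim: "AE y in lborel. (\<lambda>n. f n y) \<longlonglongrightarrow> \<phi> y"
    and gint: "integrable lborel (\<lambda>y. (norm (g y))\<^sup>2)"
  shows "integrable lborel (\<lambda>y. (norm (\<phi> y))\<^sup>2)"
    and "integrable lborel (\<lambda>y. g y * \<phi> y)"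
    and "(\<lambda>n. LINT y|lborel. g y * f n y) \<longlonglongrightarrow> (LINT y|lborel. g y * \<phi> y)"
proof -
  have \<phi>C: "(\<integral>\<^sup>+y. ennreal ((norm (\<phi> y))\<^sup>2) \<partial>lborel) \<le> ennreal C"
  proof -
    have "(\<integral>\<^sup>+y. ennreal ((norm (\<phi> y))\<^sup>2) \<partial>lborel)
        \<le> (\<integral>\<^sup>+y. liminf (\<lambda>n. ennreal ((norm (f n y))\<^sup>2)) \<partial>lborel)"
    proof (rule nn_integral_mono_AE)
      show "AE y in lborel. ennreal ((norm (\<phi> y))\<^sup>2) \<le> liminf (\<lambda>n. ennreal ((norm (f n y))\<^sup>2))"
        using lim
      proof eventually_elim
        case (elim y)
        then have "(\<lambda>n. ennreal ((norm (f n y))\<^sup>2)) \<longlonglongrightarrow> ennreal ((norm (\<phi> y))\<^sup>2)"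
          by (intro tendsto_intros tendsto_ennrealI)
        from lim_imp_Liminf[OF sequentially_bot this] show ?case by (simp only: order_refl)
      qed
    qed
    also have "\<dots> \<le> liminf (\<lambda>n. \<integral>\<^sup>+y. ennreal ((norm (f n y))\<^sup>2) \<partial>lborel)"
      by (rule nn_integral_liminf) measurable
    also have "\<dots> \<le> liminf (\<lambda>n. ennreal C)"
      by (rule Liminf_mono) (simp add: C)
    finally show ?thesis by (simp add: Liminf_const)
  qed
  show \<phi>2: "integrable lborel (\<lambda>y. (norm (\<phi> y))\<^sup>2)"
    using \<phi>C by (intro integrableI_bounded) (auto intro: le_less_trans)
  have f2: "integrable lborel (\<lambda>y. (norm (f n y))\<^sup>2)" for n
    using C[of n] by (intro integrableI_bounded) (auto intro: le_less_trans)
  have prod: "integrable lborel (\<lambda>y. g y * h y)"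
    if [measurable]: "h \<in> borel_measurable lborel" and "integrable lborel (\<lambda>y. (norm (h y))\<^sup>2)" for h
  proof (rule Bochner_Integration.integrable_bound)
    show "integrable lborel (\<lambda>y. (norm (g y))\<^sup>2 + (norm (h y))\<^sup>2)"
      using gint that(2) by simp
    have "norm (g y * h y) \<le> (norm (g y))\<^sup>2 + (norm (h y))\<^sup>2" for y
    proof -
      have "2 * (norm (g y) * norm (h y)) \<le> (norm (g y))\<^sup>2 + (norm (h y))\<^sup>2"
        using zero_le_power2[of "norm (g y) - norm (h y)"] by (simp add: power2_eq_square algebra_simps)
      moreover have "0 \<le> norm (g y) * norm (h y)" by simp
      ultimately show ?thesis unfolding norm_mult by linarith
    qed
    then show "AE y in lborel. norm (g y * h y) \<le> norm ((norm (g y))\<^sup>2 + (norm (h y))\<^sup>2)"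
      by (simp add: abs_of_nonneg)
  qed measurable
  show g\<phi>: "integrable lborel (\<lambda>y. g y * \<phi> y)" by (rule prod[OF \<phi> \<phi>2])
  have gf: "integrable lborel (\<lambda>y. g y * f n y)" for n by (rule prod[OF f f2])
  \<comment> \<open>\<open>f n\<close> and \<open>\<phi>\<close> both have squared norm at most |C|,
    and the square of a difference is at most twice the sum of the squares.\<close>
  define D where "D = 4 * \<bar>C\<bar>"
  define h where "h = (\<lambda>n y. f n y - \<phi> y)"
  have [measurable]: "h n \<in> borel_measurable lborel" for n by (simp add: h_def)
  have sq: "(norm (h n y))\<^sup>2 \<le> 2 * (norm (f n y))\<^sup>2 + 2 * (norm (\<phi> y))\<^sup>2" for n y
  proof -
    have "(norm (h n y))\<^sup>2 \<le> (norm (f n y) + norm (\<phi> y))\<^sup>2"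
      unfolding h_def by (intro power_mono norm_triangle_ineq4) simp
    also have "\<dots> \<le> 2 * (norm (f n y))\<^sup>2 + 2 * (norm (\<phi> y))\<^sup>2"
      using zero_le_power2[of "norm (f n y) - norm (\<phi> y)"] by (simp add: power2_eq_square algebra_simps)
    finally show ?thesis .
  qed
  have h2: "integrable lborel (\<lambda>y. (norm (h n y))\<^sup>2)" for n
    by (rule Bochner_Integration.integrable_bound[of _ "\<lambda>y. 2 * (norm (f n y))\<^sup>2 + 2 * (norm (\<phi> y))\<^sup>2"])
       (use f2 \<phi>2 sq in \<open>auto simp: abs_of_nonneg\<close>)
  have leC: "(LINT y|lborel. (norm (k y))\<^sup>2) \<le> \<bar>C\<bar>"
    if "(\<integral>\<^sup>+y. ennreal ((norm (k y))\<^sup>2) \<partial>lborel) \<le> ennreal C" and "integrable lborel (\<lambda>y. (norm (k y))\<^sup>2)" for k :: "real \<Rightarrow> complex"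
  proof -
    have "ennreal (LINT y|lborel. (norm (k y))\<^sup>2) \<le> ennreal \<bar>C\<bar>"
      using that by (subst nn_integral_eq_integral[symmetric]) (auto intro: order_trans ennreal_leI)
    then show ?thesis by simp
  qed
  have hD: "(LINT y|lborel. (norm (h n y))\<^sup>2) \<le> D" for n
  proof -
    have "(LINT y|lborel. (norm (h n y))\<^sup>2) \<le> (LINT y|lborel. 2 * (norm (f n y))\<^sup>2 + 2 * (norm (\<phi> y))\<^sup>2)"
      using sq f2 \<phi>2 h2 by (intro integral_mono) auto
    also have "\<dots> = 2 * (LINT y|lborel. (norm (f n y))\<^sup>2) + 2 * (LINT y|lborel. (norm (\<phi> y))\<^sup>2)"
      using f2 \<phi>2 by simp
    also have "\<dots> \<le> D"
      unfolding D_def using leC[OF C[of n] f2[of n]] leC[OF \<phi>C \<phi>2] by linarith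
    finally show ?thesis .
  qed
  have "(\<lambda>n. LINT y|lborel. g y * h n y) \<longlonglongrightarrow> 0"
    unfolding tendsto_iff dist_norm diff_zero
  proof (intro allI impI)
    fix e :: real assume e: "e > 0"
    \<comment> \<open>Where |h| <= K |g|, the product |g h| is dominated by K |g|^2 and tends to 0
      pointwise. Elsewhere it is at most |h|^2/K, with integral at most D/K <= e/2.\<close>
    define K where "K = 2 * (D + 1) / e"
    have D0: "D \<ge> 0" by (simp add: D_def)
    have K: "K > 0" using e D0 by (simp add: K_def)
    define q where "q = (\<lambda>n y. min (norm (g y) * norm (h n y)) (K * (norm (g y))\<^sup>2))"
    have [measurable]: "q n \<in> borel_measurable lborel" for n by (simp add: q_def)
    have qb: "0 \<le> q n y" "q n y \<le> K * (norm (g y))\<^sup>2" for n y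
      using K by (auto simp: q_def)
    have q0: "(\<lambda>n. LINT y|lborel. q n y) \<longlonglongrightarrow> (LINT y|(lborel :: real measure). 0)"
    proof (rule integral_dominated_convergence[where w = "\<lambda>y. K * (norm (g y))\<^sup>2"])
      show "AE y in lborel. (\<lambda>n. q n y) \<longlonglongrightarrow> 0"
        using lim
      proof eventually_elim
        case (elim y)
        then have "(\<lambda>n. h n y) \<longlonglongrightarrow> 0" by (simp add: h_def LIM_zero)
        then have l: "(\<lambda>n. norm (g y) * norm (h n y)) \<longlonglongrightarrow> 0"
          by (intro tendsto_mult_right_zero tendsto_norm_zero)
        show ?case
          by (rule tendsto_sandwich[OF _ _ tendsto_const l]) (auto simp: qb(1), simp add: q_def)
      qed
      show "integrable lborel (\<lambda>y. K * (norm (g y))\<^sup>2)" using gint by simp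
      show "AE y in lborel. norm (q n y) \<le> K * (norm (g y))\<^sup>2" for n
        using qb[of n] by (simp add: abs_of_nonneg)
    qed auto
    have qi: "integrable lborel (q n)" for n
      by (rule Bochner_Integration.integrable_bound[of _ "\<lambda>y. K * (norm (g y))\<^sup>2"])
         (use gint qb K in \<open>auto simp: abs_of_nonneg\<close>)
    have "eventually (\<lambda>n. norm (LINT y|lborel. q n y) < e / 2) sequentially"
      using tendstoD[OF q0, of "e / 2"] e by (simp add: dist_norm)
    then show "\<forall>\<^sub>F n in sequentially. norm (LINT y|lborel. g y * h n y) < e"
    proof eventually_elim
      case (elim n)
      have pt: "norm (g y * h n y) \<le> q n y + (norm (h n y))\<^sup>2 / K" for y
      proof (cases "norm (h n y) \<le> K * norm (g y)")
        case True
        then have "norm (g y) * norm (h n y) \<le> norm (g y) * (K * norm (g y))"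
          by (intro mult_left_mono) auto
        then have "norm (g y) * norm (h n y) \<le> K * (norm (g y))\<^sup>2"
          by (simp add: power2_eq_square mult_ac)
        then show ?thesis using K by (simp add: q_def norm_mult min_def)
      next
        case False
        then have "K * norm (g y) * norm (h n y) \<le> norm (h n y) * norm (h n y)"
          by (intro mult_right_mono) auto
        then have "norm (g y) * norm (h n y) \<le> (norm (h n y))\<^sup>2 / K"
          using K by (simp add: field_simps power2_eq_square)
        then show ?thesis using qb(1)[of n y] by (simp add: norm_mult)
      qed
      have "norm (LINT y|lborel. g y * h n y) \<le> (LINT y|lborel. norm (g y * h n y))"
        by (rule integral_norm_bound)
      also have "\<dots> \<le> (LINT y|lborel. q n y + (norm (h n y))\<^sup>2 / K)"
        using prod[OF _ h2[of n]] qi h2 pt by (intro integral_mono) auto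
      also have "\<dots> = (LINT y|lborel. q n y) + (LINT y|lborel. (norm (h n y))\<^sup>2) / K"
        using qi h2 by simp
      also have "\<dots> \<le> (LINT y|lborel. q n y) + D / K"
        using hD K by (intro add_left_mono divide_right_mono) auto
      also have "D / K \<le> e / 2"
        using e D0 by (simp add: K_def field_simps)
      finally show ?case using elim by (simp add: abs_if split: if_splits)
    qed
  qed
  moreover have "(LINT y|lborel. g y * h n y) = (LINT y|lborel. g y * f n y) - (LINT y|lborel. g y * \<phi> y)" for n
    using gf g\<phi> by (simp add: h_def right_diff_distrib)
  ultimately show "(\<lambda>n. LINT y|lborel. g y * f n y) \<longlonglongrightarrow> (LINT y|lborel. g y * \<phi> y)"
    by (simp add: LIM_zero_iff)
qed

lemma lower_bound_sq: "2 * (a * b :: real) \<le> a\<^sup>2 + b\<^sup>2"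
  using zero_le_power2[of "a - b"] by (simp add: power2_eq_square algebra_simps)

lemma cmod_plus_one_ge: "x \<ge> 0 \<Longrightarrow> 1 + y\<^sup>2 \<le> (norm (Complex x y + 1))\<^sup>2"
  unfolding cmod_power2 by (simp add: power2_eq_square algebra_simps)

lemma Complex_plus_one_nonzero: "x \<ge> 0 \<Longrightarrow> Complex x y + 1 \<noteq> 0"
  by (auto simp: complex_eq_iff)

lemma continuous_on_Complex [continuous_intros]:
  "continuous_on S f \<Longrightarrow> continuous_on S g \<Longrightarrow> continuous_on S (\<lambda>x. Complex (f x) (g x))"
  unfolding Complex_eq by (intro continuous_intros)

lemma inv_plus_one_sq_integrable:
  assumes "x \<ge> 0"
  shows "integrable lborel (\<lambda>y. (norm (1 / (Complex x y + 1)))\<^sup>2)"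
    and "(LINT y|lborel. (norm (1 / (Complex x y + 1)))\<^sup>2) \<le> pi"
proof -
  have [measurable]: "(\<lambda>y. 1 / (Complex x y + 1)) \<in> borel_measurable lborel"
    using Complex_plus_one_nonzero[OF assms]
    by (simp, intro borel_measurable_continuous_onI continuous_intros) auto
  have le: "(norm (1 / (Complex x y + 1)))\<^sup>2 \<le> 1 / (1 + y\<^sup>2)" for y
    using cmod_plus_one_ge[OF assms, of y]
    by (simp add: norm_divide power_divide frac_le add_pos_nonneg)
  show i: "integrable lborel (\<lambda>y. (norm (1 / (Complex x y + 1)))\<^sup>2)"
    by (rule Bochner_Integration.integrable_bound[OF integrable_inverse_1_plus_square_lborel])
       (use le in \<open>auto simp: abs_of_nonneg\<close>)
  have "(LINT y|lborel. (norm (1 / (Complex x y + 1)))\<^sup>2) \<le> (LINT y|lborel. 1 / (1 + y\<^sup>2))"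
    by (rule integral_mono[OF i integrable_inverse_1_plus_square_lborel]) (rule le)
  then show "(LINT y|lborel. (norm (1 / (Complex x y + 1)))\<^sup>2) \<le> pi"
    by (simp add: integral_inverse_1_plus_square_lborel)
qed

section \<open>Scalar Hardy functions: Cauchy's theorem on vertical lines\<close>

locale scalar_hardy =
  fixes F :: "complex \<Rightarrow> complex" and C :: real
  assumes hol: "F holomorphic_on right_half_plane"
    and C: "\<And>x. x > 0 \<Longrightarrow> (\<integral>\<^sup>+y. ennreal ((norm (F (Complex x y)))\<^sup>2) \<partial>lborel) \<le> ennreal C"
    and C0: "C \<ge> 0"
begin

text \<open>The weight 1/(z + 1) is square integrable on the lines Re z = x >= 0, uniformly in x.
  Hence \<open>h\<close> is absolutely integrable on the lines inside the half-plane, although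
  \<open>F\<close> is only square integrable there.\<close>

definition h where "h z = F z / (z + 1)"

lemma cont_line: "x > 0 \<Longrightarrow> continuous_on UNIV (\<lambda>y. F (Complex x y))"
  by (rule continuous_on_compose2[OF holomorphic_on_imp_continuous_on[OF hol]])
     (auto intro!: continuous_intros simp: right_half_plane_def)

lemma meas_line: "x > 0 \<Longrightarrow> (\<lambda>y. F (Complex x y)) \<in> borel_measurable lborel"
  using cont_line by (simp add: borel_measurable_continuous_onI)

lemma sq_line:
  assumes "x > 0"
  shows "integrable lborel (\<lambda>y. (norm (F (Complex x y)))\<^sup>2)"
    "(LINT y|lborel. (norm (F (Complex x y)))\<^sup>2) \<le> C"
proof -
  have [measurable]: "(\<lambda>y. F (Complex x y)) \<in> borel_measurable lborel"
    by (rule meas_line[OF assms])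
  show i: "integrable lborel (\<lambda>y. (norm (F (Complex x y)))\<^sup>2)"
    using C[OF assms] by (intro integrableI_bounded) (auto intro: le_less_trans)
  have "ennreal (LINT y|lborel. (norm (F (Complex x y)))\<^sup>2) \<le> ennreal C"
    using C[OF assms] i by (subst nn_integral_eq_integral[symmetric]) auto
  then show "(LINT y|lborel. (norm (F (Complex x y)))\<^sup>2) \<le> C" using C0 by simp
qed

lemma h_hol: "h holomorphic_on right_half_plane"
  unfolding h_def by (intro holomorphic_intros hol) (auto simp: right_half_plane_def complex_eq_iff)

lemma h_line_meas: "x > 0 \<Longrightarrow> (\<lambda>y. h (Complex x y)) \<in> borel_measurable lborel"
  using h_hol
  by (simp, intro borel_measurable_continuous_onI continuous_on_compose2[OF holomorphic_on_imp_continuous_on[OF h_hol]])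
     (auto intro!: continuous_intros simp: right_half_plane_def)

text \<open>The arithmetic-geometric mean with a free parameter \<open>e\<close>: on far lines the
  integral of the weight term tends to 0, after which \<open>e\<close> can be made small.\<close>

lemma h_norm_le:
  assumes "x > 0" "e > 0"
  shows "norm (h (Complex x y)) \<le> e * (norm (F (Complex x y)))\<^sup>2 + (norm (1 / (Complex x y + 1)))\<^sup>2 / e"
proof -
  let ?a = "norm (F (Complex x y))" and ?b = "norm (1 / (Complex x y + 1))"
  have "2 * ((sqrt e * ?a) * (?b / sqrt e)) \<le> (sqrt e * ?a)\<^sup>2 + (?b / sqrt e)\<^sup>2"
    by (rule lower_bound_sq)
  then have "2 * (?a * ?b) \<le> e * ?a\<^sup>2 + ?b\<^sup>2 / e"
    using assms by (simp add: power_mult_distrib power_divide)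
  moreover have "norm (h (Complex x y)) = ?a * ?b" "?a * ?b \<ge> 0"
    by (simp_all add: h_def norm_divide)
  ultimately show ?thesis by linarith
qed

lemma h_int:
  assumes "x > 0"
  shows "integrable lborel (\<lambda>y. h (Complex x y))"
proof -
  have [measurable]: "(\<lambda>y. h (Complex x y)) \<in> borel_measurable lborel"
    by (rule h_line_meas[OF assms])
  show ?thesis
  proof (rule Bochner_Integration.integrable_bound)
    show "integrable lborel (\<lambda>y. 1 * (norm (F (Complex x y)))\<^sup>2 + (norm (1 / (Complex x y + 1)))\<^sup>2 / 1)"
      using sq_line(1)[OF assms] inv_plus_one_sq_integrable(1)[of x] assms by simp
    show "AE y in lborel. norm (h (Complex x y)) \<le> norm (1 * (norm (F (Complex x y)))\<^sup>2 + (norm (1 / (Complex x y + 1)))\<^sup>2 / 1)"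
      using h_norm_le[OF assms, of 1] by (intro AE_I2) (auto intro: order_trans)
  qed measurable
qed

lemma h_norm_int:
  assumes "x > 0" "e > 0"
  shows "(LINT y|lborel. norm (h (Complex x y))) \<le> e * C + pi / e"
proof -
  have i: "integrable lborel (\<lambda>y. (norm (1 / (Complex x y + 1)))\<^sup>2)"
    "(LINT y|lborel. (norm (1 / (Complex x y + 1)))\<^sup>2) \<le> pi"
    using inv_plus_one_sq_integrable[of x] assms(1) by auto
  have "(LINT y|lborel. norm (h (Complex x y)))
      \<le> (LINT y|lborel. e * (norm (F (Complex x y)))\<^sup>2 + (norm (1 / (Complex x y + 1)))\<^sup>2 / e)"
    using h_int[OF assms(1)] sq_line(1)[OF assms(1)] i(1) h_norm_le[OF assms]
    by (intro integral_mono Bochner_Integration.integrable_add integrable_norm) auto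
  also have "\<dots> = e * (LINT y|lborel. (norm (F (Complex x y)))\<^sup>2)
      + (LINT y|lborel. (norm (1 / (Complex x y + 1)))\<^sup>2) / e"
    using sq_line(1)[OF assms(1)] i(1) by (subst Bochner_Integration.integral_add) auto
  also have "\<dots> \<le> e * C + pi / e"
    using sq_line(2)[OF assms(1)] i(2) assms(2) by (intro add_mono mult_left_mono divide_right_mono) auto
  finally show ?thesis .
qed

text \<open>Cauchy's theorem for a rectangle, through a primitive of \<open>h\<close> on the convex
  half-plane: the vertical sides differ by the horizontal ones.\<close>

lemma rectangle:
  assumes "0 < a" "a < b" "T > 0"
  shows "norm ((LINT y|lborel. indicator {-T..T} y *\<^sub>R h (Complex a y)) - (LINT y|lborel. indicator {-T..T} y *\<^sub>R h (Complex b y)))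
    \<le> (LINT s|lborel. indicator {a..b} s *\<^sub>R norm (h (Complex s T))) + (LINT s|lborel. indicator {a..b} s *\<^sub>R norm (h (Complex s (- T))))"
proof -
  obtain P where P: "\<And>z. z \<in> right_half_plane \<Longrightarrow> (P has_field_derivative h z) (at z within right_half_plane)"
    using holomorphic_convex_primitive'[OF convex_rhp open_rhp h_hol] by blast
  then have P: "(P has_field_derivative h z) (at z)" if "z \<in> right_half_plane" for z
    using that at_within_open[OF that open_rhp] by metis
  have conth: "continuous_on right_half_plane h"
    using h_hol by (rule holomorphic_on_imp_continuous_on)
  \<comment> \<open>On a vertical line dz = i dy, hence the factor \<open>- \<i>\<close>.\<close>
  have vert: "(LINT y|lborel. indicator {-T..T} y *\<^sub>R h (Complex x y)) = - \<i> * (P (Complex x T) - P (Complex x (- T)))"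
    if "x > 0" for x
  proof -
    have "((\<lambda>y. - \<i> * P (Complex x y)) has_vector_derivative h (Complex x y)) (at y within {-T..T})" for y
    proof -
      have "((\<lambda>y. Complex x y) has_vector_derivative \<i>) (at y within {-T..T})"
        unfolding Complex_eq by (auto intro!: derivative_eq_intros)
      moreover have "(P has_field_derivative h (Complex x y)) (at (Complex x y) within Complex x ` {-T..T})"
        by (rule has_field_derivative_at_within[OF P]) (use that in \<open>simp add: right_half_plane_def\<close>)
      ultimately have "(P \<circ> Complex x has_vector_derivative \<i> * h (Complex x y)) (at y within {-T..T})"
        by (rule field_vector_diff_chain_within)
      from has_vector_derivative_mult_right[OF this, of "- \<i>"] show ?thesis
        by (simp only: o_def mult.assoc[symmetric]) simp
    qed
    then have "((\<lambda>y. h (Complex x y)) has_integral (- \<i> * P (Complex x T) - - \<i> * P (Complex x (- T)))) {-T..T}"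
      using assms(3) by (intro fundamental_theorem_of_calculus) auto
    moreover have "set_integrable lborel {-T..T} (\<lambda>y. h (Complex x y))"
      unfolding set_integrable_def
      using that by (intro borel_integrable_compact continuous_on_compose2[OF conth] continuous_intros)
         (auto simp: right_half_plane_def)
    ultimately show ?thesis
      using set_borel_integral_eq_integral(2)[of "{-T..T}" "\<lambda>y. h (Complex x y)"]
      by (simp add: set_lebesgue_integral_def integral_unique algebra_simps)
  qed
  have hor: "norm (P (Complex b y) - P (Complex a y)) \<le> (LINT s|lborel. indicator {a..b} s *\<^sub>R norm (h (Complex s y)))" for y
  proof -
    have "((\<lambda>s. P (Complex s y)) has_vector_derivative h (Complex s y)) (at s within {a..b})" if "s \<in> {a..b}" for s
    proof -
      have "((\<lambda>s. Complex s y) has_vector_derivative 1) (at s within {a..b})"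
        unfolding Complex_eq by (auto intro!: derivative_eq_intros)
      moreover have "(P has_field_derivative h (Complex s y)) (at (Complex s y) within (\<lambda>s. Complex s y) ` {a..b})"
        by (rule has_field_derivative_at_within[OF P]) (use that assms(1) in \<open>simp add: right_half_plane_def\<close>)
      ultimately have "(P \<circ> (\<lambda>s. Complex s y) has_vector_derivative 1 * h (Complex s y)) (at s within {a..b})"
        by (rule field_vector_diff_chain_within)
      then show ?thesis by (simp only: o_def mult_1)
    qed
    then have I: "((\<lambda>s. h (Complex s y)) has_integral (P (Complex b y) - P (Complex a y))) {a..b}"
      using assms(2) by (intro fundamental_theorem_of_calculus) auto
    have si: "set_integrable lborel {a..b} (\<lambda>s. h (Complex s y))"
      unfolding set_integrable_def
      using assms(1) by (intro borel_integrable_compact continuous_on_compose2[OF conth] continuous_intros)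
         (auto simp: right_half_plane_def)
    have "P (Complex b y) - P (Complex a y) = (LINT s|lborel. indicator {a..b} s *\<^sub>R h (Complex s y))"
      using set_borel_integral_eq_integral(2)[OF si] I
      by (simp add: set_lebesgue_integral_def integral_unique)
    also have "norm \<dots> \<le> (LINT s|lborel. norm (indicator {a..b} s *\<^sub>R h (Complex s y)))"
      by (rule integral_norm_bound)
    finally show ?thesis by simp
  qed
  have "a > 0" "b > 0" using assms by auto
  have "(LINT y|lborel. indicator {-T..T} y *\<^sub>R h (Complex a y)) - (LINT y|lborel. indicator {-T..T} y *\<^sub>R h (Complex b y))
      = \<i> * ((P (Complex b T) - P (Complex a T)) - (P (Complex b (- T)) - P (Complex a (- T))))"
    unfolding vert[OF \<open>a > 0\<close>] vert[OF \<open>b > 0\<close>] by (simp add: algebra_simps)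
  then have "norm ((LINT y|lborel. indicator {-T..T} y *\<^sub>R h (Complex a y)) - (LINT y|lborel. indicator {-T..T} y *\<^sub>R h (Complex b y)))
      = norm ((P (Complex b T) - P (Complex a T)) - (P (Complex b (- T)) - P (Complex a (- T))))"
    by (simp add: norm_mult)
  also have "\<dots> \<le> norm (P (Complex b T) - P (Complex a T)) + norm (P (Complex b (- T)) - P (Complex a (- T)))"
    by (rule norm_triangle_ineq4)
  also have "\<dots> \<le> (LINT s|lborel. indicator {a..b} s *\<^sub>R norm (h (Complex s T))) + (LINT s|lborel. indicator {a..b} s *\<^sub>R norm (h (Complex s (- T))))"
    by (intro add_mono hor)
  finally show ?thesis .
qed

text \<open>By Fubini on the strip, the horizontal sides are integrable functions of the height.
  This takes the place of a pointwise decay of \<open>h\<close>.\<close>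

lemma horizontal_integrable:
  assumes "0 < a" "a < b"
  shows "integrable lborel (\<lambda>y. LINT s|lborel. indicator {a..b} s *\<^sub>R norm (h (Complex s y)))"
proof -
  define k where "k = (\<lambda>(y, s). indicator {a..b} s *\<^sub>R norm (h (Complex s y)))"
  have "continuous_on (UNIV \<times> {a..b}) (\<lambda>p. norm (h (Complex (snd p) (fst p))))"
    using assms(1)
    by (intro continuous_intros continuous_on_compose2[OF holomorphic_on_imp_continuous_on[OF h_hol]])
       (auto simp: right_half_plane_def)
  then have "(\<lambda>p. indicator (UNIV \<times> {a..b}) p *\<^sub>R norm (h (Complex (snd p) (fst p)))) \<in> borel_measurable borel"
    by (intro borel_measurable_continuous_on_indicator) (auto intro!: borel_closed closed_Times)
  also have "(\<lambda>p. indicator (UNIV \<times> {a..b}) p *\<^sub>R norm (h (Complex (snd p) (fst p)))) = k"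
    by (auto simp: k_def indicator_def fun_eq_iff)
  finally have [measurable]: "k \<in> borel_measurable (lborel \<Otimes>\<^sub>M lborel)"
    by (simp add: lborel_prod)
  have "integrable (lborel \<Otimes>\<^sub>M lborel) k"
  proof (rule integrableI_bounded)
    have "(\<integral>\<^sup>+ p. ennreal (norm (k p)) \<partial>(lborel \<Otimes>\<^sub>M lborel))
        = (\<integral>\<^sup>+ s. \<integral>\<^sup>+ y. ennreal (norm (k (y, s))) \<partial>lborel \<partial>lborel)"
      by (subst lborel_pair.nn_integral_snd[symmetric]) auto
    also have "\<dots> \<le> (\<integral>\<^sup>+ s. ennreal (C + pi) * indicator {a..b} s \<partial>lborel)"
    proof (rule nn_integral_mono)
      fix s
      show "(\<integral>\<^sup>+ y. ennreal (norm (k (y, s))) \<partial>lborel) \<le> ennreal (C + pi) * indicator {a..b} s"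
      proof (cases "s \<in> {a..b}")
        case True
        then have s: "s > 0" using assms(1) by simp
        have "(\<integral>\<^sup>+ y. ennreal (norm (k (y, s))) \<partial>lborel) = (\<integral>\<^sup>+ y. ennreal (norm (h (Complex s y))) \<partial>lborel)"
          using True by (simp add: k_def)
        also have "\<dots> = ennreal (LINT y|lborel. norm (h (Complex s y)))"
          using h_int[OF s] by (intro nn_integral_eq_integral) auto
        also have "\<dots> \<le> ennreal (C + pi)"
          using h_norm_int[OF s, of 1] by (intro ennreal_leI) simp
        finally show ?thesis using True by simp
      qed (simp add: k_def)
    qed
    also have "\<dots> < \<infinity>"
      using assms by (simp add: nn_integral_cmult_indicator ennreal_mult_less_top)
    finally show "(\<integral>\<^sup>+ p. ennreal (norm (k p)) \<partial>(lborel \<Otimes>\<^sub>M lborel)) < \<infinity>" .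
  qed measurable
  from lborel_pair.integrable_fst'[OF this] show ?thesis
    by (simp add: k_def)
qed

lemma truncated_limit:
  assumes "integrable lborel (k :: real \<Rightarrow> complex)"
  shows "((\<lambda>T. LINT y|lborel. indicator {-T..T} y *\<^sub>R k y) \<longlongrightarrow> (LINT y|lborel. k y)) at_top"
proof (rule integral_dominated_convergence_at_top[where w = "\<lambda>y. norm (k y)"])
  show "AE y in lborel. ((\<lambda>T. indicator {-T..T} y *\<^sub>R k y) \<longlongrightarrow> k y) at_top"
  proof (intro AE_I2 tendsto_eventually)
    fix y
    show "\<forall>\<^sub>F T in at_top. indicator {-T..T} y *\<^sub>R k y = k y"
      using eventually_ge_at_top[of "\<bar>y\<bar>"] by eventually_elim (auto simp: indicator_def)
  qed
qed (use assms in \<open>auto simp: indicator_def intro!: always_eventually\<close>)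

text \<open>If two line integrals differed by 2 d in modulus, the horizontal sides at heights T and
  -T would together exceed d for all large T, contrary to their integrability.\<close>

lemma line_integral_const:
  assumes "0 < a" "a < b"
  shows "(LINT y|lborel. h (Complex a y)) = (LINT y|lborel. h (Complex b y))"
proof (rule ccontr)
  assume ne: "\<not> ?thesis"
  define I where "I = (\<lambda>x. LINT y|lborel. h (Complex x y))"
  define d where "d = norm (I a - I b) / 2"
  have d: "d > 0" using ne by (simp add: d_def I_def)
  have b0: "b > 0" using assms by simp
  define D where "D = (\<lambda>T. (LINT y|lborel. indicator {-T..T} y *\<^sub>R h (Complex a y)) - (LINT y|lborel. indicator {-T..T} y *\<^sub>R h (Complex b y)))"
  have "((\<lambda>T. norm (D T)) \<longlongrightarrow> norm (I a - I b)) at_top"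
    unfolding D_def I_def by (intro tendsto_intros truncated_limit h_int assms(1) b0)
  then have "eventually (\<lambda>T. d < norm (D T)) at_top"
    using d by (intro order_tendstoD(1)) (auto simp: d_def)
  then obtain T0 where T0: "\<And>T. T \<ge> T0 \<Longrightarrow> d < norm (D T)"
    by (auto simp: eventually_at_top_linorder)
  define H where "H = (\<lambda>y. LINT s|lborel. indicator {a..b} s *\<^sub>R norm (h (Complex s y)))"
  have H: "integrable lborel H"
    unfolding H_def by (rule horizontal_integrable[OF assms])
  have H': "integrable lborel (\<lambda>y. H (- y))"
    using lborel_integrable_real_affine[OF H, of "-1" 0] by simp
  have H0: "H y \<ge> 0" for y
    unfolding H_def by (intro integral_nonneg_AE) auto
  define M where "M = (LINT y|lborel. H y + H (- y))"
  \<comment> \<open>Over an interval of this length the constant \<open>d\<close> already integrates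
    to M + d, more than the total \<open>M\<close>.\<close>
  define n where "n = M / d + 1"
  have M0: "M \<ge> 0" unfolding M_def by (intro integral_nonneg_AE) (auto simp: H0)
  define T1 where "T1 = max T0 1"
  have "n * d = (LINT y|lborel. indicator {T1..T1 + n} y *\<^sub>R d)"
    using M0 d by (simp add: n_def)
  also have "\<dots> \<le> M"
    unfolding M_def
  proof (rule integral_mono)
    show "integrable lborel (\<lambda>y. indicator {T1..T1 + n} y *\<^sub>R d)"
      by (intro integrable_scaleR_left integrable_real_indicator) (auto simp: emeasure_lborel_Icc_eq)
    show "integrable lborel (\<lambda>y. H y + H (- y))" using H H' by simp
    fix y
    show "indicator {T1..T1 + n} y *\<^sub>R d \<le> H y + H (- y)"
    proof (cases "y \<in> {T1..T1 + n}")
      case True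
      then have "y \<ge> T0" "y > 0" by (auto simp: T1_def)
      then show ?thesis
        using True T0[of y] rectangle[OF assms, of y] by (simp add: D_def H_def)
    qed (use H0 in \<open>simp add: add_nonneg_nonneg\<close>)
  qed
  finally have "n * d \<le> M" .
  moreover have "n * d = M + d" using d by (simp add: n_def field_simps)
  ultimately show False using d by simp
qed

text \<open>The constant value is estimated on the lines Re z = n, where the L2 norm of the weight
  tends to 0. The limit of the bound is e C, for every e > 0.\<close>

lemma line_integral_zero:
  assumes "0 < a"
  shows "(LINT y|lborel. h (Complex a y)) = 0"
proof -
  define J where "J = (\<lambda>n::nat. LINT y|lborel. (norm (1 / (Complex (real n) y + 1)))\<^sup>2)"
  have J: "J \<longlonglongrightarrow> (LINT y|(lborel :: real measure). 0)"
    unfolding J_def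
  proof (rule integral_dominated_convergence[where w = "\<lambda>y. 1 / (1 + y\<^sup>2)"])
    show "AE y in lborel. (\<lambda>n. (norm (1 / (Complex (real n) y + 1)))\<^sup>2) \<longlonglongrightarrow> 0"
    proof (intro AE_I2)
      fix y
      have "norm ((norm (1 / (Complex (real n) y + 1)))\<^sup>2) \<le> 1 / real n" if "n \<ge> 1" for n
      proof -
        have n: "real n \<ge> 1" using that by simp
        have "real n \<le> (real n)\<^sup>2" using n by (simp add: power2_eq_square)
        also have "\<dots> \<le> (norm (Complex (real n) y + 1))\<^sup>2"
          unfolding cmod_power2 using n by (simp add: power2_eq_square algebra_simps)
        finally show ?thesis using n by (simp add: norm_divide power_divide frac_le)
      qed
      then show "(\<lambda>n. (norm (1 / (Complex (real n) y + 1)))\<^sup>2) \<longlonglongrightarrow> 0"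
        by (intro Lim_null_comparison[OF _ lim_1_over_n] eventually_sequentiallyI[of 1])
    qed
    show "AE y in lborel. norm ((norm (1 / (Complex (real n) y + 1)))\<^sup>2) \<le> 1 / (1 + y\<^sup>2)" for n
      using cmod_plus_one_ge[of "real n"]
      by (intro AE_I2) (simp add: norm_divide power_divide frac_le add_pos_nonneg)
    show "(\<lambda>y. (norm (1 / (Complex (real n) y + 1)))\<^sup>2) \<in> borel_measurable lborel" for n
      using borel_measurable_integrable[OF inv_plus_one_sq_integrable(1)[of "real n"]] by simp
  qed (use integrable_inverse_1_plus_square_lborel in auto)
  define I where "I = (LINT y|lborel. h (Complex a y))"
  have bound: "norm I \<le> e * C" if e: "e > 0" for e
  proof (rule LIMSEQ_le_const)
    show "(\<lambda>n. e * C + J n / e) \<longlonglongrightarrow> e * C"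
      using J by (auto intro!: tendsto_eq_intros simp: e[THEN less_imp_neq, symmetric])
    show "\<exists>N. \<forall>n\<ge>N. norm I \<le> e * C + J n / e"
    proof (intro exI allI impI)
      fix n assume n: "nat \<lceil>a\<rceil> + 1 \<le> n"
      then have n0: "a < real n" "0 < real n" using assms by linarith+
      have i: "integrable lborel (\<lambda>y. (norm (1 / (Complex (real n) y + 1)))\<^sup>2)"
        using inv_plus_one_sq_integrable(1)[of "real n"] by simp
      have "norm I \<le> (LINT y|lborel. norm (h (Complex (real n) y)))"
        unfolding I_def line_integral_const[OF assms n0(1)] by (rule integral_norm_bound)
      also have "\<dots> \<le> (LINT y|lborel. e * (norm (F (Complex (real n) y)))\<^sup>2 + (norm (1 / (Complex (real n) y + 1)))\<^sup>2 / e)"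
        using h_int[OF n0(2)] sq_line(1)[OF n0(2)] i h_norm_le[OF n0(2) e]
        by (intro integral_mono Bochner_Integration.integrable_add integrable_norm) auto
      also have "\<dots> = e * (LINT y|lborel. (norm (F (Complex (real n) y)))\<^sup>2) + J n / e"
        unfolding J_def using sq_line(1)[OF n0(2)] i by (subst Bochner_Integration.integral_add) auto
      also have "\<dots> \<le> e * C + J n / e"
        using sq_line(2)[OF n0(2)] e by simp
      finally show "norm I \<le> e * C + J n / e" .
    qed
  qed
  have "norm I \<le> 0"
  proof (rule field_le_epsilon)
    fix e :: real assume e: "e > 0"
    have "norm I \<le> e / (C + 1) * C" using bound[of "e / (C + 1)"] e C0 by simp
    also have "\<dots> \<le> 0 + e" using e C0 by (simp add: field_simps)
    finally show "norm I \<le> 0 + e" .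
  qed
  then show ?thesis by (simp add: I_def)
qed

lemma boundary_integral:
  assumes [measurable]: "\<phi> \<in> borel_measurable lborel"
    and lim: "AE y in lborel. (\<lambda>n. F (Complex (inverse (real (Suc n))) y)) \<longlonglongrightarrow> \<phi> y"
  shows "integrable lborel (\<lambda>y. (norm (\<phi> y))\<^sup>2)"
    and "has_bochner_integral lborel (\<lambda>y. 1 / (Complex 0 y + 1) * \<phi> y) 0"
proof -
  define x where "x = (\<lambda>n. inverse (real (Suc n)))"
  have x: "x n > 0" for n by (simp add: x_def)
  have x0: "x \<longlonglongrightarrow> 0" unfolding x_def by (rule LIMSEQ_inverse_real_of_nat)
  \<comment> \<open>Weak convergence tests against a fixed function. With f = r F, the fixed weight
    1/(iy + 1) times \<open>f n\<close> is the value of \<open>h\<close> on the shifted line; as |r|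
    <= 1, the L2 bound survives.\<close>
  define r where "r = (\<lambda>n y. (Complex 0 y + 1) / (Complex (x n) y + 1))"
  have nz: "Complex (x n) y + 1 \<noteq> 0" "Complex 0 y + 1 \<noteq> 0" for n y
    using x[of n] Complex_plus_one_nonzero by (auto simp: less_imp_le)
  define f where "f = (\<lambda>n y. r n y * F (Complex (x n) y))"
  have rle: "norm (r n y) \<le> 1" for n y
  proof -
    have "(norm (Complex 0 y + 1))\<^sup>2 \<le> (norm (Complex (x n) y + 1))\<^sup>2"
      unfolding cmod_power2 using x[of n] by (simp add: power2_eq_square algebra_simps)
    then have "norm (Complex 0 y + 1) \<le> norm (Complex (x n) y + 1)"
      by (rule power2_le_imp_le) simp
    then show ?thesis using nz(1) by (simp add: r_def norm_divide)
  qed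
  have fm: "f n \<in> borel_measurable lborel" for n
  proof -
    have "continuous_on UNIV (f n)"
      unfolding f_def r_def using nz by (intro continuous_intros cont_line x) auto
    then show ?thesis by (simp add: borel_measurable_continuous_onI)
  qed
  have gm: "(\<lambda>y. 1 / (Complex 0 y + 1)) \<in> borel_measurable lborel"
    using nz by (simp, intro borel_measurable_continuous_onI continuous_intros) auto
  have fC: "(\<integral>\<^sup>+y. ennreal ((norm (f n y))\<^sup>2) \<partial>lborel) \<le> ennreal C" for n
  proof -
    have "norm (f n y) \<le> norm (F (Complex (x n) y))" for y
      using mult_right_mono[OF rle[of n y], of "norm (F (Complex (x n) y))"] by (simp add: f_def norm_mult)
    then have "(\<integral>\<^sup>+y. ennreal ((norm (f n y))\<^sup>2) \<partial>lborel) \<le> (\<integral>\<^sup>+y. ennreal ((norm (F (Complex (x n) y)))\<^sup>2) \<partial>lborel)"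
      by (intro nn_integral_mono ennreal_leI power_mono) auto
    also have "\<dots> \<le> ennreal C" by (rule C[OF x])
    finally show ?thesis .
  qed
  have flim: "AE y in lborel. (\<lambda>n. f n y) \<longlonglongrightarrow> \<phi> y"
    using lim
  proof eventually_elim
    case (elim y)
    have "(\<lambda>n. Complex (x n) y) \<longlonglongrightarrow> Complex 0 y"
      unfolding Complex_eq by (intro tendsto_intros x0)
    then have "(\<lambda>n. r n y) \<longlonglongrightarrow> (Complex 0 y + 1) / (Complex 0 y + 1)"
      unfolding r_def using nz(2) by (intro tendsto_divide tendsto_add tendsto_const)
    then have "(\<lambda>n. f n y) \<longlonglongrightarrow> (Complex 0 y + 1) / (Complex 0 y + 1) * \<phi> y"
      unfolding f_def by (intro tendsto_mult) (use elim in \<open>simp_all add: x_def\<close>)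
    then show ?case using nz(2)[of y] by simp
  qed
  note W = weak_limit_L2[OF fm assms(1) gm fC flim inv_plus_one_sq_integrable(1)[of 0, simplified]]
  show "integrable lborel (\<lambda>y. (norm (\<phi> y))\<^sup>2)" by (rule W(1))
  have "(LINT y|lborel. 1 / (Complex 0 y + 1) * f n y) = 0" for n
  proof -
    have "1 / (Complex 0 y + 1) * f n y = h (Complex (x n) y)" for y
      using nz by (simp add: f_def r_def h_def)
    then show ?thesis using line_integral_zero[OF x] by simp
  qed
  with W(3) have "(LINT y|lborel. 1 / (Complex 0 y + 1) * \<phi> y) = 0"
    by (simp add: LIMSEQ_const_iff)
  with W(2) show "has_bochner_integral lborel (\<lambda>y. 1 / (Complex 0 y + 1) * \<phi> y) 0"
    by (metis has_bochner_integral_integrable)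
qed

end

section \<open>Vector-valued Hardy functions and their boundary values\<close>

lemma has_bochner_integral_vec:
  fixes f :: "'a \<Rightarrow> complex^'k::finite"
  assumes "\<And>i. has_bochner_integral M (\<lambda>x. f x $ i) (I $ i)"
  shows "has_bochner_integral M f I"
proof -
  have bl: "bounded_linear (axis i :: complex \<Rightarrow> complex^'k)" for i
    by (intro linear_conv_bounded_linear[THEN iffD1] linearI) (auto simp: vec_eq_iff axis_def)
  have "has_bochner_integral M (\<lambda>x. \<Sum>i\<in>UNIV. axis i (f x $ i)) (\<Sum>i\<in>UNIV. axis i (I $ i))"
    by (intro has_bochner_integral_sum has_bochner_integral_bounded_linear[OF bl] assms)
  moreover have "(\<Sum>i\<in>UNIV. axis i (v $ i)) = v" for v :: "complex^'k"
    by (simp add: vec_eq_iff axis_def)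
  ultimately show ?thesis by simp
qed

lemma tendsto_matrix_vector:
  fixes A :: "'a \<Rightarrow> complex^'k::finite^'l::finite"
  assumes "(A \<longlongrightarrow> A0) F" "(v \<longlongrightarrow> v0) F"
  shows "((\<lambda>x. A x *v v x) \<longlongrightarrow> A0 *v v0) F"
  unfolding matrix_vector_mult_def
  by (intro vec_tendstoI) (auto intro!: tendsto_intros assms)

lemma tendsto_scale:
  fixes v :: "'a \<Rightarrow> complex^'k::finite"
  assumes "(a \<longlongrightarrow> a0) F" "(v \<longlongrightarrow> v0) F"
  shows "((\<lambda>x. a x *s v x) \<longlongrightarrow> a0 *s v0) F"
  by (intro vec_tendstoI) (auto intro!: tendsto_intros assms)

lemma measurable_matrix_vector:
  fixes T :: "'a \<Rightarrow> complex^'k::finite^'l::finite"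
  assumes "T \<in> borel_measurable M" "\<phi> \<in> borel_measurable M"
  shows "(\<lambda>y. T y *v \<phi> y) \<in> borel_measurable M"
proof -
  have "continuous_on UNIV (\<lambda>p :: (complex^'k^'l) \<times> (complex^'k). fst p *v snd p)"
    unfolding continuous_on_def
    by (intro ballI tendsto_matrix_vector tendsto_fst tendsto_snd tendsto_ident_at)
  from borel_measurable_continuous_Pair[OF assms this[unfolded case_prod_unfold[symmetric]]] 
  show ?thesis by simp
qed

lemma measurable_scale:
  fixes \<phi> :: "'a \<Rightarrow> complex^'k::finite"
  assumes "a \<in> borel_measurable M" "\<phi> \<in> borel_measurable M"
  shows "(\<lambda>y. a y *s \<phi> y) \<in> borel_measurable M"
proof -
  have "continuous_on UNIV (\<lambda>p :: complex \<times> (complex^'k). fst p *s snd p)"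
    unfolding continuous_on_def
    by (intro ballI tendsto_scale tendsto_fst tendsto_snd tendsto_ident_at)
  from borel_measurable_continuous_Pair[OF assms this[unfolded case_prod_unfold[symmetric]]] 
  show ?thesis by simp
qed

lemma hardy2_scalar:
  assumes "F \<in> hardy2"
  obtains C where "\<And>i. scalar_hardy (\<lambda>z. F z $ i) C"
proof -
  obtain C where hol: "vec_holomorphic_on F right_half_plane"
    and C: "\<And>x. x > 0 \<Longrightarrow> (\<integral>\<^sup>+y. ennreal ((norm (F (Complex x y)))\<^sup>2) \<partial>lborel) \<le> ennreal C"
    using assms unfolding hardy2_def by auto
  have "scalar_hardy (\<lambda>z. F z $ i) \<bar>C\<bar>" for i
  proof
    show "(\<lambda>z. F z $ i) holomorphic_on right_half_plane"
      using hol by (simp add: vec_holomorphic_on_def)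
    fix x :: real assume x: "x > 0"
    have "(\<integral>\<^sup>+y. ennreal ((norm (F (Complex x y) $ i))\<^sup>2) \<partial>lborel)
        \<le> (\<integral>\<^sup>+y. ennreal ((norm (F (Complex x y)))\<^sup>2) \<partial>lborel)"
      by (intro nn_integral_mono ennreal_leI power_mono Finite_Cartesian_Product.norm_nth_le) auto
    also have "\<dots> \<le> ennreal \<bar>C\<bar>"
      using C[OF x] by (rule order_trans) (simp add: ennreal_leI)
    finally show "(\<integral>\<^sup>+y. ennreal ((norm (F (Complex x y) $ i))\<^sup>2) \<partial>lborel) \<le> ennreal \<bar>C\<bar>" .
  qed simp
  then show ?thesis using that by blast
qed

lemma ntbv_radial:
  assumes "nontangential_boundary_values F \<phi>"
  shows "AE y in lborel. (\<lambda>n. F (Complex (inverse (real (Suc n))) y)) \<longlonglongrightarrow> \<phi> y"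
  using assms unfolding nontangential_boundary_values_def
proof eventually_elim
  case (elim y)
  define S where "S = {z. Re z > 0 \<and> \<bar>Im z - y\<bar> < 1 * Re z}"
  have "(F \<longlongrightarrow> \<phi> y) (at (Complex 0 y) within S)"
    using elim zero_less_one unfolding S_def by blast
  moreover have "filterlim (\<lambda>n. Complex (inverse (real (Suc n))) y) (at (Complex 0 y) within S) sequentially"
    unfolding filterlim_at
  proof
    show "(\<lambda>n. Complex (inverse (real (Suc n))) y) \<longlonglongrightarrow> Complex 0 y"
      unfolding Complex_eq by (intro tendsto_intros LIMSEQ_inverse_real_of_nat)
  qed (auto simp: S_def)
  ultimately show ?case by (rule filterlim_compose)
qed

lemma ntbv_cong:
  assumes "nontangential_boundary_values F \<phi>" "AE y in lborel. \<phi> y = \<psi> y"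
  shows "nontangential_boundary_values F \<psi>"
  using assms unfolding nontangential_boundary_values_def by eventually_elim auto

lemma hardy2_line_measurable:
  assumes "F \<in> hardy2" "x > 0"
  shows "(\<lambda>y. F (Complex x y)) \<in> borel_measurable lborel"
proof -
  have "vec_holomorphic_on F right_half_plane" using assms(1) by (simp add: hardy2_def)
  then have "continuous_on UNIV (\<lambda>y. F (Complex x y))"
    by (intro continuous_on_compose2[OF vec_holomorphic_continuous] continuous_intros)
       (use assms(2) in \<open>auto simp: right_half_plane_def\<close>)
  then show ?thesis by (simp add: borel_measurable_continuous_onI)
qed

text \<open>A boundary function agrees almost everywhere with the limit of \<open>F\<close> along
  horizontal approach. Being a limit of continuous functions, the latter is measurable, and all
  integrals use this representative.\<close>

lemma ntbv_measurable:
  assumes "F \<in> hardy2" "nontangential_boundary_values F \<phi>"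
  obtains \<psi> where "\<psi> \<in> borel_measurable lborel" "AE y in lborel. \<phi> y = \<psi> y"
    "nontangential_boundary_values F \<psi>"
proof -
  define \<psi> where "\<psi> = (\<lambda>y. lim (\<lambda>n. F (Complex (inverse (real (Suc n))) y)))"
  have "\<psi> \<in> borel_measurable lborel"
    unfolding \<psi>_def by (intro borel_measurable_lim_metric hardy2_line_measurable assms(1)) simp
  moreover have ae: "AE y in lborel. \<phi> y = \<psi> y"
    using ntbv_radial[OF assms(2)] by eventually_elim (simp add: \<psi>_def limI)
  ultimately show ?thesis using that ntbv_cong[OF assms(2) ae] by blast
qed

lemma norm_sq_vec: "(norm (v :: complex^'k::finite))\<^sup>2 = (\<Sum>i\<in>UNIV. (norm (v $ i))\<^sup>2)"
  by (simp add: norm_vec_def L2_set_def sum_nonneg)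

lemma hardy2_boundary:
  assumes F: "F \<in> hardy2" and bv: "nontangential_boundary_values F \<phi>"
    and m: "\<phi> \<in> borel_measurable lborel"
  shows "\<phi> \<in> L2_line"
    and "has_bochner_integral lborel (\<lambda>y. (1 / (Complex 0 y + 1)) *s \<phi> y) 0"
proof -
  obtain C where C: "\<And>i. scalar_hardy (\<lambda>z. F z $ i) C"
    using hardy2_scalar[OF F] by blast
  have mi: "(\<lambda>y. \<phi> y $ i) \<in> borel_measurable lborel" for i
    using m by (rule measurable_compose) (simp add: borel_measurable_continuous_onI continuous_intros)
  have li: "AE y in lborel. (\<lambda>n. F (Complex (inverse (real (Suc n))) y) $ i) \<longlonglongrightarrow> \<phi> y $ i" for i
    using ntbv_radial[OF bv] by eventually_elim (rule tendsto_vec_nth)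
  show "\<phi> \<in> L2_line"
    unfolding L2_line_def norm_sq_vec
    using scalar_hardy.boundary_integral(1)[OF C mi li] m by auto
  show "has_bochner_integral lborel (\<lambda>y. (1 / (Complex 0 y + 1)) *s \<phi> y) 0"
    using scalar_hardy.boundary_integral(2)[OF C mi li] by (intro has_bochner_integral_vec) simp
qed

text \<open>A common criterion for membership in H^2. \<open>K\<close> is empty or a disk around a
  spectrum, where the estimate may fail but \<open>f\<close> is bounded by compactness; the term
  with 1/|z + 1| accounts for resolvents applied to constants.\<close>

lemma hardy2_dominated:
  fixes f :: "complex \<Rightarrow> complex^'k::finite" and F :: "complex \<Rightarrow> complex^'l::finite"
  assumes hol: "vec_holomorphic_on f right_half_plane" and F: "F \<in> hardy2"
    and K: "compact K" "K \<subseteq> right_half_plane"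
    and le: "\<And>z. z \<in> right_half_plane \<Longrightarrow> z \<notin> K \<Longrightarrow> norm (f z) \<le> B * norm (F z) + B / norm (z + 1)"
  shows "f \<in> hardy2"
proof -
  obtain C where C: "\<And>x. x > 0 \<Longrightarrow> (\<integral>\<^sup>+y. ennreal ((norm (F (Complex x y)))\<^sup>2) \<partial>lborel) \<le> ennreal C"
    using F unfolding hardy2_def by auto
  have "bounded (f ` K)"
    using hol K by (meson compact_continuous_image compact_imp_bounded continuous_on_subset vec_holomorphic_continuous)
  then obtain M where M: "\<And>z. z \<in> K \<Longrightarrow> norm (f z) \<le> M"
    by (auto simp: bounded_iff)
  obtain R where R: "\<And>z. z \<in> K \<Longrightarrow> norm z \<le> R"
    using compact_imp_bounded[OF K(1)] by (auto simp: bounded_iff)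
  \<comment> \<open>Points of \<open>K\<close> have height at most |R|, hence the indicator. The
    factors 2 come from squaring a sum of two terms.\<close>
  have pt: "(norm (f (Complex x y)))\<^sup>2 \<le> 2 * B\<^sup>2 * (norm (F (Complex x y)))\<^sup>2 + 2 * B\<^sup>2 * (norm (1 / (Complex x y + 1)))\<^sup>2
      + M\<^sup>2 * indicator {-\<bar>R\<bar>..\<bar>R\<bar>} y" if x: "x > 0" for x y
  proof (cases "Complex x y \<in> K")
    case True
    have "\<bar>y\<bar> \<le> \<bar>R\<bar>" using R[OF True] abs_Im_le_cmod[of "Complex x y"] by simp
    moreover have "(norm (f (Complex x y)))\<^sup>2 \<le> M\<^sup>2"
      using M[OF True] by (intro power_mono) auto
    moreover have "0 \<le> 2 * B\<^sup>2 * (norm (F (Complex x y)))\<^sup>2" "0 \<le> 2 * B\<^sup>2 * (norm (1 / (Complex x y + 1)))\<^sup>2"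
      by (intro mult_nonneg_nonneg; simp)+
    moreover have "indicator {-\<bar>R\<bar>..\<bar>R\<bar>} y = (1::real)"
      using \<open>\<bar>y\<bar> \<le> \<bar>R\<bar>\<close> by (auto simp: indicator_def)
    ultimately show ?thesis by (simp only: mult_1_right)
  next
    case False
    let ?a = "B * norm (F (Complex x y))" and ?b = "B * norm (1 / (Complex x y + 1))"
    have "norm (f (Complex x y)) \<le> ?a + ?b"
      using le[OF _ False] x by (simp add: right_half_plane_def norm_divide)
    then have "(norm (f (Complex x y)))\<^sup>2 \<le> (?a + ?b)\<^sup>2"
      by (intro power_mono) auto
    also have "\<dots> \<le> 2 * ?a\<^sup>2 + 2 * ?b\<^sup>2"
      using lower_bound_sq[of ?a ?b] by (simp add: power2_sum)
    finally show ?thesis by (simp add: power_mult_distrib add_increasing2)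
  qed
  have "(\<integral>\<^sup>+y. ennreal ((norm (f (Complex x y)))\<^sup>2) \<partial>lborel)
      \<le> ennreal (2 * B\<^sup>2 * \<bar>C\<bar> + 2 * B\<^sup>2 * pi + M\<^sup>2 * (2 * \<bar>R\<bar>))" if x: "x > 0" for x
  proof -
    have [measurable]: "(\<lambda>y. F (Complex x y)) \<in> borel_measurable lborel"
      by (rule hardy2_line_measurable[OF F x])
    have [measurable]: "(\<lambda>y. (norm (1 / (Complex x y + 1)))\<^sup>2) \<in> borel_measurable lborel"
      using borel_measurable_integrable inv_plus_one_sq_integrable(1)[of x] x by auto
    have "(\<integral>\<^sup>+y. ennreal ((norm (f (Complex x y)))\<^sup>2) \<partial>lborel)
      \<le> (\<integral>\<^sup>+y. ennreal (2 * B\<^sup>2) * ennreal ((norm (F (Complex x y)))\<^sup>2)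
          + ennreal (2 * B\<^sup>2) * ennreal ((norm (1 / (Complex x y + 1)))\<^sup>2)
          + ennreal (M\<^sup>2) * indicator {-\<bar>R\<bar>..\<bar>R\<bar>} y \<partial>lborel)"
    proof (rule nn_integral_mono)
      fix y
      have "ennreal ((norm (f (Complex x y)))\<^sup>2) \<le> ennreal (2 * B\<^sup>2 * (norm (F (Complex x y)))\<^sup>2 + 2 * B\<^sup>2 * (norm (1 / (Complex x y + 1)))\<^sup>2
        + M\<^sup>2 * indicator {-\<bar>R\<bar>..\<bar>R\<bar>} y)"
        by (intro ennreal_leI pt x)
      also have "\<dots> = ennreal (2 * B\<^sup>2) * ennreal ((norm (F (Complex x y)))\<^sup>2)
          + ennreal (2 * B\<^sup>2) * ennreal ((norm (1 / (Complex x y + 1)))\<^sup>2)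
          + ennreal (M\<^sup>2) * indicator {-\<bar>R\<bar>..\<bar>R\<bar>} y"
        by (simp add: ennreal_mult'[symmetric] ennreal_plus[symmetric] indicator_def del: ennreal_plus)
      finally show "ennreal ((norm (f (Complex x y)))\<^sup>2) \<le> ennreal (2 * B\<^sup>2) * ennreal ((norm (F (Complex x y)))\<^sup>2)
          + ennreal (2 * B\<^sup>2) * ennreal ((norm (1 / (Complex x y + 1)))\<^sup>2)
          + ennreal (M\<^sup>2) * indicator {-\<bar>R\<bar>..\<bar>R\<bar>} y" .
    qed
    also have "\<dots> = ennreal (2 * B\<^sup>2) * (\<integral>\<^sup>+y. ennreal ((norm (F (Complex x y)))\<^sup>2) \<partial>lborel)
        + ennreal (2 * B\<^sup>2) * (\<integral>\<^sup>+y. ennreal ((norm (1 / (Complex x y + 1)))\<^sup>2) \<partial>lborel)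
        + ennreal (M\<^sup>2) * emeasure lborel {-\<bar>R\<bar>..\<bar>R\<bar>}"
      by (simp add: nn_integral_add nn_integral_cmult nn_integral_cmult_indicator)
    also have "\<dots> \<le> ennreal (2 * B\<^sup>2) * ennreal \<bar>C\<bar> + ennreal (2 * B\<^sup>2) * ennreal pi + ennreal (M\<^sup>2) * ennreal (2 * \<bar>R\<bar>)"
    proof (intro add_mono mult_left_mono)
      show "(\<integral>\<^sup>+y. ennreal ((norm (F (Complex x y)))\<^sup>2) \<partial>lborel) \<le> ennreal \<bar>C\<bar>"
        using C[OF x] by (rule order_trans) (simp add: ennreal_leI)
      have "(\<integral>\<^sup>+y. ennreal ((norm (1 / (Complex x y + 1)))\<^sup>2) \<partial>lborel) = ennreal (LINT y|lborel. (norm (1 / (Complex x y + 1)))\<^sup>2)"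
        using inv_plus_one_sq_integrable(1)[of x] x by (intro nn_integral_eq_integral) auto
      also have "\<dots> \<le> ennreal pi"
        using inv_plus_one_sq_integrable(2)[of x] x by (intro ennreal_leI) auto
      finally show "(\<integral>\<^sup>+y. ennreal ((norm (1 / (Complex x y + 1)))\<^sup>2) \<partial>lborel) \<le> ennreal pi" .
    qed auto
    also have "\<dots> = ennreal (2 * B\<^sup>2 * \<bar>C\<bar> + 2 * B\<^sup>2 * pi + M\<^sup>2 * (2 * \<bar>R\<bar>))"
      by (simp add: ennreal_mult'[symmetric] ennreal_plus[symmetric] del: ennreal_plus)
    finally show ?thesis .
  qed
  then show ?thesis using hol unfolding hardy2_def by blast
qed

lemma hardy2_zero [simp]: "(\<lambda>_. 0) \<in> hardy2"
  by (auto simp: hardy2_def intro!: exI[of _ 0])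

lemma hardy2_decay:
  fixes f :: "complex \<Rightarrow> complex^'k::finite"
  assumes "vec_holomorphic_on f right_half_plane" "compact K" "K \<subseteq> right_half_plane"
    and "\<And>z. z \<in> right_half_plane \<Longrightarrow> z \<notin> K \<Longrightarrow> norm (f z) \<le> B / norm (z + 1)"
  shows "f \<in> hardy2"
  by (rule hardy2_dominated[where F = "\<lambda>_. 0 :: complex^'k" and B = B, OF assms(1) _ assms(2,3)])
     (use assms(4) in simp_all)

lemma hardy2_holomorphic: "F \<in> hardy2 \<Longrightarrow> vec_holomorphic_on F right_half_plane"
  by (simp add: hardy2_def)

lemma hardy2_mult:
  fixes T :: "complex \<Rightarrow> complex^'k::finite^'l::finite"
  assumes "F \<in> hardy2" "mat_holomorphic_on T right_half_plane"
    and "\<And>z v. z \<in> right_half_plane \<Longrightarrow> norm (T z *v v) \<le> B * norm v"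
  shows "(\<lambda>z. T z *v F z) \<in> hardy2"
proof (rule hardy2_dominated[OF _ assms(1), where K = "{}" and B = "\<bar>B\<bar>"])
  fix z assume "z \<in> right_half_plane"
  then have "norm (T z *v F z) \<le> B * norm (F z)" by (rule assms(3))
  also have "\<dots> \<le> \<bar>B\<bar> * norm (F z)" by (intro mult_right_mono) auto
  finally show "norm (T z *v F z) \<le> \<bar>B\<bar> * norm (F z) + \<bar>B\<bar> / norm (z + 1)" by (simp add: add_increasing2)
next
  show "vec_holomorphic_on (\<lambda>z. T z *v F z) right_half_plane"
    by (intro mat_vec_holomorphic assms hardy2_holomorphic[OF assms(1)])
qed auto

lemma hardy2_const_mult:
  "F \<in> hardy2 \<Longrightarrow> (\<lambda>z. (M :: complex^'k::finite^'l::finite) *v F z) \<in> hardy2"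
  by (rule hardy2_mult[where B = "norm M"]) (auto intro: norm_matrix_vector_le)

lemma hardy2_add:
  assumes "F \<in> hardy2" "G \<in> hardy2"
  shows "(\<lambda>z. F z + G z :: complex^'k::finite) \<in> hardy2"
proof -
  obtain C1 where C1: "\<And>x. x > 0 \<Longrightarrow> (\<integral>\<^sup>+y. ennreal ((norm (F (Complex x y)))\<^sup>2) \<partial>lborel) \<le> ennreal C1"
    using assms(1) unfolding hardy2_def by auto
  obtain C2 where C2: "\<And>x. x > 0 \<Longrightarrow> (\<integral>\<^sup>+y. ennreal ((norm (G (Complex x y)))\<^sup>2) \<partial>lborel) \<le> ennreal C2"
    using assms(2) unfolding hardy2_def by auto
  have "(\<integral>\<^sup>+y. ennreal ((norm (F (Complex x y) + G (Complex x y)))\<^sup>2) \<partial>lborel) \<le> ennreal (2 * \<bar>C1\<bar> + 2 * \<bar>C2\<bar>)"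
    if x: "x > 0" for x
  proof -
    have [measurable]: "(\<lambda>y. F (Complex x y)) \<in> borel_measurable lborel" "(\<lambda>y. G (Complex x y)) \<in> borel_measurable lborel"
      by (intro hardy2_line_measurable assms x)+
    have pt: "(norm (a + b))\<^sup>2 \<le> 2 * (norm a)\<^sup>2 + 2 * (norm b)\<^sup>2" for a b :: "complex^'k"
    proof -
      have "(norm (a + b))\<^sup>2 \<le> (norm a + norm b)\<^sup>2" by (intro power_mono norm_triangle_ineq) auto
      also have "\<dots> \<le> 2 * (norm a)\<^sup>2 + 2 * (norm b)\<^sup>2"
        using lower_bound_sq[of "norm a" "norm b"] by (simp add: power2_sum)
      finally show ?thesis .
    qed
    have "(\<integral>\<^sup>+y. ennreal ((norm (F (Complex x y) + G (Complex x y)))\<^sup>2) \<partial>lborel)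
      \<le> (\<integral>\<^sup>+y. 2 * ennreal ((norm (F (Complex x y)))\<^sup>2) + 2 * ennreal ((norm (G (Complex x y)))\<^sup>2) \<partial>lborel)"
    proof (rule nn_integral_mono)
      fix y
      show "ennreal ((norm (F (Complex x y) + G (Complex x y)))\<^sup>2)
        \<le> 2 * ennreal ((norm (F (Complex x y)))\<^sup>2) + 2 * ennreal ((norm (G (Complex x y)))\<^sup>2)"
        using ennreal_leI[OF pt[of "F (Complex x y)" "G (Complex x y)"]]
        by (simp add: ennreal_mult')
    qed
    also have "\<dots> = 2 * (\<integral>\<^sup>+y. ennreal ((norm (F (Complex x y)))\<^sup>2) \<partial>lborel) + 2 * (\<integral>\<^sup>+y. ennreal ((norm (G (Complex x y)))\<^sup>2) \<partial>lborel)"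
      by (simp add: nn_integral_add nn_integral_cmult)
    also have "\<dots> \<le> 2 * ennreal \<bar>C1\<bar> + 2 * ennreal \<bar>C2\<bar>"
      by (intro add_mono mult_left_mono order_trans[OF C1[OF x]] order_trans[OF C2[OF x]]) (auto intro: ennreal_leI)
    also have "\<dots> = ennreal (2 * \<bar>C1\<bar> + 2 * \<bar>C2\<bar>)"
      by (simp add: ennreal_mult')
    finally show ?thesis .
  qed
  moreover have "vec_holomorphic_on (\<lambda>z. F z + G z) right_half_plane"
    by (intro vec_holomorphic_on_add hardy2_holomorphic assms)
  ultimately show ?thesis unfolding hardy2_def by blast
qed

section \<open>Resolvents and quotients in H^2\<close>

lemma resolvent_decay:
  fixes A :: "complex^'k::finite^'k"
  assumes E: "closed E" "\<And>z. z \<in> E \<Longrightarrow> Re z \<ge> 0" "E \<inter> spectrum A = {}"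
  obtains B where "B > 0" "\<And>z x. z \<in> E \<Longrightarrow> norm (resolvent A z *v x) \<le> B * norm x / norm (z + 1)"
proof -
  obtain R where R: "R > 0" "\<And>z x. norm z \<ge> R \<Longrightarrow> norm (resolvent A z *v x) \<le> 2 * norm x / norm z"
    using resolvent_large[of A] by metis
  have "compact (E \<inter> cball 0 (R + 1))" using E(1) by (simp add: closed_Int_compact)
  then obtain B where B: "B > 0" "\<And>z x. z \<in> E \<inter> cball 0 (R + 1) \<Longrightarrow> norm (resolvent A z *v x) \<le> B * norm x"
    by (rule mat_holomorphic_bound_compact[of _ "resolvent A"]) (use E(3) in \<open>auto intro!: resolvent_holomorphic\<close>)
  show ?thesis
  proof
    \<comment> \<open>B (R + 2) serves |z| <= R + 1, where |z + 1| <= R + 2. The 4 serves larger z,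
      where the resolvent is at most 2 |x|/|z| and |z + 1| <= 2 |z|. Measuring decay by z + 1 keeps
      the bound finite at the origin.\<close>
    show "B * (R + 2) + 4 > 0" using B(1) R(1) by (simp add: add_nonneg_pos)
    fix z x assume z: "z \<in> E"
    have "norm (z + 1) \<ge> 1"
      using complex_Re_le_cmod[of "z + 1"] E(2)[OF z] by simp
    then have nzp: "norm (z + 1) > 0" by linarith
    have tri: "norm (z + 1) \<le> norm z + 1" using norm_triangle_ineq[of z 1] by simp
    show "norm (resolvent A z *v x) \<le> (B * (R + 2) + 4) * norm x / norm (z + 1)"
    proof (cases "norm z \<le> R + 1")
      case True
      have "norm (resolvent A z *v x) * norm (z + 1) \<le> (B * norm x) * (R + 2)"
        using B(2)[of z x] True z tri B(1) R(1) by (intro mult_mono) auto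
      also have "\<dots> \<le> (B * (R + 2) + 4) * norm x" by (simp add: algebra_simps)
      finally show ?thesis using nzp by (simp add: pos_le_divide_eq)
    next
      case False
      then have nz1: "norm z > 1" "norm z \<ge> R" using R(1) by auto
      have "norm (resolvent A z *v x) * norm (z + 1) \<le> (2 * norm x / norm z) * (2 * norm z)"
        using R(2)[OF nz1(2)] nz1 tri by (intro mult_mono) auto
      also have "\<dots> = 4 * norm x"
      proof -
        have "norm z \<noteq> 0" using nz1 by linarith
        then show ?thesis by simp
      qed
      also have "\<dots> \<le> (B * (R + 2) + 4) * norm x"
        using B(1) R(1) by (intro mult_right_mono) auto
      finally show ?thesis using nzp by (simp add: pos_le_divide_eq)
    qed
  qed
qed

text \<open>Quantifying over all approach sets inside the half-plane keeps the apertures of the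
  Stolz angles out of later limit arguments.\<close>

lemma ntbv_transfer:
  assumes "nontangential_boundary_values F \<phi>"
    and "AE y in lborel. \<forall>S\<subseteq>right_half_plane. (F \<longlongrightarrow> \<phi> y) (at (Complex 0 y) within S) \<longrightarrow>
      (G \<longlongrightarrow> \<psi> y) (at (Complex 0 y) within S)"
  shows "nontangential_boundary_values G \<psi>"
  using assms unfolding nontangential_boundary_values_def
  by eventually_elim (auto simp: right_half_plane_def subset_iff)

lemma ntbv_add:
  assumes "nontangential_boundary_values F \<phi>" "nontangential_boundary_values G \<psi>"
  shows "nontangential_boundary_values (\<lambda>z. F z + G z) (\<lambda>y. \<phi> y + \<psi> y)"
  using assms unfolding nontangential_boundary_values_def
  by eventually_elim (auto intro: tendsto_add)

lemma ntbv_mult: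
  assumes "nontangential_boundary_values F \<phi>"
    and "AE y in lborel. (T \<longlongrightarrow> T0 y) (at (Complex 0 y) within right_half_plane)"
  shows "nontangential_boundary_values (\<lambda>z. T z *v F z) (\<lambda>y. T0 y *v \<phi> y)"
proof (rule ntbv_transfer[OF assms(1)])
  show "AE y in lborel. \<forall>S\<subseteq>right_half_plane. (F \<longlongrightarrow> \<phi> y) (at (Complex 0 y) within S) \<longrightarrow>
      ((\<lambda>z. T z *v F z) \<longlongrightarrow> T0 y *v \<phi> y) (at (Complex 0 y) within S)"
    using assms(2) by eventually_elim (blast intro: tendsto_matrix_vector tendsto_within_subset)
qed

lemma ntbv_const_mult:
  "nontangential_boundary_values F \<phi> \<Longrightarrow> nontangential_boundary_values (\<lambda>z. M *v F z) (\<lambda>y. M *v \<phi> y)"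
  by (rule ntbv_mult) auto

lemma ntbv_continuous:
  assumes "AE y in lborel. (G \<longlongrightarrow> \<psi> y) (at (Complex 0 y) within right_half_plane)"
  shows "nontangential_boundary_values G \<psi>"
  using assms unfolding nontangential_boundary_values_def
  by eventually_elim (auto intro: tendsto_within_subset simp: right_half_plane_def)

lemma holomorphic_tendsto:
  "mat_holomorphic_on T D \<Longrightarrow> open D \<Longrightarrow> z0 \<in> D \<Longrightarrow> (T \<longlongrightarrow> T z0) (at z0 within S)"
  by (metis at_within_open continuous_on_def mat_holomorphic_continuous subset_UNIV tendsto_within_subset)

lemma resolvent_tendsto:
  assumes "z0 \<notin> spectrum A"
  shows "(resolvent A \<longlongrightarrow> resolvent A z0) (at z0 within S)"
  by (rule holomorphic_tendsto[of _ "UNIV - spectrum A"])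
     (use assms in \<open>auto intro!: resolvent_holomorphic simp: open_Diff finite_imp_closed\<close>)

lemma axis_notin_spectrum:
  "spectrum A \<subseteq> right_half_plane \<Longrightarrow> Complex 0 y \<notin> spectrum A"
  "spectrum A \<subseteq> {z. Re z < 0} \<Longrightarrow> Complex 0 y \<notin> spectrum A"
  by (auto simp: right_half_plane_def)

lemma resolvent_axis_measurable:
  assumes "\<And>y. Complex 0 y \<notin> spectrum A"
  shows "(\<lambda>y. resolvent A (Complex 0 y)) \<in> borel_measurable lborel"
proof -
  have "continuous_on UNIV (\<lambda>y. resolvent A (Complex 0 y))"
    by (intro continuous_on_compose2[OF mat_holomorphic_continuous[OF resolvent_holomorphic[of "UNIV - spectrum A" A]]] continuous_intros)
       (use assms in auto)
  then show ?thesis by (simp add: borel_measurable_continuous_onI)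
qed

lemma axis_plus_one: "Complex 0 y + 1 \<noteq> 0"
  by (rule Complex_plus_one_nonzero) simp

lemma rhp_plus_one: "z \<in> right_half_plane \<Longrightarrow> z + 1 \<noteq> 0"
  by (auto simp: right_half_plane_def complex_eq_iff)

lemma ntbv_resolvent_mult:
  assumes "nontangential_boundary_values F \<phi>" "\<And>y. Complex 0 y \<notin> spectrum A"
  shows "nontangential_boundary_values (\<lambda>z. resolvent A z *v F z) (\<lambda>y. resolvent A (Complex 0 y) *v \<phi> y)"
  by (rule ntbv_mult[OF assms(1)]) (intro AE_I2 resolvent_tendsto assms(2))

text \<open>With its spectrum on the left, the resolvent is of size 1/|z + 1| on the whole closed
  right half-plane. The version multiplied by z + 1 is the one that leads to unweighted integrals
  over the axis.\<close>

lemma hardy2_resolvent_neg: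
  fixes A :: "complex^'k::finite^'k"
  assumes A: "spectrum A \<subseteq> {z. Re z < 0}" and F: "F \<in> hardy2"
  shows "(\<lambda>z. resolvent A z *v F z) \<in> hardy2" "(\<lambda>z. (z + 1) *s (resolvent A z *v F z)) \<in> hardy2"
    "(\<lambda>z. resolvent A z *v c) \<in> hardy2"
proof -
  have "closed {z. Re z \<ge> 0}" by (rule closed_halfspace_Re_ge)
  then obtain B where B: "B > 0" "\<And>z x. Re z \<ge> 0 \<Longrightarrow> norm (resolvent A z *v x) \<le> B * norm x / norm (z + 1)"
    by (rule resolvent_decay[of _ A]) (use A in force)+
  have hol: "vec_holomorphic_on (\<lambda>z. resolvent A z *v G z) right_half_plane"
    if "vec_holomorphic_on G right_half_plane" for G
    by (intro mat_vec_holomorphic resolvent_holomorphic that) (use A in \<open>force simp: right_half_plane_def\<close>)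
  have le1: "norm (z + 1) * norm (resolvent A z *v x) \<le> B * norm x" if "z \<in> right_half_plane" for z x
    using B(2)[of z x] rhp_plus_one[OF that] that by (simp add: right_half_plane_def field_simps)
  have ge1: "norm (z + 1) \<ge> 1" if "z \<in> right_half_plane" for z
    using complex_Re_le_cmod[of "z + 1"] that by (simp add: right_half_plane_def)
  show "(\<lambda>z. resolvent A z *v F z) \<in> hardy2"
  proof (rule hardy2_dominated[OF hol F, where K = "{}" and B = B])
    fix z assume z: "z \<in> right_half_plane"
    have "norm (resolvent A z *v F z) \<le> norm (z + 1) * norm (resolvent A z *v F z)"
      using mult_right_mono[OF ge1[OF z], of "norm (resolvent A z *v F z)"] by simp
    also have "\<dots> \<le> B * norm (F z)" by (rule le1[OF z])
    finally show "norm (resolvent A z *v F z) \<le> B * norm (F z) + B / norm (z + 1)"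
      using B(1) by (simp add: add_increasing2)
  qed (use F in \<open>auto intro: hardy2_holomorphic\<close>)
  show "(\<lambda>z. (z + 1) *s (resolvent A z *v F z)) \<in> hardy2"
  proof (rule hardy2_dominated[OF _ F, where K = "{}" and B = B])
    fix z assume z: "z \<in> right_half_plane"
    show "norm ((z + 1) *s (resolvent A z *v F z)) \<le> B * norm (F z) + B / norm (z + 1)"
      unfolding norm_scale using le1[OF z, of "F z"] B(1) by (simp add: add_increasing2)
  next
    show "vec_holomorphic_on (\<lambda>z. (z + 1) *s (resolvent A z *v F z)) right_half_plane"
      by (intro vec_holomorphic_on_scale hol holomorphic_intros hardy2_holomorphic F)
  qed auto
  show "(\<lambda>z. resolvent A z *v c) \<in> hardy2"
  proof (rule hardy2_decay[where K = "{}" and B = "B * norm c"])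
    show "vec_holomorphic_on (\<lambda>z. resolvent A z *v c) right_half_plane"
      by (intro hol vec_holomorphic_on_const)
  qed (use B in \<open>auto simp: right_half_plane_def\<close>)
qed

lemma ntbv_resolvent_const:
  assumes "\<And>y. Complex 0 y \<notin> spectrum A"
  shows "nontangential_boundary_values (\<lambda>z. resolvent A z *v c) (\<lambda>y. resolvent A (Complex 0 y) *v c)"
  by (rule ntbv_continuous) (auto intro!: tendsto_matrix_vector resolvent_tendsto assms)

lemma scale_cancel: "a \<noteq> 0 \<Longrightarrow> (1 / a) *s (a *s (v :: complex^'k::finite)) = v"
  by (simp add: vector_smult_assoc)

lemma axis_measurable: "(\<lambda>y. Complex 0 y) \<in> borel_measurable lborel"
  by (simp add: borel_measurable_continuous_onI continuous_intros)

text \<open>\<open>hardy2_boundary\<close> integrates against the weight 1/(z + 1); applied to (z +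
  1) G, the weight cancels.\<close>

lemma hardy2_scaled_integral:
  assumes F: "(\<lambda>z. (z + 1) *s G z) \<in> hardy2" and bv: "nontangential_boundary_values G \<gamma>"
    and m: "\<gamma> \<in> borel_measurable lborel"
  shows "has_bochner_integral lborel \<gamma> 0"
proof -
  have "nontangential_boundary_values (\<lambda>z. mat (z + 1) *v G z) (\<lambda>y. mat (Complex 0 y + 1) *v \<gamma> y)"
  proof (rule ntbv_mult[OF bv AE_I2])
    fix y
    show "((\<lambda>z. mat (z + 1)) \<longlongrightarrow> (mat (Complex 0 y + 1) :: complex^'a^'a)) (at (Complex 0 y) within right_half_plane)"
    proof (intro vec_tendstoI)
      fix i j :: 'a
      show "((\<lambda>z. mat (z + 1) $ i $ j) \<longlongrightarrow> mat (Complex 0 y + 1) $ i $ j) (at (Complex 0 y) within right_half_plane)"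
        by (cases "i = j") (auto simp: mat_def intro!: tendsto_intros)
    qed
  qed
  then have "nontangential_boundary_values (\<lambda>z. (z + 1) *s G z) (\<lambda>y. (Complex 0 y + 1) *s \<gamma> y)"
    by (simp add: mat_mult_vector)
  moreover have "(\<lambda>y. (Complex 0 y + 1) *s \<gamma> y) \<in> borel_measurable lborel"
    by (intro measurable_scale m borel_measurable_add axis_measurable) simp
  ultimately have "has_bochner_integral lborel (\<lambda>y. (1 / (Complex 0 y + 1)) *s ((Complex 0 y + 1) *s \<gamma> y)) 0"
    by (rule hardy2_boundary(2)[OF F])
  then show ?thesis
    by (simp only: scale_cancel[OF axis_plus_one])
qed

lemma resolvent_integral_neg:
  assumes A: "spectrum A \<subseteq> {z. Re z < 0}" and F: "F \<in> hardy2"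
    and bv: "nontangential_boundary_values F \<phi>" and m: "\<phi> \<in> borel_measurable lborel"
  shows "has_bochner_integral lborel (\<lambda>y. resolvent A (Complex 0 y) *v \<phi> y) 0"
  by (rule hardy2_scaled_integral[OF hardy2_resolvent_neg(2)[OF A F]])
     (intro ntbv_resolvent_mult bv measurable_matrix_vector resolvent_axis_measurable m
       axis_notin_spectrum(2)[OF A])+

text \<open>Off a disk, \<open>G\<close> is the resolvent applied to F - c. The part from
  \<open>F\<close> gains a factor 1/(z + 1), but the constant contributes a term like - c/z at
  infinity, which is not integrable; adding c/(z + 1) removes it.\<close>

lemma divided_bounds:
  fixes A :: "complex^'k::finite^'k"
  assumes A: "spectrum A \<subseteq> right_half_plane" and F: "F \<in> hardy2" and G: "vec_holomorphic_on G right_half_plane"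
    and eq: "\<And>z. z \<in> right_half_plane \<Longrightarrow> F z = c + (mat z - A) *v G z"
  shows "G \<in> hardy2" "(\<lambda>z. (z + 1) *s (G z + (1 / (z + 1)) *s c)) \<in> hardy2"
    and "nontangential_boundary_values F \<phi> \<Longrightarrow>
      nontangential_boundary_values G (\<lambda>y. resolvent A (Complex 0 y) *v (\<phi> y - c))"
proof -
  obtain a r where r: "r > 0" "spectrum A \<subseteq> ball a r" "cball a r \<subseteq> right_half_plane"
    by (rule rhp_ball_cover[OF finite_imp_compact[OF finite_spectrum] A])
  define E where "E = {z. Re z \<ge> 0} - ball a r"
  have "closed E" unfolding E_def by (intro closed_Diff closed_halfspace_Re_ge) simp
  then obtain B where B: "B > 0" "\<And>z x. z \<in> E \<Longrightarrow> norm (resolvent A z *v x) \<le> B * norm x / norm (z + 1)"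
    by (rule resolvent_decay[of E A]) (use r in \<open>auto simp: E_def\<close>)
  have le1: "norm (z + 1) * norm (resolvent A z *v x) \<le> B * norm x"
    and le2: "norm (resolvent A z *v x) \<le> B * norm x"
    and Gz: "G z = resolvent A z *v (F z - c)"
    if "z \<in> right_half_plane" "z \<notin> cball a r" for z x
  proof -
    have zE: "z \<in> E" using that by (auto simp: E_def right_half_plane_def)
    have ge1: "norm (z + 1) \<ge> 1"
      using complex_Re_le_cmod[of "z + 1"] that by (simp add: right_half_plane_def)
    show le: "norm (z + 1) * norm (resolvent A z *v x) \<le> B * norm x"
      using B(2)[OF zE, of x] rhp_plus_one[OF that(1)] by (simp add: field_simps)
    have "norm (resolvent A z *v x) \<le> norm (z + 1) * norm (resolvent A z *v x)"
      using mult_right_mono[OF ge1, of "norm (resolvent A z *v x)"] by simp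
    with le show "norm (resolvent A z *v x) \<le> B * norm x" by linarith
    have "z \<notin> spectrum A" using that r(2) by auto
    then show "G z = resolvent A z *v (F z - c)"
      using eq[OF that(1)] by (simp add: resolvent_left_vec)
  qed
  show "G \<in> hardy2"
  proof (rule hardy2_dominated[OF G F, where K = "cball a r" and B = "B + B * norm c"])
    fix z assume z: "z \<in> right_half_plane" "z \<notin> cball a r"
    have zE: "z \<in> E" using z by (auto simp: E_def right_half_plane_def)
    have "norm (G z) \<le> norm (resolvent A z *v F z) + norm (resolvent A z *v c)"
      unfolding Gz[OF z] matrix_vector_mult_diff_distrib by (rule norm_triangle_ineq4)
    also have "\<dots> \<le> B * norm (F z) + B * norm c / norm (z + 1)"
      by (intro add_mono le2[OF z] B(2)[OF zE])
    also have "\<dots> \<le> (B + B * norm c) * norm (F z) + (B + B * norm c) / norm (z + 1)"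
      using B(1) by (intro add_mono mult_right_mono divide_right_mono) auto
    finally show "norm (G z) \<le> (B + B * norm c) * norm (F z) + (B + B * norm c) / norm (z + 1)" .
  qed (use r in auto)
  \<comment> \<open>What is left of the constant after the correction: (z + 1) c - (z - A) c = A c +
    c.\<close>
  define w where "w = A *v c + c"
  show "(\<lambda>z. (z + 1) *s (G z + (1 / (z + 1)) *s c)) \<in> hardy2"
  proof (rule hardy2_dominated[OF _ F, where K = "cball a r" and B = "B + B * norm w"])
    show "vec_holomorphic_on (\<lambda>z. (z + 1) *s (G z + (1 / (z + 1)) *s c)) right_half_plane"
      by (intro mat_holo_intros holomorphic_intros G) (auto dest: rhp_plus_one)
    fix z assume z: "z \<in> right_half_plane" "z \<notin> cball a r"
    have zE: "z \<in> E" using z by (auto simp: E_def right_half_plane_def)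
    have ns: "z \<notin> spectrum A" using z r(2) by auto
    have "(z + 1) *s c - (mat z - A) *v c = w"
      by (simp add: w_def mat_vec_simps vector_sadd_rdistrib algebra_simps)
    then have "resolvent A z *v ((z + 1) *s c) - c = resolvent A z *v w"
      using resolvent_left_vec[OF ns, of c] by (metis matrix_vector_mult_diff_distrib)
    then have "(z + 1) *s (G z + (1 / (z + 1)) *s c) = (z + 1) *s (resolvent A z *v F z) - resolvent A z *v w"
      using rhp_plus_one[OF z(1)]
      by (simp add: Gz[OF z] matrix_vector_mult_diff_distrib vector_add_ldistrib vector_ssub_ldistrib
          matrix_vector_scale vector_smult_assoc algebra_simps)
    also have "norm \<dots> \<le> norm (z + 1) * norm (resolvent A z *v F z) + norm (resolvent A z *v w)"
      by (rule order_trans[OF norm_triangle_ineq4]) (simp only: norm_scale order_refl)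
    also have "\<dots> \<le> B * norm (F z) + B * norm w / norm (z + 1)"
      by (intro add_mono le1[OF z] B(2)[OF zE])
    also have "\<dots> \<le> (B + B * norm w) * norm (F z) + (B + B * norm w) / norm (z + 1)"
      using B(1) by (intro add_mono mult_right_mono divide_right_mono) auto
    finally show "norm ((z + 1) *s (G z + (1 / (z + 1)) *s c)) \<le> (B + B * norm w) * norm (F z) + (B + B * norm w) / norm (z + 1)" .
  qed (use r in auto)
  assume bv: "nontangential_boundary_values F \<phi>"
  show "nontangential_boundary_values G (\<lambda>y. resolvent A (Complex 0 y) *v (\<phi> y - c))"
  proof (rule ntbv_transfer[OF bv], intro AE_I2 allI impI)
    fix y S assume S: "S \<subseteq> right_half_plane" "(F \<longlongrightarrow> \<phi> y) (at (Complex 0 y) within S)"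
    have "((\<lambda>z. resolvent A z *v (F z - c)) \<longlongrightarrow> resolvent A (Complex 0 y) *v (\<phi> y - c)) (at (Complex 0 y) within S)"
      by (intro tendsto_matrix_vector resolvent_tendsto tendsto_diff S(2) tendsto_const axis_notin_spectrum(1)[OF A])
    moreover have "eventually (\<lambda>z. G z = resolvent A z *v (F z - c)) (at (Complex 0 y) within S)"
    proof -
      have "Complex 0 y \<in> - cball a r" using r(3) by (auto simp: right_half_plane_def)
      then have "eventually (\<lambda>z. z \<in> - cball a r) (nhds (Complex 0 y))"
        by (intro eventually_nhds_in_open) auto
      then have "eventually (\<lambda>z. z \<notin> cball a r) (at (Complex 0 y) within S)"
        by (auto simp: eventually_at_filter elim: eventually_mono)
      moreover have "eventually (\<lambda>z. z \<in> S) (at (Complex 0 y) within S)"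
        by (auto simp: eventually_at_filter)
      ultimately show ?thesis
        by eventually_elim (use S(1) Gz in auto)
    qed
    ultimately show "(G \<longlongrightarrow> resolvent A (Complex 0 y) *v (\<phi> y - c)) (at (Complex 0 y) within S)"
      by (simp add: tendsto_cong)
  qed
qed

lemma has_bochner_integral_reflect:
  assumes "has_bochner_integral lborel f x"
  shows "has_bochner_integral lborel (\<lambda>y. f (- y :: real) :: 'a::{banach, second_countable_topology}) x"
  using assms lborel_has_bochner_integral_real_affine_iff[of "-1" f x 0] by simp

text \<open>With R the resolvent, R \<phi> is the sum of R (\<phi> - c) + c/(1 + iy), of R c + c/(1
  - iy), and of - 2 c/(1 + y^2). The first has integral 0 by \<open>divided_bounds\<close>; the
  second becomes under y -> -y an expression in the resolvent of - A, whose spectrum is on the left,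
  and also has integral 0; the last gives - 2 pi c.\<close>

lemma resolvent_integral_pos:
  fixes A :: "complex^'k::finite^'k"
  assumes A: "spectrum A \<subseteq> right_half_plane" and F: "F \<in> hardy2"
    and bv: "nontangential_boundary_values F \<phi>" and m: "\<phi> \<in> borel_measurable lborel"
    and G: "vec_holomorphic_on G right_half_plane"
    and eq: "\<And>z. z \<in> right_half_plane \<Longrightarrow> F z = c + (mat z - A) *v G z"
  shows "has_bochner_integral lborel (\<lambda>y. resolvent A (Complex 0 y) *v \<phi> y) ((- 2 * pi) *\<^sub>R c)"
proof -
  let ?R = "\<lambda>y. resolvent A (Complex 0 y)"
  have ax: "Complex 0 y \<notin> spectrum A" for y by (rule axis_notin_spectrum(1)[OF A])
  have mR: "?R \<in> borel_measurable lborel" by (rule resolvent_axis_measurable[OF ax])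
  have minv: "(\<lambda>y. 1 / (Complex 0 y + 1)) \<in> borel_measurable lborel"
    using axis_plus_one by (simp, intro borel_measurable_continuous_onI continuous_intros) auto
  have cinv: "nontangential_boundary_values (\<lambda>z. (1 / (z + 1)) *s c) (\<lambda>y. (1 / (Complex 0 y + 1)) *s c)"
    by (intro ntbv_continuous AE_I2 tendsto_scale tendsto_intros axis_plus_one)
  have 1: "has_bochner_integral lborel (\<lambda>y. ?R y *v (\<phi> y - c) + (1 / (Complex 0 y + 1)) *s c) 0"
    by (rule hardy2_scaled_integral[OF divided_bounds(2)[OF A F G eq]])
       (intro ntbv_add divided_bounds(3)[OF A F G eq bv] cinv borel_measurable_add measurable_matrix_vector
         measurable_scale mR borel_measurable_diff m minv borel_measurable_const | assumption)+
  define A' where "A' = - A"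
  have A': "spectrum A' \<subseteq> {z. Re z < 0}"
    using A by (auto simp: A'_def spectrum_minus right_half_plane_def)
  define w where "w = A *v c - c"
  have ax': "Complex 0 y \<notin> spectrum A'" for y by (rule axis_notin_spectrum(2)[OF A'])
  have "has_bochner_integral lborel (\<lambda>y. (1 / (Complex 0 y + 1)) *s c - resolvent A' (Complex 0 y) *v c) 0"
  proof (rule hardy2_scaled_integral)
    have "(\<lambda>z. resolvent A' z *v w) \<in> hardy2" by (rule hardy2_resolvent_neg(3)[OF A' hardy2_zero])
    moreover have eqw: "(z + 1) *s ((1 / (z + 1)) *s c - resolvent A' z *v c) = resolvent A' z *v w" if "z \<in> right_half_plane" for z
    proof -
      have ns: "z \<notin> spectrum A'" using A' that by (auto simp: right_half_plane_def)
      have "c - (z + 1) *s (resolvent A' z *v c) = resolvent A' z *v ((mat z - A') *v c) - resolvent A' z *v ((z + 1) *s c)"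
        using resolvent_left_vec[OF ns, of c] by (simp only: matrix_vector_scale)
      also have "\<dots> = resolvent A' z *v ((mat z - A') *v c - (z + 1) *s c)"
        by (simp only: matrix_vector_mult_diff_distrib)
      also have "(mat z - A') *v c - (z + 1) *s c = w"
        by (simp add: w_def A'_def mat_vec_simps vector_sadd_rdistrib algebra_simps)
      finally show ?thesis
        using rhp_plus_one[OF that] by (simp add: vector_ssub_ldistrib vector_smult_assoc)
    qed
    ultimately show "(\<lambda>z. (z + 1) *s ((1 / (z + 1)) *s c - resolvent A' z *v c)) \<in> hardy2"
    proof -
      assume h: "(\<lambda>z. resolvent A' z *v w) \<in> hardy2"
      have "vec_holomorphic_on (\<lambda>z. (z + 1) *s ((1 / (z + 1)) *s c - resolvent A' z *v c)) right_half_plane"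
        using hardy2_holomorphic[OF h] by (rule vec_holomorphic_on_cong) (simp only: eqw)
      then show ?thesis
        by (rule hardy2_dominated[OF _ h, where K = "{}" and B = 1]) (simp_all only: eqw, auto)
    qed
    show "nontangential_boundary_values (\<lambda>z. (1 / (z + 1)) *s c - resolvent A' z *v c)
        (\<lambda>y. (1 / (Complex 0 y + 1)) *s c - resolvent A' (Complex 0 y) *v c)"
      by (intro ntbv_continuous AE_I2 tendsto_diff tendsto_scale tendsto_intros axis_plus_one
          tendsto_matrix_vector resolvent_tendsto ax')
    show "(\<lambda>y. (1 / (Complex 0 y + 1)) *s c - resolvent A' (Complex 0 y) *v c) \<in> borel_measurable lborel"
      by (intro borel_measurable_diff measurable_scale measurable_matrix_vector minv resolvent_axis_measurable ax') auto
  qed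
  from has_bochner_integral_reflect[OF this]
  have 2: "has_bochner_integral lborel (\<lambda>y. (1 / (Complex 0 (- y) + 1)) *s c + ?R y *v c) 0"
  proof -
    have "resolvent A' (Complex 0 (- y)) = - ?R y" for y
    proof -
      have e: "- Complex 0 (- y) = Complex 0 y" by (simp add: complex_eq_iff)
      then show ?thesis using resolvent_minus[of "Complex 0 (- y)" A] ax[of y] by (simp add: A'_def)
    qed
    then show ?thesis
      using \<open>has_bochner_integral lborel (\<lambda>y. (1 / (Complex 0 (- y) + 1)) *s c - resolvent A' (Complex 0 (- y)) *v c) 0\<close>
      by (simp add: matrix_vector_minus_left)
  qed
  have 3: "has_bochner_integral lborel (\<lambda>y. (- 2 * (1 / (1 + y\<^sup>2))) *\<^sub>R c) ((- 2 * pi) *\<^sub>R c)"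
    using integrable_inverse_1_plus_square_lborel integral_inverse_1_plus_square_lborel
    by (intro has_bochner_integral_scaleR_left has_bochner_integral_mult_right) (auto simp: has_bochner_integral_iff)
  have "?R y *v \<phi> y = (?R y *v (\<phi> y - c) + (1 / (Complex 0 y + 1)) *s c)
      + ((1 / (Complex 0 (- y) + 1)) *s c + ?R y *v c) + (- 2 * (1 / (1 + y\<^sup>2))) *\<^sub>R c" for y
  proof -
    have "1 / (Complex 0 y + 1) + 1 / (Complex 0 (- y) + 1) = of_real (2 * (1 / (1 + y\<^sup>2)))"
    proof -
      let ?a = "Complex 0 y + 1" and ?b = "Complex 0 (- y) + 1"
      have "1 / ?a + 1 / ?b = (?a + ?b) / (?a * ?b)"
        using axis_plus_one[of y] axis_plus_one[of "- y"] by (simp add: add_divide_eq_iff divide_add_eq_iff field_simps)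
      also have "?a + ?b = 2" by (simp add: complex_eq_iff)
      also have "?a * ?b = of_real (1 + y\<^sup>2)" by (simp add: complex_eq_iff power2_eq_square algebra_simps)
      finally show ?thesis by simp
    qed
    then have "(1 / (Complex 0 y + 1)) *s c + (1 / (Complex 0 (- y) + 1)) *s c = (2 * (1 / (1 + y\<^sup>2))) *\<^sub>R c"
      by (simp only: vector_sadd_rdistrib[symmetric]) (simp add: vec_eq_iff, simp add: scaleR_conv_of_real)
    then show ?thesis
      by (simp add: matrix_vector_mult_diff_distrib algebra_simps)
  qed
  then show ?thesis
    using has_bochner_integral_add[OF has_bochner_integral_add[OF 1 2] 3] by simp
qed

section \<open>Block matrices and Gramians\<close>

lemma stack_nth [simp]: "stack a b $ Inl i = a $ i" "stack a b $ Inr j = b $ j"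
  by (simp_all add: stack_def)

lemma sum_UNIV_plus: "(\<Sum>i\<in>(UNIV :: ('p::finite + 'm::finite) set). f i) = (\<Sum>i\<in>UNIV. f (Inl i)) + (\<Sum>i\<in>UNIV. f (Inr i))"
  by (simp add: UNIV_Plus_UNIV[symmetric] sum.Plus del: UNIV_Plus_UNIV)

lemma vec_eq_plus: "(u :: 'a^('p::finite + 'm::finite)) = v \<longleftrightarrow> (\<forall>i. u $ Inl i = v $ Inl i) \<and> (\<forall>i. u $ Inr i = v $ Inr i)"
  by (auto simp: vec_eq_iff split_sum_all)

text \<open>Applied to a matrix, which is a vector of rows, this selects a block of rows;
  \<open>leftc\<close> and \<open>rightc\<close> are the counterparts for columns.\<close>

definition upper :: "'a^('p::finite + 'm::finite) \<Rightarrow> 'a^'p" where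
  "upper v = (\<chi> i. v $ Inl i)"

definition lower :: "'a^('p::finite + 'm::finite) \<Rightarrow> 'a^'m" where
  "lower v = (\<chi> i. v $ Inr i)"

lemma upper_stack [simp]: "upper (stack a b) = a" and lower_stack [simp]: "lower (stack a b) = b"
  by (simp_all add: upper_def lower_def vec_eq_iff)

lemma stack_upper_lower: "stack (upper v) (lower v) = v"
  by (simp add: vec_eq_plus upper_def lower_def)

lemma stack_eq_iff [simp]: "stack a b = stack c d \<longleftrightarrow> a = c \<and> b = d"
  by (auto simp: vec_eq_plus vec_eq_iff)

lemma stack_add: "stack a b + stack c d = stack (a + c) (b + d)"
  by (simp add: vec_eq_plus)

lemma stack_diff: "stack a b - stack c d = stack (a - c) (b - d)"
  by (simp add: vec_eq_plus)

lemma stack_minus: "- stack a b = stack (- a) (- b)"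
  by (simp add: vec_eq_plus)

lemma stack_zero: "stack 0 0 = 0"
  by (simp add: vec_eq_plus)

lemma stack_scale: "c *s stack a b = stack (c *s a) (c *s b)"
  by (simp add: vec_eq_plus)

lemma stack_mult_vec: "stack M N *v x = stack (M *v x) (N *v x)"
  by (simp add: vec_eq_plus matrix_vector_mult_def)

lemma beside_nth [simp]: "beside A B $ i = stack (A $ i) (B $ i)"
  by (simp add: beside_def)

lemma beside_mult_vec: "beside A B *v stack x y = A *v x + B *v y"
  by (simp add: vec_eq_iff matrix_vector_mult_def sum_UNIV_plus)

lemma beside_vec_mult: "beside A B *v v = A *v upper v + B *v lower v"
  by (metis beside_mult_vec stack_upper_lower)

lemma stack_mult: "stack M N ** Q = stack (M ** Q) (N ** Q)"
  by (simp add: vec_eq_plus matrix_matrix_mult_def)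

lemma mult_beside: "Q ** beside A B = beside (Q ** A) (Q ** B)"
  by (simp add: vec_eq_iff split_sum_all matrix_matrix_mult_def)

lemma beside_mult_stack: "beside A B ** stack M N = A ** M + B ** N"
  by (simp add: vec_eq_iff matrix_matrix_mult_def sum_UNIV_plus)

lemma conj_transpose_stack: "conj_transpose (stack M N) = beside (conj_transpose M) (conj_transpose N)"
  by (simp add: vec_eq_iff split_sum_all)

lemma conj_transpose_beside: "conj_transpose (beside M N) = stack (conj_transpose M) (conj_transpose N)"
  by (simp add: vec_eq_iff split_sum_all)

lemma beside_eq_iff [simp]: "beside A B = beside C D \<longleftrightarrow> A = C \<and> B = D"
  by (auto simp: vec_eq_iff split_sum_all)

lemma beside_add: "beside A B + beside C D = beside (A + C) (B + D)"
  by (simp add: vec_eq_iff split_sum_all)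

lemma beside_diff: "beside A B - beside C D = beside (A - C) (B - D)"
  by (simp add: vec_eq_iff split_sum_all)

lemma beside_minus: "- beside A B = beside (- A) (- B)"
  by (simp add: vec_eq_iff split_sum_all)

lemma mat_stack: "mat c = stack (beside (mat c) 0) (beside 0 (mat c))"
  by (auto simp: vec_eq_plus vec_eq_iff mat_def)

lemma cinner_stack: "cinner (stack a b) (stack c d) = cinner a c + cinner b d"
  by (simp add: cinner_def sum_UNIV_plus)

lemma J_sig_stack: "J_sig *v stack a b = stack a (- b)"
  by (simp add: vec_eq_plus J_sig_def matrix_vector_mult_def sum_UNIV_plus if_distrib[of "\<lambda>x. x * _"] cong: if_cong)

lemma J_sig_J_sig: "J_sig ** J_sig = mat 1"
proof (rule matrix_eqI)
  fix x :: "complex^('a + 'b)"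
  show "J_sig ** J_sig *v x = mat 1 *v x"
    using J_sig_stack[of "upper x" "lower x"] J_sig_stack[of "upper x" "- lower x"]
    by (simp add: stack_upper_lower flip: matrix_vector_mul_assoc)
qed

lemma conj_transpose_J_sig: "conj_transpose J_sig = J_sig"
  by (auto simp: vec_eq_iff J_sig_def split: sum.splits)

lemma schur_norm:
  assumes "S \<in> schur_class" "z \<in> right_half_plane"
  shows "norm (S z *v v) \<le> norm v"
proof -
  have "norm (S z *v v) \<le> onorm (\<lambda>v. S z *v v) * norm v"
    by (rule onorm) (simp add: linear_conv_bounded_linear[symmetric])
  also have "\<dots> \<le> 1 * norm v"
    using assms by (intro mult_right_mono) (auto simp: schur_class_def)
  finally show ?thesis by simp
qed

lemma schur_classI:
  assumes "mat_holomorphic_on S right_half_plane"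
    and "\<And>z v. z \<in> right_half_plane \<Longrightarrow> norm (S z *v v) \<le> norm v"
  shows "S \<in> schur_class"
  using assms by (auto simp: schur_class_def intro!: onorm_le)

lemma schur_holomorphic: "S \<in> schur_class \<Longrightarrow> mat_holomorphic_on S right_half_plane"
  by (simp add: schur_class_def)

lemma schur_hardy2: "S \<in> schur_class \<Longrightarrow> F \<in> hardy2 \<Longrightarrow> (\<lambda>z. S z *v F z) \<in> hardy2"
  by (rule hardy2_mult[where B = 1]) (auto simp: schur_holomorphic schur_norm)

lemma scaleR_vec: "r *\<^sub>R (v :: complex^'k::finite) = complex_of_real r *s v"
proof -
  have "r *\<^sub>R (v $ i) = complex_of_real r * v $ i" for i by (rule scaleR_conv_of_real)
  then show ?thesis by (simp add: vec_eq_iff)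
qed

lemma bounded_linear_cinner_left: "bounded_linear (\<lambda>v. cinner v w)"
  by (intro linear_conv_bounded_linear[THEN iffD1] linearI)
     (simp_all add: cinner_add_left scaleR_vec cinner_scale_left scaleR_conv_of_real)

section \<open>Pairings with resolvents on the imaginary axis, and Gramians\<close>

lemma spectrum_neg_conj_transpose:
  "spectrum Z \<subseteq> right_half_plane \<Longrightarrow> spectrum (- conj_transpose Z) \<subseteq> {z. Re z < 0}"
  by (auto simp: spectrum_minus spectrum_conj_transpose right_half_plane_def)

lemma spectrum_conj_transpose_rhp:
  "spectrum Z \<subseteq> right_half_plane \<Longrightarrow> spectrum (conj_transpose Z) \<subseteq> right_half_plane"
  by (auto simp: spectrum_conj_transpose right_half_plane_def)

text \<open>On the axis the conjugate of \<lambda> is - \<lambda>, so the adjoint of a resolvent is,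
  up to sign, again a resolvent at the same point.\<close>

lemma resolvent_axis_adjoint:
  assumes "spectrum Z \<subseteq> right_half_plane"
  shows "conj_transpose (resolvent (- conj_transpose Z) (Complex 0 y)) = - resolvent Z (Complex 0 y)"
    and "conj_transpose (resolvent Z (Complex 0 y)) = - resolvent (- conj_transpose Z) (Complex 0 y)"
proof -
  have e: "cnj (Complex 0 y) = - Complex 0 y" by (simp add: complex_eq_iff)
  show *: "conj_transpose (resolvent (- conj_transpose Z) (Complex 0 y)) = - resolvent Z (Complex 0 y)"
    using conj_transpose_resolvent[OF axis_notin_spectrum(2)[OF spectrum_neg_conj_transpose[OF assms]], of y]
      resolvent_minus[of "- Complex 0 y" Z] axis_notin_spectrum(1)[OF assms, of y]
    by (simp add: conj_transpose_minus e)
  show "conj_transpose (resolvent Z (Complex 0 y)) = - resolvent (- conj_transpose Z) (Complex 0 y)"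
    using arg_cong[OF *, of conj_transpose] by (simp add: conj_transpose_minus minus_equation_iff)
qed

text \<open>Moving the adjoints across the inner product leaves an integral of (\<lambda> - Z)^{-1}
  X F, which \<open>resolvent_integral_pos\<close> evaluates. So X^H (\<lambda> + Z^H)^{-1} y is, up
  to 2 pi, the kernel function of the left evaluation.\<close>

lemma hardy_inner_left:
  assumes Z: "spectrum Z \<subseteq> right_half_plane" and F: "F \<in> hardy2"
    and bv: "nontangential_boundary_values F \<phi>" and m: "\<phi> \<in> borel_measurable lborel"
    and G: "vec_holomorphic_on G right_half_plane"
    and eq: "\<And>z. z \<in> right_half_plane \<Longrightarrow> X *v F z = c + (mat z - Z) *v G z"
  shows "has_bochner_integral lborel
    (\<lambda>t. cinner (\<phi> t) (conj_transpose X *v (resolvent (- conj_transpose Z) (Complex 0 t) *v y)))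
    (2 * pi * cinner c y)"
proof -
  have "has_bochner_integral lborel (\<lambda>t. resolvent Z (Complex 0 t) *v (X *v \<phi> t)) ((- 2 * pi) *\<^sub>R c)"
    by (rule resolvent_integral_pos[OF Z hardy2_const_mult[OF F] ntbv_const_mult[OF bv] measurable_matrix_vector[OF _ m] G eq]) auto
  from has_bochner_integral_bounded_linear[OF bounded_linear_cinner_left[of "- y"] this]
  have "has_bochner_integral lborel (\<lambda>t. cinner (resolvent Z (Complex 0 t) *v (X *v \<phi> t)) (- y)) (cinner ((- 2 * pi) *\<^sub>R c) (- y))" .
  moreover have "cinner ((- 2 * pi) *\<^sub>R c) (- y) = 2 * pi * cinner c y"
    by (simp add: cinner_minus_right cinner_minus_left scaleR_vec cinner_scale_left)
  moreover have "cinner (resolvent Z (Complex 0 t) *v (X *v \<phi> t)) (- y)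
    = cinner (\<phi> t) (conj_transpose X *v (resolvent (- conj_transpose Z) (Complex 0 t) *v y))" for t
    by (simp add: cinner_adjoint resolvent_axis_adjoint(2)[OF Z] cinner_minus_right mat_vec_simps)
  ultimately show ?thesis by simp
qed

text \<open>V (\<lambda> - W)^{-1} x has all its poles in the right half-plane and is thus
  orthogonal to H^2: taking adjoints produces a resolvent with spectrum on the left.\<close>

lemma hardy_inner_right:
  assumes W: "spectrum W \<subseteq> right_half_plane" and F: "F \<in> hardy2"
    and bv: "nontangential_boundary_values F \<phi>" and m: "\<phi> \<in> borel_measurable lborel"
  shows "has_bochner_integral lborel (\<lambda>t. cinner (\<phi> t) (V *v (resolvent W (Complex 0 t) *v x))) 0"
proof -
  have "has_bochner_integral lborel (\<lambda>t. resolvent (- conj_transpose W) (Complex 0 t) *v (conj_transpose V *v \<phi> t)) 0"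
    by (rule resolvent_integral_neg[OF spectrum_neg_conj_transpose[OF W] hardy2_const_mult[OF F] ntbv_const_mult[OF bv] measurable_matrix_vector[OF _ m]]) auto
  from has_bochner_integral_bounded_linear[OF bounded_linear_cinner_left[of "- x"] this]
  have "has_bochner_integral lborel (\<lambda>t. cinner (resolvent (- conj_transpose W) (Complex 0 t) *v (conj_transpose V *v \<phi> t)) (- x)) 0"
    by simp
  moreover have "cinner (resolvent (- conj_transpose W) (Complex 0 t) *v (conj_transpose V *v \<phi> t)) (- x)
    = cinner (\<phi> t) (V *v (resolvent W (Complex 0 t) *v x))" for t
    by (simp add: cinner_adjoint resolvent_axis_adjoint(1)[OF W] cinner_minus_right mat_vec_simps)
  ultimately show ?thesis by simp
qed

text \<open>The solution of Z G + G Z^H = X X^H, introduced as the left evaluation of its own kernel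
  functions. In this form division yields the Lyapunov equation and \<open>hardy_inner_left\<close>
  the integral formula.\<close>

definition gram :: "complex^'z::finite^'z \<Rightarrow> complex^'p::finite^'z \<Rightarrow> complex^'z^'z" where
  "gram Z X = mat_left_eval Z (\<lambda>z. X ** conj_transpose X ** resolvent (- conj_transpose Z) z)"

lemma gram_integrand_holomorphic:
  assumes "spectrum Z \<subseteq> right_half_plane"
  shows "mat_holomorphic_on (\<lambda>z. M ** resolvent (- conj_transpose Z) z) right_half_plane"
  by (intro mat_holo_intros resolvent_holomorphic)
     (use spectrum_neg_conj_transpose[OF assms] in \<open>force simp: right_half_plane_def\<close>)

lemma gram_decomp:
  assumes Z: "spectrum Z \<subseteq> right_half_plane"
  obtains H where "mat_holomorphic_on H right_half_plane"
    "\<And>z. z \<in> right_half_plane \<Longrightarrow>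
      X ** conj_transpose X ** resolvent (- conj_transpose Z) z = gram Z X + (mat z - Z) ** H z"
  unfolding gram_def
  by (rule mat_left_eval_decomp[OF gram_integrand_holomorphic[OF Z, of "X ** conj_transpose X"] Z]) blast

text \<open>The defect \<open>E\<close> of the equation is a constant and at the same time a
  holomorphic multiple of \<open>mat z - Z\<close>. A constant is its own evaluation, and a multiple
  of the pencil evaluates to 0.\<close>

lemma gram_lyapunov:
  assumes Z: "spectrum Z \<subseteq> right_half_plane"
  shows "Z ** gram Z X + gram Z X ** conj_transpose Z = X ** conj_transpose X"
proof -
  let ?G = "gram Z X" and ?X = "X ** conj_transpose X"
  obtain H where H: "mat_holomorphic_on H right_half_plane"
    "\<And>z. z \<in> right_half_plane \<Longrightarrow> ?X ** resolvent (- conj_transpose Z) z = ?G + (mat z - Z) ** H z"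
    using gram_decomp[OF Z, of X] by blast
  define E where "E = ?X - Z ** ?G - ?G ** conj_transpose Z"
  have "E = 0 + (mat z - Z) ** (H z ** (mat z + conj_transpose Z) + ?G)" if z: "z \<in> right_half_plane" for z
  proof -
    have ns: "z \<notin> spectrum (- conj_transpose Z)"
      using spectrum_neg_conj_transpose[OF Z] z by (auto simp: right_half_plane_def)
    have "?X = ?X ** resolvent (- conj_transpose Z) z ** (mat z - - conj_transpose Z)"
      using resolvent_left[OF ns] by (simp flip: matrix_mul_assoc)
    also have "\<dots> = (?G + (mat z - Z) ** H z) ** (mat z + conj_transpose Z)"
      by (simp add: H(2)[OF z])
    finally show ?thesis
      by (simp add: E_def mat_mul_simps matrix_mul_assoc mat_mult_commute)
  qed
  then have "mat_left_eval Z (\<lambda>_. E) = 0"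
    by (intro mat_left_eval_unique[OF Z, of "\<lambda>z. H z ** (mat z + conj_transpose Z) + ?G"] mat_holo_intros H(1)) auto
  moreover have "mat_left_eval Z (\<lambda>_. E) = E"
    by (rule mat_left_eval_unique[OF Z, of "\<lambda>_. 0"]) auto
  ultimately show ?thesis by (simp add: E_def algebra_simps)
qed

lemma left_state:
  assumes Z: "spectrum Z \<subseteq> right_half_plane"
  shows "(\<lambda>z. M *v (resolvent (- conj_transpose Z) z *v y)) \<in> hardy2"
    and "nontangential_boundary_values (\<lambda>z. M *v (resolvent (- conj_transpose Z) z *v y))
      (\<lambda>t. M *v (resolvent (- conj_transpose Z) (Complex 0 t) *v y))"
    and "(\<lambda>t. M *v (resolvent (- conj_transpose Z) (Complex 0 t) *v y)) \<in> borel_measurable lborel"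
    and "(\<lambda>t. M *v (resolvent (- conj_transpose Z) (Complex 0 t) *v y)) \<in> L2_line"
proof -
  note A = spectrum_neg_conj_transpose[OF Z]
  show 1: "(\<lambda>z. M *v (resolvent (- conj_transpose Z) z *v y)) \<in> hardy2"
    by (rule hardy2_const_mult[OF hardy2_resolvent_neg(3)[OF A hardy2_zero]])
  show 2: "nontangential_boundary_values (\<lambda>z. M *v (resolvent (- conj_transpose Z) z *v y))
      (\<lambda>t. M *v (resolvent (- conj_transpose Z) (Complex 0 t) *v y))"
    by (rule ntbv_const_mult[OF ntbv_resolvent_const[OF axis_notin_spectrum(2)[OF A]]])
  show 3: "(\<lambda>t. M *v (resolvent (- conj_transpose Z) (Complex 0 t) *v y)) \<in> borel_measurable lborel"
    by (intro measurable_matrix_vector resolvent_axis_measurable axis_notin_spectrum(2)[OF A] borel_measurable_const)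
  show "(\<lambda>t. M *v (resolvent (- conj_transpose Z) (Complex 0 t) *v y)) \<in> L2_line"
    by (rule hardy2_boundary(1)[OF 1 2 3])
qed

lemma gram_inner:
  assumes Z: "spectrum Z \<subseteq> right_half_plane"
  shows "has_bochner_integral lborel
    (\<lambda>t. cinner (conj_transpose X *v (resolvent (- conj_transpose Z) (Complex 0 t) *v y'))
       (conj_transpose X *v (resolvent (- conj_transpose Z) (Complex 0 t) *v y)))
    (2 * pi * cinner (gram Z X *v y') y)"
proof -
  obtain H where H: "mat_holomorphic_on H right_half_plane"
    "\<And>z. z \<in> right_half_plane \<Longrightarrow>
      X ** conj_transpose X ** resolvent (- conj_transpose Z) z = gram Z X + (mat z - Z) ** H z"
    using gram_decomp[OF Z, of X] by blast
  show ?thesis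
  proof (rule hardy_inner_left[OF Z left_state(1,2,3)[OF Z]])
    show "vec_holomorphic_on (\<lambda>z. H z *v y') right_half_plane"
      by (intro mat_holo_intros H)
    fix z assume "z \<in> right_half_plane"
    from arg_cong[OF H(2)[OF this], of "\<lambda>M. M *v y'"]
    show "X *v (conj_transpose X *v (resolvent (- conj_transpose Z) z *v y')) = gram Z X *v y' + (mat z - Z) *v (H z *v y')"
      by (simp add: matrix_vector_mult_add_rdistrib matrix_vector_mul_assoc matrix_mul_assoc)
  qed
qed

text \<open>The adjoint data and the reflection t -> -t carry the left formula over to functions
  with poles in the right half-plane.\<close>

lemma gram_inner_right:
  assumes W: "spectrum W \<subseteq> right_half_plane"
  shows "has_bochner_integral lborel
    (\<lambda>t. cinner (V *v (resolvent W (Complex 0 t) *v x')) (V *v (resolvent W (Complex 0 t) *v x)))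
    (2 * pi * cinner (gram (conj_transpose W) (conj_transpose V) *v x') x)"
proof -
  have r: "resolvent (- W) (Complex 0 (- t)) = - resolvent W (Complex 0 t)" for t
  proof -
    have e: "- Complex 0 (- t) = Complex 0 t" by (simp add: complex_eq_iff)
    then show ?thesis
      using resolvent_minus[of "Complex 0 (- t)" W] axis_notin_spectrum(1)[OF W, of t] by simp
  qed
  from has_bochner_integral_reflect[OF gram_inner[OF spectrum_conj_transpose_rhp[OF W], of "conj_transpose V" x' x]]
  show ?thesis
    by (simp add: r mat_vec_simps cinner_minus_left cinner_minus_right)
qed

lemma right_state_L2:
  assumes W: "spectrum W \<subseteq> right_half_plane"
  shows "(\<lambda>t. V *v (resolvent W (Complex 0 t) *v x)) \<in> L2_line"
proof -
  have m: "(\<lambda>t. V *v (resolvent W (Complex 0 t) *v x)) \<in> borel_measurable lborel"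
    by (intro measurable_matrix_vector resolvent_axis_measurable axis_notin_spectrum(1)[OF W] borel_measurable_const)
  have "integrable lborel (\<lambda>t. Re (cinner (V *v (resolvent W (Complex 0 t) *v x)) (V *v (resolvent W (Complex 0 t) *v x))))"
    using gram_inner_right[OF W, of V x x] by (intro integrable_Re) (auto simp: has_bochner_integral_iff)
  then show ?thesis using m by (simp add: L2_line_def Re_cinner_self)
qed

lemma gram_hermitian:
  assumes Z: "spectrum Z \<subseteq> right_half_plane"
  shows "conj_transpose (gram Z X) = gram Z X"
proof (rule matrix_eqI, rule cinner_ext)
  fix y y'
  let ?f = "\<lambda>t y. conj_transpose X *v (resolvent (- conj_transpose Z) (Complex 0 t) *v y)"
  have "has_bochner_integral lborel (\<lambda>t. cnj (cinner (?f t y') (?f t y))) (cnj (2 * pi * cinner (gram Z X *v y') y))"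
    by (rule has_bochner_integral_bounded_linear[OF bounded_linear_cnj gram_inner[OF Z]])
  then have "has_bochner_integral lborel (\<lambda>t. cinner (?f t y) (?f t y')) (2 * pi * cinner y (gram Z X *v y'))"
    by (simp add: cnj_cinner)
  then have "2 * pi * cinner y (gram Z X *v y') = 2 * pi * cinner (gram Z X *v y) y'"
    using gram_inner[OF Z, of X y y'] by (rule has_bochner_integral_eq)
  then show "cinner (conj_transpose (gram Z X) *v y) y' = cinner (gram Z X *v y) y'"
    by (simp add: cinner_adjoint)
qed

lemma gram_nonneg:
  assumes Z: "spectrum Z \<subseteq> right_half_plane"
  shows "0 \<le> Re (cinner (gram Z X *v y) y)"
proof -
  let ?f = "\<lambda>t. conj_transpose X *v (resolvent (- conj_transpose Z) (Complex 0 t) *v y)"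
  have "has_bochner_integral lborel (\<lambda>t. Re (cinner (?f t) (?f t))) (Re (2 * pi * cinner (gram Z X *v y) y))"
    by (rule has_bochner_integral_bounded_linear[OF bounded_linear_Re gram_inner[OF Z]])
  then have "Re (2 * pi * cinner (gram Z X *v y) y) = (LINT t|lborel. Re (cinner (?f t) (?f t)))"
    by (rule has_bochner_integral_integral_eq[symmetric])
  also have "\<dots> \<ge> 0"
    by (rule integral_nonneg_AE) (simp add: Re_cinner_self)
  finally have "0 \<le> 2 * pi * Re (cinner (gram Z X *v y) y)" by simp
  then show ?thesis using pi_gt_zero by (simp add: zero_le_mult_iff)
qed

text \<open>The first variation vanishes at a zero of a nonnegative form: with w = G y, passing from
  y to y - s w gives the value - 2 s |w|^2 + s^2 b, which is negative for small s > 0 unless w =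
  0.\<close>

lemma nonneg_hermitian_kernel:
  fixes G :: "complex^'k::finite^'k"
  assumes herm: "conj_transpose G = G" and nn: "\<And>y. 0 \<le> Re (cinner (G *v y) y)"
    and y: "Re (cinner (G *v y) y) = 0"
  shows "G *v y = 0"
proof (rule ccontr)
  assume ne: "G *v y \<noteq> 0"
  define w where "w = G *v y"
  define b where "b = Re (cinner (G *v w) w)"
  have n: "(norm w)\<^sup>2 > 0" using ne by (simp add: w_def)
  have ex: "Re (cinner (G *v (y - of_real s *s w)) (y - of_real s *s w)) = - 2 * s * (norm w)\<^sup>2 + s\<^sup>2 * b" for s :: real
  proof -
    have "cinner (G *v w) y = cinner w w"
      using cinner_adjoint[of G w y] by (simp add: herm w_def)
    moreover have "cinner (G *v y) w = cinner w w" by (simp add: w_def)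
    ultimately show ?thesis
      using y by (simp add: mat_vec_simps cinner_diff_left cinner_diff_right cinner_scale_left cinner_scale_right
          b_def cinner_self power2_eq_square algebra_simps)
  qed
  \<comment> \<open>Makes s b < |w|^2, so that the linear term wins.\<close>
  define s where "s = (norm w)\<^sup>2 / (\<bar>b\<bar> + 1)"
  have s: "s > 0" using n by (simp add: s_def)
  have "s * b \<le> s * \<bar>b\<bar>" using s by (intro mult_left_mono) auto
  also have "\<dots> < s * (\<bar>b\<bar> + 1)" using s by simp
  also have "s * (\<bar>b\<bar> + 1) = (norm w)\<^sup>2" by (simp add: s_def)
  finally have "s * b < 2 * (norm w)\<^sup>2" using n by linarith
  then have "s * (s * b) < s * (2 * (norm w)\<^sup>2)"
    using s by (intro mult_strict_left_mono)
  then have "- 2 * s * (norm w)\<^sup>2 + s\<^sup>2 * b < 0" by (simp add: power2_eq_square algebra_simps)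
  with ex[of s] nn show False by (metis not_le)
qed

text \<open>Pairing the Lyapunov equation with a kernel vector of the Hermitian Gramian G leaves
  |X^H y|^2 = 0; the equation itself then reads G Z^H y = 0.\<close>

lemma gram_kernel_invariant:
  assumes Z: "spectrum Z \<subseteq> right_half_plane" and y: "gram Z X *v y = 0"
  shows "conj_transpose X *v y = 0" "gram Z X *v (conj_transpose Z *v y) = 0"
proof -
  let ?G = "gram Z X"
  have L: "Z *v (?G *v v) + ?G *v (conj_transpose Z *v v) = X *v (conj_transpose X *v v)" for v
    using arg_cong[OF gram_lyapunov[OF Z, of X], of "\<lambda>M. M *v v"]
    by (simp add: matrix_vector_mult_add_rdistrib matrix_vector_mul_assoc)
  have "cinner (conj_transpose X *v y) (conj_transpose X *v y) = cinner (X *v (conj_transpose X *v y)) y"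
    by (simp add: cinner_adjoint)
  also have "\<dots> = cinner (?G *v (conj_transpose Z *v y)) y"
    using L[of y] y by (simp)
  also have "\<dots> = cinner (conj_transpose Z *v y) (?G *v y)"
    by (simp add: cinner_adjoint[of ?G] gram_hermitian[OF Z])
  finally show x: "conj_transpose X *v y = 0" using y by (simp add: cinner_self)
  show "?G *v (conj_transpose Z *v y) = 0" using L[of y] x y by simp
qed

text \<open>By invariance of the kernel, a null vector of the form is annihilated by every U
  W^k.\<close>

lemma gram_observable_pos:
  fixes W :: "complex^'w::finite^'w"
  assumes W: "spectrum W \<subseteq> right_half_plane" and obs: "observable U W"
    and x: "Re (cinner (gram (conj_transpose W) (conj_transpose U) *v x) x) = 0"
  shows "x = 0"
proof -
  note W' = spectrum_conj_transpose_rhp[OF W]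
  have k: "gram (conj_transpose W) (conj_transpose U) *v x = 0"
    by (rule nonneg_hermitian_kernel[OF gram_hermitian[OF W'] gram_nonneg[OF W'] x])
  have "((\<lambda>M. M ** W) ^^ k) U *v x = 0" for k
    using k
  proof (induction k arbitrary: x)
    case 0
    then show ?case using gram_kernel_invariant(1)[OF W', of "conj_transpose U" x] by simp
  next
    case (Suc k)
    have "((\<lambda>M. M ** W) ^^ Suc k) U *v x = ((\<lambda>M. M ** W) ^^ k) U *v (W *v x)"
      by (simp add: matrix_vector_mul_assoc)
    then show ?case using Suc.IH gram_kernel_invariant(2)[OF W' Suc.prems] by simp
  qed
  then have "x \<in> (\<Inter>k<CARD('w). {x. ((\<lambda>M. M ** W) ^^ k) U *v x = 0})" by auto
  then have "x \<in> {0}" using obs unfolding observable_def by (simp only:)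
  then show ?thesis by simp
qed

text \<open>A null vector of the form is orthogonal to every Z^k X u, and these span the whole
  space.\<close>

lemma gram_controllable_pos:
  assumes Z: "spectrum Z \<subseteq> right_half_plane" and ctr: "controllable Z X"
    and y: "Re (cinner (gram Z X *v y) y) = 0"
  shows "y = 0"
proof -
  have "gram Z X *v y = 0"
    by (rule nonneg_hermitian_kernel[OF gram_hermitian[OF Z] gram_nonneg[OF Z] y])
  then have k: "conj_transpose (((\<lambda>M. Z ** M) ^^ k) X) *v y = 0" for k
  proof (induction k arbitrary: y)
    case 0
    then show ?case using gram_kernel_invariant(1)[OF Z, of X y] by simp
  next
    case (Suc k)
    have "conj_transpose (((\<lambda>M. Z ** M) ^^ Suc k) X) *v y = conj_transpose (((\<lambda>M. Z ** M) ^^ k) X) *v (conj_transpose Z *v y)"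
      by (simp add: matrix_vector_mul_assoc conj_transpose_mult)
    then show ?case using Suc.IH gram_kernel_invariant(2)[OF Z Suc.prems] by simp
  qed
  have "vec.span (\<Union>k<CARD('a). range (\<lambda>u. (((\<lambda>M. Z ** M) ^^ k) X) *v u)) \<subseteq> {v. cinner v y = 0}"
  proof (rule vec.span_minimal)
    show "(\<Union>k<CARD('a). range (\<lambda>u. (((\<lambda>M. Z ** M) ^^ k) X) *v u)) \<subseteq> {v. cinner v y = 0}"
      by (auto simp: cinner_adjoint k)
    show "vec.subspace {v. cinner v y = 0}"
      by (auto simp: vec.subspace_def cinner_add_left cinner_scale_left)
  qed
  then have "cinner y y = 0" using ctr by (auto simp: controllable_def)
  then show ?thesis by (simp add: cinner_self)
qed

section \<open>The Pick form of a solvable problem\<close>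

definition pick_form ::
    "complex^'z::finite^'z \<Rightarrow> complex^'p::finite^'z \<Rightarrow> complex^'m::finite^'z \<Rightarrow>
     complex^'w::finite^'m \<Rightarrow> complex^'w^'p \<Rightarrow> complex^'w^'w \<Rightarrow> complex^'w^'z \<Rightarrow>
     complex^'z \<Rightarrow> complex^'w \<Rightarrow> real" where
  "pick_form Z X Y U V W \<Gamma> y x =
     Re (cinner (gram Z X *v y) y) - Re (cinner (gram Z Y *v y) y) + 2 * Re (cinner (\<Gamma> *v x) y)
     + Re (cinner (gram (conj_transpose W) (conj_transpose U) *v x) x)
     - Re (cinner (gram (conj_transpose W) (conj_transpose V) *v x) x)"

text \<open>The values of \<open>S\<close> on the axis are its limits from the half-plane, at every
  point. This supplies boundary values without a Fatou theorem; translates of Schur functions and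
  the transform of G = 0 qualify.\<close>

definition boundary_regular :: "(complex \<Rightarrow> complex^'m::finite^'p::finite) \<Rightarrow> bool" where
  "boundary_regular S \<longleftrightarrow> S \<in> schur_class \<and>
     (\<forall>y. (S \<longlongrightarrow> S (Complex 0 y)) (at (Complex 0 y) within right_half_plane)) \<and>
     (\<lambda>y. S (Complex 0 y)) \<in> borel_measurable lborel"

lemma radial_filterlim:
  "filterlim (\<lambda>n. Complex (inverse (real (Suc n))) y) (at (Complex 0 y) within right_half_plane) sequentially"
  unfolding filterlim_at
proof
  show "(\<lambda>n. Complex (inverse (real (Suc n))) y) \<longlonglongrightarrow> Complex 0 y"
    unfolding Complex_eq by (intro tendsto_intros LIMSEQ_inverse_real_of_nat)
qed (auto simp: right_half_plane_def)

lemma boundary_regular_norm: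
  assumes "boundary_regular S"
  shows "norm (S (Complex 0 y) *v v) \<le> norm v"
proof (rule LIMSEQ_le_const2)
  have "((\<lambda>z. norm (S z *v v)) \<longlongrightarrow> norm (S (Complex 0 y) *v v)) (at (Complex 0 y) within right_half_plane)"
    using assms by (intro tendsto_norm tendsto_matrix_vector tendsto_const) (simp add: boundary_regular_def)
  from filterlim_compose[OF this radial_filterlim]
  show "(\<lambda>n. norm (S (Complex (inverse (real (Suc n))) y) *v v)) \<longlonglongrightarrow> norm (S (Complex 0 y) *v v)" .
  show "\<exists>N. \<forall>n\<ge>N. norm (S (Complex (inverse (real (Suc n))) y) *v v) \<le> norm v"
    using assms by (intro exI allI impI schur_norm) (auto simp: boundary_regular_def right_half_plane_def)
qed

lemma boundary_regular_mult:
  assumes S: "boundary_regular S" and F: "F \<in> hardy2"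
    and bv: "nontangential_boundary_values F \<phi>"
  shows "(\<lambda>z. S z *v F z) \<in> hardy2"
    and "nontangential_boundary_values (\<lambda>z. S z *v F z) (\<lambda>y. S (Complex 0 y) *v \<phi> y)"
    and "\<phi> \<in> borel_measurable lborel \<Longrightarrow> (\<lambda>y. S (Complex 0 y) *v \<phi> y) \<in> borel_measurable lborel"
  using S F by (auto simp: boundary_regular_def intro!: schur_hardy2 ntbv_mult bv measurable_matrix_vector AE_I2)

text \<open>Off a disk, K x = S U (z - W)^{-1} x - V (z - W)^{-1} x. This is of size 1/|z + 1|
  because \<open>S\<close> is contractive, and it inherits the limits of \<open>S\<close> on the
  axis.\<close>

lemma right_quotient_hardy2:
  fixes W :: "complex^'w::finite^'w"
  assumes S: "S \<in> schur_class" and W: "spectrum W \<subseteq> right_half_plane"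
    and K: "mat_holomorphic_on K right_half_plane"
    and eq: "\<And>z. z \<in> right_half_plane \<Longrightarrow> S z ** U = V + K z ** (mat z - W)"
  shows "(\<lambda>z. K z *v x) \<in> hardy2"
    and "(\<And>y. (S \<longlongrightarrow> S0 y) (at (Complex 0 y) within right_half_plane)) \<Longrightarrow>
      nontangential_boundary_values (\<lambda>z. K z *v x)
        (\<lambda>t. S0 t *v (U *v (resolvent W (Complex 0 t) *v x)) - V *v (resolvent W (Complex 0 t) *v x))"
proof -
  obtain a r where r: "r > 0" "spectrum W \<subseteq> ball a r" "cball a r \<subseteq> right_half_plane"
    by (rule rhp_ball_cover[OF finite_imp_compact[OF finite_spectrum] W])
  define E where "E = {z. Re z \<ge> 0} - ball a r"
  have "closed E" unfolding E_def by (intro closed_Diff closed_halfspace_Re_ge) simp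
  then obtain B where B: "B > 0" "\<And>z x. z \<in> E \<Longrightarrow> norm (resolvent W z *v x) \<le> B * norm x / norm (z + 1)"
    by (rule resolvent_decay[of E W]) (use r in \<open>auto simp: E_def\<close>)
  have Kz: "K z *v x = S z *v (U *v (resolvent W z *v x)) - V *v (resolvent W z *v x)"
    if z: "z \<in> right_half_plane" "z \<notin> cball a r" for z
  proof -
    have ns: "z \<notin> spectrum W" using z r(2) by auto
    have "S z *v (U *v (resolvent W z *v x)) = V *v (resolvent W z *v x) + K z *v ((mat z - W) *v (resolvent W z *v x))"
      using arg_cong[OF eq[OF z(1)], of "\<lambda>M. M *v (resolvent W z *v x)"]
      by (simp add: matrix_vector_mult_add_rdistrib flip: matrix_vector_mul_assoc)
    then show ?thesis by (simp add: resolvent_right_vec[OF ns])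
  qed
  show "(\<lambda>z. K z *v x) \<in> hardy2"
  proof (rule hardy2_decay[where K = "cball a r" and B = "(norm U + norm V) * (B * norm x)"])
    show "vec_holomorphic_on (\<lambda>z. K z *v x) right_half_plane" by (intro mat_holo_intros K)
    fix z assume z: "z \<in> right_half_plane" "z \<notin> cball a r"
    have zE: "z \<in> E" using z by (auto simp: E_def right_half_plane_def)
    have "norm (K z *v x) \<le> norm (S z *v (U *v (resolvent W z *v x))) + norm (V *v (resolvent W z *v x))"
      unfolding Kz[OF z] by (rule norm_triangle_ineq4)
    also have "\<dots> \<le> norm U * norm (resolvent W z *v x) + norm V * norm (resolvent W z *v x)"
      by (intro add_mono order_trans[OF schur_norm[OF S z(1)]] norm_matrix_vector_le)
    also have "\<dots> = (norm U + norm V) * norm (resolvent W z *v x)" by (simp add: algebra_simps)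
    also have "\<dots> \<le> (norm U + norm V) * (B * norm x / norm (z + 1))"
      by (intro mult_left_mono B(2)[OF zE]) auto
    finally show "norm (K z *v x) \<le> (norm U + norm V) * (B * norm x) / norm (z + 1)" by simp
  qed (use r in auto)
  assume lim: "\<And>y. (S \<longlongrightarrow> S0 y) (at (Complex 0 y) within right_half_plane)"
  show "nontangential_boundary_values (\<lambda>z. K z *v x)
        (\<lambda>t. S0 t *v (U *v (resolvent W (Complex 0 t) *v x)) - V *v (resolvent W (Complex 0 t) *v x))"
  proof (intro ntbv_continuous AE_I2)
    fix y
    have "((\<lambda>z. S z *v (U *v (resolvent W z *v x)) - V *v (resolvent W z *v x)) \<longlongrightarrow>
      S0 y *v (U *v (resolvent W (Complex 0 y) *v x)) - V *v (resolvent W (Complex 0 y) *v x)) (at (Complex 0 y) within right_half_plane)"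
      by (intro tendsto_diff tendsto_matrix_vector lim tendsto_const resolvent_tendsto axis_notin_spectrum(1)[OF W])
    moreover have "eventually (\<lambda>z. K z *v x = S z *v (U *v (resolvent W z *v x)) - V *v (resolvent W z *v x))
      (at (Complex 0 y) within right_half_plane)"
    proof -
      have "Complex 0 y \<in> - cball a r" using r(3) by (auto simp: right_half_plane_def)
      then have "eventually (\<lambda>z. z \<in> - cball a r) (nhds (Complex 0 y))"
        by (intro eventually_nhds_in_open) auto
      then have "eventually (\<lambda>z. z \<notin> cball a r) (at (Complex 0 y) within right_half_plane)"
        by (auto simp: eventually_at_filter elim: eventually_mono)
      moreover have "eventually (\<lambda>z. z \<in> right_half_plane) (at (Complex 0 y) within right_half_plane)"
        by (auto simp: eventually_at_filter)
      ultimately show ?thesis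
        by eventually_elim (use Kz in auto)
    qed
    ultimately show "((\<lambda>z. K z *v x) \<longlongrightarrow>
      S0 y *v (U *v (resolvent W (Complex 0 y) *v x)) - V *v (resolvent W (Complex 0 y) *v x)) (at (Complex 0 y) within right_half_plane)"
      by (simp add: tendsto_cong)
  qed
qed

text \<open>For \<open>q\<close> with upper part \<open>v - \<alpha>\<close> and lower part \<open>u - \<beta>\<close>, the form is the integral over the
  imaginary axis of the nonnegative function \<open>q\<^sup>* M q\<close>, where \<open>M\<close> is the block matrix with rows
  \<open>(I, -S)\<close> and \<open>(-S\<^sup>*, I)\<close>.\<close>

lemma pick_form_nonneg_regular:
  fixes Z :: "complex^'z::finite^'z" and W :: "complex^'w::finite^'w"
  assumes Z: "spectrum Z \<subseteq> right_half_plane" and W: "spectrum W \<subseteq> right_half_plane"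
    and S: "boundary_regular S" and I: "interpolates Z X Y U V W \<Gamma> S"
  shows "0 \<le> pick_form Z X Y U V W \<Gamma> y x"
proof -
  obtain H K L where H: "mat_holomorphic_on H right_half_plane"
    and K: "mat_holomorphic_on K right_half_plane" and L: "mat_holomorphic_on L right_half_plane"
    and eH: "\<And>z. z \<in> right_half_plane \<Longrightarrow> X ** S z = Y + (mat z - Z) ** H z"
    and eK: "\<And>z. z \<in> right_half_plane \<Longrightarrow> S z ** U = V + K z ** (mat z - W)"
    and eL: "\<And>z. z \<in> right_half_plane \<Longrightarrow> X ** K z = \<Gamma> + (mat z - Z) ** L z"
    using I unfolding interpolates_def by auto
  have schur: "S \<in> schur_class" and lim: "\<And>y. (S \<longlongrightarrow> S (Complex 0 y)) (at (Complex 0 y) within right_half_plane)"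
    and Sm: "(\<lambda>y. S (Complex 0 y)) \<in> borel_measurable lborel"
    using S by (auto simp: boundary_regular_def)
  let ?R = "\<lambda>t. resolvent (- conj_transpose Z) (Complex 0 t) *v y"
  let ?Q = "\<lambda>t. resolvent W (Complex 0 t) *v x"
  define \<alpha> where "\<alpha> = (\<lambda>t. conj_transpose X *v ?R t)"
  define \<beta> where "\<beta> = (\<lambda>t. conj_transpose Y *v ?R t)"
  define u where "u = (\<lambda>t. U *v ?Q t)"
  define v where "v = (\<lambda>t. V *v ?Q t)"
  define T where "T = (\<lambda>t. S (Complex 0 t))"
  \<comment> \<open>The boundary values of K x: on the axis T u = v + k with k in H^2.\<close>
  define k where "k = (\<lambda>t. T t *v u t - v t)"
  have Qm: "(\<lambda>t. M *v ?Q t) \<in> borel_measurable lborel" for M :: "complex^'w^'e::finite"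
    by (intro measurable_matrix_vector resolvent_axis_measurable axis_notin_spectrum(1)[OF W] borel_measurable_const)
  have k: "(\<lambda>z. K z *v x) \<in> hardy2" "nontangential_boundary_values (\<lambda>z. K z *v x) k"
    "k \<in> borel_measurable lborel"
  proof -
    show "(\<lambda>z. K z *v x) \<in> hardy2" by (rule right_quotient_hardy2(1)[OF schur W K eK])
    show "nontangential_boundary_values (\<lambda>z. K z *v x) k"
      unfolding k_def u_def v_def T_def by (rule right_quotient_hardy2(2)[OF schur W K eK lim])
    show "k \<in> borel_measurable lborel"
      unfolding k_def u_def v_def T_def
      by (intro borel_measurable_diff measurable_matrix_vector[OF Sm] Qm)
  qed
  let ?B = "\<lambda>z. conj_transpose Y *v (resolvent (- conj_transpose Z) z *v y)"
  note Bs = left_state[OF Z, of "conj_transpose Y" y, folded \<beta>_def]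
  have SB: "(\<lambda>z. S z *v ?B z) \<in> hardy2"
    "nontangential_boundary_values (\<lambda>z. S z *v ?B z) (\<lambda>t. T t *v \<beta> t)"
    "(\<lambda>t. T t *v \<beta> t) \<in> borel_measurable lborel"
    unfolding T_def
    by (rule boundary_regular_mult(1)[OF S Bs(1,2)] boundary_regular_mult(2)[OF S Bs(1,2)]
        boundary_regular_mult(3)[OF S Bs(1,2,3)])+
  define gx gy wu wv where "gx = cinner (gram Z X *v y) y" and "gy = cinner (gram Z Y *v y) y"
    and "wu = cinner (gram (conj_transpose W) (conj_transpose U) *v x) x"
    and "wv = cinner (gram (conj_transpose W) (conj_transpose V) *v x) x"
  have 1: "has_bochner_integral lborel (\<lambda>t. cinner (v t) (v t)) (2 * pi * wv)"
    unfolding v_def wv_def by (rule gram_inner_right[OF W])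
  have 2: "has_bochner_integral lborel (\<lambda>t. cinner (\<alpha> t) (\<alpha> t)) (2 * pi * gx)"
    unfolding \<alpha>_def gx_def by (rule gram_inner[OF Z])
  have 4: "has_bochner_integral lborel (\<lambda>t. cinner (u t) (u t)) (2 * pi * wu)"
    unfolding u_def wu_def by (rule gram_inner_right[OF W])
  have 5: "has_bochner_integral lborel (\<lambda>t. cinner (\<beta> t) (\<beta> t)) (2 * pi * gy)"
    unfolding \<beta>_def gy_def by (rule gram_inner[OF Z])
  have 6: "has_bochner_integral lborel (\<lambda>t. cinner (\<beta> t) (u t)) 0"
    unfolding u_def by (rule hardy_inner_right[OF W Bs(1,2,3)])
  have 7: "has_bochner_integral lborel (\<lambda>t. cinner (k t) (v t)) 0"
    unfolding v_def by (rule hardy_inner_right[OF W k])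
  have 8: "has_bochner_integral lborel (\<lambda>t. cinner (k t) (\<alpha> t)) (2 * pi * cinner (\<Gamma> *v x) y)"
    unfolding \<alpha>_def
  proof (rule hardy_inner_left[OF Z k])
    show "vec_holomorphic_on (\<lambda>z. L z *v x) right_half_plane" by (intro mat_holo_intros L)
    show "X *v (K z *v x) = \<Gamma> *v x + (mat z - Z) *v (L z *v x)" if "z \<in> right_half_plane" for z
      using arg_cong[OF eL[OF that], of "\<lambda>M. M *v x"]
      by (simp add: matrix_vector_mult_add_rdistrib flip: matrix_vector_mul_assoc)
  qed
  have 9: "has_bochner_integral lborel (\<lambda>t. cinner (T t *v \<beta> t) (v t)) 0"
    unfolding v_def by (rule hardy_inner_right[OF W SB(1,2,3)])
  \<comment> \<open>T \<beta> is in H^2, so its pairing with \<open>\<alpha>\<close> is the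
    evaluation of X S applied to the kernel function. Modulo multiples of the pencil X S is Y, and
    the kernel function of \<open>Y\<close> evaluates under Y to its Gramian.\<close>
  have 10: "has_bochner_integral lborel (\<lambda>t. cinner (T t *v \<beta> t) (\<alpha> t)) (2 * pi * gy)"
  proof -
    obtain G where G: "mat_holomorphic_on G right_half_plane"
      "\<And>z. z \<in> right_half_plane \<Longrightarrow>
        Y ** conj_transpose Y ** resolvent (- conj_transpose Z) z = gram Z Y + (mat z - Z) ** G z"
      using gram_decomp[OF Z, of Y] by blast
    show ?thesis
      unfolding \<alpha>_def gy_def
    proof (rule hardy_inner_left[OF Z SB(1,2,3)])
      show "vec_holomorphic_on (\<lambda>z. G z *v y + H z *v ?B z) right_half_plane"
        by (intro mat_holo_intros G H hardy2_holomorphic Bs(1))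
      show "X *v (S z *v ?B z) = gram Z Y *v y + (mat z - Z) *v (G z *v y + H z *v ?B z)"
        if z: "z \<in> right_half_plane" for z
      proof -
        have "X *v (S z *v ?B z) = Y *v ?B z + (mat z - Z) *v (H z *v ?B z)"
          using arg_cong[OF eH[OF z], of "\<lambda>M. M *v ?B z"]
          by (simp add: matrix_vector_mult_add_rdistrib flip: matrix_vector_mul_assoc)
        also have "Y *v ?B z = gram Z Y *v y + (mat z - Z) *v (G z *v y)"
          using arg_cong[OF G(2)[OF z], of "\<lambda>M. M *v y"]
          by (simp add: matrix_vector_mult_add_rdistrib flip: matrix_vector_mul_assoc)
        finally show ?thesis by (simp add: matrix_vector_right_distrib algebra_simps)
      qed
    qed
  qed
  \<comment> \<open>Up to imaginary parts, this is |v - \<alpha>|^2 + |u - \<beta>|^2 - 2 <T (u -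
    \<beta>), v - \<alpha>> with T u = v + k inserted. The sign of |v|^2 flips and the mixed terms
    of \<open>v\<close> and \<open>\<alpha>\<close> cancel, so every summand has a known
    integral.\<close>
  define N where "N = (\<lambda>t. - cinner (v t) (v t) + cinner (\<alpha> t) (\<alpha> t) + cinner (u t) (u t) + cinner (\<beta> t) (\<beta> t)
    - 2 * cinner (\<beta> t) (u t) - 2 * cinner (k t) (v t) + 2 * cinner (k t) (\<alpha> t)
    + 2 * cinner (T t *v \<beta> t) (v t) - 2 * cinner (T t *v \<beta> t) (\<alpha> t))"
  have "has_bochner_integral lborel N (- (2 * pi * wv) + 2 * pi * gx + 2 * pi * wu + 2 * pi * gy
    - 2 * 0 - 2 * 0 + 2 * (2 * pi * cinner (\<Gamma> *v x) y) + 2 * 0 - 2 * (2 * pi * gy))"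
    unfolding N_def
    by (intro has_bochner_integral_add has_bochner_integral_diff has_bochner_integral_minus
        has_bochner_integral_mult_right 1 2 4 5 6 7 8 9 10)
  from has_bochner_integral_bounded_linear[OF bounded_linear_Re this]
  have "has_bochner_integral lborel (\<lambda>t. Re (N t)) (2 * pi * pick_form Z X Y U V W \<Gamma> y x)"
    by (simp add: pick_form_def gx_def gy_def wu_def wv_def algebra_simps)
  then have "2 * pi * pick_form Z X Y U V W \<Gamma> y x = (LINT t|lborel. Re (N t))"
    by (rule has_bochner_integral_integral_eq[symmetric])
  also have "\<dots> \<ge> 0"
  proof (rule integral_nonneg_AE, rule AE_I2)
    fix t
    let ?a = "v t - \<alpha> t" and ?b = "u t - \<beta> t"
    have "Re (cinner (T t *v ?b) ?a) \<le> norm (T t *v ?b) * norm ?a"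
      using complex_Re_le_cmod norm_cinner_le by (rule order_trans)
    also have "\<dots> \<le> norm ?b * norm ?a"
      unfolding T_def by (intro mult_right_mono boundary_regular_norm[OF S]) auto
    finally have "2 * Re (cinner (T t *v ?b) ?a) \<le> Re (cinner ?a ?a) + Re (cinner ?b ?b)"
      using lower_bound_sq[of "norm ?b" "norm ?a"] by (simp add: Re_cinner_self)
    moreover have "Re (cinner ?a ?a) + Re (cinner ?b ?b) - 2 * Re (cinner (T t *v ?b) ?a) = Re (N t)"
    proof -
      have "Re (cinner (v t) (\<alpha> t)) = Re (cinner (\<alpha> t) (v t))" "Re (cinner (u t) (\<beta> t)) = Re (cinner (\<beta> t) (u t))"
        by (rule Re_cinner_commute)+
      then show ?thesis
        by (simp add: N_def k_def cinner_diff_left cinner_diff_right matrix_vector_mult_diff_distrib)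
    qed
    ultimately show "0 \<le> Re (N t)" by linarith
  qed
  finally show ?thesis using pi_gt_zero by (simp add: zero_le_mult_iff)
qed

section \<open>Continuity of the evaluations and of the Pick form\<close>

lemma sum_residue_tendsto:
  assumes pts: "finite pts" "pts \<subseteq> right_half_plane"
    and fn: "\<And>n. f n holomorphic_on right_half_plane - pts" and f: "g holomorphic_on right_half_plane - pts"
    and ul: "\<And>K. compact K \<Longrightarrow> K \<subseteq> right_half_plane - pts \<Longrightarrow> uniform_limit K f g sequentially"
  shows "(\<lambda>n::nat. \<Sum>p\<in>pts. residue (f n) p) \<longlonglongrightarrow> (\<Sum>p\<in>pts. residue g p)"
proof -
  obtain a r where r: "r > 0" "pts \<subseteq> ball a r" "cball a r \<subseteq> right_half_plane"
    by (rule rhp_ball_cover[OF finite_imp_compact[OF pts(1)] pts(2)])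
  have c: "contour_integral (circlepath a r) h = 2 * pi * \<i> * (\<Sum>p\<in>pts. residue h p)"
    if "h holomorphic_on right_half_plane - pts" for h
    by (rule sum_residue_circlepath[OF pts(1) r(2,3) _ _ that r(1)]) (auto intro: convex_connected convex_rhp)
  have "sphere a r \<subseteq> right_half_plane - pts" using r by fastforce
  then have "uniform_limit (sphere a r) f g sequentially" by (intro ul) auto
  then have "(\<lambda>n. contour_integral (circlepath a r) (f n)) \<longlonglongrightarrow> contour_integral (circlepath a r) g"
    by (intro contour_integral_uniform_limit_circlepath(2) always_eventually allI
        circlepath_integrable[OF fn r(2,3,1)] r) auto
  then have "(\<lambda>n. 2 * pi * \<i> * (\<Sum>p\<in>pts. residue (f n) p)) \<longlonglongrightarrow> 2 * pi * \<i> * (\<Sum>p\<in>pts. residue g p)"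
    by (simp add: c fn f)
  from tendsto_mult_left[OF this, of "1 / (2 * pi * \<i>)"] show ?thesis by simp
qed

lemma uniform_limit_sandwich_entry:
  fixes A :: "complex \<Rightarrow> complex^'k::finite^'l::finite" and B :: "complex \<Rightarrow> complex^'q::finite^'r::finite"
  assumes K: "compact K" and A: "continuous_on K A" and B: "continuous_on K B"
    and S: "uniform_limit K S T sequentially"
  shows "uniform_limit K (\<lambda>n z. (A z ** S n z ** B z) $ i $ j) (\<lambda>z. (A z ** T z ** B z) $ i $ j) sequentially"
proof -
  have "bounded (A ` K)" "bounded (B ` K)"
    using K A B compact_continuous_image compact_imp_bounded by blast+
  then obtain a b where ab: "a > 0" "b > 0" "\<And>z. z \<in> K \<Longrightarrow> norm (A z) \<le> a" "\<And>z. z \<in> K \<Longrightarrow> norm (B z) \<le> b"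
    by (auto simp: bounded_pos)
  show ?thesis
    unfolding uniform_limit_iff
  proof (intro allI impI)
    fix e :: real assume e: "e > 0"
    have "eventually (\<lambda>n. \<forall>z\<in>K. dist (S n z) (T z) < e / (a * b)) sequentially"
      using S e ab by (auto simp: uniform_limit_iff)
    then show "\<forall>\<^sub>F n in sequentially. \<forall>z\<in>K. dist ((A z ** S n z ** B z) $ i $ j) ((A z ** T z ** B z) $ i $ j) < e"
    proof eventually_elim
      case (elim n)
      show ?case
      proof
        fix z assume z: "z \<in> K"
        let ?e = "axis j 1 :: complex^'q"
        have "(A z ** S n z ** B z) $ i $ j - (A z ** T z ** B z) $ i $ j = (A z *v ((S n z - T z) *v (B z *v ?e))) $ i"
          by (simp add: matrix_vector_mul_assoc matrix_mul_assoc matrix_vector_axis mat_mul_simps)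
        also have "norm \<dots> \<le> norm (A z *v ((S n z - T z) *v (B z *v ?e)))"
          by (rule Finite_Cartesian_Product.norm_nth_le)
        also have "\<dots> \<le> norm (A z) * (norm (S n z - T z) * (norm (B z) * norm ?e))"
          by (intro order_trans[OF norm_matrix_vector_le] mult_left_mono order_refl) auto
        also have "\<dots> \<le> a * (norm (S n z - T z) * (b * 1))"
          using ab z by (intro mult_mono) auto
        also have "\<dots> < a * (e / (a * b) * (b * 1))"
          using elim z ab by (intro mult_strict_left_mono mult_strict_right_mono) (auto simp: dist_norm)
        also have "\<dots> = e" using ab by simp
        finally show "dist ((A z ** S n z ** B z) $ i $ j) ((A z ** T z ** B z) $ i $ j) < e"
          by (simp add: dist_norm)
      qed
    qed
  qed
qed

definition locally_uniform_limit ::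
    "(nat \<Rightarrow> complex \<Rightarrow> complex^'m::finite^'p::finite) \<Rightarrow> (complex \<Rightarrow> complex^'m^'p) \<Rightarrow> bool" where
  "locally_uniform_limit Sn S \<longleftrightarrow> (\<forall>K. compact K \<longrightarrow> K \<subseteq> right_half_plane \<longrightarrow> uniform_limit K Sn S sequentially)"

text \<open>The three evaluations, and the Gramians too, are residue sums of a product with fixed
  outer factors that are holomorphic off finitely many points; their limits are all instances of
  this one.\<close>

lemma sandwich_residues_tendsto:
  assumes pts: "finite pts" "pts \<subseteq> right_half_plane"
    and A: "mat_holomorphic_on A (right_half_plane - pts)" and B: "mat_holomorphic_on B (right_half_plane - pts)"
    and Sn: "\<And>n. mat_holomorphic_on (Sn n) right_half_plane" and S: "mat_holomorphic_on S right_half_plane"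
    and ul: "locally_uniform_limit Sn S"
  shows "(\<lambda>n. \<Sum>p\<in>pts. residue (\<lambda>z. (A z ** Sn n z ** B z) $ i $ j) p)
    \<longlonglongrightarrow> (\<Sum>p\<in>pts. residue (\<lambda>z. (A z ** S z ** B z) $ i $ j) p)"
proof (rule sum_residue_tendsto[OF pts])
  have hol: "(\<lambda>z. (A z ** T z ** B z) $ i $ j) holomorphic_on right_half_plane - pts"
    if "mat_holomorphic_on T right_half_plane" for T
  proof -
    have "mat_holomorphic_on (\<lambda>z. A z ** T z ** B z) (right_half_plane - pts)"
      by (intro mat_holomorphic_on_mult A B mat_holomorphic_on_subset[OF that]) auto
    then show ?thesis by (simp add: mat_holomorphic_on_def)
  qed
  show "(\<lambda>z. (A z ** Sn n z ** B z) $ i $ j) holomorphic_on right_half_plane - pts" for n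
    by (rule hol[OF Sn])
  show "(\<lambda>z. (A z ** S z ** B z) $ i $ j) holomorphic_on right_half_plane - pts"
    by (rule hol[OF S])
  fix K assume "compact K" "K \<subseteq> right_half_plane - pts"
  then show "uniform_limit K (\<lambda>n z. (A z ** Sn n z ** B z) $ i $ j) (\<lambda>z. (A z ** S z ** B z) $ i $ j) sequentially"
    using ul by (intro uniform_limit_sandwich_entry continuous_on_subset[OF mat_holomorphic_continuous[OF A]]
        continuous_on_subset[OF mat_holomorphic_continuous[OF B]]) (auto simp: locally_uniform_limit_def)
qed

lemma mat_tendstoI: "(\<And>i j. ((\<lambda>x. f x $ i $ j) \<longlongrightarrow> l $ i $ j) F) \<Longrightarrow> (f \<longlongrightarrow> l) F"
  by (intro vec_tendstoI) auto

lemma evals_tendsto: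
  assumes Z: "spectrum Z \<subseteq> right_half_plane" and W: "spectrum W \<subseteq> right_half_plane"
    and Sn: "\<And>n. mat_holomorphic_on (Sn n) right_half_plane" and S: "mat_holomorphic_on S right_half_plane"
    and ul: "locally_uniform_limit Sn S"
  shows "(\<lambda>n. left_eval Z X (Sn n)) \<longlonglongrightarrow> left_eval Z X S"
    and "(\<lambda>n. right_eval U W (Sn n)) \<longlonglongrightarrow> right_eval U W S"
    and "(\<lambda>n. left_right_eval Z X U W (Sn n)) \<longlonglongrightarrow> left_right_eval Z X U W S"
proof -
  show "(\<lambda>n. left_eval Z X (Sn n)) \<longlonglongrightarrow> left_eval Z X S"
  proof (rule mat_tendstoI)
    fix i j
    have "(\<lambda>n. \<Sum>p\<in>spectrum Z. residue (\<lambda>z. ((resolvent Z z ** X) ** Sn n z ** mat 1) $ i $ j) p)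
      \<longlonglongrightarrow> (\<Sum>p\<in>spectrum Z. residue (\<lambda>z. ((resolvent Z z ** X) ** S z ** mat 1) $ i $ j) p)"
      by (rule sandwich_residues_tendsto[OF _ Z _ _ Sn S ul]) (auto intro!: mat_holo_intros resolvent_holomorphic)
    then show "(\<lambda>n. left_eval Z X (Sn n) $ i $ j) \<longlonglongrightarrow> left_eval Z X S $ i $ j"
      by (simp add: left_eval_def mat_residue_def)
  qed
  show "(\<lambda>n. right_eval U W (Sn n)) \<longlonglongrightarrow> right_eval U W S"
  proof (rule mat_tendstoI)
    fix i j
    have "(\<lambda>n. \<Sum>p\<in>spectrum W. residue (\<lambda>z. (mat 1 ** Sn n z ** (U ** resolvent W z)) $ i $ j) p)
      \<longlonglongrightarrow> (\<Sum>p\<in>spectrum W. residue (\<lambda>z. (mat 1 ** S z ** (U ** resolvent W z)) $ i $ j) p)"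
      by (rule sandwich_residues_tendsto[OF _ W _ _ Sn S ul]) (auto intro!: mat_holo_intros resolvent_holomorphic)
    then show "(\<lambda>n. right_eval U W (Sn n) $ i $ j) \<longlonglongrightarrow> right_eval U W S $ i $ j"
      by (simp add: right_eval_def mat_residue_def matrix_mul_assoc)
  qed
  show "(\<lambda>n. left_right_eval Z X U W (Sn n)) \<longlonglongrightarrow> left_right_eval Z X U W S"
  proof (rule mat_tendstoI)
    fix i j
    let ?P = "spectrum Z \<union> spectrum W"
    have "(\<lambda>n. \<Sum>p\<in>?P. residue (\<lambda>z. ((resolvent Z z ** X) ** Sn n z ** (U ** resolvent W z)) $ i $ j) p)
      \<longlonglongrightarrow> (\<Sum>p\<in>?P. residue (\<lambda>z. ((resolvent Z z ** X) ** S z ** (U ** resolvent W z)) $ i $ j) p)"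
      by (rule sandwich_residues_tendsto[OF _ _ _ _ Sn S ul])
         (use Z W in \<open>auto intro!: mat_holomorphic_on_mult mat_holomorphic_on_const resolvent_holomorphic\<close>)
    then show "(\<lambda>n. left_right_eval Z X U W (Sn n) $ i $ j) \<longlonglongrightarrow> left_right_eval Z X U W S $ i $ j"
      by (simp add: left_right_eval_def mat_residue_def matrix_mul_assoc)
  qed
qed

lemma tendsto_matrix_mult:
  fixes A :: "'a \<Rightarrow> complex^'k::finite^'l::finite" and B :: "'a \<Rightarrow> complex^'q::finite^'k"
  assumes "(A \<longlongrightarrow> A0) F" "(B \<longlongrightarrow> B0) F"
  shows "((\<lambda>x. A x ** B x) \<longlongrightarrow> A0 ** B0) F"
  unfolding matrix_matrix_mult_def
  by (rule mat_tendstoI) (auto intro!: tendsto_intros assms)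

lemma tendsto_conj_transpose:
  "(A \<longlongrightarrow> A0) F \<Longrightarrow> ((\<lambda>x. conj_transpose (A x)) \<longlongrightarrow> conj_transpose A0) F"
  by (rule mat_tendstoI) (auto intro!: tendsto_intros)

lemma tendsto_cinner:
  "(u \<longlongrightarrow> u0) F \<Longrightarrow> (v \<longlongrightarrow> v0) F \<Longrightarrow> ((\<lambda>x. cinner (u x) (v x)) \<longlongrightarrow> cinner u0 v0) F"
  unfolding cinner_def by (auto intro!: tendsto_intros)

lemma gram_tendsto:
  assumes Z: "spectrum Z \<subseteq> right_half_plane" and Y: "(\<lambda>n. Yn n) \<longlonglongrightarrow> Y"
  shows "(\<lambda>n. gram Z (Yn n)) \<longlonglongrightarrow> gram Z Y"
proof -
  let ?R = "resolvent (- conj_transpose Z)"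
  have "(\<lambda>n. Yn n ** conj_transpose (Yn n)) \<longlonglongrightarrow> Y ** conj_transpose Y"
    by (intro tendsto_matrix_mult tendsto_conj_transpose Y)
  then have "locally_uniform_limit (\<lambda>n z. Yn n ** conj_transpose (Yn n)) (\<lambda>z. Y ** conj_transpose Y)"
    by (auto simp: locally_uniform_limit_def uniform_limit_iff tendsto_iff)
  moreover have "mat_holomorphic_on ?R (right_half_plane - spectrum Z)"
    by (rule mat_holomorphic_on_subset[OF gram_integrand_holomorphic[OF Z, of "mat 1", simplified]]) auto
  ultimately have "(\<lambda>n. \<Sum>p\<in>spectrum Z. residue (\<lambda>z. (resolvent Z z ** (Yn n ** conj_transpose (Yn n)) ** ?R z) $ i $ j) p)
      \<longlonglongrightarrow> (\<Sum>p\<in>spectrum Z. residue (\<lambda>z. (resolvent Z z ** (Y ** conj_transpose Y) ** ?R z) $ i $ j) p)" for i j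
    by (intro sandwich_residues_tendsto[OF _ Z]) (auto intro!: resolvent_holomorphic)
  moreover have "gram Z M $ i $ j = (\<Sum>p\<in>spectrum Z. residue (\<lambda>z. (resolvent Z z ** (M ** conj_transpose M) ** ?R z) $ i $ j) p)"
    for M :: "complex^'b^'a" and i j
  proof -
    have "gram Z M = left_eval Z (mat 1) (\<lambda>z. M ** conj_transpose M ** ?R z)"
      by (simp add: gram_def left_eval_mat_left_eval)
    then show ?thesis by (simp add: left_eval_def mat_residue_def matrix_mul_assoc)
  qed
  ultimately show ?thesis by (intro mat_tendstoI) simp
qed

lemma pick_form_tendsto:
  assumes Z: "spectrum Z \<subseteq> right_half_plane" and W: "spectrum W \<subseteq> right_half_plane"
    and "Yn \<longlonglongrightarrow> Y" "Vn \<longlonglongrightarrow> V" "\<Gamma>n \<longlonglongrightarrow> \<Gamma>"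
  shows "(\<lambda>n. pick_form Z X (Yn n) U (Vn n) W (\<Gamma>n n) y x) \<longlonglongrightarrow> pick_form Z X Y U V W \<Gamma> y x"
  unfolding pick_form_def
  by (intro tendsto_intros tendsto_cinner tendsto_matrix_vector gram_tendsto tendsto_conj_transpose
      Z spectrum_conj_transpose_rhp[OF W] assms)

text \<open>The translate is holomorphic on Re z > - e, hence continuous across the axis.\<close>

lemma schur_shift:
  assumes S: "S \<in> schur_class" and e: "e > 0"
  shows "boundary_regular (\<lambda>z. S (z + of_real e))"
proof -
  define D where "D = {z. Re z > - e}"
  have "open D" unfolding D_def by (rule open_halfspace_Re_gt)
  have hol: "mat_holomorphic_on (\<lambda>z. S (z + of_real e)) D"
    unfolding mat_holomorphic_on_def
  proof (intro allI)
    fix i j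
    have "((\<lambda>w. S w $ i $ j) \<circ> (\<lambda>z. z + of_real e)) holomorphic_on D"
      using schur_holomorphic[OF S]
      by (intro holomorphic_on_compose_gen[where t = right_half_plane] holomorphic_intros)
         (auto simp: mat_holomorphic_on_def D_def right_half_plane_def)
    then show "(\<lambda>z. S (z + of_real e) $ i $ j) holomorphic_on D" by (simp add: o_def)
  qed
  have "right_half_plane \<subseteq> D" using e by (auto simp: D_def right_half_plane_def)
  have "(\<lambda>z. S (z + of_real e)) \<in> schur_class"
    by (rule schur_classI[OF mat_holomorphic_on_subset[OF hol \<open>right_half_plane \<subseteq> D\<close>]])
       (rule schur_norm[OF S], use e in \<open>auto simp: right_half_plane_def\<close>)
  moreover have "((\<lambda>z. S (z + of_real e)) \<longlongrightarrow> S (Complex 0 y + of_real e)) (at (Complex 0 y) within right_half_plane)" for y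
    by (rule holomorphic_tendsto[OF hol \<open>open D\<close>]) (use e in \<open>simp add: D_def\<close>)
  moreover have "continuous_on UNIV (\<lambda>y. S (Complex 0 y + of_real e))"
    by (rule continuous_on_compose2[OF mat_holomorphic_continuous[OF hol]])
       (use e in \<open>auto intro!: continuous_intros simp: D_def\<close>)
  ultimately show ?thesis
    by (simp add: boundary_regular_def borel_measurable_continuous_onI)
qed

text \<open>The translates of \<open>K\<close> by at most 1 sweep out a compact subset of the
  half-plane, on which \<open>S\<close> is uniformly continuous.\<close>

lemma shift_uniform_limit:
  assumes S: "mat_holomorphic_on S right_half_plane"
  shows "locally_uniform_limit (\<lambda>n z. S (z + of_real (inverse (real (Suc n))))) S"
  unfolding locally_uniform_limit_def uniform_limit_iff
proof (intro allI impI)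
  fix K :: "complex set" and e :: real assume K: "compact K" "K \<subseteq> right_half_plane" and e: "e > 0"
  define K' where "K' = (\<lambda>(z, t). z + of_real t) ` (K \<times> {0..1::real})"
  have "compact K'"
    unfolding K'_def case_prod_unfold
    by (intro compact_continuous_image compact_Times K continuous_intros) simp
  moreover have "K' \<subseteq> right_half_plane" using K(2) by (fastforce simp: K'_def right_half_plane_def)
  ultimately have "uniformly_continuous_on K' S"
    by (intro compact_uniformly_continuous continuous_on_subset[OF mat_holomorphic_continuous[OF S]])
  then obtain d where d: "d > 0" "\<And>z w. z \<in> K' \<Longrightarrow> w \<in> K' \<Longrightarrow> dist w z < d \<Longrightarrow> dist (S w) (S z) < e"
    using e unfolding uniformly_continuous_on_def by metis
  have "eventually (\<lambda>n. inverse (real (Suc n)) < d) sequentially"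
    using order_tendstoD(2)[OF LIMSEQ_inverse_real_of_nat d(1)] .
  then show "\<forall>\<^sub>F n in sequentially. \<forall>z\<in>K. dist (S (z + of_real (inverse (real (Suc n))))) (S z) < e"
  proof eventually_elim
    case (elim n)
    show ?case
    proof
      fix z assume z: "z \<in> K"
      have "inverse (real (Suc n)) \<in> {0..1}" by (simp add: inverse_le_1_iff)
      then have "z + of_real (inverse (real (Suc n))) \<in> K'" "z \<in> K'"
        unfolding K'_def using z by (force intro: image_eqI[where x = "(z, inverse (real (Suc n)))"] image_eqI[where x = "(z, 0)"])+
      moreover have "dist (z + of_real (inverse (real (Suc n)))) z < d"
        using elim by (simp add: dist_norm norm_inverse del: of_nat_Suc)
      ultimately show "dist (S (z + of_real (inverse (real (Suc n))))) (S z) < e"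
        using d(2) by blast
    qed
  qed
qed

text \<open>A translate of \<open>S\<close> solves the problem whose data are its own evaluations,
  so the regular case applies to it. These data converge to the given ones, and the form depends
  continuously on them.\<close>

lemma pick_form_nonneg:
  assumes Z: "spectrum Z \<subseteq> right_half_plane" and W: "spectrum W \<subseteq> right_half_plane"
    and S: "S \<in> schur_class" and I: "interpolates Z X Y U V W \<Gamma> S"
  shows "0 \<le> pick_form Z X Y U V W \<Gamma> y x"
proof (rule LIMSEQ_le_const)
  define Sn where "Sn = (\<lambda>n z. S (z + of_real (inverse (real (Suc n)))))"
  have br: "boundary_regular (Sn n)" for n
    unfolding Sn_def by (rule schur_shift[OF S]) simp
  then have hol: "mat_holomorphic_on (Sn n) right_half_plane" for n
    by (auto simp: boundary_regular_def intro: schur_holomorphic)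
  have "locally_uniform_limit Sn S"
    unfolding Sn_def by (rule shift_uniform_limit[OF schur_holomorphic[OF S]])
  note ev = evals_tendsto[OF Z W hol schur_holomorphic[OF S] this]
  note E = interpolates_imp_evals[OF Z W I]
  show "(\<lambda>n. pick_form Z X (left_eval Z X (Sn n)) U (right_eval U W (Sn n)) W (left_right_eval Z X U W (Sn n)) y x)
    \<longlonglongrightarrow> pick_form Z X Y U V W \<Gamma> y x"
    using ev(1)[of X] ev(2)[of U] ev(3)[of X U] unfolding E by (rule pick_form_tendsto[OF Z W])
  show "\<exists>N. \<forall>n\<ge>N. 0 \<le> pick_form Z X (left_eval Z X (Sn n)) U (right_eval U W (Sn n)) W (left_right_eval Z X U W (Sn n)) y x"
  proof (intro exI allI impI)
    show "0 \<le> pick_form Z X (left_eval Z X (Sn n)) U (right_eval U W (Sn n)) W (left_right_eval Z X U W (Sn n)) y x" for n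
      by (rule pick_form_nonneg_regular[OF Z W br interpolates_evals[OF hol Z W]])
  qed
qed

section \<open>State-space realizations and the closed loop\<close>

lemma cinner_J_sig: "cinner (J_sig *v stack a b) (stack a b) = of_real ((norm a)\<^sup>2 - (norm b)\<^sup>2)"
  by (simp add: J_sig_stack cinner_stack cinner_minus_left cinner_self)

lemma cinner_J_sig_right: "cinner u (J_sig *v v) = cinner (J_sig *v u) v"
  by (simp add: cinner_adjoint' conj_transpose_J_sig)

text \<open>|M v|^2 = <v, M^H M v> <= |v| |M v|.\<close>

lemma adjoint_contraction:
  fixes M :: "complex^'k::finite^'l::finite"
  assumes "\<And>v. norm (conj_transpose M *v v) \<le> norm v"
  shows "norm (M *v v) \<le> norm v"
proof -
  have "(norm (M *v v))\<^sup>2 = Re (cinner v (conj_transpose M *v (M *v v)))"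
    by (simp add: cinner_adjoint Re_cinner_self[symmetric])
  also have "\<dots> \<le> norm v * norm (conj_transpose M *v (M *v v))"
    using complex_Re_le_cmod norm_cinner_le by (rule order_trans)
  also have "\<dots> \<le> norm v * norm (M *v v)"
    by (intro mult_left_mono assms) auto
  finally have "norm (M *v v) * norm (M *v v) \<le> norm v * norm (M *v v)"
    by (simp add: power2_eq_square)
  then show ?thesis
    by (cases "M *v v = 0") (auto dest: mult_right_le_imp_le)
qed

text \<open>What the interpolation problem passes on is a Lyapunov equation with P > 0. The
  eigenvalues of \<open>A\<close> may lie on both sides of the axis, so arguments rest on the energy
  balance instead of stability.\<close>

locale state_space =
  fixes A P :: "complex^'n::finite^'n" and C :: "complex^'n^('p::finite + 'm::finite)"
  assumes lyap: "P ** A + conj_transpose A ** P = - (conj_transpose C ** J_sig ** C)"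
    and herm: "conj_transpose P = P"
    and pos: "\<And>v. v \<noteq> 0 \<Longrightarrow> 0 < Re (cinner (P *v v) v)"
begin

definition Pinv where "Pinv = matrix_inv P"
text \<open>The input matrix with P B = C^H J; this relation makes P an energy function for the
  system with output i - C s.\<close>

definition B where "B = Pinv ** conj_transpose C ** J_sig"
definition C1 where "C1 = upper C"
definition C2 where "C2 = lower C"

lemma C_stack: "C = stack C1 C2"
  by (simp add: C1_def C2_def stack_upper_lower)

lemma P_invertible: "invertible P"
  unfolding invertible_iff_inj using pos by fastforce

lemma P_Pinv: "P ** Pinv = mat 1" and Pinv_P: "Pinv ** P = mat 1"
  by (simp_all add: Pinv_def matrix_inv_mult_left matrix_inv_mult_right P_invertible)

lemma P_B: "P ** B = conj_transpose C ** J_sig"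
  by (simp add: B_def matrix_mul_assoc P_Pinv)

lemma P_nonneg: "0 \<le> Re (cinner (P *v v) v)"
  using pos[of v] by (cases "v = 0") auto

lemma lyap_vec: "P *v (A *v v) + conj_transpose A *v (P *v v) = - (conj_transpose C *v (J_sig *v (C *v v)))"
  using arg_cong[OF lyap, of "\<lambda>M. M *v v"]
  by (simp add: matrix_vector_mult_add_rdistrib matrix_vector_minus_left matrix_vector_mul_assoc matrix_mul_assoc)

lemma lyap_form: "2 * Re (cinner (P *v (A *v v)) v) = - Re (cinner (J_sig *v (C *v v)) (C *v v))"
proof -
  have "Re (cinner (conj_transpose A *v (P *v v)) v) = Re (cinner (P *v (A *v v)) v)"
  proof -
    have "cinner (conj_transpose A *v (P *v v)) v = cinner (P *v v) (A *v v)"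
      by (simp add: cinner_adjoint)
    also have "\<dots> = cinner v (P *v (A *v v))" by (simp add: cinner_adjoint herm)
    finally show ?thesis using Re_cinner_commute by metis
  qed
  moreover have "cinner (P *v (A *v v)) v + cinner (conj_transpose A *v (P *v v)) v = - cinner (J_sig *v (C *v v)) (C *v v)"
    by (simp only: cinner_add_left[symmetric] lyap_vec) (simp add: cinner_minus_left cinner_adjoint)
  ultimately show ?thesis by (metis (no_types, lifting) mult_2 plus_complex.sel(1) uminus_complex.sel(1))
qed

text \<open>Pair the state equation with P s. The Lyapunov equation turns <P A s, s> into the J-form
  of C s, and P B = C^H J gives the cross term of i and C s; together they complete the J-form of
  the output i - C s.\<close>

lemma energy:
  assumes s: "(mat z - A) *v s = B *v i + e"
  shows "2 * Re z * Re (cinner (P *v s) s) = 2 * Re (cinner (P *v e) s)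
    + Re (cinner (J_sig *v i) i) - Re (cinner (J_sig *v (i - C *v s)) (i - C *v s))"
proof -
  have "cinner (P *v ((mat z - A) *v s)) s = z * cinner (P *v s) s - cinner (P *v (A *v s)) s"
    by (simp add: mat_vec_simps cinner_diff_left cinner_scale_left)
  moreover have "Im (cinner (P *v s) s) = 0"
  proof -
    have "cnj (cinner (P *v s) s) = cinner (P *v s) s"
      by (simp add: cnj_cinner cinner_adjoint herm)
    then show ?thesis by (simp add: complex_eq_iff)
  qed
  ultimately have 1: "2 * Re (cinner (P *v ((mat z - A) *v s)) s)
      = 2 * Re z * Re (cinner (P *v s) s) + Re (cinner (J_sig *v (C *v s)) (C *v s))"
    using lyap_form[of s] by simp
  have "P *v (B *v i) = conj_transpose C *v (J_sig *v i)"
    by (simp add: matrix_vector_mul_assoc P_B)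
  then have 2: "cinner (P *v ((mat z - A) *v s)) s = cinner (J_sig *v i) (C *v s) + cinner (P *v e) s"
    unfolding s by (simp add: matrix_vector_right_distrib cinner_add_left cinner_adjoint)
  have 3: "Re (cinner (J_sig *v (i - C *v s)) (i - C *v s))
    = Re (cinner (J_sig *v i) i) - 2 * Re (cinner (J_sig *v i) (C *v s)) + Re (cinner (J_sig *v (C *v s)) (C *v s))"
  proof -
    have "Re (cinner (J_sig *v (C *v s)) i) = Re (cinner (J_sig *v i) (C *v s))"
      by (metis Re_cinner_commute cinner_J_sig_right)
    then show ?thesis
      by (simp add: matrix_vector_mult_diff_distrib cinner_diff_left cinner_diff_right)
  qed
  show ?thesis using 1 2 3 by simp
qed

definition \<Theta>0 where "\<Theta>0 z = mat 1 - C ** resolvent A z ** B"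

lemma \<Theta>0_form:
  assumes "z \<notin> spectrum A"
  shows "Re (cinner (J_sig *v i) i) - Re (cinner (J_sig *v (\<Theta>0 z *v i)) (\<Theta>0 z *v i))
    = 2 * Re z * Re (cinner (P *v (resolvent A z *v (B *v i))) (resolvent A z *v (B *v i)))"
proof -
  let ?s = "resolvent A z *v (B *v i)"
  have "(mat z - A) *v ?s = B *v i + 0" using resolvent_right_vec[OF assms] by simp
  from energy[OF this] show ?thesis
    by (simp add: \<Theta>0_def matrix_vector_mult_diff_rdistrib matrix_vector_mul_assoc matrix_mul_assoc)
qed

definition defect :: "complex^('p + 'm)^('p + 'm) \<Rightarrow> complex^('p + 'm)^('p + 'm)" where
  "defect M = J_sig - conj_transpose M ** J_sig ** M"

lemma defect_hermitian: "conj_transpose (defect M) = defect M"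
  by (simp add: defect_def conj_transpose_diff conj_transpose_mult conj_transpose_J_sig matrix_mul_assoc)

lemma defect_form: "cinner (defect M *v i) i = cinner (J_sig *v i) i - cinner (J_sig *v (M *v i)) (M *v i)"
  by (simp add: defect_def matrix_vector_mult_diff_rdistrib cinner_diff_left cinner_adjoint flip: matrix_vector_mul_assoc)

text \<open>On the axis the stored energy drops out of the balance, so the Hermitian defect has zero
  quadratic form and vanishes.\<close>

lemma \<Theta>0_J_unitary:
  assumes "z \<notin> spectrum A" "Re z = 0"
  shows "conj_transpose (\<Theta>0 z) ** J_sig ** \<Theta>0 z = J_sig"
proof -
  have 0: "Re (cinner (defect (\<Theta>0 z) *v i) i) = 0" for i
    using \<Theta>0_form[OF assms(1), of i] assms(2) by (simp add: defect_form)
  have "defect (\<Theta>0 z) *v i = 0" for i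
    by (rule nonneg_hermitian_kernel[OF defect_hermitian]) (simp_all add: 0)
  then have "defect (\<Theta>0 z) = 0" by (intro matrix_eqI) simp
  then show ?thesis by (simp add: defect_def)
qed

lemma \<Theta>0_J_contractive:
  assumes "z \<notin> spectrum A" "z \<in> right_half_plane"
  shows "pos_semidef (defect (\<Theta>0 z))"
  unfolding pos_semidef_def
proof
  fix i
  have "cnj (cinner (defect (\<Theta>0 z) *v i) i) = cinner (defect (\<Theta>0 z) *v i) i"
    by (simp add: cnj_cinner cinner_adjoint defect_hermitian)
  then have "Im (cinner (defect (\<Theta>0 z) *v i) i) = 0"
    by (simp add: complex_eq_iff)
  moreover have "0 \<le> Re (cinner (defect (\<Theta>0 z) *v i) i)"
    using \<Theta>0_form[OF assms(1), of i] assms(2) P_nonneg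
    by (simp add: defect_form right_half_plane_def)
  ultimately show "Im (cinner (defect (\<Theta>0 z) *v i) i) = 0 \<and> 0 \<le> Re (cinner (defect (\<Theta>0 z) *v i) i)" ..
qed

text \<open>Closing the loop \<open>i = (G v, v)\<close> around the system with transfer function \<open>\<Theta>0\<close> gives a
  pencil that is invertible on the whole half-plane, also at the poles of \<open>\<Theta>0\<close>.\<close>

definition loop :: "complex^'m^'p \<Rightarrow> complex \<Rightarrow> complex^'n^'n" where
  "loop G z = mat z - A - B ** stack G (mat 1) ** C2"

text \<open>Responses of the closed loop to an external signal w: \<open>xi\<close> gives the state,
  \<open>feed\<close> the loop signal v = C2 s + w, and \<open>lft\<close> the upper output. Off the
  spectrum of \<open>A\<close>, \<open>feed\<close> is the inverse of the denominator of the
  linear-fractional formula. \<open>kap\<close> supplies the quotient of the right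
  condition.\<close>

definition xi where "xi G z = matrix_inv (loop G z) ** B ** stack G (mat 1)"
definition feed where "feed G z = mat 1 + C2 ** xi G z"
definition lft where "lft G z = G ** feed G z - C1 ** xi G z"
definition kap where "kap G z = (C1 - G ** C2) ** matrix_inv (loop G z)"

text \<open>The input (G v, v) has nonpositive J-form because \<open>G\<close> is contractive, and
  the output is (G v - C1 s, w).\<close>

lemma loop_energy:
  assumes s: "(mat z - A) *v s = B *v stack (G *v v) v" and v: "v = C2 *v s + w"
    and G: "\<And>u. norm (G *v u) \<le> norm u"
  shows "2 * Re z * Re (cinner (P *v s) s) + (norm (G *v v - C1 *v s))\<^sup>2 \<le> (norm w)\<^sup>2"
proof -
  have "C *v s = stack (C1 *v s) (C2 *v s)" by (subst C_stack) (rule stack_mult_vec)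
  then have i: "stack (G *v v) v - C *v s = stack (G *v v - C1 *v s) w"
    by (simp add: stack_diff v)
  have "(norm (G *v v))\<^sup>2 \<le> (norm v)\<^sup>2" by (intro power_mono G) simp
  moreover have "(mat z - A) *v s = B *v stack (G *v v) v + 0" using s by simp
  from energy[OF this]
  have "2 * Re z * Re (cinner (P *v s) s) = (norm (G *v v))\<^sup>2 - (norm v)\<^sup>2 - ((norm (G *v v - C1 *v s))\<^sup>2 - (norm w)\<^sup>2)"
    unfolding i cinner_J_sig by simp
  ultimately show ?thesis by linarith
qed

lemma loop_vec: "loop G z *v s = (mat z - A) *v s - B *v stack (G *v (C2 *v s)) (C2 *v s)"
  by (simp add: loop_def matrix_vector_mult_diff_rdistrib stack_mult_vec flip: matrix_vector_mul_assoc)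

text \<open>A kernel vector is a loop state with w = 0, so inside the half-plane its energy is at
  most 0. On the axis the energy has weight 0; with G = 0 the balance still forces C2 s = 0, and
  \<open>s\<close> falls into the kernel of z - A.\<close>

lemma loop_invertible:
  assumes z: "Re z > 0 \<or> Re z = 0 \<and> z \<notin> spectrum A" and G: "\<And>u. norm (G *v u) \<le> norm u"
    and G0: "Re z = 0 \<Longrightarrow> G = 0"
  shows "invertible (loop G z)"
  unfolding invertible_iff_inj
proof (intro allI impI)
  fix s assume s: "loop G z *v s = 0"
  then have s: "(mat z - A) *v s = B *v stack (G *v (C2 *v s)) (C2 *v s)"
    by (simp add: loop_vec)
  show "s = 0"
  proof (cases "Re z > 0")
    case True
    have "2 * Re z * Re (cinner (P *v s) s) + (norm (G *v (C2 *v s) - C1 *v s))\<^sup>2 \<le> 0"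
      using loop_energy[OF s, of 0] G by simp
    then have "2 * Re z * Re (cinner (P *v s) s) \<le> 0"
      using zero_le_power2[of "norm (G *v (C2 *v s) - C1 *v s)"] by linarith
    then have "Re (cinner (P *v s) s) \<le> 0" using True by (simp add: mult_le_0_iff)
    then show ?thesis using pos[of s] by fastforce
  next
    case False
    then have z0: "Re z = 0" "z \<notin> spectrum A" and G0: "G = 0" using z G0 by auto
    have "C *v s = stack (C1 *v s) (C2 *v s)" by (subst C_stack) (rule stack_mult_vec)
    then have i: "stack (G *v (C2 *v s)) (C2 *v s) - C *v s = stack (- (C1 *v s)) 0"
      by (simp add: stack_diff G0)
    have "(mat z - A) *v s = B *v stack (G *v (C2 *v s)) (C2 *v s) + 0" using s by simp
    from energy[OF this] have "0 = - (norm (C2 *v s))\<^sup>2 - (norm (C1 *v s))\<^sup>2"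
      unfolding i cinner_J_sig using z0 by (simp add: G0)
    then have "(norm (C2 *v s))\<^sup>2 = 0"
      using zero_le_power2[of "norm (C2 *v s)"] zero_le_power2[of "norm (C1 *v s)"] by linarith
    then have "(mat z - A) *v s = 0" using s by (simp add: G0 stack_zero)
    then show ?thesis using resolvent_left_vec[OF z0(2), of s] by simp
  qed
qed

context
  fixes G z
  assumes inv: "invertible (loop G z)"
begin

lemma xi_eq: "(mat z - A) ** xi G z = B ** stack G (mat 1) ** feed G z"
proof -
  have "loop G z ** xi G z = B ** stack G (mat 1)"
    by (simp add: xi_def matrix_mul_assoc matrix_inv_mult_right[OF inv])
  then show ?thesis
    by (simp add: loop_def feed_def mat_mul_simps matrix_mul_assoc algebra_simps)
qed

lemma lft_stack: "stack (lft G z) (mat 1) = stack G (mat 1) ** feed G z - C ** xi G z"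
  by (subst C_stack) (simp add: stack_mult stack_diff lft_def feed_def)

text \<open>Through the Lyapunov equation, \<open>P\<close> exchanges the pencil of \<open>A\<close>
  for that of - A^H. In the upper block this is the left interpolation condition, with
  \<open>P ** xi G z\<close> as quotient up to sign.\<close>

lemma xi_interp: "(mat z + conj_transpose A) ** (P ** xi G z) = conj_transpose C ** J_sig ** stack (lft G z) (mat 1)"
proof -
  have "conj_transpose A ** P = - (conj_transpose C ** J_sig ** C) - P ** A"
    by (metis add_diff_cancel_left' lyap)
  then have "(mat z + conj_transpose A) ** (P ** xi G z)
      = P ** ((mat z - A) ** xi G z) - conj_transpose C ** J_sig ** C ** xi G z"
    by (simp add: mat_mul_simps matrix_mul_assoc mat_mult_commute[symmetric])
  also have "\<dots> = conj_transpose C ** J_sig ** (stack G (mat 1) ** feed G z - C ** xi G z)"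
    unfolding xi_eq by (simp add: mat_mul_simps matrix_mul_assoc P_B)
  finally show ?thesis by (simp add: lft_stack)
qed

lemma inv_loop_right: "matrix_inv (loop G z) ** (mat z - A) = mat 1 + xi G z ** C2"
proof -
  have "matrix_inv (loop G z) ** loop G z = mat 1" by (rule matrix_inv_mult_left[OF inv])
  then show ?thesis
    by (simp add: loop_def xi_def mat_mul_simps matrix_mul_assoc algebra_simps)
qed

text \<open>In the columns belonging to \<open>W\<close> this is the right interpolation condition.
  It holds also at eigenvalues of \<open>A\<close>, as \<open>kap\<close> is built from the inverse
  of the loop.\<close>

lemma kap_eq: "kap G z ** (mat z - A) = C1 - lft G z ** C2"
proof -
  have "kap G z ** (mat z - A) = (C1 - G ** C2) ** (mat 1 + xi G z ** C2)"
    unfolding kap_def by (simp only: matrix_mul_assoc[symmetric] inv_loop_right)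
  then show ?thesis
    by (simp add: lft_def feed_def mat_mul_simps matrix_mul_assoc algebra_simps)
qed

text \<open>The exchange of pencils used for \<open>xi\<close>, now for the whole inverse of the
  loop. Its mixed block, rows of \<open>Z\<close> and columns of \<open>W\<close>, is the two-sided
  condition; the constant \<open>P\<close> contributes its block \<open>\<Gamma>\<close>.\<close>

lemma inv_loop_interp:
  "(mat z + conj_transpose A) ** (P ** matrix_inv (loop G z)) = P - conj_transpose C ** J_sig ** stack (kap G z) 0"
proof -
  let ?M = "matrix_inv (loop G z)"
  have "conj_transpose A ** P = - (conj_transpose C ** J_sig ** C) - P ** A"
    by (metis add_diff_cancel_left' lyap)
  then have "(mat z + conj_transpose A) ** (P ** ?M)
      = P ** ((mat z - A) ** ?M) - conj_transpose C ** J_sig ** C ** ?M"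
    by (simp add: mat_mul_simps matrix_mul_assoc mat_mult_commute[symmetric])
  also have "(mat z - A) ** ?M = mat 1 + B ** stack G (mat 1) ** C2 ** ?M"
    using matrix_inv_mult_right[OF inv]
    by (simp add: loop_def mat_mul_simps matrix_mul_assoc algebra_simps)
  also have "P ** (mat 1 + B ** stack G (mat 1) ** C2 ** ?M) - conj_transpose C ** J_sig ** C ** ?M
      = P + conj_transpose C ** J_sig ** (stack G (mat 1) ** C2 ** ?M - C ** ?M)"
    by (simp add: mat_mul_simps matrix_mul_assoc P_B)
  also have "stack G (mat 1) ** C2 ** ?M - C ** ?M = - stack (kap G z) 0"
    by (subst C_stack) (simp add: stack_mult stack_diff stack_minus kap_def mat_mul_simps matrix_mul_assoc)
  finally show ?thesis by (simp add: mat_mul_simps)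
qed

lemma \<Theta>0_feed:
  assumes "z \<notin> spectrum A"
  shows "\<Theta>0 z ** stack G (mat 1) ** feed G z = stack (lft G z) (mat 1)"
proof -
  have "xi G z = resolvent A z ** ((mat z - A) ** xi G z)"
    using resolvent_left[OF assms] by (simp add: matrix_mul_assoc)
  then have "C ** xi G z = C ** resolvent A z ** B ** stack G (mat 1) ** feed G z"
    by (simp add: xi_eq matrix_mul_assoc)
  then show ?thesis
    by (simp add: \<Theta>0_def lft_stack mat_mul_simps matrix_mul_assoc)
qed

end

lemma lft_contractive:
  assumes z: "Re z \<ge> 0" and inv: "invertible (loop G z)" and G: "\<And>u. norm (G *v u) \<le> norm u"
  shows "norm (lft G z *v w) \<le> norm w"
proof -
  define s where "s = xi G z *v w"
  define v where "v = feed G z *v w"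
  have v: "v = C2 *v s + w"
    by (simp add: v_def s_def feed_def matrix_vector_mult_add_rdistrib matrix_vector_mul_assoc)
  have s: "(mat z - A) *v s = B *v stack (G *v v) v"
    using arg_cong[OF xi_eq[OF inv], of "\<lambda>M. M *v w"]
    by (simp add: s_def v_def stack_mult_vec flip: matrix_vector_mul_assoc)
  have "(norm (G *v v - C1 *v s))\<^sup>2 \<le> (norm w)\<^sup>2"
    using loop_energy[OF s v G] z P_nonneg[of s] by (smt (verit) mult_nonneg_nonneg)
  then have "norm (G *v v - C1 *v s) \<le> norm w"
    by (rule power2_le_imp_le) simp
  moreover have "lft G z *v w = G *v v - C1 *v s"
    by (simp add: lft_def v_def s_def matrix_vector_mult_diff_rdistrib flip: matrix_vector_mul_assoc)
  ultimately show ?thesis by simp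
qed

lemma loop_holomorphic:
  assumes G: "mat_holomorphic_on G D" and inv: "\<And>z. z \<in> D \<Longrightarrow> invertible (loop (G z) z)"
  shows "mat_holomorphic_on (\<lambda>z. matrix_inv (loop (G z) z)) D" "mat_holomorphic_on (\<lambda>z. xi (G z) z) D"
    "mat_holomorphic_on (\<lambda>z. lft (G z) z) D" "mat_holomorphic_on (\<lambda>z. kap (G z) z) D"
proof -
  have st: "mat_holomorphic_on (\<lambda>z. stack (G z) (mat 1) :: complex^'m^('p + 'm)) D"
    using G by (simp add: mat_holomorphic_on_def split_sum_all)
  show M: "mat_holomorphic_on (\<lambda>z. matrix_inv (loop (G z) z)) D"
  proof (rule matrix_inv_holomorphic[OF _ inv])
    show "mat_holomorphic_on (\<lambda>z. loop (G z) z) D"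
      unfolding loop_def by (intro mat_holo_intros st)
  qed
  show xi: "mat_holomorphic_on (\<lambda>z. xi (G z) z) D"
    unfolding xi_def by (intro mat_holo_intros M st)
  show "mat_holomorphic_on (\<lambda>z. lft (G z) z) D"
    unfolding lft_def feed_def by (intro mat_holo_intros xi G)
  show "mat_holomorphic_on (\<lambda>z. kap (G z) z) D"
    unfolding kap_def by (intro mat_holo_intros M G)
qed

end

text \<open>Riemann's theorem one point at a time: \<open>U x\<close> is \<open>D\<close> without
  the exceptional points other than \<open>x\<close>. The values found at the points of
  \<open>E\<close> are then glued.\<close>

lemma scalar_extension:
  fixes f :: "complex \<Rightarrow> complex"
  assumes D: "open D" and E: "finite E" and f: "f holomorphic_on D - E"
    and b: "\<And>z. z \<in> D - E \<Longrightarrow> norm (f z) \<le> b"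
  obtains g where "g holomorphic_on D" "\<And>z. z \<in> D - E \<Longrightarrow> g z = f z"
proof -
  define U where "U = (\<lambda>x. D - (E - {x}))"
  have U: "open (U x)" for x using D E by (simp add: U_def open_Diff finite_imp_closed)
  have "\<exists>h. h holomorphic_on U x \<and> (\<forall>z\<in>U x - {x}. h z = f z)" if x: "x \<in> E \<inter> D" for x
  proof -
    have "U x - {x} = D - E" using x by (auto simp: U_def)
    then have hol: "f holomorphic_on U x - {x}" using f by simp
    have xU: "x \<in> interior (U x)" using U[of x] x by (simp add: interior_open U_def)
    have xU': "x \<in> U x" using x by (simp add: U_def)
    have "eventually (\<lambda>z. norm (f z) \<le> b) (at x)"
      using eventually_at_in_open[OF U xU'] by eventually_elim (use b \<open>U x - {x} = D - E\<close> in auto)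
    then show ?thesis using holomorphic_on_extend_bounded[OF hol xU] by blast
  qed
  then obtain h where h: "\<And>x. x \<in> E \<inter> D \<Longrightarrow> h x holomorphic_on U x"
    "\<And>x z. x \<in> E \<inter> D \<Longrightarrow> z \<in> U x - {x} \<Longrightarrow> h x z = f z"
    by metis
  define g where "g = (\<lambda>z. if z \<in> E then h z z else f z)"
  have gf: "g z = f z" if "z \<in> D - E" for z using that by (simp add: g_def)
  show ?thesis
  proof
    show "g holomorphic_on D"
    proof (rule no_isolated_singularity'[where K = "E \<inter> D"])
      show "g holomorphic_on D - E \<inter> D"
        using f by (rule holomorphic_transform[OF holomorphic_on_subset]) (auto simp: gf)
      fix x assume x: "x \<in> E \<inter> D"
      then have xU: "x \<in> U x" by (simp add: U_def)
      have "isCont (h x) x"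
        using holomorphic_on_imp_continuous_on[OF h(1)[OF x]] continuous_on_eq_continuous_at[OF U] xU by blast
      then have "(h x \<longlongrightarrow> h x x) (at x)" by (simp add: isCont_def)
      moreover have "eventually (\<lambda>z. h x z = g z) (at x)"
        using eventually_at_in_open[OF U xU] by eventually_elim (use x h(2)[OF x] in \<open>auto simp: g_def U_def\<close>)
      ultimately have "(g \<longlongrightarrow> h x x) (at x)" by (simp add: tendsto_cong)
      then show "(g \<longlongrightarrow> g x) (at x within D)"
        using x by (auto simp: g_def intro: tendsto_within_subset)
    qed (use D E in auto)
  qed (rule gf)
qed

text \<open>Contractivity bounds each entry by 1, so the singularities are removable; at the
  exceptional points the norm bound follows by continuity.\<close>

lemma schur_extension:
  fixes G0 :: "complex \<Rightarrow> complex^'m::finite^'p::finite"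
  assumes E: "finite E" and hol: "mat_holomorphic_on G0 (right_half_plane - E)"
    and le: "\<And>z v. z \<in> right_half_plane - E \<Longrightarrow> norm (G0 z *v v) \<le> norm v"
  obtains G where "G \<in> schur_class" "\<And>z. z \<in> right_half_plane - E \<Longrightarrow> G z = G0 z"
proof -
  have "\<exists>g. g holomorphic_on right_half_plane \<and> (\<forall>z\<in>right_half_plane - E. g z = G0 z $ i $ j)" for i j
  proof -
    have "norm (G0 z $ i $ j) \<le> 1" if "z \<in> right_half_plane - E" for z
    proof -
      have "norm (G0 z $ i $ j) = norm ((G0 z *v axis j 1) $ i)" by (simp add: matrix_vector_axis)
      also have "\<dots> \<le> norm (G0 z *v axis j 1)" by (rule Finite_Cartesian_Product.norm_nth_le)
      also have "\<dots> \<le> 1" using le[OF that, of "axis j 1"] by simp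
      finally show ?thesis .
    qed
    moreover have "(\<lambda>z. G0 z $ i $ j) holomorphic_on right_half_plane - E"
      using hol by (simp add: mat_holomorphic_on_def)
    ultimately obtain g where "g holomorphic_on right_half_plane" "\<And>z. z \<in> right_half_plane - E \<Longrightarrow> g z = G0 z $ i $ j"
      using scalar_extension[OF open_rhp E, of "\<lambda>z. G0 z $ i $ j" 1] by metis
    then show ?thesis by blast
  qed
  then obtain g where g: "\<And>i j. g i j holomorphic_on right_half_plane"
    "\<And>i j z. z \<in> right_half_plane - E \<Longrightarrow> g i j z = G0 z $ i $ j"
    by metis
  define G where "G = (\<lambda>z. \<chi> i j. g i j z)"
  have GG0: "G z = G0 z" if "z \<in> right_half_plane - E" for z
    using g(2)[OF that] by (simp add: G_def vec_eq_iff)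
  have Ghol: "mat_holomorphic_on G right_half_plane"
    using g(1) by (simp add: mat_holomorphic_on_def G_def)
  have "norm (G z *v v) \<le> norm v" if z: "z \<in> right_half_plane" for z v
  proof (rule tendsto_upperbound)
    show "((\<lambda>z. norm (G z *v v)) \<longlongrightarrow> norm (G z *v v)) (at z)"
      by (intro tendsto_norm tendsto_matrix_vector tendsto_const holomorphic_tendsto[OF Ghol open_rhp z])
    define s where "s = right_half_plane - (E - {z})"
    have s: "open s" "z \<in> s" using z E by (auto simp: s_def open_Diff finite_imp_closed)
    show "\<forall>\<^sub>F z in at z. norm (G z *v v) \<le> norm v"
      using eventually_at_in_open[OF s] by eventually_elim (use GG0 le in \<open>auto simp: s_def\<close>)
  qed simp
  then show ?thesis using that schur_classI[OF Ghol] GG0 by blast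
qed

definition leftc :: "'a^('p::finite + 'm::finite)^'k::finite \<Rightarrow> 'a^'p^'k" where
  "leftc M = (\<chi> i. upper (M $ i))"

definition rightc :: "'a^('p::finite + 'm::finite)^'k::finite \<Rightarrow> 'a^'m^'k" where
  "rightc M = (\<chi> i. lower (M $ i))"

lemma beside_leftc_rightc: "beside (leftc M) (rightc M) = M"
  by (simp add: vec_eq_iff leftc_def rightc_def stack_upper_lower)

lemma mat_holomorphic_leftc: "mat_holomorphic_on F D \<Longrightarrow> mat_holomorphic_on (\<lambda>z. leftc (F z)) D"
  by (simp add: mat_holomorphic_on_def leftc_def upper_def)

lemma mat_holomorphic_rightc: "mat_holomorphic_on F D \<Longrightarrow> mat_holomorphic_on (\<lambda>z. rightc (F z)) D"
  by (simp add: mat_holomorphic_on_def rightc_def lower_def)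

lemma mat_holomorphic_beside:
  "mat_holomorphic_on F D \<Longrightarrow> mat_holomorphic_on G D \<Longrightarrow> mat_holomorphic_on (\<lambda>z. beside (F z) (G z)) D"
  by (simp add: mat_holomorphic_on_def split_sum_all)

lemma upper_mult: "upper (M ** Q) = upper M ** Q" and lower_mult: "lower (M ** Q) = lower M ** Q"
  by (simp_all add: vec_eq_iff upper_def lower_def matrix_matrix_mult_def)

lemma block_lft:
  "block11 M ** G + block12 M = upper (M ** stack G (mat 1))"
  "block21 M ** G + block22 M = lower (M ** stack G (mat 1))"
  by (simp_all add: vec_eq_iff upper_def lower_def block11_def block12_def block21_def block22_def
      matrix_matrix_mult_def sum_UNIV_plus mat_def if_distrib[of "\<lambda>x. _ * x"] cong: if_cong)

text \<open>Common factors are cancelled by induction on the degree of the denominator. Equality is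
  confined to points with q nonzero: at a zero of q the quotient is 0 by convention before
  cancellation, but may be different after it.\<close>

lemma rational_reduction:
  fixes p q :: "complex poly"
  assumes "q \<noteq> 0"
  shows "\<exists>p' q'. q' \<noteq> 0 \<and> coprime p' q' \<and> (\<forall>z. poly q z \<noteq> 0 \<longrightarrow> poly p z / poly q z = poly p' z / poly q' z)"
  using assms
proof (induction "degree q" arbitrary: p q rule: less_induct)
  case less
  show ?case
  proof (cases "coprime p q")
    case True
    with less.prems show ?thesis by blast
  next
    case False
    then obtain d where d: "d dvd p" "d dvd q" "\<not> is_unit d"
      unfolding coprime_def by blast
    then obtain p1 q1 where pq: "p = d * p1" "q = d * q1" by (auto elim!: dvdE)
    have nz: "d \<noteq> 0" "q1 \<noteq> 0" using pq less.prems by auto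
    have "degree d > 0" using d(3) nz(1) by (simp add: is_unit_iff_degree)
    then have "degree q1 < degree q" using nz by (simp add: pq degree_mult_eq)
    from less.hyps[OF this nz(2), of p1] obtain p' q' where r: "q' \<noteq> 0" "coprime p' q'"
      "\<forall>z. poly q1 z \<noteq> 0 \<longrightarrow> poly p1 z / poly q1 z = poly p' z / poly q' z"
      by blast
    moreover have "\<forall>z. poly q z \<noteq> 0 \<longrightarrow> poly p z / poly q z = poly p' z / poly q' z"
      using r(3) by (auto simp: pq)
    ultimately show ?thesis by blast
  qed
qed

section \<open>Rationality, the J-inner property and transforms of Schur functions\<close>

context state_space
begin

text \<open>By Cramer's rule the entries of the resolvent share the characteristic polynomial as
  denominator, and each entry of \<open>\<Theta>0\<close> is brought to lowest terms separately. On
  the spectrum the value of \<open>resolvent\<close> is meaningless, hence agreement off it.\<close>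

lemma rational_Theta:
  obtains \<Theta> where "rational_matrix \<Theta>" "\<And>z. z \<notin> spectrum A \<Longrightarrow> \<Theta> z = \<Theta>0 z"
proof -
  obtain q where q: "q \<noteq> 0" "\<And>z. poly q z = det (mat z - A)"
    using char_poly_exists by blast
  have qz: "poly q z \<noteq> 0 \<longleftrightarrow> z \<notin> spectrum A" for z
    by (simp add: q spectrum_def invertible_det_nz)
  define num where "num = (\<lambda>k l z. det (\<chi> i j. if j = k then (if i = l then 1 else 0) else (mat z - A) $ i $ j))"
  have num: "polynomial_fun (num k l)" for k l
    unfolding num_def
  proof (rule polynomial_fun_det)
    fix i j
    show "polynomial_fun (\<lambda>z. (\<chi> i j. if j = k then (if i = l then 1 else 0) else (mat z - A) $ i $ j) $ i $ j)"
      by (cases "j = k"; cases "i = j") (auto simp: mat_def intro!: polynomial_fun_diff)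
  qed
  have res: "resolvent A z $ k $ l = num k l z / poly q z" if "z \<notin> spectrum A" for k l z
    using that by (simp add: resolvent_def spectrum_def matrix_inv_cramer num_def q)
  have "\<exists>p' q'. q' \<noteq> 0 \<and> coprime p' q' \<and> (\<forall>z. z \<notin> spectrum A \<longrightarrow> \<Theta>0 z $ i $ j = poly p' z / poly q' z)" for i j
  proof -
    have "polynomial_fun (\<lambda>z. (if i = j then 1 else 0) * poly q z - (\<Sum>l\<in>UNIV. (\<Sum>k\<in>UNIV. C $ i $ k * num k l z) * B $ l $ j))"
      by (intro polynomial_fun_diff polynomial_fun_mult polynomial_fun_sum polynomial_fun_const num)
         (auto simp: polynomial_fun_def)
    then obtain p where p: "\<And>z. poly p z = (if i = j then 1 else 0) * poly q z - (\<Sum>l\<in>UNIV. (\<Sum>k\<in>UNIV. C $ i $ k * num k l z) * B $ l $ j)"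
      unfolding polynomial_fun_def by metis
    obtain p' q' where r: "q' \<noteq> 0" "coprime p' q'" "\<And>z. poly q z \<noteq> 0 \<Longrightarrow> poly p z / poly q z = poly p' z / poly q' z"
      using rational_reduction[OF q(1), of p] by metis
    have "\<Theta>0 z $ i $ j = poly p' z / poly q' z" if z: "z \<notin> spectrum A" for z
    proof -
      have "\<Theta>0 z $ i $ j = (if i = j then 1 else 0) - (\<Sum>l\<in>UNIV. (\<Sum>k\<in>UNIV. C $ i $ k * (num k l z / poly q z)) * B $ l $ j)"
        by (simp add: \<Theta>0_def matrix_matrix_mult_def mat_def res[OF z])
      also have "\<dots> = poly p z / poly q z"
        using z qz[of z] by (simp add: p diff_divide_distrib sum_divide_distrib sum_distrib_right sum_distrib_left)
      also have "\<dots> = poly p' z / poly q' z" using r(3) qz z by blast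
      finally show ?thesis .
    qed
    with r show ?thesis by blast
  qed
  then obtain p' q' where pq: "\<And>i j. q' i j \<noteq> 0" "\<And>i j. coprime (p' i j) (q' i j)"
    "\<And>i j z. z \<notin> spectrum A \<Longrightarrow> \<Theta>0 z $ i $ j = poly (p' i j) z / poly (q' i j) z"
    by metis
  show ?thesis
  proof
    show "rational_matrix (\<lambda>z. \<chi> i j. poly (p' i j) z / poly (q' i j) z)"
      unfolding rational_matrix_def
    proof (intro allI)
      fix i j
      show "\<exists>P Q. Q \<noteq> 0 \<and> coprime P Q \<and> (\<forall>z. (\<chi> i j. poly (p' i j) z / poly (q' i j) z) $ i $ j = poly P z / poly Q z)"
        by (rule exI[of _ "p' i j"], rule exI[of _ "q' i j"]) (simp add: pq)
    qed
    show "(\<chi> i j. poly (p' i j) z / poly (q' i j) z) = \<Theta>0 z" if "z \<notin> spectrum A" for z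
      using pq(3)[OF that] by (simp add: vec_eq_iff)
  qed
qed

lemma \<Theta>0_holomorphic: "mat_holomorphic_on \<Theta>0 (UNIV - spectrum A)"
proof -
  have "mat_holomorphic_on (\<lambda>z. mat 1 - C ** resolvent A z ** B) (UNIV - spectrum A)"
    by (intro mat_holo_intros resolvent_holomorphic) auto
  then show ?thesis by (simp add: \<Theta>0_def[abs_def])
qed

lemma pos_semidef_limit:
  assumes M: "(M \<longlongrightarrow> M0) (at z)" and ps: "eventually (\<lambda>w. pos_semidef (M w)) (at (z :: complex))"
  shows "pos_semidef M0"
  unfolding pos_semidef_def
proof (intro allI conjI)
  fix v
  have l: "((\<lambda>w. cinner (M w *v v) v) \<longlongrightarrow> cinner (M0 *v v) v) (at z)"
    by (intro tendsto_cinner tendsto_matrix_vector M tendsto_const)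
  have "((\<lambda>w. Im (cinner (M w *v v) v)) \<longlongrightarrow> Im (cinner (M0 *v v) v)) (at z)"
    by (intro tendsto_Im l)
  moreover have "eventually (\<lambda>w. Im (cinner (M w *v v) v) = 0) (at z)"
    using ps by eventually_elim (simp add: pos_semidef_def)
  ultimately have "((\<lambda>w. 0) \<longlongrightarrow> Im (cinner (M0 *v v) v)) (at z)"
    by (rule Lim_transform_eventually)
  then show "Im (cinner (M0 *v v) v) = 0"
    by (simp add: tendsto_const_iff)
  have "eventually (\<lambda>w. 0 \<le> Re (cinner (M w *v v) v)) (at z)"
    using ps by eventually_elim (simp add: pos_semidef_def)
  then show "0 \<le> Re (cinner (M0 *v v) v)"
    by (rule tendsto_lowerbound[OF tendsto_Re[OF l]]) simp
qed

text \<open>After cancellation \<open>\<Theta>\<close> may be analytic at points of the spectrum of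
  \<open>A\<close>; there the inequality is a limit of the inequality at neighbouring
  points.\<close>

lemma rational_Theta_J_inner:
  assumes rat: "rational_matrix \<Theta>" and eq: "\<And>z. z \<notin> spectrum A \<Longrightarrow> \<Theta> z = \<Theta>0 z"
    and ax: "\<And>z. Re z = 0 \<Longrightarrow> z \<notin> spectrum A"
  shows "rational_J_inner \<Theta>"
  unfolding rational_J_inner_def
proof (intro conjI allI impI ballI rat)
  have op: "open (UNIV - spectrum A)" by (simp add: open_Diff finite_imp_closed)
  fix z :: complex assume z: "Re z = 0"
  have "mat_holomorphic_on \<Theta> (UNIV - spectrum A)"
    by (rule mat_holomorphic_on_cong[OF \<Theta>0_holomorphic]) (simp add: eq)
  then show "mat_analytic_at \<Theta> z"
    unfolding mat_analytic_at_def mat_holomorphic_on_def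
    using op ax[OF z] by (meson DiffI UNIV_I analytic_on_def analytic_on_open analytic_on_analytic_at)
  show "conj_transpose (\<Theta> z) ** J_sig ** \<Theta> z = J_sig"
    using \<Theta>0_J_unitary[OF ax[OF z] z] by (simp add: eq[OF ax[OF z]])
next
  fix z assume z: "z \<in> right_half_plane" and an: "mat_analytic_at \<Theta> z"
  have lim: "(\<Theta> \<longlongrightarrow> \<Theta> z) (at z)"
  proof (rule mat_tendstoI)
    fix i j
    obtain s where "open s" "z \<in> s" "(\<lambda>w. \<Theta> w $ i $ j) holomorphic_on s"
      using an unfolding mat_analytic_at_def analytic_at by blast
    then have "isCont (\<lambda>w. \<Theta> w $ i $ j) z"
      using holomorphic_on_imp_continuous_on continuous_on_eq_continuous_at by blast
    then show "((\<lambda>w. \<Theta> w $ i $ j) \<longlongrightarrow> \<Theta> z $ i $ j) (at z)" by (simp add: isCont_def)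
  qed
  show "pos_semidef (J_sig - conj_transpose (\<Theta> z) ** J_sig ** \<Theta> z)"
  proof (rule pos_semidef_limit)
    show "((\<lambda>w. J_sig - conj_transpose (\<Theta> w) ** J_sig ** \<Theta> w) \<longlongrightarrow> J_sig - conj_transpose (\<Theta> z) ** J_sig ** \<Theta> z) (at z)"
      by (intro tendsto_diff tendsto_matrix_mult tendsto_conj_transpose lim tendsto_const)
    have "eventually (\<lambda>w. w \<in> right_half_plane - {z}) (at z)"
      by (rule eventually_at_in_open[OF open_rhp z])
    then show "\<forall>\<^sub>F w in at z. pos_semidef (J_sig - conj_transpose (\<Theta> w) ** J_sig ** \<Theta> w)"
      using eventually_at_spectrum[of A z]
      by eventually_elim (use \<Theta>0_J_contractive in \<open>auto simp: eq defect_def\<close>)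
  qed
qed

lemma schur_loop_invertible:
  assumes "G \<in> schur_class" "z \<in> right_half_plane"
  shows "invertible (loop (G z) z)"
  using assms(2) by (intro loop_invertible schur_norm[OF assms]) (simp_all add: right_half_plane_def)

lemma lft_schur:
  assumes G: "G \<in> schur_class"
  shows "(\<lambda>z. lft (G z) z) \<in> schur_class"
proof (rule schur_classI)
  show "mat_holomorphic_on (\<lambda>z. lft (G z) z) right_half_plane"
    by (rule loop_holomorphic(3)[OF schur_holomorphic[OF G] schur_loop_invertible[OF G]])
  fix z v assume z: "z \<in> right_half_plane"
  show "norm (lft (G z) z *v v) \<le> norm v"
    by (rule lft_contractive[OF _ schur_loop_invertible[OF G z] schur_norm[OF G z]])
       (use z in \<open>simp add: right_half_plane_def\<close>)
qed

lemma lft_formula: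
  assumes inv: "invertible (loop G z)" and z: "z \<notin> spectrum A"
  shows "invertible (block21 (\<Theta>0 z) ** G + block22 (\<Theta>0 z))"
    and "(block11 (\<Theta>0 z) ** G + block12 (\<Theta>0 z)) ** matrix_inv (block21 (\<Theta>0 z) ** G + block22 (\<Theta>0 z)) = lft G z"
proof -
  let ?M = "\<Theta>0 z ** stack G (mat 1)"
  have D: "lower ?M ** feed G z = mat 1" and N: "upper ?M ** feed G z = lft G z"
    using \<Theta>0_feed[OF inv z] by (metis lower_mult lower_stack, metis upper_mult upper_stack)
  show i: "invertible (block21 (\<Theta>0 z) ** G + block22 (\<Theta>0 z))"
    unfolding block_lft invertible_right_inverse using D by blast
  then have "matrix_inv (lower ?M) ** (lower ?M ** feed G z) = feed G z"
    unfolding block_lft by (simp add: matrix_mul_assoc matrix_inv_mult_left)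
  then have "matrix_inv (lower ?M) = feed G z" by (simp add: D)
  then show "(block11 (\<Theta>0 z) ** G + block12 (\<Theta>0 z)) ** matrix_inv (block21 (\<Theta>0 z) ** G + block22 (\<Theta>0 z)) = lft G z"
    unfolding block_lft by (simp add: N)
qed

text \<open>\<open>lft\<close> is holomorphic on the whole half-plane and satisfies the formula off
  the finite spectrum, so it is what remains of the formula once removable singularities are
  removed.\<close>

lemma is_lft_iff:
  assumes eq: "\<And>z. z \<notin> spectrum A \<Longrightarrow> \<Theta> z = \<Theta>0 z" and G: "G \<in> schur_class"
  shows "is_lft \<Theta> G S \<longleftrightarrow> (\<forall>z\<in>right_half_plane. S z = lft (G z) z)"
proof
  have ev: "eventually (\<lambda>w. w \<in> right_half_plane \<and> w \<notin> spectrum A) (at z)" if "z \<in> right_half_plane" for z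
    using eventually_at_in_open[OF open_rhp that] eventually_at_spectrum[of A z] by eventually_elim auto
  have formula: "invertible (block21 (\<Theta> w) ** G w + block22 (\<Theta> w))"
    "(block11 (\<Theta> w) ** G w + block12 (\<Theta> w)) ** matrix_inv (block21 (\<Theta> w) ** G w + block22 (\<Theta> w)) = lft (G w) w"
    if "w \<in> right_half_plane" "w \<notin> spectrum A" for w
    using lft_formula[OF schur_loop_invertible[OF G that(1)] that(2)] by (simp_all add: eq[OF that(2)])
  have holl: "mat_holomorphic_on (\<lambda>z. lft (G z) z) right_half_plane"
    using lft_schur[OF G] by (rule schur_holomorphic)
  {
    assume S: "is_lft \<Theta> G S"
    show "\<forall>z\<in>right_half_plane. S z = lft (G z) z"
    proof
      fix z assume z: "z \<in> right_half_plane"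
      have Sz: "(S \<longlongrightarrow> S z) (at z)"
        using S by (intro holomorphic_tendsto[OF _ open_rhp z]) (simp add: is_lft_def)
      have l: "((\<lambda>z. lft (G z) z) \<longlongrightarrow> lft (G z) z) (at z)"
        by (rule holomorphic_tendsto[OF holl open_rhp z])
      have "(S \<longlongrightarrow> lft (G z) z) (at z)"
      proof (rule Lim_transform_eventually[OF l])
        have "\<forall>\<^sub>F w in at z. S w = (block11 (\<Theta> w) ** G w + block12 (\<Theta> w)) ** matrix_inv (block21 (\<Theta> w) ** G w + block22 (\<Theta> w))"
          using S z unfolding is_lft_def eventually_cosparse_open_eq[OF open_rhp]
          by (auto elim!: eventually_mono)
        then show "\<forall>\<^sub>F w in at z. lft (G w) w = S w"
          using ev[OF z] by eventually_elim (simp add: formula)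
      qed
      with Sz show "S z = lft (G z) z"
        by (rule tendsto_unique[OF at_neq_bot])
    qed
  }
  assume S: "\<forall>z\<in>right_half_plane. S z = lft (G z) z"
  show "is_lft \<Theta> G S"
    unfolding is_lft_def eventually_cosparse_open_eq[OF open_rhp]
  proof (intro conjI ballI)
    show "mat_holomorphic_on S right_half_plane"
      using holl by (rule mat_holomorphic_on_cong) (simp add: S)
    fix z assume "z \<in> right_half_plane"
    from ev[OF this] show "\<forall>\<^sub>F z in at z. invertible (block21 (\<Theta> z) ** G z + block22 (\<Theta> z)) \<and>
        S z = (block11 (\<Theta> z) ** G z + block12 (\<Theta> z)) ** matrix_inv (block21 (\<Theta> z) ** G z + block22 (\<Theta> z))"
      by eventually_elim (simp add: formula S)
  qed
qed

section \<open>Inverting the transform\<close>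

lemma Pinv_hermitian: "conj_transpose Pinv = Pinv"
proof -
  have "conj_transpose Pinv ** P = mat 1"
    using arg_cong[OF P_Pinv, of conj_transpose] by (simp add: conj_transpose_mult herm conj_transpose_mat)
  then show ?thesis
    by (metis P_Pinv matrix_mul_assoc matrix_mul_lid matrix_mul_rid)
qed

text \<open>Inverting the loop: \<open>(\<alpha>, -\<beta>) = (I, -S) \<Theta>0\<close>, so that \<open>S\<close> is the transform of
  \<open>\<alpha>\<^sup>-\<^sup>1 \<beta>\<close>. The dual energy balance is the one at the reflected point \<open>- cnj z\<close>.\<close>

definition row where "row S k = beside (mat 1) (- S) - k ** B"

lemma dual_energy:
  assumes k: "k ** (mat z - A) = C1 - S ** C2"
    and p: "p = Pinv *v (conj_transpose k *v e)"
  shows "Re (cinner (J_sig *v (conj_transpose (row S k) *v e)) (conj_transpose (row S k) *v e))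
      = (norm e)\<^sup>2 - (norm (conj_transpose S *v e))\<^sup>2 - 2 * Re z * Re (cinner (P *v p) p)"
    and "conj_transpose (row S k) *v e = 0 \<Longrightarrow> - cnj z \<notin> spectrum A \<Longrightarrow> e = 0"
proof -
  \<comment> \<open>The adjoint of the row (1, - S), applied to \<open>e\<close>.\<close>
  define g where "g = stack e (- (conj_transpose S *v e))"
  have Pp: "P *v p = conj_transpose k *v e"
    by (simp add: p matrix_vector_mul_assoc matrix_mul_assoc P_Pinv)
  have Bk: "conj_transpose B *v (conj_transpose k *v e) = J_sig *v (C *v p)"
    by (simp add: B_def p conj_transpose_mult conj_transpose_J_sig Pinv_hermitian matrix_vector_mul_assoc matrix_mul_assoc)
  have r: "conj_transpose (row S k) *v e = g - J_sig *v (C *v p)"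
    by (simp add: row_def g_def Bk[symmetric] conj_transpose_diff conj_transpose_beside conj_transpose_mult
        conj_transpose_mat conj_transpose_minus stack_mult_vec matrix_vector_mult_diff_rdistrib
        matrix_vector_minus_left flip: matrix_vector_mul_assoc)
  have "beside (mat 1) (- S) ** C = C1 - S ** C2"
    by (subst C_stack) (simp add: beside_mult_stack mat_mul_simps)
  then have "conj_transpose (beside (mat 1) (- S) ** C) = conj_transpose (k ** (mat z - A))"
    by (simp add: k)
  then have "conj_transpose C *v g = (mat (cnj z) - conj_transpose A) *v (P *v p)"
    unfolding Pp by (simp add: g_def conj_transpose_mult conj_transpose_beside conj_transpose_diff conj_transpose_mat
        conj_transpose_minus stack_mult_vec matrix_vector_minus_left matrix_vector_mul_assoc[symmetric])
       (metis (no_types, lifting) conj_transpose_minus matrix_vector_minus_left matrix_vector_mul_assoc matrix_vector_mul_lid stack_mult_vec)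
  moreover have "conj_transpose A *v (P *v p) = - (conj_transpose C *v (J_sig *v (C *v p))) - P *v (A *v p)"
    by (metis add_diff_cancel_left' lyap_vec)
  ultimately have "P *v ((mat (- cnj z) - A) *v p) = - (conj_transpose C *v g) + conj_transpose C *v (J_sig *v (C *v p))"
    by (simp add: mat_vec_simps)
  also have "\<dots> = P *v (B *v (C *v p - J_sig *v g))"
  proof -
    have "J_sig *v (J_sig *v g) = g" by (simp add: matrix_vector_mul_assoc J_sig_J_sig)
    moreover have "P *v (B *v i) = conj_transpose C *v (J_sig *v i)" for i
      by (simp add: matrix_vector_mul_assoc P_B)
    ultimately show ?thesis
      by (simp add: matrix_vector_mult_diff_distrib)
  qed
  finally have "Pinv *v (P *v ((mat (- cnj z) - A) *v p)) = Pinv *v (P *v (B *v (C *v p - J_sig *v g)))"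
    by simp
  \<comment> \<open>So \<open>p\<close> is a state of the original system at the point - cnj z, with
    input C p - J g and output - J g. The energy balance there is the dual one.\<close>
  then have eqp: "(mat (- cnj z) - A) *v p = B *v (C *v p - J_sig *v g)"
    by (simp add: matrix_vector_mul_assoc matrix_mul_assoc Pinv_P)
  have r': "conj_transpose (row S k) *v e = - (J_sig *v (C *v p - J_sig *v g))"
    by (simp add: r matrix_vector_mult_diff_distrib matrix_vector_mul_assoc J_sig_J_sig)
  have JJ: "cinner (J_sig *v (J_sig *v u)) (J_sig *v u) = cinner (J_sig *v u) u" for u :: "complex^('p + 'm)"
    by (simp add: matrix_vector_mul_assoc J_sig_J_sig cinner_J_sig_right)
  have "(mat (- cnj z) - A) *v p = B *v (C *v p - J_sig *v g) + 0" using eqp by simp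
  from energy[OF this]
  have "Re (cinner (J_sig *v (C *v p - J_sig *v g)) (C *v p - J_sig *v g))
      = - 2 * Re z * Re (cinner (P *v p) p) + Re (cinner (J_sig *v g) g)"
    by (simp add: JJ matrix_vector_minus_right cinner_minus_left cinner_minus_right)
  moreover have "Re (cinner (J_sig *v g) g) = (norm e)\<^sup>2 - (norm (conj_transpose S *v e))\<^sup>2"
    by (simp add: g_def cinner_J_sig)
  ultimately show "Re (cinner (J_sig *v (conj_transpose (row S k) *v e)) (conj_transpose (row S k) *v e))
      = (norm e)\<^sup>2 - (norm (conj_transpose S *v e))\<^sup>2 - 2 * Re z * Re (cinner (P *v p) p)"
    unfolding r' by (simp add: matrix_vector_minus_right cinner_minus_left cinner_minus_right JJ)
  \<comment> \<open>A vanishing row makes the input vanish; \<open>p\<close> then lies in the kernel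
    of the pencil at - cnj z, hence is 0, and g = 0 follows.\<close>
  assume 0: "conj_transpose (row S k) *v e = 0" and ns: "- cnj z \<notin> spectrum A"
  have "J_sig *v (J_sig *v (C *v p - J_sig *v g)) = 0" using 0 by (simp add: r')
  then have "C *v p - J_sig *v g = 0" by (simp only: matrix_vector_mul_assoc J_sig_J_sig matrix_vector_mul_lid)
  then have "p = 0" using eqp resolvent_left_vec[OF ns, of p] by simp
  then have "g = 0" using 0 by (simp add: r)
  then show "e = 0" by (simp add: g_def stack_zero[symmetric])
qed

text \<open>Off the spectrum \<open>k\<close> is (1, - S) C times the resolvent, so the row is (1, -
  S) times \<open>\<Theta>0 z\<close>. If the row annihilates (G, 1), then (1, - S) annihilates
  (lft, 1).\<close>

lemma row_lft:
  assumes inv: "invertible (loop G z)" and z: "z \<notin> spectrum A"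
    and k: "k ** (mat z - A) = C1 - S ** C2"
    and G: "leftc (row S k) ** G + rightc (row S k) = 0"
  shows "S = lft G z"
proof -
  have "beside (mat 1) (- S) ** C = C1 - S ** C2"
    by (subst C_stack) (simp add: beside_mult_stack mat_mul_simps)
  then have "beside (mat 1) (- S) ** C ** resolvent A z = k ** ((mat z - A) ** resolvent A z)"
    by (simp add: k matrix_mul_assoc)
  then have "beside (mat 1) (- S) ** C ** resolvent A z = k"
    by (simp add: resolvent_right[OF z])
  then have "beside (mat 1) (- S) ** \<Theta>0 z = row S k"
    by (simp add: \<Theta>0_def row_def mat_mul_simps matrix_mul_assoc)
  then have "beside (mat 1) (- S) ** stack (lft G z) (mat 1) = row S k ** stack G (mat 1) ** feed G z"
    by (simp add: \<Theta>0_feed[OF inv z, symmetric] matrix_mul_assoc)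
  also have "row S k ** stack G (mat 1) = 0"
    using G by (subst beside_leftc_rightc[symmetric]) (simp add: beside_mult_stack)
  finally show ?thesis
    by (simp add: beside_mult_stack mat_mul_simps)
qed

text \<open>The assumed inequality says |\<beta>^H e| <= |\<alpha>^H e| for the two parts of the
  row. Hence \<open>\<alpha>\<close> is invertible off a finite set, and - \<alpha>^{-1} \<beta> is
  contractive there because its adjoint is; its extension is \<open>G\<close>.\<close>

lemma lft_inverse:
  assumes S: "S \<in> schur_class" and khol: "mat_holomorphic_on k right_half_plane"
    and k: "\<And>z. z \<in> right_half_plane \<Longrightarrow> k z ** (mat z - A) = C1 - S z ** C2"
    and le: "\<And>z e. z \<in> right_half_plane \<Longrightarrow>
      2 * Re z * Re (cinner (P *v (Pinv *v (conj_transpose (k z) *v e))) (Pinv *v (conj_transpose (k z) *v e)))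
      \<le> (norm e)\<^sup>2 - (norm (conj_transpose (S z) *v e))\<^sup>2"
  obtains G where "G \<in> schur_class" "\<And>z. z \<in> right_half_plane \<Longrightarrow> S z = lft (G z) z"
proof -
  \<comment> \<open>The reflected spectrum: where - cnj z is an eigenvalue of \<open>A\<close>, the
    energy argument cannot exclude a kernel of \<open>\<alpha>\<close>.\<close>
  define E where "E = (\<lambda>w. - cnj w) ` spectrum A"
  have finE: "finite E" by (simp add: E_def)
  have notE: "- cnj z \<notin> spectrum A" if "z \<notin> E" for z
  proof
    assume "- cnj z \<in> spectrum A"
    then have "- cnj (- cnj z) \<in> E" unfolding E_def by (rule imageI)
    with that show False by simp
  qed
  define r where "r = (\<lambda>z. row (S z) (k z))"
  define \<alpha> where "\<alpha> = (\<lambda>z. leftc (r z))"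
  define \<beta> where "\<beta> = (\<lambda>z. rightc (r z))"
  have r_adj: "conj_transpose (r z) *v e = stack (conj_transpose (\<alpha> z) *v e) (conj_transpose (\<beta> z) *v e)" for z e
  proof -
    have "r z = beside (\<alpha> z) (\<beta> z)" by (simp add: \<alpha>_def \<beta>_def beside_leftc_rightc)
    then show ?thesis by (simp add: conj_transpose_beside stack_mult_vec)
  qed
  have ab: "norm (conj_transpose (\<beta> z) *v e) \<le> norm (conj_transpose (\<alpha> z) *v e)" if z: "z \<in> right_half_plane" for z e
  proof (rule power2_le_imp_le)
    have "Re (cinner (J_sig *v (conj_transpose (r z) *v e)) (conj_transpose (r z) *v e)) \<ge> 0"
      unfolding r_def dual_energy(1)[OF k[OF z] refl] using le[OF z, of e] by linarith
    then show "(norm (conj_transpose (\<beta> z) *v e))\<^sup>2 \<le> (norm (conj_transpose (\<alpha> z) *v e))\<^sup>2"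
      unfolding r_adj cinner_J_sig by simp
  qed simp
  have inv\<alpha>: "invertible (\<alpha> z)" if z: "z \<in> right_half_plane - E" for z
  proof -
    have zr: "z \<in> right_half_plane" and nE: "- cnj z \<notin> spectrum A" using z notE by auto
    have "e = 0" if e: "conj_transpose (\<alpha> z) *v e = 0" for e
    proof -
      have "conj_transpose (\<beta> z) *v e = 0" using ab[OF zr, of e] e by simp
      then have "conj_transpose (row (S z) (k z)) *v e = 0"
        using r_adj[of z e] e by (simp add: r_def stack_zero)
      then show ?thesis by (rule dual_energy(2)[OF k[OF zr] refl _ nE])
    qed
    then have "invertible (conj_transpose (\<alpha> z))" by (simp add: invertible_iff_inj)
    then show ?thesis by (simp add: invertible_conj_transpose)
  qed
  have rhol: "mat_holomorphic_on r right_half_plane"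
  proof -
    have "mat_holomorphic_on (\<lambda>z. beside (mat 1) (- S z) - k z ** B) right_half_plane"
      by (intro mat_holo_intros mat_holomorphic_beside khol schur_holomorphic[OF S])
    then show ?thesis by (simp add: r_def row_def)
  qed
  define G0 where "G0 = (\<lambda>z. - (matrix_inv (\<alpha> z) ** \<beta> z))"
  have G0hol: "mat_holomorphic_on G0 (right_half_plane - E)"
  proof -
    have 1: "mat_holomorphic_on \<alpha> (right_half_plane - E)" "mat_holomorphic_on \<beta> (right_half_plane - E)"
      unfolding \<alpha>_def \<beta>_def
      by (intro mat_holomorphic_leftc mat_holomorphic_rightc mat_holomorphic_on_subset[OF rhol] Diff_subset)+
    show ?thesis
      unfolding G0_def by (intro mat_holo_intros matrix_inv_holomorphic 1 inv\<alpha>)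
  qed
  have G0le: "norm (G0 z *v v) \<le> norm v" if z: "z \<in> right_half_plane - E" for z v
  proof (rule adjoint_contraction)
    fix f
    let ?e = "conj_transpose (matrix_inv (\<alpha> z)) *v f"
    have "conj_transpose (\<alpha> z) *v ?e = f"
      using arg_cong[OF matrix_inv_mult_left[OF inv\<alpha>[OF z]], of conj_transpose]
      by (simp add: matrix_vector_mul_assoc conj_transpose_mult conj_transpose_mat)
    moreover have "conj_transpose (G0 z) *v f = - (conj_transpose (\<beta> z) *v ?e)"
      by (simp add: G0_def conj_transpose_minus conj_transpose_mult matrix_vector_minus_left matrix_vector_mul_assoc)
    ultimately show "norm (conj_transpose (G0 z) *v f) \<le> norm f"
      using ab[of z ?e] z by simp
  qed
  obtain G where G: "G \<in> schur_class" "\<And>z. z \<in> right_half_plane - E \<Longrightarrow> G z = G0 z"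
    using schur_extension[OF finE G0hol G0le] by blast
  have holl: "mat_holomorphic_on (\<lambda>z. lft (G z) z) right_half_plane"
    using lft_schur[OF G(1)] by (rule schur_holomorphic)
  have off: "S z = lft (G z) z" if z: "z \<in> right_half_plane" "z \<notin> E" "z \<notin> spectrum A" for z
  proof (rule row_lft[OF schur_loop_invertible[OF G(1) z(1)] z(3) k[OF z(1)]])
    have "\<alpha> z ** G z + \<beta> z = 0"
      using z inv\<alpha>[of z] by (simp add: G(2) G0_def mat_mul_simps matrix_mul_assoc matrix_inv_mult_right)
    then show "leftc (row (S z) (k z)) ** G z + rightc (row (S z) (k z)) = 0"
      by (simp add: \<alpha>_def \<beta>_def r_def)
  qed
  have "S z = lft (G z) z" if z: "z \<in> right_half_plane" for z
  proof -
    define s where "s = right_half_plane - ((E \<union> spectrum A) - {z})"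
    have s: "open s" "z \<in> s" using z finE by (auto simp: s_def open_Diff finite_imp_closed)
    have "(S \<longlongrightarrow> S z) (at z)"
      by (rule holomorphic_tendsto[OF schur_holomorphic[OF S] open_rhp z])
    moreover have "(S \<longlongrightarrow> lft (G z) z) (at z)"
    proof (rule Lim_transform_eventually)
      show "((\<lambda>z. lft (G z) z) \<longlongrightarrow> lft (G z) z) (at z)"
        by (rule holomorphic_tendsto[OF holl open_rhp z])
      show "\<forall>\<^sub>F w in at z. lft (G w) w = S w"
        using eventually_at_in_open[OF s] by eventually_elim (auto simp: s_def intro!: off[symmetric])
    qed
    ultimately show ?thesis by (rule tendsto_unique[OF at_neq_bot])
  qed
  with G(1) that show ?thesis by blast
qed

end

section \<open>The interpolation data as a state space\<close>

lemma beside_mult: "beside A B ** Q = A ** upper Q + B ** lower Q"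
  by (metis beside_mult_stack stack_upper_lower)

lemma upper_add: "upper (M + N) = upper M + upper N" and lower_add: "lower (M + N) = lower M + lower N"
  by (simp_all add: vec_eq_iff upper_def lower_def)

lemma upper_diff: "upper (M - N) = upper M - upper N" and lower_diff: "lower (M - N) = lower M - lower N"
  by (simp_all add: vec_eq_iff upper_def lower_def)

lemma leftc_beside [simp]: "leftc (beside A B) = A" and rightc_beside [simp]: "rightc (beside A B) = B"
  by (simp_all add: vec_eq_iff leftc_def rightc_def)

lemma rightc_mult: "rightc (Q ** M) = Q ** rightc M"
  by (simp_all add: vec_eq_iff leftc_def rightc_def upper_def lower_def matrix_matrix_mult_def)

lemma rightc_add: "rightc (M + N) = rightc M + rightc N"
  by (simp_all add: vec_eq_iff leftc_def rightc_def upper_def lower_def)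

lemma rightc_diff: "rightc (M - N) = rightc M - rightc N"
  by (simp_all add: vec_eq_iff leftc_def rightc_def upper_def lower_def)

lemma mat_holomorphic_upper: "mat_holomorphic_on F D \<Longrightarrow> mat_holomorphic_on (\<lambda>z. upper (F z)) D"
  by (simp add: mat_holomorphic_on_def upper_def)

lemma mult_stack: "Q ** stack M N = leftc Q ** M + rightc Q ** N"
  by (metis beside_leftc_rightc beside_mult_stack)

lemma J_sig_mult_stack: "J_sig ** stack M N = stack M (- N)"
  by (rule matrix_eqI) (simp add: stack_mult_vec J_sig_stack matrix_vector_minus_left flip: matrix_vector_mul_assoc)

lemma beside_stack: "beside (stack A B) (stack C D) = stack (beside A C) (beside B D)"
  by (simp add: vec_eq_iff split_sum_all)

text \<open>The equation reads (z - Z) G = G (z + Z^H). Thus the constant \<open>G\<close> is z - Z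
  times a function holomorphic on the half-plane, and its evaluation, which is \<open>G\<close>
  itself, is 0.\<close>

lemma lyapunov_unique:
  assumes Z: "spectrum Z \<subseteq> right_half_plane" and G: "Z ** G + G ** conj_transpose Z = 0"
  shows "G = 0"
proof -
  let ?R = "resolvent (- conj_transpose Z)"
  have "G = 0 + (mat z - Z) ** (G ** ?R z)" if z: "z \<in> right_half_plane" for z
  proof -
    have ns: "z \<notin> spectrum (- conj_transpose Z)"
      using spectrum_neg_conj_transpose[OF Z] z by (auto simp: right_half_plane_def)
    have "(mat z - Z) ** G = G ** (mat z - - conj_transpose Z)"
      using G by (simp add: mat_mul_simps mat_mult_commute eq_neg_iff_add_eq_0 diff_eq_eq add.assoc add.commute)
    then have "(mat z - Z) ** (G ** ?R z) = G ** ((mat z - - conj_transpose Z) ** ?R z)"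
      by (simp only: matrix_mul_assoc)
    then show ?thesis by (simp only: resolvent_right[OF ns]) simp
  qed
  then have "mat_left_eval Z (\<lambda>_. G) = 0"
    by (rule mat_left_eval_unique[OF Z gram_integrand_holomorphic[OF Z]])
  moreover have "mat_left_eval Z (\<lambda>_. G) = G"
    by (rule mat_left_eval_unique[OF Z, of "\<lambda>_. 0"]) auto
  ultimately show ?thesis by simp
qed

locale btoa_data =
  fixes Z :: "complex^'z::finite^'z" and X :: "complex^'p::finite^'z" and Y :: "complex^'m::finite^'z"
    and U :: "complex^'w::finite^'m" and V :: "complex^'w^'p" and W :: "complex^'w^'w"
    and \<Gamma> :: "complex^'w^'z"
  assumes Z: "spectrum Z \<subseteq> right_half_plane" and W: "spectrum W \<subseteq> right_half_plane"
    and sylvester: "\<Gamma> ** W - Z ** \<Gamma> = X ** V - Y ** U"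
begin

abbreviation "Zs \<equiv> - conj_transpose Z"
abbreviation "gU \<equiv> gram (conj_transpose W) (conj_transpose U)"
abbreviation "gV \<equiv> gram (conj_transpose W) (conj_transpose V)"

text \<open>The blocks have their spectra on opposite sides: - Z^H carries the kernel functions of
  the left condition, which lie in H^2, and \<open>W\<close> the functions with poles in the right
  half-plane.\<close>

definition AA :: "complex^('z + 'w)^('z + 'w)" where
  "AA = stack (beside Zs 0) (beside 0 W)"

definition CC :: "complex^('z + 'w)^('p + 'm)" where
  "CC = stack (beside (- conj_transpose X) V) (beside (- conj_transpose Y) U)"

definition PP :: "complex^('z + 'w)^('z + 'w)" where
  "PP = stack (beside (gram Z X - gram Z Y) \<Gamma>) (beside (conj_transpose \<Gamma>) (gU - gV))"

lemma W': "spectrum (conj_transpose W) \<subseteq> right_half_plane"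
  by (rule spectrum_conj_transpose_rhp[OF W])

lemma PP_vec: "PP *v stack y x = stack ((gram Z X - gram Z Y) *v y + \<Gamma> *v x) (conj_transpose \<Gamma> *v y + (gU - gV) *v x)"
  by (simp add: PP_def stack_mult_vec beside_mult_vec)

lemma PP_form: "Re (cinner (PP *v stack y x) (stack y x)) = pick_form Z X Y U V W \<Gamma> y x"
proof -
  have "Re (cinner (conj_transpose \<Gamma> *v y) x) = Re (cinner (\<Gamma> *v x) y)"
    by (simp add: cinner_adjoint Re_cinner_commute[of y])
  then show ?thesis
    by (simp add: PP_vec cinner_stack cinner_add_left pick_form_def matrix_vector_mult_diff_rdistrib cinner_diff_left)
qed

lemma PP_hermitian: "conj_transpose PP = PP"
  by (simp add: PP_def conj_transpose_stack conj_transpose_beside conj_transpose_diff gram_hermitian[OF Z] gram_hermitian[OF W'])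
     (simp add: vec_eq_iff split_sum_all)

lemma CC_adjoint: "conj_transpose CC = stack (beside (- X) (- Y)) (beside (conj_transpose V) (conj_transpose U))"
  by (simp add: CC_def conj_transpose_stack conj_transpose_beside conj_transpose_minus)
     (simp add: vec_eq_iff split_sum_all)

lemma AA_adjoint: "conj_transpose AA = stack (beside (- Z) 0) (beside 0 (conj_transpose W))"
  by (simp add: AA_def) (simp add: vec_eq_iff split_sum_all)

text \<open>The diagonal blocks are differences of the Lyapunov equations of the Gramians, the
  off-diagonal ones the Sylvester equation and its adjoint.\<close>

lemma PP_lyapunov: "PP ** AA + conj_transpose AA ** PP = - (conj_transpose CC ** J_sig ** CC)"
proof -
  have sylv': "conj_transpose W ** conj_transpose \<Gamma> - conj_transpose \<Gamma> ** conj_transpose Z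
      = conj_transpose V ** conj_transpose X - conj_transpose U ** conj_transpose Y"
    using arg_cong[OF sylvester, of conj_transpose] by (simp add: conj_transpose_diff conj_transpose_mult)
  have LX: "Z ** gram Z X + gram Z X ** conj_transpose Z = X ** conj_transpose X"
    and LY: "Z ** gram Z Y + gram Z Y ** conj_transpose Z = Y ** conj_transpose Y"
    by (rule gram_lyapunov[OF Z])+
  have LU: "conj_transpose W ** gU + gU ** W = conj_transpose U ** U"
    and LV: "conj_transpose W ** gV + gV ** W = conj_transpose V ** V"
    using gram_lyapunov[OF W', of "conj_transpose U"] gram_lyapunov[OF W', of "conj_transpose V"] by simp_all
  have "PP ** AA + conj_transpose AA ** PP
      = stack (beside (- (gram Z X - gram Z Y) ** conj_transpose Z - Z ** (gram Z X - gram Z Y)) (\<Gamma> ** W - Z ** \<Gamma>))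
          (beside (conj_transpose W ** conj_transpose \<Gamma> - conj_transpose \<Gamma> ** conj_transpose Z)
            ((gU - gV) ** W + conj_transpose W ** (gU - gV)))"
    by (simp add: PP_def AA_adjoint) (simp add: AA_def stack_mult beside_mult_stack mult_beside beside_add stack_add mat_mul_simps)
  also have "\<dots> = - (conj_transpose CC ** J_sig ** CC)"
    unfolding sylvester sylv'
  proof -
    have "conj_transpose CC ** J_sig ** CC = stack (beside (X ** conj_transpose X - Y ** conj_transpose Y) (- (X ** V) + Y ** U))
        (beside (- (conj_transpose V ** conj_transpose X) + conj_transpose U ** conj_transpose Y)
          (conj_transpose V ** V - conj_transpose U ** U))"
      unfolding matrix_mul_assoc[symmetric]
      by (simp add: CC_adjoint) (simp add: CC_def J_sig_mult_stack stack_mult beside_mult_stack mult_beside beside_add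
          beside_minus mat_mul_simps)
    then show "stack (beside (- (gram Z X - gram Z Y) ** conj_transpose Z - Z ** (gram Z X - gram Z Y)) (X ** V - Y ** U))
          (beside (conj_transpose V ** conj_transpose X - conj_transpose U ** conj_transpose Y)
            ((gU - gV) ** W + conj_transpose W ** (gU - gV))) = - (conj_transpose CC ** J_sig ** CC)"
    proof -
      have "- (gram Z X - gram Z Y) ** conj_transpose Z - Z ** (gram Z X - gram Z Y) = - (X ** conj_transpose X - Y ** conj_transpose Y)"
        unfolding LX[symmetric] LY[symmetric] by (simp add: mat_mul_simps)
      moreover have "(gU - gV) ** W + conj_transpose W ** (gU - gV) = - (conj_transpose V ** V - conj_transpose U ** U)"
        unfolding LU[symmetric] LV[symmetric] by (simp add: mat_mul_simps)
      ultimately show ?thesis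
        using \<open>conj_transpose CC ** J_sig ** CC = _\<close> by (simp add: stack_minus beside_minus)
    qed
  qed
  finally show ?thesis .
qed

lemma AA_vec: "(mat z - AA) *v stack a b = stack ((mat z - Zs) *v a) ((mat z - W) *v b)"
  by (simp add: AA_def mat_vec_simps stack_mult_vec beside_mult_vec stack_scale stack_diff)

lemma AA_spectrum:
  assumes "z \<notin> spectrum Zs" "z \<notin> spectrum W"
  shows "z \<notin> spectrum AA"
proof -
  have "s = 0" if "(mat z - AA) *v s = 0" for s
  proof -
    have "stack ((mat z - Zs) *v upper s) ((mat z - W) *v lower s) = stack 0 0"
      using that AA_vec[of z "upper s" "lower s"] by (simp add: stack_upper_lower stack_zero)
    then have "(mat z - Zs) *v upper s = 0" "(mat z - W) *v lower s = 0"
      by (simp_all only: stack_eq_iff)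
    then have "upper s = 0" "lower s = 0"
      using resolvent_left_vec[OF assms(1), of "upper s"] resolvent_left_vec[OF assms(2), of "lower s"]
      by simp_all
    then show ?thesis using stack_upper_lower[of s] by (simp add: stack_zero)
  qed
  then show ?thesis by (simp add: spectrum_def invertible_iff_inj)
qed

lemma AA_axis: "Re z = 0 \<Longrightarrow> z \<notin> spectrum AA"
  by (rule AA_spectrum) (use spectrum_neg_conj_transpose[OF Z] W in \<open>auto simp: right_half_plane_def\<close>)

lemma AA_resolvent:
  assumes "z \<notin> spectrum Zs" "z \<notin> spectrum W"
  shows "resolvent AA z *v stack a b = stack (resolvent Zs z *v a) (resolvent W z *v b)"
  by (rule resolvent_unique[OF AA_spectrum[OF assms]])
     (simp only: AA_vec resolvent_right_vec[OF assms(1)] resolvent_right_vec[OF assms(2)])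

lemma rhp_not_Zs: "z \<in> right_half_plane \<Longrightarrow> z \<notin> spectrum Zs"
  using spectrum_neg_conj_transpose[OF Z] by (auto simp: right_half_plane_def)

end

section \<open>Positive Pick matrix: transforms of Schur functions interpolate\<close>

locale btoa_pos = btoa_data Z X Y U V W \<Gamma>
  for Z :: "complex^'z::finite^'z" and X :: "complex^'p::finite^'z" and Y :: "complex^'m::finite^'z"
    and U :: "complex^'w::finite^'m" and V :: "complex^'w^'p" and W :: "complex^'w^'w"
    and \<Gamma> :: "complex^'w^'z" +
  assumes pick_pos: "\<And>y x. (y, x) \<noteq> (0, 0) \<Longrightarrow> 0 < pick_form Z X Y U V W \<Gamma> y x"
begin

sublocale state_space AA PP CC
proof
  show "PP ** AA + conj_transpose AA ** PP = - (conj_transpose CC ** J_sig ** CC)"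
    by (rule PP_lyapunov)
  show "conj_transpose PP = PP" by (rule PP_hermitian)
  fix v :: "complex^('z + 'w)" assume "v \<noteq> 0"
  then have "(upper v, lower v) \<noteq> (0, 0)"
    using stack_upper_lower[of v] by (auto simp: stack_zero)
  from pick_pos[OF this] show "0 < Re (cinner (PP *v v) v)"
    by (simp add: stack_upper_lower flip: PP_form)
qed

lemma C1_eq: "C1 = beside (- conj_transpose X) V" and C2_eq: "C2 = beside (- conj_transpose Y) U"
  unfolding C1_def C2_def by (simp_all add: CC_def)

lemma plus_AA_adjoint_mult: "upper ((mat z + conj_transpose AA) ** Q) = (mat z - Z) ** upper Q"
proof -
  have "mat z + conj_transpose AA = stack (beside (mat z - Z) 0) (beside 0 (mat z + conj_transpose W))"
    unfolding AA_adjoint mat_stack[of z] by (simp add: stack_add beside_add)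
  then show ?thesis by (simp add: upper_mult beside_mult)
qed

lemma CC_adjoint_mult: "upper (conj_transpose CC ** J_sig ** stack M N) = Y ** N - X ** M"
  unfolding matrix_mul_assoc[symmetric] J_sig_mult_stack
  by (simp add: CC_adjoint upper_mult beside_mult_stack mat_mul_simps)

lemma mult_minus_AA: "rightc (Q ** (mat z - AA)) = rightc Q ** (mat z - W)"
  and mult_minus_AA_left: "leftc (Q ** (mat z - AA)) = leftc Q ** (mat z - Zs)"
proof -
  have "mat z - AA = stack (beside (mat z - Zs) 0) (beside 0 (mat z - W))"
    unfolding AA_def mat_stack[of z] by (simp add: stack_diff beside_diff)
  then show "rightc (Q ** (mat z - AA)) = rightc Q ** (mat z - W)"
    "leftc (Q ** (mat z - AA)) = leftc Q ** (mat z - Zs)"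
    by (simp_all add: mult_stack mult_beside beside_add)
qed

text \<open>The three closed-loop identities, read in the rows of \<open>Z\<close>, in the columns
  of \<open>W\<close> and in the mixed block, are the three interpolation conditions; each quotient
  carries a minus sign.\<close>

lemma lft_interpolates:
  assumes G: "G \<in> schur_class"
  shows "interpolates Z X Y U V W \<Gamma> (\<lambda>z. lft (G z) z)"
proof -
  define H where "H = (\<lambda>z. - upper (PP ** xi (G z) z))"
  define K where "K = (\<lambda>z. - rightc (kap (G z) z))"
  define L where "L = (\<lambda>z. - rightc (upper (PP ** matrix_inv (loop (G z) z))))"
  note inv = schur_loop_invertible[OF G]
  note hol = loop_holomorphic[OF schur_holomorphic[OF G] inv]
  have Hh: "mat_holomorphic_on H right_half_plane"
    unfolding H_def
    by (intro mat_holomorphic_on_minus mat_holomorphic_upper mat_holomorphic_on_mult mat_holomorphic_on_const hol)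
  have "mat_holomorphic_on (\<lambda>z. rightc (kap (G z) z)) right_half_plane"
    using hol(4) by (simp add: mat_holomorphic_on_def rightc_def lower_def)
  then have Kh: "mat_holomorphic_on K right_half_plane"
    unfolding K_def by (rule mat_holomorphic_on_minus)
  have "mat_holomorphic_on (\<lambda>z. upper (PP ** matrix_inv (loop (G z) z))) right_half_plane"
    by (intro mat_holomorphic_upper mat_holomorphic_on_mult mat_holomorphic_on_const hol)
  then have "mat_holomorphic_on (\<lambda>z. rightc (upper (PP ** matrix_inv (loop (G z) z)))) right_half_plane"
    by (simp add: mat_holomorphic_on_def rightc_def lower_def)
  then have Lh: "mat_holomorphic_on L right_half_plane"
    unfolding L_def by (rule mat_holomorphic_on_minus)
  have "X ** lft (G z) z = Y + (mat z - Z) ** H z \<and> lft (G z) z ** U = V + K z ** (mat z - W) \<and>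
      X ** K z = \<Gamma> + (mat z - Z) ** L z" if z: "z \<in> right_half_plane" for z
  proof (intro conjI)
    have "(mat z - Z) ** upper (PP ** xi (G z) z) = Y - X ** lft (G z) z"
      using arg_cong[OF xi_interp[OF inv[OF z]], of upper]
      by (simp add: plus_AA_adjoint_mult CC_adjoint_mult)
    then show "X ** lft (G z) z = Y + (mat z - Z) ** H z"
      by (simp add: H_def mat_mul_simps(6))
    have "rightc (kap (G z) z) ** (mat z - W) = V - lft (G z) z ** U"
      using arg_cong[OF kap_eq[OF inv[OF z]], of rightc] unfolding mult_minus_AA
      by (simp add: rightc_diff rightc_mult C1_eq C2_eq)
    then show "lft (G z) z ** U = V + K z ** (mat z - W)"
      by (simp add: K_def mat_mul_simps(5))
    have "(mat z - Z) ** upper (PP ** matrix_inv (loop (G z) z)) = upper PP + X ** kap (G z) z"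
      using arg_cong[OF inv_loop_interp[OF inv[OF z]], of upper]
      by (simp add: plus_AA_adjoint_mult CC_adjoint_mult upper_diff)
    from arg_cong[OF this, of rightc]
    have "(mat z - Z) ** rightc (upper (PP ** matrix_inv (loop (G z) z))) = \<Gamma> + X ** rightc (kap (G z) z)"
      by (simp add: rightc_mult rightc_add PP_def)
    then show "X ** K z = \<Gamma> + (mat z - Z) ** L z"
      by (simp add: K_def L_def mat_mul_simps(6))
  qed
  with Hh Kh Lh show ?thesis unfolding interpolates_def by blast
qed

end

text \<open>Adjoining the value \<open>e\<^sup>* S(z0)\<close> at a point \<open>z0\<close> to the left data of a solution gives again
  a solvable problem; nonnegativity of its Pick form is the following inequality.\<close>

lemma augmented_pick_form:
  fixes Z :: "complex^'z::finite^'z" and W :: "complex^'w::finite^'w" and S :: "complex \<Rightarrow> complex^'m::finite^'p::finite"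
  assumes Z: "spectrum Z \<subseteq> right_half_plane" and W: "spectrum W \<subseteq> right_half_plane"
    and S: "S \<in> schur_class" and K: "mat_holomorphic_on K right_half_plane"
    and eY: "left_eval Z X S = Y"
    and eK: "\<And>z. z \<in> right_half_plane \<Longrightarrow> S z ** U = V + K z ** (mat z - W)"
    and e\<Gamma>: "mat_left_eval Z (\<lambda>z. X ** K z) = \<Gamma>"
    and z0: "z0 \<in> right_half_plane"
    and d: "(mat (cnj z0) + Z) *v d = X *v e - Y *v (conj_transpose (S z0) *v e)"
  shows "0 \<le> 2 * Re z0 * (pick_form Z X Y U V W \<Gamma> y x + 2 * Re (cinner d y + cinner (K z0 *v x) e))
    + (norm e)\<^sup>2 - (norm (conj_transpose (S z0) *v e))\<^sup>2"
proof -
  \<comment> \<open>The row e^H as a matrix with a single row, indexed by \<open>unit\<close>;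
    \<open>u1\<close> is the unit vector of the added coordinate.\<close>
  define E :: "complex^'p^unit" where "E = (\<chi> i j. cnj (e $ j))"
  define u1 :: "complex^unit" where "u1 = (\<chi> i. 1)"
  have Eu: "conj_transpose E *v u1 = e"
    by (simp add: vec_eq_iff matrix_vector_mult_def E_def u1_def)
  define Z' :: "complex^('z + unit)^('z + unit)" where "Z' = stack (beside Z 0) (beside 0 (mat z0))"
  define X' where "X' = stack X E"
  have Zvec: "(mat z - Z') *v stack a b = stack ((mat z - Z) *v a) ((z - z0) *s b)" for z a b
    by (simp add: Z'_def mat_vec_simps stack_mult_vec beside_mult_vec stack_scale stack_diff vector_sub_rdistrib)
  have Zup: "upper ((mat z - Z') ** Q) = (mat z - Z) ** upper Q" and Zlow: "lower ((mat z - Z') ** Q) = (mat z - mat z0) ** lower Q" for z Q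
  proof -
    have "mat z - Z' = stack (beside (mat z - Z) 0) (beside 0 (mat z - mat z0))"
      unfolding Z'_def mat_stack[of z] by (simp add: stack_diff beside_diff)
    then show "upper ((mat z - Z') ** Q) = (mat z - Z) ** upper Q" "lower ((mat z - Z') ** Q) = (mat z - mat z0) ** lower Q"
      by (simp_all add: upper_mult lower_mult beside_mult)
  qed
  have Z': "spectrum Z' \<subseteq> right_half_plane"
  proof
    fix z assume z: "z \<in> spectrum Z'"
    show "z \<in> right_half_plane"
    proof (rule ccontr)
      assume "z \<notin> right_half_plane"
      then have zZ: "z \<notin> spectrum Z" and zz0: "z \<noteq> z0" using Z z0 by auto
      have "s = 0" if "(mat z - Z') *v s = 0" for s
      proof -
        have "stack ((mat z - Z) *v upper s) ((z - z0) *s lower s) = stack 0 0"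
          using that Zvec[of z "upper s" "lower s"] by (simp add: stack_upper_lower stack_zero)
        then have a: "(mat z - Z) *v upper s = 0" and b: "(z - z0) *s lower s = 0" by (simp_all only: stack_eq_iff)
        have "upper s = 0" using a resolvent_left_vec[OF zZ, of "upper s"] by simp
        moreover have "lower s = 0" using b zz0 by (simp add: vec_eq_iff)
        ultimately show ?thesis using stack_upper_lower[of s] by (simp add: stack_zero)
      qed
      then have "z \<notin> spectrum Z'" by (simp add: spectrum_def invertible_iff_inj)
      with z show False by simp
    qed
  qed
  define Y' where "Y' = left_eval Z' X' S"
  define \<Gamma>' where "\<Gamma>' = left_right_eval Z' X' U W S"
  have shol: "mat_holomorphic_on S right_half_plane" by (rule schur_holomorphic[OF S])
  have V: "right_eval U W S = V" by (rule right_eval_unique[OF W K eK])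
  have pick: "0 \<le> pick_form Z' X' Y' U V W \<Gamma>' (stack y u1) x"
    using pick_form_nonneg[OF Z' W S interpolates_evals[OF shol Z' W, of X' U]] unfolding Y'_def \<Gamma>'_def V .
  \<comment> \<open>\<open>Z'\<close> is block diagonal, so division by its pencil happens
    blockwise; in the added coordinate the remainder is the value at \<open>z0\<close>.\<close>
  have blocks: "upper (mat_left_eval Z' F) = mat_left_eval Z (\<lambda>z. upper (F z))"
    "lower (mat_left_eval Z' F) = lower (F z0)" if F: "mat_holomorphic_on F right_half_plane" for F :: "complex \<Rightarrow> complex^'l::finite^('z + unit)"
  proof -
    obtain H where H: "mat_holomorphic_on H right_half_plane"
      "\<And>z. z \<in> right_half_plane \<Longrightarrow> F z = mat_left_eval Z' F + (mat z - Z') ** H z"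
      using mat_left_eval_decomp[OF F Z'] by blast
    have "upper (F z) = upper (mat_left_eval Z' F) + (mat z - Z) ** upper (H z)" if "z \<in> right_half_plane" for z
      using arg_cong[OF H(2)[OF that], of upper] by (simp add: upper_add Zup)
    then show "upper (mat_left_eval Z' F) = mat_left_eval Z (\<lambda>z. upper (F z))"
      by (rule mat_left_eval_unique[OF Z mat_holomorphic_upper[OF H(1)], symmetric])
    show "lower (mat_left_eval Z' F) = lower (F z0)"
      using arg_cong[OF H(2)[OF z0], of lower] by (simp add: lower_add Zlow)
  qed
  have Y': "Y' = stack Y (E ** S z0)"
  proof -
    have h: "mat_holomorphic_on (\<lambda>z. X' ** S z) right_half_plane" by (intro mat_holo_intros shol)
    have "upper Y' = Y" "lower Y' = E ** S z0"
      unfolding Y'_def left_eval_mat_left_eval blocks[OF h]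
      using eY by (simp_all add: X'_def stack_mult left_eval_mat_left_eval)
    then show ?thesis by (metis stack_upper_lower)
  qed
  have \<Gamma>': "\<Gamma>' = stack \<Gamma> (E ** K z0)"
  proof -
    have h: "mat_holomorphic_on (\<lambda>z. X' ** K z) right_half_plane" by (intro mat_holo_intros K)
    have lr: "\<Gamma>' = mat_left_eval Z' (\<lambda>z. X' ** K z)"
      unfolding \<Gamma>'_def by (rule left_right_eval_eq[OF Z' W K eK])
    have "upper \<Gamma>' = \<Gamma>" "lower \<Gamma>' = E ** K z0"
      unfolding lr blocks[OF h]
      using e\<Gamma> by (simp_all add: X'_def stack_mult)
    then show ?thesis by (metis stack_upper_lower)
  qed
  \<comment> \<open>The blocks of this difference of Gramians are identified from its Lyapunov
    equation instead of residues: the old block by uniqueness, the border by the equation assumed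
    for \<open>d\<close>, the corner up to the factor 2 Re z0.\<close>
  define D where "D = gram Z' X' - gram Z' Y'"
  have Dh: "conj_transpose D = D"
    by (simp add: D_def conj_transpose_diff gram_hermitian[OF Z'])
  define D1 where "D1 = leftc (upper D)"
  define D2 where "D2 = rightc (upper D)"
  define D3 where "D3 = leftc (lower D)"
  define D4 where "D4 = rightc (lower D)"
  have Dblk: "D = stack (beside D1 D2) (beside D3 D4)"
    by (simp add: D1_def D2_def D3_def D4_def beside_leftc_rightc stack_upper_lower)
  have lyapD: "Z' ** D + D ** conj_transpose Z' = X' ** conj_transpose X' - Y' ** conj_transpose Y'"
    using gram_lyapunov[OF Z', of X'] gram_lyapunov[OF Z', of Y']
    by (simp add: D_def mat_mul_simps algebra_simps)
  have Z'adj: "conj_transpose Z' = stack (beside (conj_transpose Z) 0) (beside 0 (mat (cnj z0)))"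
  proof -
    have "conj_transpose (0 :: complex^unit^'z) = 0" "conj_transpose (0 :: complex^'z^unit) = 0"
      by (simp_all add: vec_eq_iff)
    then show ?thesis
      unfolding Z'_def conj_transpose_stack conj_transpose_beside conj_transpose_mat
      by (simp add: vec_eq_iff split_sum_all)
  qed
  have L: "stack (beside (Z ** D1 + D1 ** conj_transpose Z) (Z ** D2 + D2 ** mat (cnj z0)))
      (beside (mat z0 ** D3 + D3 ** conj_transpose Z) (mat z0 ** D4 + D4 ** mat (cnj z0)))
    = stack (beside (X ** conj_transpose X - Y ** conj_transpose Y)
          (X ** conj_transpose E - Y ** (conj_transpose (S z0) ** conj_transpose E)))
        (beside (E ** conj_transpose X - E ** S z0 ** conj_transpose Y)
          (E ** conj_transpose E - E ** S z0 ** (conj_transpose (S z0) ** conj_transpose E)))"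
    (is "?l = ?r")
  proof -
    have "Z' ** D + D ** conj_transpose Z' = ?l"
      unfolding Dblk Z'adj
      by (simp add: Z'_def stack_mult beside_mult_stack mult_beside beside_add stack_add)
    moreover have "X' ** conj_transpose X' - Y' ** conj_transpose Y' = ?r"
      by (simp add: X'_def Y' stack_mult mult_beside stack_diff beside_diff conj_transpose_stack conj_transpose_mult beside_stack)
    ultimately show ?thesis using lyapD by simp
  qed
  have L1: "Z ** D1 + D1 ** conj_transpose Z = X ** conj_transpose X - Y ** conj_transpose Y"
    and L2: "Z ** D2 + D2 ** mat (cnj z0) = X ** conj_transpose E - Y ** (conj_transpose (S z0) ** conj_transpose E)"
    and L4: "mat z0 ** D4 + D4 ** mat (cnj z0) = E ** conj_transpose E - E ** S z0 ** (conj_transpose (S z0) ** conj_transpose E)"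
    using L by (simp_all only: stack_eq_iff beside_eq_iff)
  have D1: "D1 = gram Z X - gram Z Y"
  proof -
    have "Z ** (D1 - (gram Z X - gram Z Y)) + (D1 - (gram Z X - gram Z Y)) ** conj_transpose Z = 0"
      using L1 gram_lyapunov[OF Z, of X] gram_lyapunov[OF Z, of Y] by (simp add: mat_mul_simps algebra_simps)
    from lyapunov_unique[OF Z this] show ?thesis by simp
  qed
  have D2: "D2 *v u1 = d"
  proof -
    have nZ: "- cnj z0 \<notin> spectrum Z" using Z z0 by (auto simp: right_half_plane_def)
    have "(mat (cnj z0) + Z) *v (D2 *v u1) = (mat (cnj z0) + Z) *v d"
      unfolding d using arg_cong[OF L2, of "\<lambda>M. M *v u1"]
      by (simp add: mat_vec_simps Eu add.commute flip: matrix_vector_mul_assoc)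
    then have "(mat (- cnj z0) - Z) *v (D2 *v u1) = (mat (- cnj z0) - Z) *v d"
      by (simp add: mat_vec_simps algebra_simps)
    then show ?thesis using resolvent_left_vec[OF nZ] by metis
  qed
  have D4: "2 * Re z0 * Re (cinner (D4 *v u1) u1) = (norm e)\<^sup>2 - (norm (conj_transpose (S z0) *v e))\<^sup>2"
  proof -
    have "cinner ((mat z0 ** D4 + D4 ** mat (cnj z0)) *v u1) u1 = z0 * cinner (D4 *v u1) u1 + cnj z0 * cinner (D4 *v u1) u1"
      by (simp add: mat_vec_simps cinner_add_left cinner_scale_left flip: matrix_vector_mul_assoc)
    moreover have "cinner ((E ** conj_transpose E - E ** S z0 ** (conj_transpose (S z0) ** conj_transpose E)) *v u1) u1
        = cinner e e - cinner (conj_transpose (S z0) *v e) (conj_transpose (S z0) *v e)"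
      by (simp add: mat_vec_simps cinner_diff_left Eu cinner_adjoint[of E] cinner_adjoint[of "S z0"] flip: matrix_vector_mul_assoc)
    ultimately have "z0 * cinner (D4 *v u1) u1 + cnj z0 * cinner (D4 *v u1) u1
        = cinner e e - cinner (conj_transpose (S z0) *v e) (conj_transpose (S z0) *v e)"
      using L4 by simp
    from arg_cong[OF this, of Re] show ?thesis by (simp add: Re_cinner_self)
  qed
  have D3: "Re (cinner (D3 *v y) u1) = Re (cinner d y)"
  proof -
    have "D3 = conj_transpose D2"
      using Dh unfolding Dblk
      by (simp add: vec_eq_iff split_sum_all)
    then show ?thesis
      by (simp add: cinner_adjoint D2 Re_cinner_commute[of y])
  qed
  have "pick_form Z' X' Y' U V W \<Gamma>' (stack y u1) x
      = pick_form Z X Y U V W \<Gamma> y x + 2 * Re (cinner d y + cinner (K z0 *v x) e) + Re (cinner (D4 *v u1) u1)"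
  proof -
    have "Re (cinner (gram Z' X' *v stack y u1) (stack y u1)) - Re (cinner (gram Z' Y' *v stack y u1) (stack y u1))
        = Re (cinner (D *v stack y u1) (stack y u1))"
      by (simp add: D_def matrix_vector_mult_diff_rdistrib cinner_diff_left)
    also have "\<dots> = Re (cinner (gram Z X *v y) y) - Re (cinner (gram Z Y *v y) y) + 2 * Re (cinner d y) + Re (cinner (D4 *v u1) u1)"
      unfolding Dblk
      by (simp add: stack_mult_vec beside_mult_vec cinner_stack cinner_add_left D1 D2 D3
          matrix_vector_mult_diff_rdistrib cinner_diff_left)
    finally show ?thesis
      by (simp add: pick_form_def \<Gamma>' stack_mult_vec cinner_stack cinner_adjoint[of E] Eu flip: matrix_vector_mul_assoc)
  qed
  with pick have "0 \<le> 2 * Re z0 * (pick_form Z X Y U V W \<Gamma> y x + 2 * Re (cinner d y + cinner (K z0 *v x) e) + Re (cinner (D4 *v u1) u1))"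
    using z0 by (intro mult_nonneg_nonneg) (auto simp: right_half_plane_def)
  then show ?thesis using D4 by (simp add: algebra_simps)
qed

section \<open>Every solution is a transform\<close>

context btoa_pos
begin

lemma solution_is_lft:
  assumes S: "S \<in> schur_class" and I: "interpolates Z X Y U V W \<Gamma> S"
  obtains G where "G \<in> schur_class" "\<And>z. z \<in> right_half_plane \<Longrightarrow> S z = lft (G z) z"
proof -
  obtain H K L where K: "mat_holomorphic_on K right_half_plane" and L: "mat_holomorphic_on L right_half_plane"
    and eK: "\<And>z. z \<in> right_half_plane \<Longrightarrow> S z ** U = V + K z ** (mat z - W)"
    and eL: "\<And>z. z \<in> right_half_plane \<Longrightarrow> X ** K z = \<Gamma> + (mat z - Z) ** L z"
    using I unfolding interpolates_def by auto
  have eY: "left_eval Z X S = Y" by (rule interpolates_imp_evals(1)[OF Z W I])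
  have e\<Gamma>: "mat_left_eval Z (\<lambda>z. X ** K z) = \<Gamma>" by (rule mat_left_eval_unique[OF Z L eL])
  \<comment> \<open>\<open>k\<close> has to satisfy k (z - A) = C1 - S C2. In the columns of - Z^H
    the resolvent solves this without poles in the half-plane; in the columns of \<open>W\<close>
    the right condition offers the quotient \<open>- K z\<close>.\<close>
  define k1 where "k1 = (\<lambda>z. (- conj_transpose X + S z ** conj_transpose Y) ** resolvent Zs z)"
  define k where "k = (\<lambda>z. beside (k1 z) (- K z))"
  show ?thesis
  proof (rule lft_inverse[OF S, of k])
    show "mat_holomorphic_on k right_half_plane"
      unfolding k_def k1_def
      by (intro mat_holomorphic_beside mat_holo_intros schur_holomorphic[OF S] K resolvent_holomorphic)
         (use rhp_not_Zs in auto)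
    show "k z ** (mat z - AA) = C1 - S z ** C2" if z: "z \<in> right_half_plane" for z
    proof -
      have "leftc (k z ** (mat z - AA)) = - conj_transpose X + S z ** conj_transpose Y"
        unfolding mult_minus_AA_left
        by (simp only: k_def k1_def leftc_beside matrix_mul_assoc[symmetric] resolvent_left[OF rhp_not_Zs[OF z]] matrix_mul_rid)
      moreover have "rightc (k z ** (mat z - AA)) = V - S z ** U"
        unfolding mult_minus_AA by (simp add: k_def eK[OF z] mat_mul_simps(5))
      moreover have "C1 - S z ** C2 = beside (- conj_transpose X + S z ** conj_transpose Y) (V - S z ** U)"
        by (simp add: C1_eq C2_eq mult_beside beside_diff mat_mul_simps)
      ultimately show ?thesis by (metis beside_leftc_rightc)
    qed
    fix z e assume z: "z \<in> right_half_plane"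
    \<comment> \<open>The augmented form at p is <P p, p> - 2 Re <k^H e, p> plus a term in
      \<open>e\<close> alone. This \<open>p\<close> minimises it, with minimum - <P p, p> apart from
      that term, so it gives the sharpest inequality.\<close>
    define p where "p = Pinv *v (conj_transpose (k z) *v e)"
    have Pp: "PP *v p = conj_transpose (k z) *v e"
      by (simp add: p_def matrix_vector_mul_assoc matrix_mul_assoc P_Pinv)
    define d where "d = - (conj_transpose (k1 z) *v e)"
    have d: "(mat (cnj z) + Z) *v d = X *v e - Y *v (conj_transpose (S z) *v e)"
    proof -
      have "conj_transpose (k1 z) *v e = conj_transpose (resolvent Zs z) *v (- (X *v e) + Y *v (conj_transpose (S z) *v e))"
        by (simp add: k1_def conj_transpose_mult conj_transpose_add conj_transpose_diff conj_transpose_minus mat_vec_simps flip: matrix_vector_mul_assoc)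
      moreover have "mat (cnj z) + Z = conj_transpose (mat z - Zs)"
        by (simp add: conj_transpose_diff conj_transpose_add conj_transpose_mat conj_transpose_minus)
      moreover have "conj_transpose (mat z - Zs) ** conj_transpose (resolvent Zs z) = mat 1"
        using arg_cong[OF resolvent_left[OF rhp_not_Zs[OF z]], of conj_transpose]
        by (simp only: conj_transpose_mult conj_transpose_mat complex_cnj_one)
      ultimately show ?thesis
        by (simp add: d_def matrix_vector_minus_right matrix_vector_mul_assoc) 
    qed
    have "pick_form Z X Y U V W \<Gamma> (upper p) (lower p) = Re (cinner (PP *v p) p)"
      by (simp add: stack_upper_lower flip: PP_form)
    moreover have "Re (cinner d (upper p) + cinner (K z *v lower p) e) = - Re (cinner (PP *v p) p)"
    proof -
      have "cinner (PP *v p) p = cinner (stack (- d) (- (conj_transpose (K z) *v e))) (stack (upper p) (lower p))"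
        by (simp add: Pp k_def conj_transpose_beside stack_mult_vec d_def conj_transpose_minus matrix_vector_minus_left stack_upper_lower)
      moreover have "Re (cinner (conj_transpose (K z) *v e) (lower p)) = Re (cinner (K z *v lower p) e)"
        by (simp add: cinner_adjoint Re_cinner_commute[of e])
      ultimately show ?thesis by (simp add: cinner_stack cinner_minus_left)
    qed
    moreover note augmented_pick_form[OF Z W S K eY eK e\<Gamma> z d, of "upper p" "lower p"]
    ultimately show "2 * Re z * Re (cinner (PP *v (Pinv *v (conj_transpose (k z) *v e))) (Pinv *v (conj_transpose (k z) *v e)))
      \<le> (norm e)\<^sup>2 - (norm (conj_transpose (S z) *v e))\<^sup>2"
      unfolding p_def[symmetric] by (simp add: algebra_simps)
  qed (rule that)
qed

lemma solutions_eq_lft: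
  assumes eq: "\<And>z. z \<notin> spectrum AA \<Longrightarrow> \<Theta> z = \<Theta>0 z"
  shows "btoa_solutions Z X Y U V W \<Gamma> = {S. \<exists>G\<in>schur_class. is_lft \<Theta> G S}"
    and "\<forall>G\<in>schur_class. \<exists>S. is_lft \<Theta> G S"
proof -
  show "\<forall>G\<in>schur_class. \<exists>S. is_lft \<Theta> G S"
  proof
    fix G :: "complex \<Rightarrow> complex^'m^'p" assume G: "G \<in> schur_class"
    have "is_lft \<Theta> G (\<lambda>z. lft (G z) z)" by (simp add: is_lft_iff[OF eq G])
    then show "\<exists>S. is_lft \<Theta> G S" by (rule exI[of "is_lft \<Theta> G"])
  qed
  have "S \<in> schur_class \<and> interpolates Z X Y U V W \<Gamma> S \<longleftrightarrow> (\<exists>G\<in>schur_class. is_lft \<Theta> G S)" for S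
  proof
    assume "S \<in> schur_class \<and> interpolates Z X Y U V W \<Gamma> S"
    then obtain G where G: "G \<in> schur_class" and "\<And>z. z \<in> right_half_plane \<Longrightarrow> S z = lft (G z) z"
      using solution_is_lft[of S] by metis
    then have "is_lft \<Theta> G S" by (simp add: is_lft_iff[OF eq G])
    then show "\<exists>G\<in>schur_class. is_lft \<Theta> G S" using G by (intro bexI[of "\<lambda>G. is_lft \<Theta> G S"])
  next
    assume "\<exists>G\<in>schur_class. is_lft \<Theta> G S"
    then obtain G where G: "G \<in> schur_class" and SG: "is_lft \<Theta> G S" by (rule bexE)
    have S: "S z = lft (G z) z" if "z \<in> right_half_plane" for z
      using is_lft_iff[OF eq G, of S] SG that by simp
    note lg = lft_schur[OF G]
    have "S \<in> schur_class"
      by (rule schur_classI[OF mat_holomorphic_on_cong[OF schur_holomorphic[OF lg]]])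
         (use S schur_norm[OF lg] in auto)
    moreover have "interpolates Z X Y U V W \<Gamma> S"
      using lft_interpolates[OF G] S unfolding interpolates_def by auto
    ultimately show "S \<in> schur_class \<and> interpolates Z X Y U V W \<Gamma> S" ..
  qed
  then show "btoa_solutions Z X Y U V W \<Gamma> = {S. \<exists>G\<in>schur_class. is_lft \<Theta> G S}"
    by (simp add: set_eq_iff btoa_solutions_iff[OF Z W])
qed

end

section \<open>The subspace as a Beurling-Lax image\<close>

lemma infsum_residues_left_eval:
  assumes Z: "spectrum Z \<subseteq> right_half_plane" and F: "vec_holomorphic_on F right_half_plane"
  shows "(\<Sum>\<^sub>\<infinity>z0\<in>right_half_plane. vec_residue (\<lambda>z. resolvent Z z *v F z) z0) = vec_left_eval Z F"
proof -
  have "vec_residue (\<lambda>z. resolvent Z z *v F z) z0 = 0" if z0: "z0 \<in> right_half_plane - spectrum Z" for z0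
  proof -
    have op: "open (right_half_plane - spectrum Z)"
      by (intro open_Diff open_rhp finite_imp_closed finite_spectrum)
    have "residue (\<lambda>z. (resolvent Z z *v F z) $ i) z0 = 0" for i
      using residue_holo[OF op z0] resolvent_vec_holomorphic[OF F, of Z]
      by (auto simp: vec_holomorphic_on_def)
    then show ?thesis by (simp add: vec_residue_def vec_eq_iff)
  qed
  then have "(\<Sum>\<^sub>\<infinity>z0\<in>right_half_plane. vec_residue (\<lambda>z. resolvent Z z *v F z) z0)
      = (\<Sum>\<^sub>\<infinity>z0\<in>spectrum Z. vec_residue (\<lambda>z. resolvent Z z *v F z) z0)"
    using Z by (intro infsum_cong_neutral) auto
  then show ?thesis by (simp add: vec_left_eval_def)
qed

lemma L2_line_add:
  fixes f :: "real \<Rightarrow> complex^'k::finite"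
  assumes f: "f \<in> L2_line" and g: "g \<in> L2_line"
  shows "(\<lambda>y. f y + g y) \<in> L2_line"
proof -
  have m [measurable]: "f \<in> borel_measurable lborel" "g \<in> borel_measurable lborel"
    using f g by (auto simp: L2_line_def)
  have "integrable lborel (\<lambda>y. 2 * (norm (f y))\<^sup>2 + 2 * (norm (g y))\<^sup>2)"
    using f g by (auto simp: L2_line_def)
  then have "integrable lborel (\<lambda>y. (norm (f y + g y))\<^sup>2)"
  proof (rule Bochner_Integration.integrable_bound)
    show "(\<lambda>y. (norm (f y + g y))\<^sup>2) \<in> borel_measurable lborel" by measurable
    have "(norm (f y + g y))\<^sup>2 \<le> 2 * (norm (f y))\<^sup>2 + 2 * (norm (g y))\<^sup>2" for y
    proof -
      have "(norm (f y + g y))\<^sup>2 \<le> (norm (f y) + norm (g y))\<^sup>2"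
        by (intro power_mono norm_triangle_ineq) auto
      also have "\<dots> \<le> 2 * (norm (f y))\<^sup>2 + 2 * (norm (g y))\<^sup>2"
        using lower_bound_sq[of "norm (f y)" "norm (g y)"] by (simp add: power2_sum)
      finally show ?thesis .
    qed
    then show "AE y in lborel. norm ((norm (f y + g y))\<^sup>2) \<le> norm (2 * (norm (f y))\<^sup>2 + 2 * (norm (g y))\<^sup>2)"
      by (intro AE_I2) simp
  qed
  then show ?thesis by (simp add: L2_line_def)
qed

lemma L2_line_cong:
  fixes f g :: "real \<Rightarrow> complex^'k::finite"
  assumes f: "f \<in> L2_line" and g: "g \<in> borel_measurable lborel" and ae: "AE y in lborel. g y = f y"
  shows "g \<in> L2_line"
proof -
  have fm: "f \<in> borel_measurable lborel" and fi: "integrable lborel (\<lambda>y. (norm (f y))\<^sup>2)"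
    using f by (auto simp: L2_line_def)
  have "integrable lborel (\<lambda>y. (norm (g y))\<^sup>2)"
    using fi by (rule integrable_cong_AE_imp) (use ae g in auto)
  with g show ?thesis by (simp add: L2_line_def)
qed

lemma M_D_iff:
  assumes Z: "spectrum Z \<subseteq> right_half_plane"
  shows "h \<in> M_D Z X Y U V W \<Gamma> \<longleftrightarrow> h \<in> L2_line \<and> (\<exists>x F \<phi>. F \<in> hardy2 \<and> nontangential_boundary_values F \<phi> \<and>
      (AE y in lborel. h y = stack V U *v (resolvent W (Complex 0 y) *v x) + \<phi> y) \<and>
      vec_left_eval Z (\<lambda>z. beside X (- Y) *v F z) = \<Gamma> *v x)"
proof -
  have "(\<Sum>\<^sub>\<infinity>z0\<in>right_half_plane. vec_residue (\<lambda>z. resolvent Z z *v (beside X (- Y) *v F z)) z0)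
      = vec_left_eval Z (\<lambda>z. beside X (- Y) *v F z)" if "F \<in> hardy2" for F
    using infsum_residues_left_eval[OF Z hardy2_holomorphic[OF hardy2_const_mult[OF that]]] .
  then show ?thesis unfolding M_D_def mem_Collect_eq by (metis (no_types, lifting))
qed

text \<open>An explicit quotient \<open>G\<close> stands in for the residue condition. Square
  integrability comes for free, since the resolvent part and the Hardy part both lie in L2.\<close>

lemma M_D_memI:
  assumes Z: "spectrum Z \<subseteq> right_half_plane" and W: "spectrum W \<subseteq> right_half_plane"
    and F: "F \<in> hardy2" and bv: "nontangential_boundary_values F \<phi>"
    and G: "vec_holomorphic_on G right_half_plane"
    and eq: "\<And>z. z \<in> right_half_plane \<Longrightarrow> beside X (- Y) *v F z = \<Gamma> *v x + (mat z - Z) *v G z"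
    and h: "h \<in> borel_measurable lborel"
    and ae: "AE y in lborel. h y = stack V U *v (resolvent W (Complex 0 y) *v x) + \<phi> y"
  shows "h \<in> M_D Z X Y U V W \<Gamma>"
proof -
  obtain \<psi> where \<psi>: "\<psi> \<in> borel_measurable lborel" "AE y in lborel. \<phi> y = \<psi> y"
    "nontangential_boundary_values F \<psi>"
    using ntbv_measurable[OF F bv] by metis
  have "(\<lambda>y. stack V U *v (resolvent W (Complex 0 y) *v x) + \<psi> y) \<in> L2_line"
    by (intro L2_line_add right_state_L2 W hardy2_boundary(1)[OF F \<psi>(3) \<psi>(1)])
  moreover have "AE y in lborel. h y = stack V U *v (resolvent W (Complex 0 y) *v x) + \<psi> y"
    using ae \<psi>(2) by eventually_elim simp
  ultimately have "h \<in> L2_line" by (rule L2_line_cong[OF _ h])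
  moreover have "vec_left_eval Z (\<lambda>z. beside X (- Y) *v F z) = \<Gamma> *v x"
    by (rule left_eval_unique[OF Z G eq])
  ultimately show ?thesis unfolding M_D_iff[OF Z] using F bv ae by blast
qed

context state_space
begin

lemma \<Theta>0_mult_vec: "\<Theta>0 z *v v = v - C *v (resolvent A z *v (B *v v))"
  by (simp add: \<Theta>0_def mat_vec_simps flip: matrix_vector_mul_assoc)

text \<open>Passing from a state \<open>\<eta>\<close> of the adjoint system to \<open>\<xi> = P\<^sup>-\<^sup>1 \<eta>\<close> turns the interpolation
  condition into the state equation of \<open>\<Theta>0\<close>.\<close>

lemma state_equation_iff:
  assumes g: "g = F + C *v \<xi>"
  shows "(mat z + conj_transpose A) *v (P *v \<xi>) = P *v e + conj_transpose C *v (J_sig *v F)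
    \<longleftrightarrow> (mat z - A) *v \<xi> = B *v g + e"
proof -
  have "(mat z + conj_transpose A) *v (P *v \<xi>) = P *v ((mat z - A) *v \<xi>) + (P *v (A *v \<xi>) + conj_transpose A *v (P *v \<xi>))"
    by (simp add: mat_vec_simps)
  also have "\<dots> = P *v ((mat z - A) *v \<xi>) - conj_transpose C *v (J_sig *v (C *v \<xi>))"
    unfolding lyap_vec by simp
  finally have l: "(mat z + conj_transpose A) *v (P *v \<xi>)
      = P *v ((mat z - A) *v \<xi>) - conj_transpose C *v (J_sig *v (C *v \<xi>))" .
  have r: "P *v (B *v g + e) = conj_transpose C *v (J_sig *v F) + conj_transpose C *v (J_sig *v (C *v \<xi>)) + P *v e"
    by (simp add: mat_vec_simps matrix_vector_mul_assoc P_B g) (simp add: mat_vec_simps matrix_mul_assoc P_B)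
  have "(mat z - A) *v \<xi> = B *v g + e \<longleftrightarrow> P *v ((mat z - A) *v \<xi>) = P *v (B *v g + e)"
    by (metis Pinv_P matrix_vector_mul_assoc matrix_vector_mul_lid)
  then show ?thesis unfolding l r by (auto simp: algebra_simps)
qed

text \<open>Solving for the state separates the response to \<open>g\<close> from the free response
  to \<open>e\<close>; with e = (0, x) the latter is the resolvent term in the elements of
  \<open>M_D\<close>.\<close>

lemma \<Theta>0_state:
  assumes z: "z \<notin> spectrum A" and g: "g = F + C *v \<xi>" and eq: "(mat z - A) *v \<xi> = B *v g + e"
  shows "\<Theta>0 z *v g = F + C *v (resolvent A z *v e)"
proof -
  have "\<xi> = resolvent A z *v (B *v g) + resolvent A z *v e"
    using resolvent_left_vec[OF z, of \<xi>] unfolding eq by (simp add: mat_vec_simps)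
  then have "C *v \<xi> = C *v (resolvent A z *v (B *v g)) + C *v (resolvent A z *v e)"
    by (metis matrix_vector_right_distrib)
  moreover have "F = g - C *v \<xi>" using g by simp
  ultimately show ?thesis by (simp add: \<Theta>0_mult_vec)
qed

end

section \<open>Both inclusions between \<open>M_D\<close> and the image of H^2\<close>

context btoa_pos
begin

lemma CC_stack_zero: "CC *v stack 0 b = stack V U *v b"
  by (simp add: CC_def stack_mult_vec beside_mult_vec)

lemma adjoint_state_vec:
  "(mat z + conj_transpose AA) *v stack a b = stack ((mat z - Z) *v a) ((mat z + conj_transpose W) *v b)"
  by (simp add: AA_adjoint mat_vec_simps stack_mult_vec beside_mult_vec stack_scale stack_add)

lemma adjoint_input_vec:
  "PP *v stack 0 x + conj_transpose CC *v (J_sig *v F)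
    = stack (\<Gamma> *v x - beside X (- Y) *v F) ((gU - gV) *v x + beside (conj_transpose V) (- conj_transpose U) *v F)"
proof -
  have "J_sig *v F = stack (upper F) (- lower F)"
    using J_sig_stack[of "upper F" "lower F"] by (simp add: stack_upper_lower)
  then show ?thesis
    by (simp add: PP_vec CC_adjoint stack_mult_vec beside_mult_vec beside_vec_mult stack_add mat_vec_simps)
qed

text \<open>From x and F a state \<eta> of the adjoint system is built inside H^2: its
  \<open>Z\<close>-part is minus the quotient of the interpolation condition, its
  \<open>W\<close>-part comes from the resolvent of - W^H. Then F + C P^{-1} \<eta> is in H^2 and is
  mapped to the given element.\<close>

lemma M_D_subset:
  assumes eq: "\<And>z. z \<notin> spectrum AA \<Longrightarrow> \<Theta> z = \<Theta>0 z"
  shows "M_D Z X Y U V W \<Gamma> \<subseteq> times_hardy2 \<Theta>"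
proof
  fix h assume "h \<in> M_D Z X Y U V W \<Gamma>"
  then have "h \<in> L2_line \<and> (\<exists>x F \<phi>. F \<in> hardy2 \<and> nontangential_boundary_values F \<phi> \<and>
      (AE y in lborel. h y = stack V U *v (resolvent W (Complex 0 y) *v x) + \<phi> y) \<and>
      vec_left_eval Z (\<lambda>z. beside X (- Y) *v F z) = \<Gamma> *v x)"
    by (rule M_D_iff[OF Z, THEN iffD1])
  then obtain x F \<phi> where hL: "h \<in> L2_line" and F: "F \<in> hardy2" and bv: "nontangential_boundary_values F \<phi>"
    and ae: "AE y in lborel. h y = stack V U *v (resolvent W (Complex 0 y) *v x) + \<phi> y"
    and ev: "vec_left_eval Z (\<lambda>z. beside X (- Y) *v F z) = \<Gamma> *v x"
    by (elim conjE exE)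
  let ?Q = "beside (conj_transpose V) (- conj_transpose U)" and ?Ws = "- conj_transpose W"
  note XF = hardy2_const_mult[OF F, of "beside X (- Y)"]
  have Ws: "spectrum ?Ws \<subseteq> {z. Re z < 0}" by (rule spectrum_neg_conj_transpose[OF W])
  have axs: "Complex 0 y \<notin> spectrum ?Ws" for y by (rule axis_notin_spectrum(2)[OF Ws])
  obtain G1 where G1: "vec_holomorphic_on G1 right_half_plane"
    "\<And>z. z \<in> right_half_plane \<Longrightarrow> beside X (- Y) *v F z = \<Gamma> *v x + (mat z - Z) *v G1 z"
    using left_eval_decomp[OF hardy2_holomorphic[OF XF] Z] unfolding ev by metis
  note G1h = divided_bounds(1)[OF Z XF G1]
  note G1b = divided_bounds(3)[OF Z XF G1 ntbv_const_mult[OF bv]]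
  let ?c = "(gU - gV) *v x"
  define \<eta>2 where "\<eta>2 = (\<lambda>z. resolvent ?Ws z *v ?c + resolvent ?Ws z *v (?Q *v F z))"
  define \<eta>2b where "\<eta>2b = (\<lambda>y. resolvent ?Ws (Complex 0 y) *v ?c + resolvent ?Ws (Complex 0 y) *v (?Q *v \<phi> y))"
  have \<eta>2h: "\<eta>2 \<in> hardy2"
    unfolding \<eta>2_def
    by (rule hardy2_add[OF hardy2_resolvent_neg(3)[OF Ws hardy2_zero] hardy2_resolvent_neg(1)[OF Ws hardy2_const_mult[OF F]]])
  have \<eta>2bv: "nontangential_boundary_values \<eta>2 \<eta>2b"
    unfolding \<eta>2_def \<eta>2b_def
    by (intro ntbv_add ntbv_resolvent_const ntbv_resolvent_mult ntbv_const_mult bv axs)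
  \<comment> \<open>The embeddings of the two blocks as matrices, so that closure of H^2 under
    constant matrices covers stacking.\<close>
  define I1 :: "complex^'z^('z + 'w)" where "I1 = stack (mat 1) 0"
  define I2 :: "complex^'w^('z + 'w)" where "I2 = stack 0 (mat 1)"
  have I: "I1 *v a + I2 *v b = stack a b" for a b
    by (simp add: I1_def I2_def stack_mult_vec stack_add)
  define G where "G = (\<lambda>z. F z + CC *v (Pinv *v (I1 *v (- 1 *s G1 z) + I2 *v \<eta>2 z)))"
  define \<gamma> where "\<gamma> = (\<lambda>y. \<phi> y + CC *v (Pinv *v (I1 *v (- 1 *s (resolvent Z (Complex 0 y) *v (beside X (- Y) *v \<phi> y - \<Gamma> *v x))) + I2 *v \<eta>2b y)))"
  have neg: "- 1 *s v = mat (- 1) *v v" for v :: "complex^'z" by (simp add: mat_mult_vector)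
  have Gh: "G \<in> hardy2"
    unfolding G_def neg by (intro hardy2_add F hardy2_const_mult G1h \<eta>2h)
  have Gb: "nontangential_boundary_values G \<gamma>"
    unfolding G_def \<gamma>_def neg by (intro ntbv_add bv ntbv_const_mult G1b \<eta>2bv)
  have "\<Theta> (Complex 0 y) *v \<gamma> y = stack V U *v (resolvent W (Complex 0 y) *v x) + \<phi> y" for y
  proof -
    let ?z = "Complex 0 y"
    have zA: "?z \<notin> spectrum AA" by (rule AA_axis) simp
    have zW: "?z \<notin> spectrum W" and zZ: "?z \<notin> spectrum Z" using axis_notin_spectrum(1) Z W by auto
    have zs: "?z \<notin> spectrum Zs" using axis_notin_spectrum(2)[OF spectrum_neg_conj_transpose[OF Z]] .
    define \<eta> where "\<eta> = stack (- (resolvent Z ?z *v (beside X (- Y) *v \<phi> y - \<Gamma> *v x))) (\<eta>2b y)"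
    have \<gamma>: "\<gamma> y = \<phi> y + CC *v (Pinv *v \<eta>)"
      by (simp add: \<gamma>_def \<eta>_def I)
    have "(mat ?z - ?Ws) *v \<eta>2b y = ?c + ?Q *v \<phi> y"
      unfolding \<eta>2b_def by (simp only: matrix_vector_right_distrib resolvent_right_vec[OF axs])
    then have "(mat ?z + conj_transpose AA) *v \<eta> = PP *v stack 0 x + conj_transpose CC *v (J_sig *v \<phi> y)"
      unfolding adjoint_input_vec \<eta>_def adjoint_state_vec
      by (simp add: resolvent_right_vec[OF zZ] matrix_vector_minus_right)
    moreover have "PP *v (Pinv *v \<eta>) = \<eta>" by (simp add: matrix_vector_mul_assoc P_Pinv)
    ultimately have "(mat ?z + conj_transpose AA) *v (PP *v (Pinv *v \<eta>)) = PP *v stack 0 x + conj_transpose CC *v (J_sig *v \<phi> y)"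
      by simp
    from \<Theta>0_state[OF zA \<gamma> state_equation_iff[OF \<gamma>, THEN iffD1, OF this]]
    show ?thesis unfolding eq[OF zA] AA_resolvent[OF zs zW] by (simp add: CC_stack_zero)
  qed
  then have "AE y in lborel. h y = \<Theta> (Complex 0 y) *v \<gamma> y" using ae by simp
  then show "h \<in> times_hardy2 \<Theta>"
    using hL Gh Gb unfolding times_hardy2_def L2_line_def by blast
qed

text \<open>The same state equation, starting from \<open>G\<close>. The \<open>Z\<close>-part of
  the state uses a resolvent with spectrum on the left. The \<open>W\<close>-part needs a division
  by z - W, and its remainder \<open>c\<close> becomes the vector x = - c of the resolvent
  term.\<close>

lemma times_hardy2_subset:
  assumes eq: "\<And>z. z \<notin> spectrum AA \<Longrightarrow> \<Theta> z = \<Theta>0 z"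
  shows "times_hardy2 \<Theta> \<subseteq> M_D Z X Y U V W \<Gamma>"
proof
  fix h assume "h \<in> times_hardy2 \<Theta>"
  then obtain G \<gamma> where hm: "h \<in> borel_measurable lborel" and G: "G \<in> hardy2" and bv: "nontangential_boundary_values G \<gamma>"
    and ae: "AE y in lborel. h y = \<Theta> (Complex 0 y) *v \<gamma> y"
    unfolding times_hardy2_def by blast
  have Zs: "spectrum Zs \<subseteq> {z. Re z < 0}" by (rule spectrum_neg_conj_transpose[OF Z])
  have axs: "Complex 0 y \<notin> spectrum Zs" for y by (rule axis_notin_spectrum(2)[OF Zs])
  have B: "B *v v = stack (upper B *v v) (lower B *v v)" for v
    by (metis stack_mult_vec stack_upper_lower)
  note G2 = hardy2_const_mult[OF G, of "lower B"]
  define c where "c = vec_left_eval W (\<lambda>z. lower B *v G z)"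
  obtain L where L: "vec_holomorphic_on L right_half_plane"
    "\<And>z. z \<in> right_half_plane \<Longrightarrow> lower B *v G z = c + (mat z - W) *v L z"
    using left_eval_decomp[OF hardy2_holomorphic[OF G2] W] unfolding c_def by metis
  note Lh = divided_bounds(1)[OF W G2 L]
  note Lb = divided_bounds(3)[OF W G2 L ntbv_const_mult[OF bv]]
  define I1 :: "complex^'z^('z + 'w)" where "I1 = stack (mat 1) 0"
  define I2 :: "complex^'w^('z + 'w)" where "I2 = stack 0 (mat 1)"
  have I: "I1 *v a + I2 *v b = stack a b" for a b
    by (simp add: I1_def I2_def stack_mult_vec stack_add)
  define \<xi> where "\<xi> = (\<lambda>z. I1 *v (resolvent Zs z *v (upper B *v G z)) + I2 *v L z)"
  define \<xi>b where "\<xi>b = (\<lambda>y. I1 *v (resolvent Zs (Complex 0 y) *v (upper B *v \<gamma> y)) + I2 *v (resolvent W (Complex 0 y) *v (lower B *v \<gamma> y - c)))"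
  have \<xi>h: "\<xi> \<in> hardy2"
    unfolding \<xi>_def by (intro hardy2_add hardy2_const_mult hardy2_resolvent_neg(1)[OF Zs] Lh G)
  have \<xi>bv: "nontangential_boundary_values \<xi> \<xi>b"
    unfolding \<xi>_def \<xi>b_def by (intro ntbv_add ntbv_const_mult ntbv_resolvent_mult Lb bv axs)
  define F where "F = (\<lambda>z. G z + (- CC) *v \<xi> z)"
  define \<phi> where "\<phi> = (\<lambda>y. \<gamma> y + (- CC) *v \<xi>b y)"
  have Fh: "F \<in> hardy2" unfolding F_def by (intro hardy2_add hardy2_const_mult G \<xi>h)
  have Fb: "nontangential_boundary_values F \<phi>" unfolding F_def \<phi>_def by (intro ntbv_add ntbv_const_mult bv \<xi>bv)
  have GF: "G z = F z + CC *v \<xi> z" for z by (simp add: F_def matrix_vector_minus_left)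
  have \<gamma>\<phi>: "\<gamma> y = \<phi> y + CC *v \<xi>b y" for y by (simp add: \<phi>_def matrix_vector_minus_left)
  have inner: "beside X (- Y) *v F z = \<Gamma> *v (- c) + (mat z - Z) *v (- upper (PP *v \<xi> z))" if z: "z \<in> right_half_plane" for z
  proof -
    have "(mat z - AA) *v \<xi> z = B *v G z + stack 0 (- c)"
      unfolding \<xi>_def I AA_vec resolvent_right_vec[OF rhp_not_Zs[OF z]] B[of "G z"] stack_add L(2)[OF z] by simp
    then have "(mat z + conj_transpose AA) *v (PP *v \<xi> z) = PP *v stack 0 (- c) + conj_transpose CC *v (J_sig *v F z)"
      by (rule state_equation_iff[OF GF, THEN iffD2])
    then have "(mat z + conj_transpose AA) *v stack (upper (PP *v \<xi> z)) (lower (PP *v \<xi> z)) = PP *v stack 0 (- c) + conj_transpose CC *v (J_sig *v F z)"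
      by (simp only: stack_upper_lower)
    then have "(mat z - Z) *v upper (PP *v \<xi> z) = \<Gamma> *v (- c) - beside X (- Y) *v F z"
      unfolding adjoint_state_vec adjoint_input_vec by (simp only: stack_eq_iff)
    then show ?thesis by (simp add: matrix_vector_minus_right)
  qed
  have hol: "vec_holomorphic_on (\<lambda>z. - upper (PP *v \<xi> z)) right_half_plane"
    using hardy2_holomorphic[OF hardy2_const_mult[OF \<xi>h, of PP]]
    by (auto simp: vec_holomorphic_on_def upper_def intro!: holomorphic_intros)
  have "\<Theta> (Complex 0 y) *v \<gamma> y = stack V U *v (resolvent W (Complex 0 y) *v (- c)) + \<phi> y" for y
  proof -
    let ?z = "Complex 0 y"
    have zA: "?z \<notin> spectrum AA" by (rule AA_axis) simp
    have zW: "?z \<notin> spectrum W" using axis_notin_spectrum(1) W by auto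
    have "(mat ?z - AA) *v \<xi>b y = B *v \<gamma> y + stack 0 (- c)"
      unfolding \<xi>b_def I AA_vec resolvent_right_vec[OF axs] resolvent_right_vec[OF zW] B[of "\<gamma> y"] stack_add by simp
    from \<Theta>0_state[OF zA \<gamma>\<phi> this]
    show ?thesis unfolding eq[OF zA] AA_resolvent[OF axs zW] by (simp add: CC_stack_zero)
  qed
  then have ae': "AE y in lborel. h y = stack V U *v (resolvent W (Complex 0 y) *v (- c)) + \<phi> y" using ae by simp
  show "h \<in> M_D Z X Y U V W \<Gamma>"
    by (rule M_D_memI[OF Z W Fh Fb hol inner hm ae'])
qed

end

section \<open>Existence of solutions and positivity\<close>

context btoa_pos
begin

text \<open>For G = 0 the loop is invertible on the closed half-plane, so this central solution is
  holomorphic across the axis.\<close>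

lemma lft_zero_regular: "boundary_regular (lft 0)"
proof -
  define D where "D = {z. invertible (loop 0 z)}"
  have lh: "mat_holomorphic_on (loop 0) UNIV"
    unfolding loop_def by (intro mat_holo_intros)
  have "continuous_on UNIV (\<lambda>z. det (loop 0 z))"
    by (rule holomorphic_on_imp_continuous_on[OF det_holomorphic[OF lh]])
  then have "open ((\<lambda>z. det (loop 0 z)) -` (- {0}))"
    by (intro open_vimage) (simp_all add: open_Compl)
  then have D: "open D" unfolding D_def invertible_det_nz vimage_def by simp
  have cl: "z \<in> D" if "Re z \<ge> 0" for z
    unfolding D_def mem_Collect_eq
    by (rule loop_invertible) (use that AA_axis in auto)
  have hol: "mat_holomorphic_on (lft 0) D"
    by (rule loop_holomorphic(3)[of "\<lambda>_. 0"]) (auto simp: D_def)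
  have ctr: "norm (lft 0 z *v v) \<le> norm v" if "Re z \<ge> 0" for z v
    using lft_contractive[of z 0] that cl[OF that] by (auto simp: D_def)
  have "lft 0 \<in> schur_class"
    by (rule schur_classI[OF mat_holomorphic_on_subset[OF hol]])
       (use cl ctr in \<open>auto simp: right_half_plane_def\<close>)
  moreover have "(lft 0 \<longlongrightarrow> lft 0 (Complex 0 y)) (at (Complex 0 y) within right_half_plane)" for y
    by (rule holomorphic_tendsto[OF hol D cl]) simp
  moreover have "continuous_on UNIV (\<lambda>y. lft 0 (Complex 0 y))"
    by (rule continuous_on_compose2[OF mat_holomorphic_continuous[OF hol]])
       (use cl in \<open>auto intro!: continuous_intros\<close>)
  ultimately show ?thesis
    by (simp add: boundary_regular_def borel_measurable_continuous_onI)
qed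

lemma lft_zero_interpolates: "interpolates Z X Y U V W \<Gamma> (lft 0)"
proof -
  have "(\<lambda>_. 0 :: complex^'m^'p) \<in> schur_class" by (rule schur_classI) auto
  from lft_interpolates[OF this] show ?thesis .
qed

end

section \<open>Scaled data and compactness\<close>

lemma scaleR_matrix_vector: "(r *\<^sub>R A :: complex^'k::finite^'l::finite) *v x = r *\<^sub>R (A *v x)"
  by (simp add: vec_eq_iff matrix_vector_mult_def scaleR_sum_right)

lemma conj_transpose_scaleR: "conj_transpose (r *\<^sub>R A) = r *\<^sub>R conj_transpose A"
  by (simp add: vec_eq_iff)

lemma cinner_scaleR_left: "cinner (r *\<^sub>R u) v = of_real r * cinner u v"
  by (simp add: scaleR_vec cinner_scale_left)

text \<open>Both sides solve the same Lyapunov equation, whose solution is unique.\<close>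

lemma gram_scaleR:
  assumes Z: "spectrum Z \<subseteq> right_half_plane"
  shows "gram Z (r *\<^sub>R Y) = r\<^sup>2 *\<^sub>R gram Z Y"
proof -
  have 1: "Z ** gram Z (r *\<^sub>R Y) + gram Z (r *\<^sub>R Y) ** conj_transpose Z = r\<^sup>2 *\<^sub>R (Y ** conj_transpose Y)"
    unfolding gram_lyapunov[OF Z] by (simp add: conj_transpose_scaleR power2_eq_square matrix_scalar_ac flip: scalar_matrix_assoc)
  have 2: "Z ** (r\<^sup>2 *\<^sub>R gram Z Y) + (r\<^sup>2 *\<^sub>R gram Z Y) ** conj_transpose Z = r\<^sup>2 *\<^sub>R (Y ** conj_transpose Y)"
    using gram_lyapunov[OF Z, of Y, symmetric]
    by (simp add: matrix_scalar_ac scaleR_add_right flip: scalar_matrix_assoc)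
  have "Z ** (gram Z (r *\<^sub>R Y) - r\<^sup>2 *\<^sub>R gram Z Y) + (gram Z (r *\<^sub>R Y) - r\<^sup>2 *\<^sub>R gram Z Y) ** conj_transpose Z
    = (Z ** gram Z (r *\<^sub>R Y) + gram Z (r *\<^sub>R Y) ** conj_transpose Z)
      - (Z ** (r\<^sup>2 *\<^sub>R gram Z Y) + (r\<^sup>2 *\<^sub>R gram Z Y) ** conj_transpose Z)"
    by (simp add: mat_mul_simps)
  then have "Z ** (gram Z (r *\<^sub>R Y) - r\<^sup>2 *\<^sub>R gram Z Y) + (gram Z (r *\<^sub>R Y) - r\<^sup>2 *\<^sub>R gram Z Y) ** conj_transpose Z = 0"
    unfolding 1 2 by simp
  from lyapunov_unique[OF Z this] show ?thesis by simp
qed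

lemma admissible_spectra:
  assumes "admissible_data Z X Y U V W \<Gamma>"
  shows "spectrum Z \<subseteq> right_half_plane" "spectrum W \<subseteq> right_half_plane"
    "controllable Z X" "observable U W" "\<Gamma> ** W - Z ** \<Gamma> = X ** V - Y ** U"
  using assms by (auto simp: admissible_data_def)

text \<open>Scaling \<open>Y\<close>, \<open>V\<close> and \<open>\<Gamma>\<close> together
  preserves the Sylvester equation and moves the form towards the one given by the Gramians of
  \<open>X\<close> and \<open>U\<close>, which is definite by controllability and
  observability.\<close>

lemma scaled_data_pos:
  fixes Z :: "complex^'z::finite^'z" and X :: "complex^'p::finite^'z" and Y :: "complex^'m::finite^'z"
    and W :: "complex^'w::finite^'w"
  assumes adm: "admissible_data Z X Y U V W \<Gamma>"
    and nn: "\<And>y x. 0 \<le> pick_form Z X Y U V W \<Gamma> y x" and r: "0 < r" "r < 1"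
  shows "btoa_pos Z X (r *\<^sub>R Y) U (r *\<^sub>R V) W (r *\<^sub>R \<Gamma>)"
proof
  note s = admissible_spectra[OF adm]
  have W': "spectrum (conj_transpose W) \<subseteq> right_half_plane" by (rule spectrum_conj_transpose_rhp[OF s(2)])
  show "spectrum Z \<subseteq> right_half_plane" "spectrum W \<subseteq> right_half_plane" by (rule s)+
  have "(r *\<^sub>R \<Gamma>) ** W - Z ** (r *\<^sub>R \<Gamma>) = r *\<^sub>R (\<Gamma> ** W - Z ** \<Gamma>)"
    by (simp add: matrix_scalar_ac scaleR_diff_right flip: scalar_matrix_assoc)
  also have "\<dots> = X ** (r *\<^sub>R V) - (r *\<^sub>R Y) ** U"
    unfolding s(5) by (simp add: matrix_scalar_ac scaleR_diff_right flip: scalar_matrix_assoc)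
  finally show "(r *\<^sub>R \<Gamma>) ** W - Z ** (r *\<^sub>R \<Gamma>) = X ** (r *\<^sub>R V) - (r *\<^sub>R Y) ** U" .
  fix y :: "complex^'z" and x :: "complex^'w" assume yx: "(y, x) \<noteq> (0, 0)"
  define gX where "gX = Re (cinner (gram Z X *v y) y)"
  define gY where "gY = Re (cinner (gram Z Y *v y) y)"
  define gU where "gU = Re (cinner (gram (conj_transpose W) (conj_transpose U) *v x) x)"
  define gV where "gV = Re (cinner (gram (conj_transpose W) (conj_transpose V) *v x) x)"
  define g where "g = Re (cinner (\<Gamma> *v x) y)"
  have nng: "gX \<ge> 0" "gY \<ge> 0" "gU \<ge> 0" "gV \<ge> 0"
    unfolding gX_def gY_def gU_def gV_def by (rule gram_nonneg s W')+
  have "gX + gU \<noteq> 0"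
  proof
    assume "gX + gU = 0"
    then have "gX = 0" "gU = 0" using nng by auto
    then have "y = 0" "x = 0"
      using gram_controllable_pos[OF s(1,3)] gram_observable_pos[OF s(2,4)] by (auto simp: gX_def gU_def)
    with yx show False by simp
  qed
  with nng have pos: "gX + gU > 0" by linarith
  have "pick_form Z X (r *\<^sub>R Y) U (r *\<^sub>R V) W (r *\<^sub>R \<Gamma>) y x = gX - r\<^sup>2 * gY + 2 * r * g + gU - r\<^sup>2 * gV"
    unfolding pick_form_def conj_transpose_scaleR gram_scaleR[OF s(1)] gram_scaleR[OF W']
    by (simp add: scaleR_matrix_vector cinner_scaleR_left gX_def gY_def gU_def gV_def g_def flip: of_real_power)
  \<comment> \<open>Three nonnegative terms; the middle one is positive because gX + gU vanishes
    only at (0, 0).\<close>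
  also have "\<dots> = r * pick_form Z X Y U V W \<Gamma> y x + (1 - r) * (gX + gU) + r * (1 - r) * (gY + gV)"
    by (simp add: pick_form_def gX_def gY_def gU_def gV_def g_def algebra_simps power2_eq_square)
  also have "\<dots> > 0"
  proof -
    have "0 \<le> r * pick_form Z X Y U V W \<Gamma> y x" "0 \<le> r * (1 - r) * (gY + gV)" "0 < (1 - r) * (gX + gU)"
      using r nng pos nn[of y x] by simp_all
    then show ?thesis by linarith
  qed
  finally show "0 < pick_form Z X (r *\<^sub>R Y) U (r *\<^sub>R V) W (r *\<^sub>R \<Gamma>) y x" .
qed

lemma scaled_regular_solution:
  assumes "admissible_data Z X Y U V W \<Gamma>"
    and "\<And>y x. 0 \<le> pick_form Z X Y U V W \<Gamma> y x" and "0 < r" "r < 1"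
  obtains S where "boundary_regular S" "interpolates Z X (r *\<^sub>R Y) U (r *\<^sub>R V) W (r *\<^sub>R \<Gamma>) S"
proof -
  interpret btoa_pos Z X "r *\<^sub>R Y" U "r *\<^sub>R V" W "r *\<^sub>R \<Gamma>"
    by (rule scaled_data_pos) fact+
  show ?thesis by (rule that[OF lft_zero_regular lft_zero_interpolates])
qed

lemma norm_le_sum_components: "norm (v :: 'a::real_normed_vector^'k::finite) \<le> (\<Sum>i\<in>UNIV. norm (v $ i))"
  by (simp add: norm_vec_def L2_set_le_sum)

lemma locally_uniform_limitI:
  fixes S :: "complex \<Rightarrow> complex^'m::finite^'p::finite"
  assumes "\<And>K i j. compact K \<Longrightarrow> K \<subseteq> right_half_plane \<Longrightarrow>
    uniform_limit K (\<lambda>n z. Sn n z $ i $ j) (\<lambda>z. S z $ i $ j) sequentially"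
  shows "locally_uniform_limit Sn S"
  unfolding locally_uniform_limit_def uniform_limit_iff
proof (intro allI impI)
  fix K :: "complex set" and e :: real assume K: "compact K" "K \<subseteq> right_half_plane" and e: "e > 0"
  \<comment> \<open>Summed over all entries, \<open>d\<close> gives e/2, which leaves room for the
    strict inequality.\<close>
  define d where "d = e / (2 * (real CARD('p) * real CARD('m)))"
  have d: "d > 0" using e by (simp add: d_def)
  have "\<forall>\<^sub>F n in sequentially. \<forall>z\<in>K. dist (Sn n z $ i $ j) (S z $ i $ j) < d" for i j
    using assms[OF K] d unfolding uniform_limit_iff by auto
  then have "\<forall>\<^sub>F n in sequentially. \<forall>j\<in>UNIV. \<forall>z\<in>K. dist (Sn n z $ i $ j) (S z $ i $ j) < d" for i
    by (intro eventually_ball_finite[OF finite[of UNIV]]) auto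
  then have "\<forall>\<^sub>F n in sequentially. \<forall>i\<in>UNIV. \<forall>j\<in>UNIV. \<forall>z\<in>K. dist (Sn n z $ i $ j) (S z $ i $ j) < d"
    by (intro eventually_ball_finite[OF finite[of UNIV]]) auto
  then show "\<forall>\<^sub>F n in sequentially. \<forall>z\<in>K. dist (Sn n z) (S z) < e"
  proof eventually_elim
    case (elim n)
    show ?case
    proof
      fix z assume z: "z \<in> K"
      have "norm (Sn n z - S z) \<le> (\<Sum>i\<in>UNIV. norm ((Sn n z - S z) $ i))" by (rule norm_le_sum_components)
      also have "\<dots> \<le> (\<Sum>i\<in>(UNIV :: 'p set). \<Sum>j\<in>(UNIV :: 'm set). norm ((Sn n z - S z) $ i $ j))"
        by (intro sum_mono norm_le_sum_components)
      also have "\<dots> \<le> (\<Sum>i\<in>(UNIV :: 'p set). \<Sum>j\<in>(UNIV :: 'm set). d)"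
        using elim z by (intro sum_mono) (auto simp: dist_norm less_imp_le)
      also have "\<dots> = e / 2" by (simp add: d_def)
      finally show "dist (Sn n z) (S z) < e" using e by (simp add: dist_norm)
    qed
  qed
qed

text \<open>Montel's theorem is applied to one entry after the other, thinning out the subsequence
  each time; contractivity passes to the pointwise limit.\<close>

lemma schur_subsequence:
  fixes Sn :: "nat \<Rightarrow> complex \<Rightarrow> complex^'m::finite^'p::finite"
  assumes Sn: "\<And>n. Sn n \<in> schur_class"
  obtains S r where "S \<in> schur_class" "strict_mono (r :: nat \<Rightarrow> nat)" "locally_uniform_limit (\<lambda>n. Sn (r n)) S"
proof -
  define lim where "lim r i j g \<longleftrightarrow> g holomorphic_on right_half_plane \<and> (\<forall>K. compact K \<longrightarrow> K \<subseteq> right_half_plane \<longrightarrow>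
      uniform_limit K (\<lambda>n z. Sn (r n) z $ i $ j) g sequentially)" for r :: "nat \<Rightarrow> nat" and i j g
  have entry: "norm (Sn n z $ i $ j) \<le> 1" if "z \<in> right_half_plane" for n z i j
  proof -
    have "norm (Sn n z $ i $ j) = norm ((Sn n z *v axis j 1) $ i)" by (simp add: matrix_vector_axis)
    also have "\<dots> \<le> norm (Sn n z *v axis j 1)" by (rule Finite_Cartesian_Product.norm_nth_le)
    also have "\<dots> \<le> norm (axis j 1 :: complex^'m)" by (rule schur_norm[OF Sn that])
    also have "\<dots> = 1"
    proof -
      have "(norm (axis j 1 :: complex^'m))\<^sup>2 = 1"
        by (simp add: norm_sq_vec axis_def if_distrib[of norm] if_distrib[of "\<lambda>x. x\<^sup>2"] cong: if_cong)
      then show ?thesis using norm_ge_zero[of "axis j 1 :: complex^'m"] by (simp add: power2_eq_1_iff)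
    qed
    finally show ?thesis .
  qed
  have sub: "lim (r \<circ> k) i j g" if g: "lim r i j g" and k: "strict_mono k" for r k i j g
    unfolding lim_def
  proof (intro conjI allI impI)
    show "g holomorphic_on right_half_plane" using g by (simp add: lim_def)
    fix K assume "compact K" "K \<subseteq> right_half_plane"
    then have "uniform_limit K (\<lambda>n z. Sn (r n) z $ i $ j) g sequentially" using g by (simp add: lim_def)
    from filterlim_compose[OF this filterlim_subseq[OF k]]
    show "uniform_limit K (\<lambda>n z. Sn ((r \<circ> k) n) z $ i $ j) g sequentially" by (simp add: o_def)
  qed
  have "\<exists>r. strict_mono r \<and> (\<forall>(i, j)\<in>I. \<exists>g. lim r i j g)" if "finite I" for I :: "('p \<times> 'm) set"
    using that
  proof (induction I)
    case empty
    show ?case using strict_mono_id by auto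
  next
    case (insert x I)
    obtain i j where x: "x = (i, j)" by (cases x)
    obtain r where r: "strict_mono r" "\<forall>(i, j)\<in>I. \<exists>g. lim r i j g" using insert.IH by auto
    define \<F> where "\<F> = (\<lambda>n z. Sn (r n) z $ i $ j)"
    obtain g k where g: "g holomorphic_on right_half_plane" "strict_mono (k :: nat \<Rightarrow> nat)"
      "\<And>K. compact K \<Longrightarrow> K \<subseteq> right_half_plane \<Longrightarrow> uniform_limit K (\<F> \<circ> k) g sequentially"
    proof (rule Montel[of right_half_plane "range \<F>" \<F>])
      show "h holomorphic_on right_half_plane" if "h \<in> range \<F>" for h
        using that schur_holomorphic[OF Sn] by (auto simp: \<F>_def mat_holomorphic_on_def)
      show "\<exists>B. \<forall>h\<in>range \<F>. \<forall>z\<in>K. norm (h z) \<le> B" if "K \<subseteq> right_half_plane" for K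
        using that entry by (intro exI[of _ 1]) (auto simp: \<F>_def)
    qed auto
    have "lim (r \<circ> k) i j g" unfolding lim_def using g(1) g(3) by (simp add: \<F>_def o_def)
    moreover have "\<forall>(i, j)\<in>I. \<exists>g. lim (r \<circ> k) i j g" using r(2) sub[OF _ g(2)] by fast
    ultimately show ?case
      using strict_mono_o[OF r(1) g(2)] unfolding x by fast
  qed
  from this[of UNIV] obtain r where r: "strict_mono r" and "\<forall>i j. \<exists>g. lim r i j g" by auto
  then obtain g where "\<And>i j. lim r i j (g i j)" by metis
  then have g: "\<And>i j. g i j holomorphic_on right_half_plane"
    "\<And>i j K. compact K \<Longrightarrow> K \<subseteq> right_half_plane \<Longrightarrow> uniform_limit K (\<lambda>n z. Sn (r n) z $ i $ j) (g i j) sequentially"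
    by (simp_all add: lim_def)
  define S where "S = (\<lambda>z. \<chi> i j. g i j z)"
  have ul: "locally_uniform_limit (\<lambda>n. Sn (r n)) S"
    by (rule locally_uniform_limitI) (simp add: S_def g(2))
  have "S \<in> schur_class"
  proof (rule schur_classI)
    show "mat_holomorphic_on S right_half_plane" by (simp add: mat_holomorphic_on_def S_def g(1))
    fix z v assume z: "z \<in> right_half_plane"
    have "(\<lambda>n. Sn (r n) z) \<longlonglongrightarrow> S z"
      using ul[unfolded locally_uniform_limit_def, rule_format, of "{z}"] z by simp
    then have "(\<lambda>n. norm (Sn (r n) z *v v)) \<longlonglongrightarrow> norm (S z *v v)"
      by (intro tendsto_norm tendsto_matrix_vector tendsto_const)
    then show "norm (S z *v v) \<le> norm v"
      by (rule LIMSEQ_le_const2) (use schur_norm[OF Sn z] in auto)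
  qed
  from that[OF this r ul] show ?thesis .
qed

lemma solution_exists:
  fixes Z :: "complex^'z::finite^'z" and W :: "complex^'w::finite^'w"
  assumes adm: "admissible_data Z X Y U V W \<Gamma>"
    and nn: "\<And>y x. 0 \<le> pick_form Z X Y U V W \<Gamma> y x"
  shows "\<exists>S. S \<in> btoa_solutions Z X Y U V W \<Gamma>"
proof -
  note s = admissible_spectra[OF adm]
  \<comment> \<open>The double successor makes r 0 = 1/2, so all terms are positive.\<close>
  define r where "r = (\<lambda>n. 1 - inverse (real (Suc (Suc n))))"
  have r: "0 < r n" "r n < 1" for n
    unfolding r_def by (simp_all add: field_simps)
  have "\<exists>S. boundary_regular S \<and> interpolates Z X (r n *\<^sub>R Y) U (r n *\<^sub>R V) W (r n *\<^sub>R \<Gamma>) S" for n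
    using scaled_regular_solution[OF adm nn r] by metis
  then obtain Sn where Sn: "\<And>n. boundary_regular (Sn n)"
    and I: "\<And>n. interpolates Z X (r n *\<^sub>R Y) U (r n *\<^sub>R V) W (r n *\<^sub>R \<Gamma>) (Sn n)"
    by metis
  have sc: "Sn n \<in> schur_class" for n using Sn by (simp add: boundary_regular_def)
  obtain S k where S: "S \<in> schur_class" and k: "strict_mono (k :: nat \<Rightarrow> nat)" and ul: "locally_uniform_limit (\<lambda>n. Sn (k n)) S"
    using schur_subsequence[OF sc] .
  note lims = evals_tendsto[OF s(1,2) schur_holomorphic[OF sc] schur_holomorphic[OF S] ul]
  note ev = interpolates_imp_evals[OF s(1,2) I]
  have "r \<longlonglongrightarrow> 1 - 0"
    unfolding r_def by (intro tendsto_diff tendsto_const LIMSEQ_Suc[OF LIMSEQ_inverse_real_of_nat])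
  from LIMSEQ_subseq_LIMSEQ[OF this k] have rk: "(\<lambda>n. r (k n)) \<longlonglongrightarrow> 1" by (simp add: o_def)
  show ?thesis
    using S LIMSEQ_unique[OF lims(1)[of X, unfolded ev] tendsto_scaleR[OF rk tendsto_const]]
      LIMSEQ_unique[OF lims(2)[of U, unfolded ev] tendsto_scaleR[OF rk tendsto_const]]
      LIMSEQ_unique[OF lims(3)[of X U, unfolded ev] tendsto_scaleR[OF rk tendsto_const]]
    by (auto simp: btoa_solutions_def)
qed

section \<open>Positivity of the orthogonal subspace\<close>

lemma measurable_cinner:
  fixes f g :: "'a \<Rightarrow> complex^'k::finite"
  assumes "f \<in> borel_measurable M" "g \<in> borel_measurable M"
  shows "(\<lambda>y. cinner (f y) (g y)) \<in> borel_measurable M"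
proof -
  have "(\<lambda>y. f y $ i) \<in> borel_measurable M" "(\<lambda>y. cnj (g y $ i)) \<in> borel_measurable M" for i
    by (rule borel_measurable_continuous_on[OF _ assms(1)] borel_measurable_continuous_on[OF _ assms(2)],
        intro continuous_intros)+
  then show ?thesis unfolding cinner_def
    by (intro borel_measurable_sum borel_measurable_times)
qed

lemma L2_line_cinner:
  fixes f g :: "real \<Rightarrow> complex^'k::finite"
  assumes f: "f \<in> L2_line" and g: "g \<in> L2_line"
  shows "integrable lborel (\<lambda>y. cinner (f y) (g y))"
proof (rule Bochner_Integration.integrable_bound)
  show "integrable lborel (\<lambda>y. (norm (f y))\<^sup>2 + (norm (g y))\<^sup>2)"
    using f g by (auto simp: L2_line_def)
  show "(\<lambda>y. cinner (f y) (g y)) \<in> borel_measurable lborel"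
    using f g by (intro measurable_cinner) (auto simp: L2_line_def)
  have "norm (cinner (f y) (g y)) \<le> (norm (f y))\<^sup>2 + (norm (g y))\<^sup>2" for y
    using norm_cinner_le[of "f y" "g y"] lower_bound_sq[of "norm (f y)" "norm (g y)"]
      mult_nonneg_nonneg[OF norm_ge_zero[of "f y"] norm_ge_zero[of "g y"]] by linarith
  then show "AE y in lborel. norm (cinner (f y) (g y)) \<le> norm ((norm (f y))\<^sup>2 + (norm (g y))\<^sup>2)"
    by (intro AE_I2) simp
qed

lemma J_form_stack:
  fixes a a' :: "real \<Rightarrow> complex^'p::finite" and b b' :: "real \<Rightarrow> complex^'m::finite"
  assumes "a \<in> L2_line" "a' \<in> L2_line" "b \<in> L2_line" "b' \<in> L2_line"
  shows "J_form (\<lambda>y. stack (a y) (b y)) (\<lambda>y. stack (a' y) (b' y)) = L2_inner a a' - L2_inner b b'"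
  unfolding J_form_def L2_inner_def
  by (simp add: J_sig_stack cinner_stack cinner_minus_left L2_line_cinner assms)

lemma L2_inner_self: "f \<in> L2_line \<Longrightarrow> L2_inner f f = of_real (LINT y|lborel. (norm (f y))\<^sup>2)"
  unfolding L2_inner_def cinner_self by (rule integral_complex_of_real)

lemma measurable_stack:
  fixes a :: "real \<Rightarrow> complex^'p::finite" and b :: "real \<Rightarrow> complex^'m::finite"
  assumes a: "a \<in> borel_measurable M" and b: "b \<in> borel_measurable M"
  shows "(\<lambda>y. stack (a y) (b y)) \<in> borel_measurable M"
proof -
  have "(\<lambda>y. (stack (mat 1) 0 :: complex^'p^('p+'m)) *v a y + (stack 0 (mat 1) :: complex^'m^('p+'m)) *v b y) \<in> borel_measurable M"
    by (intro borel_measurable_add measurable_matrix_vector borel_measurable_const a b)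
  then show ?thesis by (simp add: stack_mult_vec stack_add)
qed

text \<open>With c = S b / r the pair (c, b) belongs to \<open>M_D\<close>, so orthogonality turns
  |b|^2 into Re <a, c>. Since |c| <= |b|/r, this is at most (|a|^2 + |b|^2)/(2 r).\<close>

lemma regular_solution_bound:
  fixes Z :: "complex^'z::finite^'z" and W :: "complex^'w::finite^'w"
    and a :: "real \<Rightarrow> complex^'p::finite" and b :: "real \<Rightarrow> complex^'m::finite"
  assumes Z: "spectrum Z \<subseteq> right_half_plane" and W: "spectrum W \<subseteq> right_half_plane"
    and S: "boundary_regular S" and I: "interpolates Z X (r *\<^sub>R Y) U (r *\<^sub>R V) W (r *\<^sub>R \<Gamma>) S"
    and r: "r > 0" and a: "a \<in> L2_line" and b: "b \<in> M_D_minus U W"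
    and perp: "\<And>g. g \<in> M_D Z X Y U V W \<Gamma> \<Longrightarrow> J_form (\<lambda>y. stack (a y) (b y)) g = 0"
  shows "2 * r * (LINT y|lborel. (norm (b y))\<^sup>2) \<le> (LINT y|lborel. (norm (a y))\<^sup>2) + (LINT y|lborel. (norm (b y))\<^sup>2)"
proof -
  obtain x F \<phi>0 where bL: "b \<in> L2_line" and F: "F \<in> hardy2" and bv0: "nontangential_boundary_values F \<phi>0"
    and ae0: "AE y in lborel. b y = U *v (resolvent W (Complex 0 y) *v x) + \<phi>0 y"
    using b unfolding M_D_minus_def by blast
  have sc: "S \<in> schur_class" and Slim: "\<And>y. (S \<longlongrightarrow> S (Complex 0 y)) (at (Complex 0 y) within right_half_plane)"
    and Sm: "(\<lambda>y. S (Complex 0 y)) \<in> borel_measurable lborel"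
    using S by (auto simp: boundary_regular_def)
  obtain H K L where H: "mat_holomorphic_on H right_half_plane" and K: "mat_holomorphic_on K right_half_plane"
    and L: "mat_holomorphic_on L right_half_plane"
    and eH: "\<And>z. z \<in> right_half_plane \<Longrightarrow> X ** S z = r *\<^sub>R Y + (mat z - Z) ** H z"
    and eK: "\<And>z. z \<in> right_half_plane \<Longrightarrow> S z ** U = r *\<^sub>R V + K z ** (mat z - W)"
    and eL: "\<And>z. z \<in> right_half_plane \<Longrightarrow> X ** K z = r *\<^sub>R \<Gamma> + (mat z - Z) ** L z"
    using I unfolding interpolates_def by auto
  note Kh = right_quotient_hardy2(1)[OF sc W K eK, of x]
  note Kb = right_quotient_hardy2(2)[OF sc W K eK Slim, of x]
  note SF = boundary_regular_mult(1,2)[OF S F bv0]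
  \<comment> \<open>Dividing by \<open>r\<close> undoes the scaling of \<open>V\<close> and
    \<open>\<Gamma>\<close> in the data of \<open>S\<close>, so that the resolvent part of
    \<open>c\<close> is V (\<lambda> - W)^{-1} x.\<close>
  define c :: "real \<Rightarrow> complex^'p" where "c = (\<lambda>y. (1 / r) *\<^sub>R (S (Complex 0 y) *v b y))"
  have cm: "c \<in> borel_measurable lborel"
    unfolding c_def using bL by (intro borel_measurable_scaleR measurable_matrix_vector Sm borel_measurable_const) (simp add: L2_line_def)
  have cle: "norm (c y) \<le> (1 / r) * norm (b y)" for y
    using boundary_regular_norm[OF S, of y "b y"] r by (simp add: c_def divide_right_mono)
  have cL: "c \<in> L2_line"
  proof -
    have "integrable lborel (\<lambda>y. (1 / r)\<^sup>2 * (norm (b y))\<^sup>2)" using bL by (simp add: L2_line_def)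
    then have "integrable lborel (\<lambda>y. (norm (c y))\<^sup>2)"
    proof (rule Bochner_Integration.integrable_bound)
      show "(\<lambda>y. (norm (c y))\<^sup>2) \<in> borel_measurable lborel"
        by (intro borel_measurable_power measurable_compose[OF cm]) simp
      have "(norm (c y))\<^sup>2 \<le> (1 / r)\<^sup>2 * (norm (b y))\<^sup>2" for y
        using power_mono[OF cle[of y], of 2] by (simp add: power_mult_distrib power_divide)
      then show "AE y in lborel. norm ((norm (c y))\<^sup>2) \<le> norm ((1 / r)\<^sup>2 * (norm (b y))\<^sup>2)"
        by (intro AE_I2) simp
    qed
    with cm show ?thesis by (simp add: L2_line_def)
  qed
  define I1 :: "complex^'p^('p + 'm)" where "I1 = stack (mat (1 / of_real r)) 0"
  define I2 :: "complex^'m^('p + 'm)" where "I2 = stack 0 (mat 1)"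
  have I12: "I1 *v u + I2 *v v = stack ((1 / r) *\<^sub>R u) v" for u v
    by (simp add: I1_def I2_def stack_mult_vec stack_add mat_mult_vector scaleR_vec)
  define E where "E = (\<lambda>z. I1 *v (S z *v F z + K z *v x) + I2 *v F z)"
  define \<epsilon> where "\<epsilon> = (\<lambda>y. I1 *v (S (Complex 0 y) *v \<phi>0 y + (S (Complex 0 y) *v (U *v (resolvent W (Complex 0 y) *v x)) - (r *\<^sub>R V) *v (resolvent W (Complex 0 y) *v x))) + I2 *v \<phi>0 y)"
  have Eh: "E \<in> hardy2" unfolding E_def by (intro hardy2_add hardy2_const_mult SF Kh F)
  have Eb: "nontangential_boundary_values E \<epsilon>" unfolding E_def \<epsilon>_def by (intro ntbv_add ntbv_const_mult SF Kb bv0)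
  have "(\<lambda>y. stack (c y) (b y)) \<in> M_D Z X Y U V W \<Gamma>"
  proof (rule M_D_memI[OF Z W Eh Eb])
    show "vec_holomorphic_on (\<lambda>z. (mat (1 / of_real r) :: complex^'z^'z) *v (H z *v F z + L z *v x)) right_half_plane"
      by (intro mat_holo_intros H L hardy2_holomorphic[OF F])
    show "beside X (- Y) *v E z = \<Gamma> *v x + (mat z - Z) *v ((mat (1 / of_real r) :: complex^'z^'z) *v (H z *v F z + L z *v x))"
      if z: "z \<in> right_half_plane" for z
    proof -
      have 1: "X *v (S z *v F z) = r *\<^sub>R (Y *v F z) + (mat z - Z) *v (H z *v F z)"
        using arg_cong[OF eH[OF z], of "\<lambda>M. M *v F z"]
        by (simp add: matrix_vector_mult_add_rdistrib scaleR_matrix_vector flip: matrix_vector_mul_assoc)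
      have 2: "X *v (K z *v x) = r *\<^sub>R (\<Gamma> *v x) + (mat z - Z) *v (L z *v x)"
        using arg_cong[OF eL[OF z], of "\<lambda>M. M *v x"]
        by (simp add: matrix_vector_mult_add_rdistrib scaleR_matrix_vector flip: matrix_vector_mul_assoc)
      have "beside X (- Y) *v E z = (1 / r) *\<^sub>R (X *v (S z *v F z) + X *v (K z *v x)) - Y *v F z"
        unfolding E_def I12 beside_mult_vec scaleR_vec by (simp add: mat_vec_simps)
      also have "\<dots> = \<Gamma> *v x + (1 / r) *\<^sub>R ((mat z - Z) *v (H z *v F z) + (mat z - Z) *v (L z *v x))"
        unfolding 1 2 using r by (simp add: scaleR_add_right)
      finally show ?thesis
        unfolding mat_mult_vector matrix_vector_scale by (simp add: matrix_vector_right_distrib scaleR_vec)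
    qed
    show "(\<lambda>y. stack (c y) (b y)) \<in> borel_measurable lborel"
      using cm bL by (intro measurable_stack) (auto simp: L2_line_def)
    show "AE y in lborel. stack (c y) (b y) = stack V U *v (resolvent W (Complex 0 y) *v x) + \<epsilon> y"
      using ae0
    proof eventually_elim
      case (elim y)
      have "c y = V *v (resolvent W (Complex 0 y) *v x) + (1 / r) *\<^sub>R (S (Complex 0 y) *v \<phi>0 y + (S (Complex 0 y) *v (U *v (resolvent W (Complex 0 y) *v x)) - (r *\<^sub>R V) *v (resolvent W (Complex 0 y) *v x)))"
        unfolding c_def elim using r by (simp add: matrix_vector_right_distrib scaleR_matrix_vector scaleR_add_right scaleR_diff_right)
      then show ?case
        unfolding \<epsilon>_def I12 by (simp add: stack_mult_vec stack_add elim)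
    qed
  qed
  from perp[OF this] have "L2_inner a c = L2_inner b b"
    using J_form_stack[OF a cL bL bL] by simp
  then have "(LINT y|lborel. (norm (b y))\<^sup>2) = Re (L2_inner a c)"
    using L2_inner_self[OF bL] by simp
  also have "\<dots> = (LINT y|lborel. Re (cinner (a y) (c y)))"
    unfolding L2_inner_def by (rule integral_Re[OF L2_line_cinner[OF a cL], symmetric])
  also have "\<dots> \<le> (LINT y|lborel. (1 / (2 * r)) * ((norm (a y))\<^sup>2 + (norm (b y))\<^sup>2))"
  proof (rule integral_mono)
    show "integrable lborel (\<lambda>y. Re (cinner (a y) (c y)))" using L2_line_cinner[OF a cL] by simp
    show "integrable lborel (\<lambda>y. (1 / (2 * r)) * ((norm (a y))\<^sup>2 + (norm (b y))\<^sup>2))" using a bL by (simp add: L2_line_def)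
    fix y
    have "Re (cinner (a y) (c y)) \<le> norm (a y) * norm (c y)"
      by (rule order_trans[OF complex_Re_le_cmod norm_cinner_le])
    also have "\<dots> \<le> norm (a y) * ((1 / r) * norm (b y))" by (intro mult_left_mono cle) simp
    also have "\<dots> = (1 / (2 * r)) * (2 * (norm (a y) * norm (b y)))" by simp
    also have "\<dots> \<le> (1 / (2 * r)) * ((norm (a y))\<^sup>2 + (norm (b y))\<^sup>2)"
      using r by (intro mult_left_mono lower_bound_sq) simp
    finally show "Re (cinner (a y) (c y)) \<le> (1 / (2 * r)) * ((norm (a y))\<^sup>2 + (norm (b y))\<^sup>2)" .
  qed
  also have "\<dots> = (1 / (2 * r)) * ((LINT y|lborel. (norm (a y))\<^sup>2) + (LINT y|lborel. (norm (b y))\<^sup>2))"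
    using a bL by (simp add: L2_line_def)
  finally show ?thesis using r by (simp add: field_simps)
qed

lemma pick_nonneg_imp_J_positive:
  fixes Z :: "complex^'z::finite^'z" and W :: "complex^'w::finite^'w"
  assumes adm: "admissible_data Z X Y U V W \<Gamma>"
    and nn: "\<And>y x. 0 \<le> pick_form Z X Y U V W \<Gamma> y x"
  shows "J_positive (M_D_perp Z X Y U V W \<Gamma>)"
  unfolding J_positive_def
proof
  note s = admissible_spectra[OF adm]
  fix h assume "h \<in> M_D_perp Z X Y U V W \<Gamma>"
  then obtain a b where a: "a \<in> L2_line" and b: "b \<in> M_D_minus U W" and h: "h = (\<lambda>y. stack (a y) (b y))"
    and perp: "\<And>g. g \<in> M_D Z X Y U V W \<Gamma> \<Longrightarrow> J_form (\<lambda>y. stack (a y) (b y)) g = 0"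
    unfolding M_D_perp_def krein_K_def by auto
  have bL: "b \<in> L2_line" using b by (auto simp: M_D_minus_def)
  define \<alpha> where "\<alpha> = (LINT y|lborel. (norm (a y))\<^sup>2)"
  define \<beta> where "\<beta> = (LINT y|lborel. (norm (b y))\<^sup>2)"
  have le: "2 * r * \<beta> \<le> \<alpha> + \<beta>" if r: "0 < r" "r < 1" for r
  proof -
    obtain S where S: "boundary_regular S" "interpolates Z X (r *\<^sub>R Y) U (r *\<^sub>R V) W (r *\<^sub>R \<Gamma>) S"
      using scaled_regular_solution[OF adm nn r] .
    show ?thesis unfolding \<alpha>_def \<beta>_def by (rule regular_solution_bound[OF s(1,2) S r(1) a b perp])
  qed
  \<comment> \<open>The limit r -> 1 is taken in the inequality, so boundary values occur only for
    solutions of scaled problems.\<close>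
  have "2 * 1 * \<beta> \<le> \<alpha> + \<beta>"
  proof (rule tendsto_le[OF _ tendsto_const])
    show "((\<lambda>r. 2 * r * \<beta>) \<longlongrightarrow> 2 * 1 * \<beta>) (at_left 1)" by (intro tendsto_intros)
    show "\<forall>\<^sub>F r in at_left 1. 2 * r * \<beta> \<le> \<alpha> + \<beta>"
      using eventually_at_left_real[of 0 "1 :: real"] by (rule eventually_mono) (use le in auto)
  qed simp
  moreover have "Re (J_form h h) = \<alpha> - \<beta>"
    unfolding h J_form_stack[OF a a bL bL] L2_inner_self[OF a] L2_inner_self[OF bL] by (simp add: \<alpha>_def \<beta>_def)
  ultimately show "0 \<le> Re (J_form h h)" by simp
qed

section \<open>Test vectors\<close>

lemma has_integral_cinner_swap:
  assumes "has_bochner_integral M (\<lambda>t. cinner (f t) (g t)) c"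
  shows "has_bochner_integral M (\<lambda>t. cinner (g t) (f t)) (cnj c)"
  using has_bochner_integral_bounded_linear[OF bounded_linear_cnj assms] by (simp add: cnj_cinner)

text \<open>A kernel function plus a resolvent function in each component. Pairing with an element
  of \<open>M_D\<close> leaves a multiple of <gV x - \<Gamma>^H y - gU x', \<xi>>, with gU and gV
  the Gramians of \<open>U\<close> and \<open>V\<close>: the term with \<open>\<Gamma>\<close> comes
  from the Hardy part via its residue condition. The equation for x' makes this 0 for every
  \<xi>.\<close>

lemma test_vector:
  fixes Z :: "complex^'z::finite^'z" and X :: "complex^'p::finite^'z" and Y :: "complex^'m::finite^'z"
    and U :: "complex^'w::finite^'m" and V :: "complex^'w^'p" and W :: "complex^'w^'w"
    and \<Gamma> :: "complex^'w^'z"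
  assumes Z: "spectrum Z \<subseteq> right_half_plane" and W: "spectrum W \<subseteq> right_half_plane"
    and x': "gram (conj_transpose W) (conj_transpose U) *v x'
      = gram (conj_transpose W) (conj_transpose V) *v x - conj_transpose \<Gamma> *v y"
  obtains a b where "a \<in> L2_line" "b \<in> L2_line" "(\<lambda>t. stack (a t) (b t)) \<in> M_D_perp Z X Y U V W \<Gamma>"
    and "(LINT t|lborel. (norm (a t))\<^sup>2)
      = 2 * pi * (Re (cinner (gram Z X *v y) y) + Re (cinner (gram (conj_transpose W) (conj_transpose V) *v x) x))"
    and "(LINT t|lborel. (norm (b t))\<^sup>2)
      = 2 * pi * (Re (cinner (gram Z Y *v y) y) + Re (cinner (gram (conj_transpose W) (conj_transpose U) *v x') x'))"
proof -
  let ?R = "\<lambda>t. resolvent (- conj_transpose Z) (Complex 0 t) *v y"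
  define uX where "uX = (\<lambda>t. conj_transpose X *v ?R t)"
  define uY where "uY = (\<lambda>t. conj_transpose Y *v ?R t)"
  define vV where "vV = (\<lambda>x t. V *v (resolvent W (Complex 0 t) *v x))"
  define vU where "vU = (\<lambda>x t. U *v (resolvent W (Complex 0 t) *v x))"
  let ?gU = "gram (conj_transpose W) (conj_transpose U)" and ?gV = "gram (conj_transpose W) (conj_transpose V)"
  have uu: "has_bochner_integral lborel (\<lambda>t. cinner (uX t) (uX t)) (2 * pi * cinner (gram Z X *v y) y)"
    "has_bochner_integral lborel (\<lambda>t. cinner (uY t) (uY t)) (2 * pi * cinner (gram Z Y *v y) y)"
    unfolding uX_def uY_def by (rule gram_inner[OF Z])+
  have vv: "has_bochner_integral lborel (\<lambda>t. cinner (vV x t) (vV \<xi> t)) (2 * pi * cinner (?gV *v x) \<xi>)"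
    "has_bochner_integral lborel (\<lambda>t. cinner (vU x t) (vU \<xi> t)) (2 * pi * cinner (?gU *v x) \<xi>)" for x \<xi>
    unfolding vV_def vU_def by (rule gram_inner_right[OF W])+
  have uv: "has_bochner_integral lborel (\<lambda>t. cinner (uX t) (vV \<xi> t)) 0"
    "has_bochner_integral lborel (\<lambda>t. cinner (uY t) (vU \<xi> t)) 0" for \<xi>
    unfolding uX_def uY_def vV_def vU_def by (rule hardy_inner_right[OF W left_state(1,2,3)[OF Z]])+
  have vu: "has_bochner_integral lborel (\<lambda>t. cinner (vV \<xi> t) (uX t)) 0"
    "has_bochner_integral lborel (\<lambda>t. cinner (vU \<xi> t) (uY t)) 0" for \<xi>
    using has_integral_cinner_swap[OF uv(1)] has_integral_cinner_swap[OF uv(2)] by simp_all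
  have uL: "uX \<in> L2_line" "uY \<in> L2_line"
    unfolding uX_def uY_def by (rule left_state(4)[OF Z])+
  have vL: "vV \<xi> \<in> L2_line" "vU \<xi> \<in> L2_line" for \<xi>
    unfolding vV_def vU_def by (rule right_state_L2[OF W])+
  have neg: "(\<lambda>t. - uX t) \<in> L2_line" "(\<lambda>t. - uY t) \<in> L2_line"
    using uL by (simp_all add: L2_line_def)
  define a where "a = (\<lambda>t. - uX t + vV x t)"
  define b where "b = (\<lambda>t. - uY t + vU x' t)"
  have aL: "a \<in> L2_line" and bL: "b \<in> L2_line"
    unfolding a_def b_def by (intro L2_line_add neg vL)+
  have "has_bochner_integral lborel (\<lambda>t. cinner (a t) (a t))
      (2 * pi * cinner (gram Z X *v y) y - 0 - 0 + 2 * pi * cinner (?gV *v x) x)"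
  proof -
    have eq: "cinner (a t) (a t) = cinner (uX t) (uX t) - cinner (uX t) (vV x t) - cinner (vV x t) (uX t) + cinner (vV x t) (vV x t)" for t
      by (simp add: a_def cinner_add_left cinner_add_right cinner_diff_left cinner_diff_right)
    show ?thesis unfolding eq
      by (intro has_bochner_integral_add has_bochner_integral_diff uu uv vu vv)
  qed
  from has_bochner_integral_integral_eq[OF this]
  have ia: "(LINT t|lborel. (norm (a t))\<^sup>2) = 2 * pi * (Re (cinner (gram Z X *v y) y) + Re (cinner (?gV *v x) x))"
    using arg_cong[OF L2_inner_self[OF aL], of Re] by (simp add: L2_inner_def distrib_left)
  have "has_bochner_integral lborel (\<lambda>t. cinner (b t) (b t))
      (2 * pi * cinner (gram Z Y *v y) y - 0 - 0 + 2 * pi * cinner (?gU *v x') x')"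
  proof -
    have eq: "cinner (b t) (b t) = cinner (uY t) (uY t) - cinner (uY t) (vU x' t) - cinner (vU x' t) (uY t) + cinner (vU x' t) (vU x' t)" for t
      by (simp add: b_def cinner_add_left cinner_add_right cinner_diff_left cinner_diff_right)
    show ?thesis unfolding eq
      by (intro has_bochner_integral_add has_bochner_integral_diff uu uv vu vv)
  qed
  from has_bochner_integral_integral_eq[OF this]
  have ib: "(LINT t|lborel. (norm (b t))\<^sup>2) = 2 * pi * (Re (cinner (gram Z Y *v y) y) + Re (cinner (?gU *v x') x'))"
    using arg_cong[OF L2_inner_self[OF bL], of Re] by (simp add: L2_inner_def distrib_left)
  have bM: "b \<in> M_D_minus U W"
  proof -
    note ls = left_state(1,2)[OF Z, of "- conj_transpose Y" y]
    have "AE t in lborel. b t = U *v (resolvent W (Complex 0 t) *v x') + (- conj_transpose Y) *v ?R t"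
      by (simp add: b_def vU_def uY_def matrix_vector_minus_left)
    with bL ls show ?thesis unfolding M_D_minus_def by blast
  qed
  have perp: "J_form (\<lambda>t. stack (a t) (b t)) h = 0" if "h \<in> M_D Z X Y U V W \<Gamma>" for h
  proof -
    have "h \<in> L2_line \<and> (\<exists>\<xi> F \<phi>. F \<in> hardy2 \<and> nontangential_boundary_values F \<phi> \<and>
      (AE t in lborel. h t = stack V U *v (resolvent W (Complex 0 t) *v \<xi>) + \<phi> t) \<and>
      vec_left_eval Z (\<lambda>z. beside X (- Y) *v F z) = \<Gamma> *v \<xi>)"
      using that by (rule M_D_iff[OF Z, THEN iffD1])
    then obtain \<xi> F \<phi>0 where hL: "h \<in> L2_line" and F: "F \<in> hardy2" and bv0: "nontangential_boundary_values F \<phi>0"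
      and ae0: "AE t in lborel. h t = stack V U *v (resolvent W (Complex 0 t) *v \<xi>) + \<phi>0 t"
      and ev: "vec_left_eval Z (\<lambda>z. beside X (- Y) *v F z) = \<Gamma> *v \<xi>"
      by (elim conjE exE)
    obtain \<phi> where m: "\<phi> \<in> borel_measurable lborel" and ae1: "AE t in lborel. \<phi>0 t = \<phi> t"
      and bv: "nontangential_boundary_values F \<phi>"
      using ntbv_measurable[OF F bv0] by metis
    obtain G where G: "vec_holomorphic_on G right_half_plane"
      "\<And>z. z \<in> right_half_plane \<Longrightarrow> beside X (- Y) *v F z = \<Gamma> *v \<xi> + (mat z - Z) *v G z"
      using left_eval_decomp[OF hardy2_holomorphic[OF hardy2_const_mult[OF F, of "beside X (- Y)"]] Z] unfolding ev by metis
    define \<phi>1 where "\<phi>1 = (\<lambda>t. upper (\<phi> t))"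
    define \<phi>2 where "\<phi>2 = (\<lambda>t. lower (\<phi> t))"
    have ct: "conj_transpose (beside X (- Y)) *v r = stack (conj_transpose X *v r) (- (conj_transpose Y *v r))" for r
      by (simp add: conj_transpose_beside stack_mult_vec conj_transpose_minus matrix_vector_minus_left)
    have st: "\<phi> t = stack (\<phi>1 t) (\<phi>2 t)" for t
      by (simp add: \<phi>1_def \<phi>2_def stack_upper_lower)
    have "cinner (\<phi> t) (conj_transpose (beside X (- Y)) *v ?R t) = cinner (\<phi>1 t) (uX t) - cinner (\<phi>2 t) (uY t)" for t
      unfolding ct st[of t] by (simp add: cinner_stack cinner_minus_right uX_def uY_def)
    then have hl: "has_bochner_integral lborel (\<lambda>t. cinner (\<phi>1 t) (uX t) - cinner (\<phi>2 t) (uY t)) (2 * pi * cinner (\<Gamma> *v \<xi>) y)"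
      using hardy_inner_left[OF Z F bv m G, of y] by simp
    have l: "has_bochner_integral lborel (\<lambda>t. cinner (uX t) (\<phi>1 t) - cinner (uY t) (\<phi>2 t)) (2 * pi * cinner (conj_transpose \<Gamma> *v y) \<xi>)"
      using has_bochner_integral_bounded_linear[OF bounded_linear_cnj hl]
      by (simp add: cnj_cinner cinner_adjoint')
    have hr: "has_bochner_integral lborel (\<lambda>t. cinner (vV x t) (\<phi>1 t)) 0" for x
    proof -
      have eq: "cinner (\<phi> t) (stack V 0 *v (resolvent W (Complex 0 t) *v x)) = cinner (\<phi>1 t) (vV x t)" for t
        unfolding st[of t] by (simp add: stack_mult_vec cinner_stack vV_def)
      show ?thesis
        using has_integral_cinner_swap[OF hardy_inner_right[OF W F bv m, of "stack V 0" x, unfolded eq]] by simp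
    qed
    have hr': "has_bochner_integral lborel (\<lambda>t. cinner (vU x t) (\<phi>2 t)) 0" for x
    proof -
      have eq: "cinner (\<phi> t) (stack 0 U *v (resolvent W (Complex 0 t) *v x)) = cinner (\<phi>2 t) (vU x t)" for t
        unfolding st[of t] by (simp add: stack_mult_vec cinner_stack vU_def)
      show ?thesis
        using has_integral_cinner_swap[OF hardy_inner_right[OF W F bv m, of "stack 0 U" x, unfolded eq]] by simp
    qed
    \<comment> \<open>The integrand of the J-form, grouped so that each summand is one of the
      pairings computed above.\<close>
    define I where "I = (\<lambda>t. cinner (vV x t) (vV \<xi> t) - cinner (uX t) (vV \<xi> t) - (cinner (uX t) (\<phi>1 t) - cinner (uY t) (\<phi>2 t))
      + cinner (vV x t) (\<phi>1 t) + cinner (uY t) (vU \<xi> t) - cinner (vU x' t) (vU \<xi> t) - cinner (vU x' t) (\<phi>2 t))"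
    have "has_bochner_integral lborel I (2 * pi * cinner (?gV *v x) \<xi> - 0 - 2 * pi * cinner (conj_transpose \<Gamma> *v y) \<xi>
        + 0 + 0 - 2 * pi * cinner (?gU *v x') \<xi> - 0)"
      unfolding I_def by (intro has_bochner_integral_add has_bochner_integral_diff vv uv l hr hr')
    then have I0: "has_bochner_integral lborel I 0"
      unfolding x' by (simp add: cinner_diff_left right_diff_distrib)
    have "AE t in lborel. cinner (J_sig *v stack (a t) (b t)) (h t) = I t"
      using ae0 ae1
    proof eventually_elim
      case (elim t)
      have "h t = stack (vV \<xi> t + \<phi>1 t) (vU \<xi> t + \<phi>2 t)"
        unfolding elim st by (simp add: stack_mult_vec stack_add vV_def vU_def)
      then show ?case
        by (simp add: J_sig_stack cinner_stack a_def b_def I_def cinner_add_left cinner_add_right cinner_diff_left cinner_diff_right cinner_minus_left)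
    qed
    moreover have "(\<lambda>t. cinner (J_sig *v stack (a t) (b t)) (h t)) \<in> borel_measurable lborel"
      using aL bL hL
      by (intro measurable_cinner measurable_matrix_vector measurable_stack borel_measurable_const) (auto simp: L2_line_def)
    ultimately have "J_form (\<lambda>t. stack (a t) (b t)) h = (LINT t|lborel. I t)"
      unfolding J_form_def L2_inner_def
      by (intro integral_cong_AE) (use I0 in \<open>auto dest: borel_measurable_has_bochner_integral\<close>)
    then show ?thesis using has_bochner_integral_integral_eq[OF I0] by simp
  qed
  have "(\<lambda>t. stack (a t) (b t)) \<in> M_D_perp Z X Y U V W \<Gamma>"
    unfolding M_D_perp_def krein_K_def using aL bM perp by blast
  from that[OF aL bL this ia ib] show ?thesis .
qed

text \<open>x' exists because observability makes the Gramian of \<open>U\<close> invertible.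
  Completing the square, the J-form is 2 pi times the Pick form minus \<open>q\<close>, the Gramian
  form of x - x'. The last clause records the case of equality: then x' = x and, with a = 0, the
  Gramian forms of \<open>X\<close> and \<open>U\<close> vanish.\<close>

lemma test_vector_pick:
  fixes Z :: "complex^'z::finite^'z" and X :: "complex^'p::finite^'z" and Y :: "complex^'m::finite^'z"
    and U :: "complex^'w::finite^'m" and V :: "complex^'w^'p" and W :: "complex^'w^'w"
    and \<Gamma> :: "complex^'w^'z"
  assumes adm: "admissible_data Z X Y U V W \<Gamma>"
  obtains a b where "a \<in> L2_line" "b \<in> L2_line" "(\<lambda>t. stack (a t) (b t)) \<in> M_D_perp Z X Y U V W \<Gamma>"
    "(LINT t|lborel. (norm (a t))\<^sup>2) - (LINT t|lborel. (norm (b t))\<^sup>2) \<le> 2 * pi * pick_form Z X Y U V W \<Gamma> y x"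
    "pick_form Z X Y U V W \<Gamma> y x = 0 \<longrightarrow> (LINT t|lborel. (norm (a t))\<^sup>2) = (LINT t|lborel. (norm (b t))\<^sup>2)
       \<longrightarrow> (LINT t|lborel. (norm (a t))\<^sup>2) = 0 \<longrightarrow> (y, x) = (0, 0)"
proof -
  note s = admissible_spectra[OF adm]
  let ?gU = "gram (conj_transpose W) (conj_transpose U)" and ?gV = "gram (conj_transpose W) (conj_transpose V)"
  have W': "spectrum (conj_transpose W) \<subseteq> right_half_plane" by (rule spectrum_conj_transpose_rhp[OF s(2)])
  have "invertible ?gU"
    unfolding invertible_iff_inj using gram_observable_pos[OF s(2,4)] by auto
  then obtain x' where x': "?gU *v x' = ?gV *v x - conj_transpose \<Gamma> *v y"
    using matrix_inv_mult_right[of ?gU] by (metis matrix_vector_mul_assoc matrix_vector_mul_lid)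
  obtain a b where ab: "a \<in> L2_line" "b \<in> L2_line" "(\<lambda>t. stack (a t) (b t)) \<in> M_D_perp Z X Y U V W \<Gamma>"
    and ia: "(LINT t|lborel. (norm (a t))\<^sup>2) = 2 * pi * (Re (cinner (gram Z X *v y) y) + Re (cinner (?gV *v x) x))"
    and ib: "(LINT t|lborel. (norm (b t))\<^sup>2) = 2 * pi * (Re (cinner (gram Z Y *v y) y) + Re (cinner (?gU *v x') x'))"
    by (rule test_vector[OF s(1,2) x'])
  define q where "q = Re (cinner (?gU *v (x - x')) (x - x'))"
  have q: "q \<ge> 0" unfolding q_def by (rule gram_nonneg[OF W'])
  have "Re (cinner (?gU *v x') x) = Re (cinner (?gV *v x) x) - Re (cinner (\<Gamma> *v x) y)"
    unfolding x' by (simp add: cinner_diff_left cinner_adjoint Re_cinner_commute[of y])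
  moreover have "Re (cinner (?gU *v x) x') = Re (cinner (?gU *v x') x)"
    by (simp add: cinner_adjoint gram_hermitian[OF W'] Re_cinner_commute[of x])
  ultimately have "Re (cinner (gram Z X *v y) y) + Re (cinner (?gV *v x) x)
      - (Re (cinner (gram Z Y *v y) y) + Re (cinner (?gU *v x') x')) = pick_form Z X Y U V W \<Gamma> y x - q"
    unfolding q_def pick_form_def
    by (simp add: mat_vec_simps cinner_diff_left cinner_diff_right)
  then have key: "(LINT t|lborel. (norm (a t))\<^sup>2) - (LINT t|lborel. (norm (b t))\<^sup>2)
      = 2 * pi * (pick_form Z X Y U V W \<Gamma> y x - q)"
    unfolding ia ib right_diff_distrib[symmetric] by simp
  have "(LINT t|lborel. (norm (a t))\<^sup>2) - (LINT t|lborel. (norm (b t))\<^sup>2) \<le> 2 * pi * pick_form Z X Y U V W \<Gamma> y x"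
    unfolding key using q by (intro mult_left_mono) auto
  moreover have "(y, x) = (0, 0)"
    if p0: "pick_form Z X Y U V W \<Gamma> y x = 0" and e: "(LINT t|lborel. (norm (a t))\<^sup>2) = (LINT t|lborel. (norm (b t))\<^sup>2)"
      and a0: "(LINT t|lborel. (norm (a t))\<^sup>2) = 0"
  proof -
    have "q = 0" using key p0 e by simp
    then have "x - x' = 0" unfolding q_def by (rule gram_observable_pos[OF s(2,4)])
    then have xx: "x' = x" by simp
    have "Re (cinner (gram Z X *v y) y) + Re (cinner (?gV *v x) x) = 0" using a0 ia by simp
    then have "Re (cinner (gram Z X *v y) y) = 0"
      using gram_nonneg[OF s(1), of X y] gram_nonneg[OF W', of "conj_transpose V" x] by linarith
    moreover have "Re (cinner (gram Z Y *v y) y) + Re (cinner (?gU *v x) x) = 0" using a0 e ib xx by simp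
    then have "Re (cinner (?gU *v x) x) = 0"
      using gram_nonneg[OF s(1), of Y y] gram_nonneg[OF W', of "conj_transpose U" x] by linarith
    ultimately show ?thesis
      using gram_controllable_pos[OF s(1,3)] gram_observable_pos[OF s(2,4)] by simp
  qed
  ultimately show ?thesis using that[OF ab] by blast
qed

section \<open>From the subspace to the Pick form\<close>

lemma J_positive_imp_pick_nonneg:
  assumes adm: "admissible_data Z X Y U V W \<Gamma>" and J: "J_positive (M_D_perp Z X Y U V W \<Gamma>)"
  shows "0 \<le> pick_form Z X Y U V W \<Gamma> y x"
proof -
  obtain a b where ab: "a \<in> L2_line" "b \<in> L2_line" "(\<lambda>t. stack (a t) (b t)) \<in> M_D_perp Z X Y U V W \<Gamma>"
    and le: "(LINT t|lborel. (norm (a t))\<^sup>2) - (LINT t|lborel. (norm (b t))\<^sup>2) \<le> 2 * pi * pick_form Z X Y U V W \<Gamma> y x"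
    by (rule test_vector_pick[OF adm, where y = y and x = x])
  have "0 \<le> Re (J_form (\<lambda>t. stack (a t) (b t)) (\<lambda>t. stack (a t) (b t)))"
    using J ab(3) unfolding J_positive_def by (rule bspec)
  then have "0 \<le> (LINT t|lborel. (norm (a t))\<^sup>2) - (LINT t|lborel. (norm (b t))\<^sup>2)"
    unfolding J_form_stack[OF ab(1,1,2,2)] L2_inner_self[OF ab(1)] L2_inner_self[OF ab(2)] by simp
  with le have "0 \<le> 2 * pi * pick_form Z X Y U V W \<Gamma> y x" by linarith
  then show ?thesis using pi_gt_zero by (auto simp: zero_le_mult_iff)
qed

text \<open>At a zero of the Pick form the test vector has J-form at most 0, hence 0 by positivity,
  hence it is a null function by definiteness. The equality case for test vectors then gives (y, x)
  = (0, 0).\<close>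

lemma J_hilbert_imp_pick_pos:
  assumes adm: "admissible_data Z X Y U V W \<Gamma>" and J: "J_hilbert (M_D_perp Z X Y U V W \<Gamma>)"
    and yx: "(y, x) \<noteq> (0, 0)"
  shows "0 < pick_form Z X Y U V W \<Gamma> y x"
proof (rule ccontr)
  have pos: "J_positive (M_D_perp Z X Y U V W \<Gamma>)"
    and def: "\<And>f. f \<in> M_D_perp Z X Y U V W \<Gamma> \<Longrightarrow> J_form f f = 0 \<Longrightarrow> AE t in lborel. f t = 0"
    using J unfolding J_hilbert_def by blast+
  assume "\<not> 0 < pick_form Z X Y U V W \<Gamma> y x"
  then have p0: "pick_form Z X Y U V W \<Gamma> y x = 0"
    using J_positive_imp_pick_nonneg[OF adm pos, of y x] by linarith
  obtain a b where ab: "a \<in> L2_line" "b \<in> L2_line" "(\<lambda>t. stack (a t) (b t)) \<in> M_D_perp Z X Y U V W \<Gamma>"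
    and le: "(LINT t|lborel. (norm (a t))\<^sup>2) - (LINT t|lborel. (norm (b t))\<^sup>2) \<le> 2 * pi * pick_form Z X Y U V W \<Gamma> y x"
    and z: "pick_form Z X Y U V W \<Gamma> y x = 0 \<longrightarrow> (LINT t|lborel. (norm (a t))\<^sup>2) = (LINT t|lborel. (norm (b t))\<^sup>2)
       \<longrightarrow> (LINT t|lborel. (norm (a t))\<^sup>2) = 0 \<longrightarrow> (y, x) = (0, 0)"
    by (rule test_vector_pick[OF adm, where y = y and x = x])
  note Jf = J_form_stack[OF ab(1,1,2,2), unfolded L2_inner_self[OF ab(1)] L2_inner_self[OF ab(2)]]
  have "0 \<le> Re (J_form (\<lambda>t. stack (a t) (b t)) (\<lambda>t. stack (a t) (b t)))"
    using pos ab(3) unfolding J_positive_def by (rule bspec)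
  then have e: "(LINT t|lborel. (norm (a t))\<^sup>2) = (LINT t|lborel. (norm (b t))\<^sup>2)"
    using le unfolding Jf p0 by simp
  then have "AE t in lborel. stack (a t) (b t) = 0" by (intro def ab) (simp add: Jf)
  then have "AE t in lborel. (norm (a t))\<^sup>2 = 0"
    by eventually_elim (simp add: stack_zero[symmetric])
  then have "(LINT t|lborel. (norm (a t))\<^sup>2) = 0" by (rule integral_eq_zero_AE)
  with z p0 e yx show False by simp
qed

theorem theorem3p3:
  fixes Z :: "complex^'z::finite^'z" and X :: "complex^'p::finite^'z"
    and Y :: "complex^'m::finite^'z"
    and U :: "complex^'w::finite^'m" and V :: "complex^'w^'p" and W :: "complex^'w^'w"
    and \<Gamma> :: "complex^'w^'z"
  assumes "admissible_data Z X Y U V W \<Gamma>"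
  shows "((\<exists>S. S \<in> btoa_solutions Z X Y U V W \<Gamma>) \<longleftrightarrow> J_positive (M_D_perp Z X Y U V W \<Gamma>)) \<and>
    (J_hilbert (M_D_perp Z X Y U V W \<Gamma>) \<longrightarrow>
      (\<exists>\<Theta>. rational_J_inner \<Theta> \<and>
         M_D Z X Y U V W \<Gamma> = times_hardy2 \<Theta> \<and>
         btoa_solutions Z X Y U V W \<Gamma> = {S. \<exists>G\<in>schur_class. is_lft \<Theta> G S} \<and>
         (\<forall>G\<in>schur_class. \<exists>S. is_lft \<Theta> G S)))"
proof (intro conjI impI)
  note s = admissible_spectra[OF assms]
  show "(\<exists>S. S \<in> btoa_solutions Z X Y U V W \<Gamma>) \<longleftrightarrow> J_positive (M_D_perp Z X Y U V W \<Gamma>)"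
  proof
    assume "\<exists>S. S \<in> btoa_solutions Z X Y U V W \<Gamma>"
    then obtain S where "S \<in> btoa_solutions Z X Y U V W \<Gamma>" ..
    then have "S \<in> schur_class" "interpolates Z X Y U V W \<Gamma> S"
      by (simp_all add: btoa_solutions_iff[OF s(1,2)])
    then show "J_positive (M_D_perp Z X Y U V W \<Gamma>)"
      by (intro pick_nonneg_imp_J_positive[OF assms] pick_form_nonneg[OF s(1,2)])
  next
    assume "J_positive (M_D_perp Z X Y U V W \<Gamma>)"
    then show "\<exists>S. S \<in> btoa_solutions Z X Y U V W \<Gamma>"
      by (intro solution_exists[OF assms] J_positive_imp_pick_nonneg[OF assms])
  qed
  assume J: "J_hilbert (M_D_perp Z X Y U V W \<Gamma>)"
  interpret btoa_pos Z X Y U V W \<Gamma>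
    by unfold_locales (rule s J_hilbert_imp_pick_pos[OF assms J], assumption?)+
  obtain \<Theta> where rat: "rational_matrix \<Theta>" and eq: "\<And>z. z \<notin> spectrum AA \<Longrightarrow> \<Theta> z = \<Theta>0 z"
    using rational_Theta by blast
  have "rational_J_inner \<Theta>" by (rule rational_Theta_J_inner[OF rat eq AA_axis])
  moreover have "M_D Z X Y U V W \<Gamma> = times_hardy2 \<Theta>"
    using M_D_subset[OF eq] times_hardy2_subset[OF eq] by (rule subset_antisym)
  moreover note solutions_eq_lft[OF eq]
  ultimately show "\<exists>\<Theta>. rational_J_inner \<Theta> \<and>
         M_D Z X Y U V W \<Gamma> = times_hardy2 \<Theta> \<and>
         btoa_solutions Z X Y U V W \<Gamma> = {S. \<exists>G\<in>schur_class. is_lft \<Theta> G S} \<and>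
         (\<forall>G\<in>schur_class. \<exists>S. is_lft \<Theta> G S)"
    by (intro exI[of _ \<Theta>] conjI)
qed

end
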